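(* Let $m \geq 1$ be an integer and $p > 2$ a prime with $p \nmid m$. Let $\Lambda_{m,p} = \mathbb{Z}[\zeta_m][C_p]$. Then $T(\Lambda_{m,p}) = D(\Lambda_{m,p})$, and $$T(\Lambda_{m,p}) = D(\Lambda_{m,p}) \cong \operatorname{cok}(h) = \big(\mathbb{Z}[\zeta_{mp}]/(1-\zeta_p)\mathbb{Z}[\zeta_{mp}]\big)^{*} / h\big(\mathbb{Z}[\zeta_{mp}]^{*}\big),$$ where $h(\mathbb{Z}[\zeta_{mp}]^* )$ denotes the image of the unit group $\mathbb{Z}[\zeta_{mp}]^*$ under reduction modulo the ideal $(1-\zeta_p)\mathbb{Z}[\zeta_{mp}]$.
   Context: $\zeta_k$ denotes a primitive $k$-th root of unity, with $\zeta_m,\zeta_p\in\mathbb{Q}(\zeta_{mp})$; $\mathbb{Z}[\zeta_m]$ is the ring of integers of $K_m=\mathbb{Q}(\zeta_m)$; $C_p$ is the cyclic group of order $p$; for a ring $A$, $A^*$ is its unit group. For $\Lambda=\Lambda_{m,p}$: $Cl(\Lambda)$ is the locally free class group of $\Lambda$; the kernel group $D(\Lambda)\subseteq Cl(\Lambda)$ consists of the classes of locally free $\Lambda$-modules that become trivial upon extension of scalars to the maximal $\mathbb{Z}[\zeta_m]$-order of $K_m[C_p]$. Let $\Sigma=\sum_{g\in C_p} g$. For $r\in\mathbb{Z}[\zeta_m]$ with $r$ and $p$ relatively prime, the Swan module is $\langle r,\Sigma\rangle = r\Lambda+\Lambda\Sigma$, a locally free rank one $\Lambda$-ideal; the Swan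 subgroup $T(\Lambda)\subseteq Cl(\Lambda)$ is the set of classes of Swan modules. The map $h$ is the map $\mathbb{Z}[\zeta_m]^*\times\mathbb{Z}[\zeta_{mp}]^*\to(\mathbb{Z}[\zeta_{mp}]/(1-\zeta_p))^*$, $(u,v)\mapsto \bar u\,\bar v^{-1}$ (bars denoting reduction mod $(1-\zeta_p)$), occurring in the Reiner–Ullom Mayer–Vietoris sequence; its image equals the image of $\mathbb{Z}[\zeta_{mp}]^*$ under reduction. *)

theory Defs
  imports "HOL-Algebra.Algebra" "HOL-Algebra.Algebraic_Closure_Type" "HOL-Computational_Algebra.Primes"
begin

section \<open>Modules\<close>

text \<open>The library record of an \<open>R\<close>-module also carries the fields \<open>mult\<close> and \<open>one\<close> of a ring.
  They play no role for modules; below they are filled in componentwise.\<close>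

definition module_iso ::
  "('a, 'r) ring_scheme \<Rightarrow> ('a, 'b, 'm) module_scheme \<Rightarrow> ('a, 'c, 'n) module_scheme \<Rightarrow> ('b \<Rightarrow> 'c) set"
  where "module_iso R M N =
    {f \<in> iso (add_monoid M) (add_monoid N).
       \<forall>a \<in> carrier R. \<forall>x \<in> carrier M. f (a \<odot>\<^bsub>M\<^esub> x) = a \<odot>\<^bsub>N\<^esub> f x}"

definition submodule_hull ::
  "('a, 'r) ring_scheme \<Rightarrow> ('a, 'b, 'm) module_scheme \<Rightarrow> 'b set \<Rightarrow> 'b set"
  where "submodule_hull R M U = (\<lambda>N. submodule N R M) hull U"

definition finitely_generated ::
  "('a, 'r) ring_scheme \<Rightarrow> ('a, 'b, 'm) module_scheme \<Rightarrow> bool"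
  where "finitely_generated R M \<longleftrightarrow>
    (\<exists>U. finite U \<and> U \<subseteq> carrier M \<and> submodule_hull R M U = carrier M)"

definition direct_sum ::
  "('a, 'b, 'm) module_scheme \<Rightarrow> ('a, 'c, 'n) module_scheme \<Rightarrow> ('a, 'b \<times> 'c) module"
  where "direct_sum M N =
    \<lparr>carrier = carrier M \<times> carrier N,
     monoid.mult = (\<lambda>(x, y) (x', y'). (x \<otimes>\<^bsub>M\<^esub> x', y \<otimes>\<^bsub>N\<^esub> y')),
     monoid.one = (\<one>\<^bsub>M\<^esub>, \<one>\<^bsub>N\<^esub>),
     ring.zero = (\<zero>\<^bsub>M\<^esub>, \<zero>\<^bsub>N\<^esub>),
     ring.add = (\<lambda>(x, y) (x', y'). (x \<oplus>\<^bsub>M\<^esub> x', y \<oplus>\<^bsub>N\<^esub> y')),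
     module.smult = (\<lambda>a (x, y). (a \<odot>\<^bsub>M\<^esub> x, a \<odot>\<^bsub>N\<^esub> y))\<rparr>"

text \<open>\<open>M\<^sup>n\<close>, its elements being lists of length \<open>n\<close>.\<close>

definition module_power :: "('a, 'b, 'm) module_scheme \<Rightarrow> nat \<Rightarrow> ('a, 'b list) module"
  where "module_power M n =
    \<lparr>carrier = {v. length v = n \<and> set v \<subseteq> carrier M},
     monoid.mult = map2 (monoid.mult M),
     monoid.one = replicate n \<one>\<^bsub>M\<^esub>,
     ring.zero = replicate n \<zero>\<^bsub>M\<^esub>,
     ring.add = map2 (add M),
     module.smult = (\<lambda>a. map (\<lambda>x. a \<odot>\<^bsub>M\<^esub> x))\<rparr>"

definition regular_module :: "('a, 'm) ring_scheme \<Rightarrow> ('a, 'a) module"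
  where "regular_module S =
    \<lparr>carrier = carrier S, monoid.mult = monoid.mult S, monoid.one = \<one>\<^bsub>S\<^esub>, ring.zero = \<zero>\<^bsub>S\<^esub>, ring.add = add S,
     module.smult = monoid.mult S\<rparr>"

abbreviation free_module :: "('a, 'm) ring_scheme \<Rightarrow> nat \<Rightarrow> ('a, 'a list) module"
  where "free_module S n \<equiv> module_power (regular_module S) n"

definition stably_isomorphic ::
  "('a, 'r) ring_scheme \<Rightarrow> ('a, 'b, 'm) module_scheme \<Rightarrow> ('a, 'c, 'n) module_scheme \<Rightarrow> bool"
  where "stably_isomorphic S M N \<longleftrightarrow>
    (\<exists>a b. module_iso S (direct_sum M (free_module S a)) (direct_sum N (free_module S b)) \<noteq> {})"


section \<open>Orders and their locally free class groups\<close>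

text \<open>Throughout, \<open>R\<close> is a Dedekind domain with field of fractions \<open>K\<close> and \<open>A\<close> is a commutative
  finite-dimensional \<open>K\<close>-algebra.  An \<open>R\<close>-order is a subset \<open>S\<close> of the carrier of \<open>A\<close>,
  considered as a ring via \<open>subring_of A S\<close>.\<close>

abbreviation subring_of :: "('r, 'a) module \<Rightarrow> 'a set \<Rightarrow> ('r, 'a) module"
  where "subring_of A S \<equiv> A\<lparr>carrier := S\<rparr>"

definition is_order :: "'r ring \<Rightarrow> 'r ring \<Rightarrow> ('r, 'a) module \<Rightarrow> 'a set \<Rightarrow> bool"
  where "is_order K R A S \<longleftrightarrow>
    subring S A \<and> submodule S R A \<and> finitely_generated R (A\<lparr>carrier := S\<rparr>) \<and>
    submodule_hull K A S = carrier A"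

definition is_maximal_order :: "'r ring \<Rightarrow> 'r ring \<Rightarrow> ('r, 'a) module \<Rightarrow> 'a set \<Rightarrow> bool"
  where "is_maximal_order K R A S \<longleftrightarrow>
    is_order K R A S \<and> (\<forall>S'. is_order K R A S' \<and> S \<subseteq> S' \<longrightarrow> S' = S)"

text \<open>The maximal order is unique because \<open>A\<close> is commutative (and, in the application, semisimple).\<close>

definition maximal_order :: "'r ring \<Rightarrow> 'r ring \<Rightarrow> ('r, 'a) module \<Rightarrow> 'a set"
  where "maximal_order K R A = (THE S. is_maximal_order K R A S)"

text \<open>For an \<open>R\<close>-submodule \<open>M\<close> of a \<open>K\<close>-vector space \<open>V\<close>, the localization of \<open>M\<close> at \<open>P\<close>
  is identified with the subset of all \<open>v\<close> in \<open>V\<close> of the form \<open>x / s\<close>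
  with \<open>x \<in> M\<close> and \<open>s \<in> R - P\<close>.\<close>

definition localize :: "'r ring \<Rightarrow> 'r set \<Rightarrow> ('r, 'b) module \<Rightarrow> 'b set \<Rightarrow> 'b set"
  where "localize R P V M = {v \<in> carrier V. \<exists>s \<in> carrier R - P. s \<odot>\<^bsub>V\<^esub> v \<in> M}"

text \<open>A locally free \<open>S\<close>-module \<open>M\<close> of rank \<open>n\<close> embeds into \<open>K \<otimes>\<^sub>R M \<cong> A\<^sup>n\<close>, so locally free modules
  are represented by \<open>S\<close>-lattices in \<open>A\<^sup>n\<close>.  Here \<open>module_power A n\<close> is \<open>A\<^sup>n\<close> with scalars
  in \<open>K\<close> (or \<open>R\<close>), whereas \<open>free_module A n\<close> is \<open>A\<^sup>n\<close> with scalars in \<open>A\<close> (or \<open>S\<close>).\<close>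

definition lattice_module :: "('r, 'a) module \<Rightarrow> nat \<Rightarrow> 'a list set \<Rightarrow> ('a, 'a list) module"
  where "lattice_module A n M = (free_module A n)\<lparr>carrier := M\<rparr>"

definition locally_free ::
  "'r ring \<Rightarrow> ('r, 'a) module \<Rightarrow> 'a set \<Rightarrow> nat \<Rightarrow> 'a list set \<Rightarrow> bool"
  where "locally_free R A S n M \<longleftrightarrow>
    submodule M (subring_of A S) (free_module A n) \<and>
    finitely_generated (subring_of A S) (lattice_module A n M) \<and>
    (\<forall>P. maximalideal P R \<longrightarrow>
       (let S\<^sub>P = subring_of A (localize R P A S)
        in module_iso S\<^sub>P (lattice_module A n (localize R P (module_power A n) M)) (free_module S\<^sub>P n) \<noteq> {}))"

definition locally_free_modules ::
  "'r ring \<Rightarrow> ('r, 'a) module \<Rightarrow> 'a set \<Rightarrow> ('a, 'a list) module set"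
  where "locally_free_modules R A S = {lattice_module A n M | n M. locally_free R A S n M}"

text \<open>The class of \<open>L\<close> in the locally free class group is the element \<open>[L] - rank(L) [S]\<close> of the
  Grothendieck group of locally free \<open>S\<close>-modules; such elements agree for \<open>L\<close> and \<open>L'\<close> iff
  \<open>L \<oplus> S\<^sup>a \<cong> L' \<oplus> S\<^sup>b\<close> for some \<open>a\<close> and \<open>b\<close>.  Addition comes from the direct sum.\<close>

definition stable_class ::
  "'r ring \<Rightarrow> ('r, 'a) module \<Rightarrow> 'a set \<Rightarrow> ('a, 'a list) module \<Rightarrow> ('a, 'a list) module set"
  where "stable_class R A S L =
    {L' \<in> locally_free_modules R A S. stably_isomorphic (subring_of A S) L L'}"

definition class_group ::
  "'r ring \<Rightarrow> ('r, 'a) module \<Rightarrow> 'a set \<Rightarrow> ('a, 'a list) module set monoid"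
  where "class_group R A S =
    \<lparr>carrier = stable_class R A S ` locally_free_modules R A S,
     monoid.mult = (\<lambda>U W. {L \<in> locally_free_modules R A S.
        \<exists>M \<in> U. \<exists>N \<in> W. stably_isomorphic (subring_of A S) L (direct_sum M N)}),
     monoid.one = stable_class R A S (free_module (subring_of A S) 1)\<rparr>"

text \<open>Extension of scalars from \<open>S\<close> to an order \<open>\<Gamma> \<supseteq> S\<close>: for a locally free \<open>M \<subseteq> A\<^sup>n\<close> the
  canonical map from \<open>\<Gamma> \<otimes>\<^sub>S M\<close> to \<open>A\<^sup>n\<close> is injective with image \<open>\<Gamma>M\<close>.\<close>

definition extend_scalars ::
  "('r, 'a) module \<Rightarrow> 'a set \<Rightarrow> nat \<Rightarrow> 'a list set \<Rightarrow> 'a list set"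
  where "extend_scalars A \<Gamma> n M = submodule_hull (subring_of A \<Gamma>) (free_module A n) M"

definition kernel_group ::
  "'r ring \<Rightarrow> 'r ring \<Rightarrow> ('r, 'a) module \<Rightarrow> 'a set \<Rightarrow> ('a, 'a list) module set set"
  where "kernel_group K R A S =
    (let \<Gamma> = maximal_order K R A
     in {stable_class R A S (lattice_module A n M) | n M. locally_free R A S n M \<and>
           stable_class R A \<Gamma> (lattice_module A n (extend_scalars A \<Gamma> n M)) = \<one>\<^bsub>class_group R A \<Gamma>\<^esub>})"


section \<open>Group rings and Swan modules\<close>

definition group_ring ::
  "('r, 'm) ring_scheme \<Rightarrow> ('g, 'n) monoid_scheme \<Rightarrow> ('r, 'g \<Rightarrow> 'r) module"
  where "group_ring R G =
    \<lparr>carrier = carrier G \<rightarrow>\<^sub>E carrier R,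
     monoid.mult = (\<lambda>a b. \<lambda>x \<in> carrier G. \<Oplus>\<^bsub>R\<^esub>y \<in> carrier G. a y \<otimes>\<^bsub>R\<^esub> b (inv\<^bsub>G\<^esub> y \<otimes>\<^bsub>G\<^esub> x)),
     monoid.one = (\<lambda>x \<in> carrier G. if x = \<one>\<^bsub>G\<^esub> then \<one>\<^bsub>R\<^esub> else \<zero>\<^bsub>R\<^esub>),
     ring.zero = (\<lambda>x \<in> carrier G. \<zero>\<^bsub>R\<^esub>),
     ring.add = (\<lambda>a b. \<lambda>x \<in> carrier G. a x \<oplus>\<^bsub>R\<^esub> b x),
     module.smult = (\<lambda>r a. \<lambda>x \<in> carrier G. r \<otimes>\<^bsub>R\<^esub> a x)\<rparr>"

text \<open>The sum of all group elements, whose coefficients are all equal to \<open>1\<close>.\<close>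

definition norm_element :: "('r, 'm) ring_scheme \<Rightarrow> ('g, 'n) monoid_scheme \<Rightarrow> 'g \<Rightarrow> 'r"
  where "norm_element R G = (\<lambda>x \<in> carrier G. \<one>\<^bsub>R\<^esub>)"

definition swan_module ::
  "('r, 'm) ring_scheme \<Rightarrow> ('g, 'n) monoid_scheme \<Rightarrow> 'r \<Rightarrow> ('g \<Rightarrow> 'r) set"
  where "swan_module R G r =
    (let \<Lambda> = group_ring R G
     in {(r \<odot>\<^bsub>\<Lambda>\<^esub> a) \<oplus>\<^bsub>\<Lambda>\<^esub> (b \<otimes>\<^bsub>\<Lambda>\<^esub> norm_element R G) | a b. a \<in> carrier \<Lambda> \<and> b \<in> carrier \<Lambda>})"

text \<open>Ideals of the group ring are lattices of rank one, their elements being lists of length one.\<close>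

definition swan_subgroup ::
  "'r ring \<Rightarrow> 'r ring \<Rightarrow> ('g, 'n) monoid_scheme \<Rightarrow> ('g \<Rightarrow> 'r, ('g \<Rightarrow> 'r) list) module set set"
  where "swan_subgroup K R G =
    (let A = group_ring K G
     in {stable_class R A (carrier (group_ring R G)) (lattice_module A 1 {[x] | x. x \<in> swan_module R G r}) | r.
           r \<in> carrier R \<and> Idl\<^bsub>R\<^esub> {r, [Coset.order G] \<cdot>\<^bsub>R\<^esub> \<one>\<^bsub>R\<^esub>} = carrier R})"


section \<open>The cyclotomic case\<close>

definition primitive_root_of_unity :: "nat \<Rightarrow> complex \<Rightarrow> bool"
  where "primitive_root_of_unity k z \<longleftrightarrow>
    k > 0 \<and> z ^ k = 1 \<and> (\<forall>j. 0 < j \<and> j < k \<longrightarrow> z ^ j \<noteq> 1)"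

definition Z_adjoin :: "complex \<Rightarrow> complex ring"
  where "Z_adjoin z = ring_of_type_algebra\<lparr>carrier := generate_ring ring_of_type_algebra {z}\<rparr>"

definition Q_adjoin :: "complex \<Rightarrow> complex ring"
  where "Q_adjoin z = ring_of_type_algebra\<lparr>carrier := generate_field ring_of_type_algebra {z}\<rparr>"

abbreviation C :: "nat \<Rightarrow> int monoid"
  where "C p \<equiv> integer_mod_group p"

text \<open>In the next three definitions \<open>z\<close> is a primitive \<open>m\<close>-th root of unity, and the order is
  \<open>\<Lambda> = \<int>[z][C\<^sub>p]\<close> in the algebra \<open>\<rat>(z)[C\<^sub>p]\<close>.\<close>

definition Cl :: "complex \<Rightarrow> nat \<Rightarrow> (int \<Rightarrow> complex, (int \<Rightarrow> complex) list) module set monoid"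
  where "Cl z p =
    class_group (Z_adjoin z) (group_ring (Q_adjoin z) (C p)) (carrier (group_ring (Z_adjoin z) (C p)))"

definition D :: "complex \<Rightarrow> nat \<Rightarrow> (int \<Rightarrow> complex, (int \<Rightarrow> complex) list) module set set"
  where "D z p =
    kernel_group (Q_adjoin z) (Z_adjoin z) (group_ring (Q_adjoin z) (C p))
      (carrier (group_ring (Z_adjoin z) (C p)))"

definition T :: "complex \<Rightarrow> nat \<Rightarrow> (int \<Rightarrow> complex, (int \<Rightarrow> complex) list) module set set"
  where "T z p = swan_subgroup (Q_adjoin z) (Z_adjoin z) (C p)"

text \<open>In the remaining definitions, \<open>z\<^sub>p\<close> and \<open>z\<^sub>m\<^sub>p\<close> are primitive roots of unity of orders \<open>p\<close> and
  \<open>mp\<close>, so that \<open>z\<^sub>p \<in> \<int>[z\<^sub>m\<^sub>p]\<close>.\<close>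

definition residue_ideal :: "complex \<Rightarrow> complex \<Rightarrow> complex set"
  where "residue_ideal zp zmp = PIdl\<^bsub>Z_adjoin zmp\<^esub> (1 - zp)"

definition residue_units :: "complex \<Rightarrow> complex \<Rightarrow> complex set monoid"
  where "residue_units zp zmp = units_of (Z_adjoin zmp Quot residue_ideal zp zmp)"

definition reduction :: "complex \<Rightarrow> complex \<Rightarrow> complex \<Rightarrow> complex set"
  where "reduction zp zmp x = residue_ideal zp zmp +>\<^bsub>Z_adjoin zmp\<^esub> x"

definition h :: "complex \<Rightarrow> complex \<Rightarrow> complex \<times> complex \<Rightarrow> complex set"
  where "h zp zmp = (\<lambda>(u, v). reduction zp zmp u
    \<otimes>\<^bsub>residue_units zp zmp\<^esub> inv\<^bsub>residue_units zp zmp\<^esub> (reduction zp zmp v))"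

definition cok_h :: "complex \<Rightarrow> complex \<Rightarrow> complex \<Rightarrow> complex set set monoid"
  where "cok_h zm zp zmp = residue_units zp zmp Mod
    (h zp zmp ` carrier (units_of (Z_adjoin zm) \<times>\<times> units_of (Z_adjoin zmp)))"

end

theory Submission
  imports Defs "Jordan_Normal_Form.Char_Poly" "HOL-Number_Theory.Residues"
begin

text \<open>Write \<open>R = \<int>[\<zeta>\<^sub>m]\<close>, \<open>S = \<int>[\<zeta>\<^sub>m\<^sub>p]\<close>, \<open>\<pi> = 1 - \<zeta>\<^sub>p\<close>. Evaluating a generator of \<open>C\<^sub>p\<close> at \<open>1\<close> and at \<open>\<zeta>\<^sub>p\<close> embeds the
  group algebra in a product of two cyclotomic fields. There \<open>\<Lambda>\<close> becomes the set of all \<open>(a, b) \<in> R \<times> S\<close> with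
  \<open>a \<equiv> b\<close> modulo \<open>\<pi>\<close>, the maximal order is \<open>R \<times> S\<close>, and the Swan module of \<open>r\<close> is isomorphic to the module
  of all \<open>(a, b)\<close> with \<open>a \<equiv> r b\<close>. If \<open>M\<close> becomes stably free over \<open>R \<times> S\<close>, then \<open>M \<oplus> \<Lambda>\<^sup>k\<close> is the module of all
  \<open>(a, b) \<in> R\<^sup>n \<times> S\<^sup>n\<close> with \<open>a \<equiv> G b\<close> for some matrix \<open>G\<close> over \<open>R\<close> that is invertible modulo \<open>p\<close>. As \<open>p\<close> is unramified
  in \<open>R\<close>, some power of the Frobenius is the identity on \<open>R / p R\<close>, so elementary operations and Whitehead's lemma
  diagonalize \<open>G\<close> to \<open>diag(r, 1, \<dots>, 1)\<close>, and \<open>M\<close> is stably isomorphic to the Swan module of \<open>r\<close>: hence \<open>D = T\<close>.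
  Comparing determinants, the Swan modules of \<open>r\<close> and \<open>s\<close> are stably isomorphic iff \<open>r \<equiv> s u\<close> modulo \<open>\<pi>\<close> for some
  \<open>u \<in> S\<^sup>*\<close>. Since \<open>\<zeta>\<^sub>p \<equiv> 1\<close>, every residue class of \<open>S\<close> modulo \<open>\<pi>\<close> meets \<open>R\<close>, so mapping the class of the Swan module
  to the coset of \<open>r\<close> is an isomorphism onto the cokernel.\<close>

section \<open>Subrings of the complex numbers\<close>

text \<open>Two arithmetic facts carry the translation into pairs. First, R and S are integrally
  closed in their fields, so R x S contains every order. Second, an element of R that \<pi> divides
  in S is divisible by p in R; so congruences modulo \<pi> become congruences modulo p, where
  elements of \<Lambda> can be built. Both rest on one device: modulo a prime q, or modulo 1 -
  \<eta> for a root of unity \<eta> of q-power order, some power map y -> y ^ N with N > 1 is the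
  identity, so a high power, which is highly divisible, may be replaced by the element itself. The
  second fact also yields, by descent, that \<open>zp\<close> has degree p - 1 over K, whence the
  two evaluations are jointly injective. Local freeness of M enters through one consequence: an
  element of M whose S-components vanish is (p, 0) times an element of M. Hence M is recovered from
  its two projections, which are free after adding a free summand, and one matrix. Determinants can
  be compared because an isomorphism of glued modules is a pair of matrices, over R and over S;
  multiplication by (p, 0) and (0, \<pi>) separates the components.\<close>

locale complex_subring =
  fixes B :: "complex set"
  assumes one_in [simp]: "1 \<in> B"
    and add_in [simp]: "x \<in> B \<Longrightarrow> y \<in> B \<Longrightarrow> x + y \<in> B"
    and mult_in [simp]: "x \<in> B \<Longrightarrow> y \<in> B \<Longrightarrow> x * y \<in> B"
    and uminus_in [simp]: "x \<in> B \<Longrightarrow> - x \<in> B"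
begin

lemma zero_in [simp]: "0 \<in> B"
  using add_in[OF one_in uminus_in[OF one_in]] by simp

lemma diff_in [simp]: "x \<in> B \<Longrightarrow> y \<in> B \<Longrightarrow> x - y \<in> B"
  using add_in[of x "- y"] by simp

lemma power_in [simp]: "x \<in> B \<Longrightarrow> x ^ k \<in> B"
  by (induction k) auto

lemma sum_in: "(\<And>i. i \<in> I \<Longrightarrow> f i \<in> B) \<Longrightarrow> sum f I \<in> B"
  by (induction I rule: infinite_finite_induct) auto

lemma prod_in: "(\<And>i. i \<in> I \<Longrightarrow> f i \<in> B) \<Longrightarrow> prod f I \<in> B"
  by (induction I rule: infinite_finite_induct) auto

lemma of_nat_in [simp]: "of_nat k \<in> B"
  by (induction k) auto

lemma of_int_in [simp]: "of_int k \<in> B"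
  by (cases k) auto

end

text \<open>On the field of complex numbers \<open>dvd\<close> is trivial, so the ring of the
  quotient is named explicitly. Congruence of x and y modulo a is written
  \<open>dvd_in B a (x - y)\<close> throughout.\<close>

definition dvd_in :: "complex set \<Rightarrow> complex \<Rightarrow> complex \<Rightarrow> bool"
  where "dvd_in B a x \<longleftrightarrow> (\<exists>t\<in>B. x = a * t)"

lemma dvd_inI: "t \<in> B \<Longrightarrow> x = a * t \<Longrightarrow> dvd_in B a x"
  by (auto simp: dvd_in_def)

lemma dvd_in_mono: "dvd_in B a x \<Longrightarrow> B \<subseteq> B' \<Longrightarrow> dvd_in B' a x"
  by (auto simp: dvd_in_def)

section \<open>Congruences in a subring and the Frobenius power map\<close>

context complex_subring
begin

lemma dvd_in_0 [simp]: "dvd_in B a 0"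
  by (rule dvd_inI[of 0]) auto

lemma dvd_in_self [simp]: "dvd_in B a a"
  by (rule dvd_inI[of 1]) auto

lemma dvd_in_add: "dvd_in B a x \<Longrightarrow> dvd_in B a y \<Longrightarrow> dvd_in B a (x + y)"
  unfolding dvd_in_def by (metis add_in distrib_left)

lemma dvd_in_uminus: "dvd_in B a x \<Longrightarrow> dvd_in B a (- x)"
  unfolding dvd_in_def by (metis uminus_in mult_minus_right)

lemma dvd_in_diff: "dvd_in B a x \<Longrightarrow> dvd_in B a y \<Longrightarrow> dvd_in B a (x - y)"
  using dvd_in_add[of a x "- y"] dvd_in_uminus by simp

lemma dvd_in_diff_trans: "dvd_in B a (x - y) \<Longrightarrow> dvd_in B a (y - z) \<Longrightarrow> dvd_in B a (x - z)"
  using dvd_in_add[of a "x - y" "y - z"] by simp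

lemma dvd_in_diff_sym: "dvd_in B a (x - y) \<Longrightarrow> dvd_in B a (y - x)"
  using dvd_in_uminus[of a "x - y"] by simp

lemma dvd_in_mult: "dvd_in B a x \<Longrightarrow> y \<in> B \<Longrightarrow> dvd_in B a (x * y)"
  unfolding dvd_in_def by (metis mult_in mult.assoc)

lemma dvd_in_mult': "dvd_in B a x \<Longrightarrow> y \<in> B \<Longrightarrow> dvd_in B a (y * x)"
  using dvd_in_mult by (simp add: mult.commute)

lemma dvd_in_trans: "dvd_in B a b \<Longrightarrow> dvd_in B b x \<Longrightarrow> dvd_in B a x"
  unfolding dvd_in_def by (metis mult_in mult.assoc)

lemma dvd_in_sum: "(\<And>i. i \<in> I \<Longrightarrow> dvd_in B a (f i)) \<Longrightarrow> dvd_in B a (sum f I)"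
  by (induction I rule: infinite_finite_induct) (auto intro: dvd_in_add)

lemma dvd_in_mult_cong:
  assumes "dvd_in B a (x - y)" "dvd_in B a (x' - y')" "x' \<in> B" "y \<in> B"
  shows "dvd_in B a (x * x' - y * y')"
proof -
  have "x * x' - y * y' = (x - y) * x' + y * (x' - y')" by (simp add: algebra_simps)
  then show ?thesis using assms by (metis dvd_in_add dvd_in_mult dvd_in_mult')
qed

lemma dvd_in_power_cong:
  assumes "dvd_in B a (x - y)" "x \<in> B" "y \<in> B"
  shows "dvd_in B a (x ^ k - y ^ k)"
  by (induction k) (use assms in \<open>auto intro!: dvd_in_mult_cong\<close>)

lemma dvd_in_prod_cong:
  assumes "\<And>i. i \<in> I \<Longrightarrow> dvd_in B a (f i - g i)"
    and "\<And>i. i \<in> I \<Longrightarrow> f i \<in> B" "\<And>i. i \<in> I \<Longrightarrow> g i \<in> B"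
  shows "dvd_in B a (prod f I - prod g I)"
  using assms
  by (induction I rule: infinite_finite_induct) (auto intro!: dvd_in_mult_cong prod_in)

lemma one_minus_power: "x \<in> B \<Longrightarrow> dvd_in B (1 - x) (1 - x ^ k)"
  using dvd_in_power_cong[of "1 - x" 1 x k] by simp

text \<open>The inner binomial coefficients for exponent q are multiples of q. The claim iterates
  because congruent elements have congruent q-th powers.\<close>

lemma frobenius_add:
  assumes q: "Factorial_Ring.prime q" and xy: "x \<in> B" "y \<in> B"
  shows "dvd_in B (of_nat q) ((x + y) ^ (q ^ f) - (x ^ (q ^ f) + y ^ (q ^ f)))"
proof -
  have one: "dvd_in B (of_nat q) ((x + y) ^ q - (x ^ q + y ^ q))" if xy: "x \<in> B" "y \<in> B" for x y
  proof -
    have q0: "q > 0" using q prime_gt_0_nat by blast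
    have split: "{..q} = insert 0 (insert q {1..<q})" using q0 by auto
    have "(x + y) ^ q = (\<Sum>k\<le>q. of_nat (q choose k) * x ^ k * y ^ (q - k))"
      by (rule binomial_ring)
    also have "\<dots> = y ^ q + (x ^ q + (\<Sum>k\<in>{1..<q}. of_nat (q choose k) * x ^ k * y ^ (q - k)))"
      unfolding split using q0 by simp
    finally have eq: "(x + y) ^ q - (x ^ q + y ^ q)
        = (\<Sum>k\<in>{1..<q}. of_nat (q choose k) * x ^ k * y ^ (q - k))" by simp
    show ?thesis unfolding eq
    proof (rule dvd_in_sum)
      fix k assume k: "k \<in> {1..<q}"
      then have "q dvd (q choose k)" using q by (intro dvd_choose_prime) auto
      then obtain c where c: "q choose k = q * c" by (auto elim: dvdE)
      show "dvd_in B (of_nat q) (of_nat (q choose k) * x ^ k * y ^ (q - k))"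
        by (rule dvd_inI[of "of_nat c * x ^ k * y ^ (q - k)"]) (use xy c in auto)
    qed
  qed
  show ?thesis
  proof (induction f)
    case 0
    show ?case by simp
  next
    case (Suc f)
    let ?N = "q ^ f"
    have "dvd_in B (of_nat q) (((x + y) ^ ?N) ^ q - (x ^ ?N + y ^ ?N) ^ q)"
      by (rule dvd_in_power_cong[OF Suc]) (use xy in auto)
    moreover have "dvd_in B (of_nat q) ((x ^ ?N + y ^ ?N) ^ q - ((x ^ ?N) ^ q + (y ^ ?N) ^ q))"
      by (rule one) (use xy in auto)
    ultimately show ?case
      using dvd_in_diff_trans by (metis power_Suc2 power_mult)
  qed
qed

text \<open>Expanding the power of x + (- x) = 0 treats q = 2 and odd q alike.\<close>

lemma frobenius_uminus:
  assumes q: "Factorial_Ring.prime q" and x: "x \<in> B"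
  shows "dvd_in B (of_nat q) ((- x) ^ (q ^ f) - (- (x ^ (q ^ f))))"
proof -
  have "q ^ f > 0" using q prime_gt_0_nat by simp
  then show ?thesis
    using frobenius_add[OF q x uminus_in[OF x], of f] dvd_in_uminus
    by (fastforce simp: zero_power algebra_simps)
qed

text \<open>With \<open>y = \<pi> x\<close>, the power \<open>y ^ n = \<pi> ^ n * x ^ n\<close> is highly divisible by \<open>\<pi>\<close> for \<open>n = N ^ j\<close> large,
  because the denominators of the powers of \<open>x\<close> are bounded; but it is congruent to \<open>y\<close>.\<close>

lemma almost_integral_step:
  fixes D :: int
  assumes q: "Factorial_Ring.prime q" and pi: "\<pi> \<in> B" "dvd_in B \<pi> (of_nat q)" "dvd_in B (of_nat q) (\<pi> ^ E)"
    and N: "N > 1" "\<And>y. y \<in> B \<Longrightarrow> dvd_in B \<pi> (y ^ N - y)"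
    and x: "\<pi> * x \<in> B" and D: "D \<noteq> 0" "\<And>k. of_int D * x ^ k \<in> B"
  shows "x \<in> B"
proof -
  let ?q = "of_nat q :: complex"
  have q0: "?q \<noteq> 0" using q prime_gt_0_nat by auto
  have pi0: "\<pi> \<noteq> 0" using pi(2) q0 by (auto simp: dvd_in_def)
  define y where "y = \<pi> * x"
  have y: "y \<in> B" using x y_def by simp
  have q1: "\<not> is_unit (int q)" using q by (metis not_prime_unit prime_nat_int_transfer)
  \<comment> \<open>The denominator D splits into a power of q, which powers of \<pi> absorb, and a
    part d' prime to q, which Bezout coefficients remove at the end.\<close>
  define e where "e = multiplicity (int q) D"
  obtain d' where d': "D = int q ^ e * d'" "\<not> int q dvd d'"
    using multiplicity_decompose'[OF D(1) q1] unfolding e_def by metis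
  have cop: "coprime (int q) d'" using q d'(2) by (simp add: prime_imp_coprime)
  obtain u v where uv: "u * int q + v * d' = 1"
    using bezout_int[of "int q" d'] cop by (metis coprime_imp_gcd_eq_1)
  \<comment> \<open>A power of N, so that y ^ n is congruent to y, and at least E * e + 1, so that
    \<pi> ^ n contains \<pi> * (\<pi> ^ E) ^ e and with it \<pi> * q ^ e.\<close>
  define n where "n = N ^ (E * e + 1)"
  have n_ge: "n \<ge> E * e + 1"
    unfolding n_def using N(1) by (metis less_exp less_imp_le order.strict_trans2 power_mono Suc_1 Suc_leI zero_le)
  have iter: "dvd_in B \<pi> (y ^ (N ^ j) - y)" for j
  proof (induction j)
    case (Suc j)
    have "dvd_in B \<pi> ((y ^ (N ^ j)) ^ N - y ^ (N ^ j))" by (rule N(2)) (use y in auto)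
    then show ?case using Suc dvd_in_diff_trans by (metis power_Suc2 power_mult)
  qed simp
  obtain t where t: "t \<in> B" "\<pi> ^ E = ?q * t" using pi(3) by (auto simp: dvd_in_def)
  have "y ^ n = \<pi> ^ (E * e + 1 + (n - (E * e + 1))) * x ^ n"
    unfolding y_def power_mult_distrib using n_ge by simp
  also have "\<dots> = \<pi> * (\<pi> ^ E) ^ e * \<pi> ^ (n - (E * e + 1)) * x ^ n"
    by (simp only: power_add power_mult) simp
  finally have yn: "of_int d' * y ^ n = \<pi> * (t ^ e * \<pi> ^ (n - (E * e + 1)) * (of_int D * x ^ n))"
    unfolding t(2) d'(1) by (simp add: power_mult_distrib algebra_simps)
  have "dvd_in B \<pi> (of_int d' * y ^ n)" unfolding yn
    by (rule dvd_inI[OF _ refl]) (use t pi D in auto)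
  moreover have "dvd_in B \<pi> (of_int d' * (y ^ n - y))"
    unfolding n_def by (intro dvd_in_mult' iter) simp
  ultimately have 1: "dvd_in B \<pi> (of_int d' * y)"
    using dvd_in_diff[of \<pi> "of_int d' * y ^ n" "of_int d' * (y ^ n - y)"] by (simp add: algebra_simps)
  \<comment> \<open>Both q and d' * y are multiples of \<pi>, and 1 is an integer combination of q
    and d'.\<close>
  have "y = of_int (u * int q + v * d') * y" using uv by simp
  also have "\<dots> = ?q * (of_int u * y) + of_int v * (of_int d' * y)" by (simp add: algebra_simps)
  finally have eq: "y = ?q * (of_int u * y) + of_int v * (of_int d' * y)" .
  have "dvd_in B \<pi> (?q * (of_int u * y) + of_int v * (of_int d' * y))"
    by (intro dvd_in_add dvd_in_mult dvd_in_mult' pi 1) (use y in auto)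
  then have "dvd_in B \<pi> y" using eq by simp
  then show ?thesis using pi0 unfolding y_def dvd_in_def by auto
qed

end

section \<open>The rings generated by roots of unity\<close>

abbreviation ZZ :: "complex \<Rightarrow> complex set" where "ZZ z \<equiv> carrier (Z_adjoin z)"
abbreviation QQ :: "complex \<Rightarrow> complex set" where "QQ z \<equiv> carrier (Q_adjoin z)"

lemma rota_simps [simp]:
  "carrier ring_of_type_algebra = UNIV"
  "monoid.mult ring_of_type_algebra = (*)"
  "monoid.one ring_of_type_algebra = 1"
  "ring.zero ring_of_type_algebra = 0"
  "ring.add ring_of_type_algebra = (+)"
  by (simp_all add: ring_of_type_algebra_def)

lemma Z_adjoin_simps [simp]:
  "monoid.mult (Z_adjoin z) = (*)" "monoid.one (Z_adjoin z) = 1"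
  "ring.zero (Z_adjoin z) = 0" "ring.add (Z_adjoin z) = (+)"
  by (simp_all add: Z_adjoin_def)

lemma Q_adjoin_simps [simp]:
  "monoid.mult (Q_adjoin z) = (*)" "monoid.one (Q_adjoin z) = 1"
  "ring.zero (Q_adjoin z) = 0" "ring.add (Q_adjoin z) = (+)"
  by (simp_all add: Q_adjoin_def)

interpretation CC: cring "ring_of_type_algebra :: complex ring"
  by (rule cring_from_type_algebra)

lemma rota_uminus [simp]: "\<ominus>\<^bsub>ring_of_type_algebra\<^esub> x = - (x :: complex)"
  using CC.minus_equality[of "- x" x] by simp

lemma rota_inverse: "x \<noteq> 0 \<Longrightarrow> inv\<^bsub>ring_of_type_algebra\<^esub> x = inverse (x :: complex)"
  using CC.comm_inv_char[of x "inverse x"] by simp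

lemma ZZ_ring: "complex_subring (ZZ z)"
proof
  show "1 \<in> ZZ z"
    using generate_ring.one[of "ring_of_type_algebra :: complex ring"] by (simp add: Z_adjoin_def)
next
  fix x y assume "x \<in> ZZ z" "y \<in> ZZ z"
  then show "x + y \<in> ZZ z" "x * y \<in> ZZ z"
    using generate_ring.eng_add[of x "ring_of_type_algebra :: complex ring" "{z}" y]
      generate_ring.eng_mult[of x "ring_of_type_algebra :: complex ring" "{z}" y]
    by (simp_all add: Z_adjoin_def)
next
  fix x assume "x \<in> ZZ z"
  then show "- x \<in> ZZ z"
    using generate_ring.a_inv[of x "ring_of_type_algebra :: complex ring" "{z}"]
    by (simp add: Z_adjoin_def)
qed

lemma ZZ_gen: "z \<in> ZZ z"
  using generate_ring.incl[of z "{z}" "ring_of_type_algebra :: complex ring"] by (simp add: Z_adjoin_def)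

lemma ZZ_induct [consumes 1, case_names one gen uminus add mult]:
  assumes "x \<in> ZZ z" "P 1" "P z" "\<And>x. x \<in> ZZ z \<Longrightarrow> P x \<Longrightarrow> P (- x)"
    "\<And>x y. x \<in> ZZ z \<Longrightarrow> y \<in> ZZ z \<Longrightarrow> P x \<Longrightarrow> P y \<Longrightarrow> P (x + y)"
    "\<And>x y. x \<in> ZZ z \<Longrightarrow> y \<in> ZZ z \<Longrightarrow> P x \<Longrightarrow> P y \<Longrightarrow> P (x * y)"
  shows "P x"
proof -
  have "x \<in> generate_ring ring_of_type_algebra {z}" using assms(1) by (simp add: Z_adjoin_def)
  then show ?thesis
    by (induction rule: generate_ring.induct) (use assms in \<open>auto simp: Z_adjoin_def\<close>)
qed

lemma ZZ_least:
  assumes "complex_subring B" "z \<in> B" shows "ZZ z \<subseteq> B"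
proof
  interpret complex_subring B by fact
  fix x assume "x \<in> ZZ z"
  then show "x \<in> B" by (induction rule: ZZ_induct) (use assms in auto)
qed

lemma QQ_ring: "complex_subring (QQ z)"
proof
  show "1 \<in> QQ z"
    using generate_field.one[of "ring_of_type_algebra :: complex ring"] by (simp add: Q_adjoin_def)
next
  fix x y assume "x \<in> QQ z" "y \<in> QQ z"
  then show "x + y \<in> QQ z" "x * y \<in> QQ z"
    using generate_field.eng_add[of x "ring_of_type_algebra :: complex ring" "{z}" y]
      generate_field.eng_mult[of x "ring_of_type_algebra :: complex ring" "{z}" y]
    by (simp_all add: Q_adjoin_def)
next
  fix x assume "x \<in> QQ z"
  then show "- x \<in> QQ z"
    using generate_field.a_inv[of x "ring_of_type_algebra :: complex ring" "{z}"]
    by (simp add: Q_adjoin_def)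
qed

lemma QQ_inverse: "x \<in> QQ z \<Longrightarrow> inverse x \<in> QQ z"
  using generate_field.m_inv[of x "ring_of_type_algebra :: complex ring" "{z}"]
    complex_subring.zero_in[OF QQ_ring, of z]
  by (cases "x = 0") (auto simp add: Q_adjoin_def rota_inverse)

lemma QQ_divide: "x \<in> QQ z \<Longrightarrow> y \<in> QQ z \<Longrightarrow> x / y \<in> QQ z"
  unfolding divide_inverse by (intro complex_subring.mult_in[OF QQ_ring] QQ_inverse)

lemma ZZ_subset_QQ: "ZZ z \<subseteq> QQ z"
  by (rule ZZ_least[OF QQ_ring])
    (use generate_field.incl[of z "{z}" "ring_of_type_algebra :: complex ring"] in \<open>simp add: Q_adjoin_def\<close>)

text \<open>Exponents of z only matter modulo n, so these combinations are closed under
  multiplication. A spanning family is enough for the determinant argument in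
  \<open>ZZ_integral\<close>.\<close>

lemma ZZ_span:
  assumes z: "z ^ n = 1" "n > 0" and x: "x \<in> ZZ z"
  shows "\<exists>c :: nat \<Rightarrow> int. x = (\<Sum>i<n. of_int (c i) * z ^ i)"
proof -
  define W where "W = range (\<lambda>c :: nat \<Rightarrow> int. \<Sum>i<n. of_int (c i) * z ^ i)"
  have WI: "(\<Sum>i<n. of_int (c i) * z ^ i) \<in> W" for c :: "nat \<Rightarrow> int" by (auto simp: W_def)
  have W_int: "of_int k * z ^ i \<in> W" if "i < n" for i k
  proof -
    have "(\<Sum>j<n. of_int (if j = i then k else 0) * z ^ j) = (\<Sum>j<n. if j = i then of_int k * z ^ i else 0)"
      by (rule sum.cong) auto
    also have "\<dots> = of_int k * z ^ i" using that by simp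
    finally show ?thesis using WI[of "\<lambda>j. if j = i then k else 0"] by simp
  qed
  have W_add: "u + v \<in> W" if "u \<in> W" "v \<in> W" for u v
  proof -
    from that obtain c d where "u = (\<Sum>i<n. of_int (c i) * z ^ i)" "v = (\<Sum>i<n. of_int (d i) * z ^ i)"
      by (auto simp: W_def)
    then have "u + v = (\<Sum>i<n. of_int (c i + d i) * z ^ i)"
      by (simp add: sum.distrib algebra_simps)
    then show ?thesis using WI[of "\<lambda>i. c i + d i"] by simp
  qed
  have W_0: "0 \<in> W" using WI[of "\<lambda>_. 0"] by simp
  have W_sum: "sum g I \<in> W" if "\<And>i. i \<in> I \<Longrightarrow> g i \<in> W" for g :: "nat \<Rightarrow> complex" and I
    using that by (induction I rule: infinite_finite_induct) (auto simp: W_0 W_add)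
  have W_pow: "of_int k * z ^ i \<in> W" for i k
  proof -
    have "z ^ i = z ^ (i mod n + n * (i div n))" by simp
    also have "\<dots> = z ^ (i mod n)" unfolding power_add power_mult z(1) by simp
    finally show ?thesis using W_int[of "i mod n" k] z by simp
  qed
  have "x \<in> W" using x
  proof (induction rule: ZZ_induct)
    case one show ?case using W_pow[of 1 0] by simp
  next
    case gen show ?case using W_pow[of 1 1] by simp
  next
    case (uminus x)
    then obtain c where "x = (\<Sum>i<n. of_int (c i) * z ^ i)" by (auto simp: W_def)
    then show ?case using WI[of "\<lambda>i. - c i"] by (simp add: sum_negf)
  next
    case (add x y) then show ?case by (simp add: W_add)
  next
    case (mult x y)
    then obtain c d where "x = (\<Sum>i<n. of_int (c i) * z ^ i)" "y = (\<Sum>i<n. of_int (d i) * z ^ i)"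
      by (auto simp: W_def)
    then have "x * y = (\<Sum>i<n. \<Sum>j<n. of_int (c i * d j) * z ^ (i + j))"
      by (simp add: sum_product power_add algebra_simps)
    then show ?case by (auto intro!: W_sum W_pow simp del: of_int_mult)
  qed
  then show ?thesis by (auto simp: W_def)
qed

text \<open>Multiplication by y acts on the column of powers of z by an integer matrix. So y is an
  eigenvalue, and the characteristic polynomial of that matrix is monic with integer
  coefficients.\<close>

lemma ZZ_integral:
  assumes z: "z ^ n = 1" "n > 0" and y: "y \<in> ZZ z"
  shows "\<exists>f :: int poly. lead_coeff f = 1 \<and> poly (map_poly of_int f) y = 0"
proof -
  interpret complex_subring "ZZ z" by (rule ZZ_ring)
  have "\<forall>i. \<exists>c :: nat \<Rightarrow> int. y * z ^ i = (\<Sum>j<n. of_int (c j) * z ^ j)"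
    using ZZ_span[OF z] y ZZ_gen by simp
  then obtain c where c: "\<And>i. y * z ^ i = (\<Sum>j<n. of_int (c i j :: int) * z ^ j)" by metis
  define A where "A = mat n n (\<lambda>(i, j). c i j)"
  have A: "A \<in> carrier_mat n n" by (simp add: A_def)
  define v where "v = vec n (\<lambda>i. z ^ i)"
  have "eigenvector (map_mat of_int A) v y"
    unfolding eigenvector_def
  proof (intro conjI)
    show "v \<in> carrier_vec (dim_row (map_mat of_int A))" by (simp add: A_def v_def)
    show "v \<noteq> 0\<^sub>v (dim_row (map_mat of_int A))"
    proof
      assume "v = 0\<^sub>v (dim_row (map_mat of_int A))"
      then have "v $ 0 = 0" using z by (simp add: A_def)
      then show False using z by (simp add: v_def)
    qed
    show "map_mat of_int A *\<^sub>v v = y \<cdot>\<^sub>v v"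
      by (rule eq_vecI) (auto simp: A_def v_def scalar_prod_def c atLeast0LessThan)
  qed
  then have "eigenvalue (map_mat of_int A) y" by (auto simp: eigenvalue_def)
  then have "poly (char_poly (map_mat of_int A)) y = 0"
    using eigenvalue_root_char_poly[of "map_mat of_int A" n y] A by simp
  moreover have "char_poly (map_mat of_int A :: complex mat) = map_poly of_int (char_poly A)"
    by (rule of_int_hom.char_poly_hom[OF A])
  moreover have "lead_coeff (char_poly A) = 1" using degree_monic_char_poly[OF A] by simp
  ultimately show ?thesis by metis
qed

lemma ZZ_poly_in: "y \<in> ZZ z \<Longrightarrow> poly (map_poly of_int (f :: int poly)) y \<in> ZZ z"
proof -
  interpret complex_subring "ZZ z" by (rule ZZ_ring)
  assume "y \<in> ZZ z"
  then show ?thesis by (induction f) (simp_all add: map_poly_pCons)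
qed

text \<open>In an integer relation for y the constant term is y times an element of the ring. A
  vanishing constant term is cancelled together with one factor y, hence the induction over
  polynomials.\<close>

lemma ZZ_denominator:
  assumes z: "z ^ n = 1" "n > 0" and y: "y \<in> ZZ z" "y \<noteq> 0"
  shows "\<exists>w\<in>ZZ z. \<exists>d :: int. d \<noteq> 0 \<and> y * w = of_int d"
proof -
  interpret complex_subring "ZZ z" by (rule ZZ_ring)
  obtain f :: "int poly" where f: "lead_coeff f = 1" "poly (map_poly of_int f) y = 0"
    using ZZ_integral[OF z y(1)] by blast
  have "g \<noteq> 0 \<Longrightarrow> poly (map_poly of_int g) y = 0 \<Longrightarrow> \<exists>w\<in>ZZ z. \<exists>d :: int. d \<noteq> 0 \<and> y * w = of_int d"
    for g :: "int poly"
  proof (induction g)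
    case (pCons a g)
    let ?w = "poly (map_poly of_int g) y :: complex"
    have eq: "of_int a + y * ?w = 0" using pCons.prems by (simp add: map_poly_pCons)
    show ?case
    proof (cases "a = 0")
      case True
      then have "?w = 0" "g \<noteq> 0" using eq y pCons by auto
      then show ?thesis using pCons.IH by simp
    next
      case False
      moreover have "y * - ?w = of_int a" using eq by (simp add: add_eq_0_iff)
      ultimately show ?thesis using uminus_in[OF ZZ_poly_in[OF y(1), of g]] by blast
    qed
  qed simp
  moreover have "f \<noteq> 0" using f by auto
  ultimately show ?thesis using f by blast
qed

text \<open>Only inverses need an argument: if d * h lies in the ring and d * h * w is a nonzero
  integer e, then e / h = d * w.\<close>

lemma QQ_denominator:
  assumes z: "z ^ n = 1" "n > 0"
  shows "x \<in> QQ z \<longleftrightarrow> (\<exists>d :: int. d \<noteq> 0 \<and> of_int d * x \<in> ZZ z)"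
proof
  interpret complex_subring "ZZ z" by (rule ZZ_ring)
  assume "x \<in> QQ z"
  then have "x \<in> generate_field ring_of_type_algebra {z}" by (simp add: Q_adjoin_def)
  then show "\<exists>d :: int. d \<noteq> 0 \<and> of_int d * x \<in> ZZ z"
  proof (induction rule: generate_field.induct)
    case one
    show ?case by (rule exI[of _ 1]) simp
  next
    case (incl h)
    then show ?case by (intro exI[of _ 1]) (simp add: ZZ_gen)
  next
    case (a_inv h)
    then obtain d :: int where "d \<noteq> 0" "of_int d * h \<in> ZZ z" by auto
    then show ?case using uminus_in[of "of_int d * h"] by (intro exI[of _ d]) simp
  next
    case (m_inv h)
    then obtain d :: int where d: "d \<noteq> 0" "of_int d * h \<in> ZZ z" by auto
    have h0: "h \<noteq> 0" using m_inv by simp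
    obtain w and e :: int where w: "w \<in> ZZ z" "e \<noteq> 0" "of_int d * h * w = of_int e"
      using ZZ_denominator[OF z d(2)] d h0 by auto
    have "of_int e * inverse h = of_int d * w"
      using w(3) h0 by (simp add: field_simps)
    then show ?case using w h0 by (intro exI[of _ e]) (simp add: rota_inverse)
  next
    case (eng_add h1 h2)
    then obtain d1 d2 :: int where d: "d1 \<noteq> 0" "of_int d1 * h1 \<in> ZZ z" "d2 \<noteq> 0" "of_int d2 * h2 \<in> ZZ z" by auto
    have "of_int (d1 * d2) * (h1 + h2) = of_int d2 * (of_int d1 * h1) + of_int d1 * (of_int d2 * h2)"
      by (simp add: algebra_simps)
    then show ?case using d by (intro exI[of _ "d1 * d2"]) simp
  next
    case (eng_mult h1 h2)
    then obtain d1 d2 :: int where d: "d1 \<noteq> 0" "of_int d1 * h1 \<in> ZZ z" "d2 \<noteq> 0" "of_int d2 * h2 \<in> ZZ z" by auto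
    have "of_int (d1 * d2) * (h1 * h2) = (of_int d1 * h1) * (of_int d2 * h2)"
      by (simp add: algebra_simps)
    then have "of_int (d1 * d2) * (h1 * h2) \<in> ZZ z" using d mult_in by metis
    then show ?case using d by (intro exI[of _ "d1 * d2"]) simp
  qed
next
  interpret Q: complex_subring "QQ z" by (rule QQ_ring)
  assume "\<exists>d :: int. d \<noteq> 0 \<and> of_int d * x \<in> ZZ z"
  then obtain d :: int where d: "d \<noteq> 0" "of_int d * x \<in> QQ z" using ZZ_subset_QQ by auto
  then have "x = (of_int d * x) / of_int d" by simp
  then show "x \<in> QQ z" using d QQ_divide Q.of_int_in by metis
qed

section \<open>Powers of primitive roots of unity\<close>

lemma primitive_root_inj:
  assumes "primitive_root_of_unity n z"
  shows "inj_on (\<lambda>i. z ^ i) {..<n}"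
proof -
  have z0: "z \<noteq> 0" using assms by (auto simp: primitive_root_of_unity_def power_0_left)
  have "i = j" if ij: "i \<le> j" "j < n" "z ^ i = z ^ j" for i j
  proof (rule ccontr)
    assume "i \<noteq> j"
    then have "0 < j - i" "j - i < n" using ij by auto
    moreover have "z ^ i * z ^ (j - i) = z ^ i * 1" using ij by (metis le_add_diff_inverse mult.right_neutral power_add)
    then have "z ^ (j - i) = 1" using z0 by simp
    ultimately show False using assms by (auto simp: primitive_root_of_unity_def)
  qed
  then show ?thesis by (intro inj_onI) (metis lessThan_iff linear)
qed

text \<open>The n distinct powers of z already exhaust the roots of X ^ n - 1.\<close>

lemma primitive_root_generates:
  assumes z: "primitive_root_of_unity n z" and w: "w ^ n = 1"
  shows "\<exists>j<n. w = z ^ j"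
proof -
  have n: "n \<ge> 1" using z by (auto simp: primitive_root_of_unity_def)
  have "(\<lambda>i. z ^ i) ` {..<n} = {w. w ^ n = 1}"
  proof (rule card_seteq)
    show "finite {w :: complex. w ^ n = 1}" using n by (rule finite_roots_unity)
    show "(\<lambda>i. z ^ i) ` {..<n} \<subseteq> {w. w ^ n = 1}"
      using z by (auto simp: primitive_root_of_unity_def simp flip: power_mult)
        (simp add: mult.commute[of _ n] power_mult)
    show "card {w :: complex. w ^ n = 1} \<le> card ((\<lambda>i. z ^ i) ` {..<n})"
      using card_roots_unity[OF n, where ?'a=complex] card_image[OF primitive_root_inj[OF z]] by simp
  qed
  then show ?thesis using w by (auto simp: image_iff set_eq_iff)
qed

lemma primitive_root_power:
  assumes z: "primitive_root_of_unity (a * b) z"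
  shows "primitive_root_of_unity b (z ^ a)"
  unfolding primitive_root_of_unity_def
proof (intro conjI allI impI)
  have ab: "a > 0" "b > 0" using z by (auto simp: primitive_root_of_unity_def)
  show "b > 0" by fact
  show "(z ^ a) ^ b = 1" using z by (simp add: primitive_root_of_unity_def power_mult)
  fix j assume "0 < j \<and> j < b"
  then have "0 < a * j" "a * j < a * b" using ab by auto
  then show "(z ^ a) ^ j \<noteq> 1" using z by (simp add: primitive_root_of_unity_def flip: power_mult)
qed

lemma primitive_root_sum:
  assumes z: "primitive_root_of_unity n z" and n: "n > 1"
  shows "(\<Sum>i<n. z ^ i) = 0"
proof -
  have "z ^ 1 \<noteq> 1" using z n unfolding primitive_root_of_unity_def by blast
  then have "z \<noteq> 1" by simp
  then show ?thesis using z by (simp add: geometric_sum primitive_root_of_unity_def)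
qed

text \<open>N is a power of q and \<pi> divides q, so the elements fixed by the N-th power modulo
  \<pi> form a subring. Testing the generator z is therefore enough.\<close>

lemma ZZ_frobenius:
  assumes q: "Factorial_Ring.prime q" and N: "N = q ^ f"
    and pi: "dvd_in (ZZ z) \<pi> (of_nat q)" "dvd_in (ZZ z) \<pi> (z ^ N - z)"
    and y: "y \<in> ZZ z"
  shows "dvd_in (ZZ z) \<pi> (y ^ N - y)"
  using y
proof (induction rule: ZZ_induct)
  interpret complex_subring "ZZ z" by (rule ZZ_ring)
  case one
  show ?case by simp
next
  case gen
  show ?case by (rule pi)
next
  interpret complex_subring "ZZ z" by (rule ZZ_ring)
  case (uminus x)
  have "dvd_in (ZZ z) \<pi> ((- x) ^ N - (- (x ^ N)))"
    unfolding N by (rule dvd_in_trans[OF pi(1) frobenius_uminus[OF q uminus(1)]])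
  from dvd_in_diff[OF this uminus(2)] show ?case by (simp add: algebra_simps)
next
  interpret complex_subring "ZZ z" by (rule ZZ_ring)
  case (add x y)
  have "dvd_in (ZZ z) \<pi> ((x + y) ^ N - (x ^ N + y ^ N))"
    unfolding N by (rule dvd_in_trans[OF pi(1) frobenius_add[OF q add(1,2)]])
  from dvd_in_add[OF this dvd_in_add[OF add(3,4)]] show ?case by (simp add: algebra_simps)
next
  interpret complex_subring "ZZ z" by (rule ZZ_ring)
  case (mult x y)
  then show ?case by (auto simp: power_mult_distrib intro!: dvd_in_mult_cong)
qed

text \<open>By Euler's theorem q ^ \<open>totient n\<close> is 1 modulo n, so this power fixes z
  itself.\<close>

lemma ZZ_frobenius_coprime:
  assumes z: "z ^ n = 1" "n > 0" and q: "Factorial_Ring.prime q" "\<not> q dvd n"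
  shows "\<exists>N>1. \<forall>y\<in>ZZ z. dvd_in (ZZ z) (of_nat q) (y ^ N - y)"
proof -
  interpret complex_subring "ZZ z" by (rule ZZ_ring)
  define N where "N = q ^ totient n"
  have "coprime q n" using q by (simp add: prime_imp_coprime)
  then have "[N = 1] (mod n)" unfolding N_def by (rule euler_theorem)
  moreover have N1: "N > 1"
    unfolding N_def using q(1) z(2) by (intro one_less_power prime_gt_1_nat) auto
  ultimately have "n dvd N - 1" by (metis cong_altdef_nat less_imp_le)
  then obtain j where "N - 1 = n * j" by (auto elim: dvdE)
  then have "N = n * j + 1" using N1 by simp
  then have "z ^ N = z" using z by (simp add: power_mult)
  then have "\<forall>y\<in>ZZ z. dvd_in (ZZ z) (of_nat q) (y ^ N - y)"
    using ZZ_frobenius[OF q(1) N_def] by simp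
  then show ?thesis using N1 by blast
qed

text \<open>If q does not divide n, \<open>almost_integral_step\<close> applies with \<pi> = q.
  Otherwise q ramifies: \<pi> = 1 - \<eta> replaces it, where the order of \<eta> is the full power
  of q in n, and the factors \<pi> are cancelled one at a time.\<close>

lemma ZZ_almost_integral_prime:
  fixes d :: int
  assumes z: "primitive_root_of_unity n z" and q: "Factorial_Ring.prime q"
    and x: "of_nat q * x \<in> ZZ z" and d: "d \<noteq> 0" "\<And>k. of_int d * x ^ k \<in> ZZ z"
  shows "x \<in> ZZ z"
proof -
  interpret complex_subring "ZZ z" by (rule ZZ_ring)
  have zn: "z ^ n = 1" "n > 0" using z by (auto simp: primitive_root_of_unity_def)
  show ?thesis
  proof (cases "q dvd n")
    case False
    obtain N where "N > 1" "\<And>y. y \<in> ZZ z \<Longrightarrow> dvd_in (ZZ z) (of_nat q) (y ^ N - y)"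
      using ZZ_frobenius_coprime[OF zn q False] by blast
    then show ?thesis
      by (intro almost_integral_step[where \<pi> = "of_nat q" and E = 1, OF q _ _ _ _ _ x d]) simp_all
  next
    case True
    have q1: "q > 1" using q by (rule prime_gt_1_nat)
    obtain k n' where n': "n = q ^ k * n'" "\<not> q dvd n'"
      using multiplicity_decompose'[of n q] zn q1 by (metis One_nat_def less_not_refl nat_dvd_1_iff_1)
    have n'0: "n' > 0" using n' zn by (cases n') auto
    have k: "k > 0" using True n' by (cases k) auto
    define \<eta> where "\<eta> = z ^ n'"
    have \<eta>: "\<eta> \<in> ZZ z" by (simp add: \<eta>_def ZZ_gen)
    have \<eta>_prim: "primitive_root_of_unity (q ^ k) \<eta>"
      unfolding \<eta>_def by (rule primitive_root_power) (use z n' in \<open>simp add: mult.commute\<close>)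
    then have \<eta>1: "\<eta> ^ (q ^ k) = 1" by (simp add: primitive_root_of_unity_def)
    define \<pi> where "\<pi> = 1 - \<eta>"
    have \<pi>: "\<pi> \<in> ZZ z" using \<eta> by (simp add: \<pi>_def)
    have piq: "dvd_in (ZZ z) \<pi> (of_nat q)"
    proof -
      \<comment> \<open>A power of \<eta> of exact order q: its powers sum to 0, so q is the sum of
        the terms 1 - \<theta> ^ i, and \<pi> divides each of them.\<close>
      define \<theta> where "\<theta> = \<eta> ^ (q ^ (k - 1))"
      have "primitive_root_of_unity q \<theta>"
        unfolding \<theta>_def by (rule primitive_root_power) (use \<eta>_prim k in \<open>simp flip: power_Suc2\<close>)
      then have "(\<Sum>i<q. \<theta> ^ i) = 0" using q1 by (rule primitive_root_sum)
      then have "of_nat q = (\<Sum>i<q. 1 - \<eta> ^ (q ^ (k - 1) * i))"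
        by (simp add: sum_subtractf \<theta>_def power_mult)
      then show ?thesis unfolding \<pi>_def by (simp only:) (intro dvd_in_sum one_minus_power[OF \<eta>])
    qed
    \<comment> \<open>Modulo q the power (1 - \<eta>) ^ (q ^ k) is 1 - \<eta> ^ (q ^ k) = 0.\<close>
    have qpi: "dvd_in (ZZ z) (of_nat q) (\<pi> ^ (q ^ k))"
      using dvd_in_add[OF frobenius_add[OF q one_in uminus_in[OF \<eta>], of k] frobenius_uminus[OF q \<eta>, of k]] \<eta>1
      by (simp add: \<pi>_def)
    \<comment> \<open>The exponent is 1 modulo n', the prime-to-q part of n. So z ^ N is z times a
      power of \<eta>, which is congruent to z modulo \<pi>.\<close>
    define N where "N = q ^ totient n'"
    have "coprime q n'" using q n' by (simp add: prime_imp_coprime)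
    then have "[N = 1] (mod n')" unfolding N_def by (rule euler_theorem)
    moreover have N1: "N > 1" unfolding N_def using q1 n'0 by (intro one_less_power) auto
    ultimately have "n' dvd N - 1" by (metis cong_altdef_nat less_imp_le)
    then obtain j where "N - 1 = n' * j" by (auto elim: dvdE)
    then have "N = n' * j + 1" using N1 by simp
    then have "z ^ N = \<eta> ^ j * z" by (simp only: \<eta>_def power_add power_mult power_one_right)
    then have "z ^ N - z = - ((1 - \<eta> ^ j) * z)" by (simp add: algebra_simps)
    then have "dvd_in (ZZ z) \<pi> (z ^ N - z)"
      unfolding \<pi>_def using dvd_in_uminus[OF dvd_in_mult[OF one_minus_power[OF \<eta>] ZZ_gen]] by simp
    then have fr: "dvd_in (ZZ z) \<pi> (y ^ N - y)" if "y \<in> ZZ z" for y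
      using ZZ_frobenius[OF q N_def piq] that by simp
    have pix: "\<pi> * x \<in> ZZ z"
    proof -
      \<comment> \<open>A power of \<pi> divisible by q makes the product with x integral; each
        induction step then removes one factor \<pi>, down to \<pi> * x.\<close>
      have "j \<le> q ^ k \<Longrightarrow> \<pi> ^ Suc (q ^ k - j) * x \<in> ZZ z" for j
      proof (induction j)
        case 0
        from qpi obtain t where t: "t \<in> ZZ z" "\<pi> ^ (q ^ k) = of_nat q * t" by (auto simp: dvd_in_def)
        have "\<pi> ^ Suc (q ^ k - 0) * x = \<pi> * t * (of_nat q * x)" by (simp add: t)
        then show ?case using t \<pi> x mult_in by metis
      next
        case (Suc j)
        let ?y = "\<pi> ^ Suc (q ^ k - Suc j) * x"
        have "\<pi> * ?y = \<pi> ^ Suc (q ^ k - j) * x" using Suc.prems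
          by (metis Suc_diff_Suc Suc_le_lessD mult.assoc power_Suc)
        then have 1: "\<pi> * ?y \<in> ZZ z" using Suc by (metis Suc_leD)
        have 2: "of_int d * ?y ^ i \<in> ZZ z" for i
        proof -
          have "of_int d * ?y ^ i = (\<pi> ^ Suc (q ^ k - Suc j)) ^ i * (of_int d * x ^ i)"
            by (simp add: power_mult_distrib algebra_simps)
          then show ?thesis using d \<pi> mult_in power_in by metis
        qed
        show ?case
          by (rule almost_integral_step[OF q \<pi> piq qpi N1 fr 1 d(1) 2])
      qed
      from this[of "q ^ k"] show ?thesis by simp
    qed
    show ?thesis by (rule almost_integral_step[OF q \<pi> piq qpi N1 fr pix d])
  qed
qed

text \<open>Induction over a natural denominator c of x: for a prime q dividing c, the element (c /
  q) * x is covered by \<open>ZZ_almost_integral_prime\<close>, as its powers are integer multiples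
  of those of x.\<close>

lemma ZZ_almost_integral:
  fixes d :: int
  assumes z: "primitive_root_of_unity n z"
    and x: "x \<in> QQ z" and d: "d \<noteq> 0" "\<And>k. of_int d * x ^ k \<in> ZZ z"
  shows "x \<in> ZZ z"
proof -
  interpret complex_subring "ZZ z" by (rule ZZ_ring)
  have zn: "z ^ n = 1" "n > 0" using z by (auto simp: primitive_root_of_unity_def)
  obtain e :: int where e: "e \<noteq> 0" "of_int e * x \<in> ZZ z" using x QQ_denominator[OF zn] by blast
  define c where "c = nat \<bar>e\<bar>"
  have c: "c > 0" "of_nat c * x \<in> ZZ z"
    using e uminus_in[of "of_int e * x"] by (auto simp: c_def abs_if)
  have "c > 0 \<Longrightarrow> of_nat c * x \<in> ZZ z \<Longrightarrow> (\<And>k. of_int d * x ^ k \<in> ZZ z) \<Longrightarrow> x \<in> ZZ z" for c :: nat and x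
  proof (induction c arbitrary: x rule: less_induct)
    case (less c)
    show ?case
    proof (cases "c = 1")
      case True then show ?thesis using less by simp
    next
      case False
      then obtain q where q: "Factorial_Ring.prime q" "q dvd c" using prime_factor_nat by blast
      then obtain c' where c': "c = q * c'" by (auto elim: dvdE)
      have c'0: "c' > 0" "c' < c" using c' less.prems prime_gt_1_nat[OF q(1)] by (auto intro: Nat.gr0I)
      have "of_nat c' * x \<in> ZZ z"
      proof (rule ZZ_almost_integral_prime[OF z q(1) _ d(1)])
        show "of_nat q * (of_nat c' * x) \<in> ZZ z" using less.prems c' by (simp add: mult.assoc)
        show "of_int d * (of_nat c' * x) ^ k \<in> ZZ z" for k
        proof -
          have "of_int d * (of_nat c' * x) ^ k = of_nat (c' ^ k) * (of_int d * x ^ k)"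
            by (simp add: power_mult_distrib)
          then show ?thesis using less.prems(3) mult_in of_nat_in by metis
        qed
      qed
      then show ?thesis using less.IH[OF c'0(2,1)] less.prems by blast
    qed
  qed
  then show ?thesis using c d by blast
qed

text \<open>The monic equation of degree m rewrites every power of x by lower ones. If e * x is
  integral, e ^ m therefore clears the denominators of all powers at once.\<close>

lemma ZZ_integrally_closed:
  fixes f :: "int poly"
  assumes z: "primitive_root_of_unity n z" and x: "x \<in> QQ z"
    and f: "lead_coeff f = 1" "poly (map_poly of_int f) x = 0"
  shows "x \<in> ZZ z"
proof -
  interpret complex_subring "ZZ z" by (rule ZZ_ring)
  have zn: "z ^ n = 1" "n > 0" using z by (auto simp: primitive_root_of_unity_def)
  obtain e :: int where e: "e \<noteq> 0" "of_int e * x \<in> ZZ z" using x QQ_denominator[OF zn] by blast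
  define m where "m = degree f"
  have "poly (map_poly of_int f) x = (\<Sum>i\<le>m. of_int (coeff f i) * x ^ i)"
    by (simp add: poly_altdef m_def coeff_map_poly)
  also have "{..m} = insert m {..<m}" by auto
  finally have "x ^ m + (\<Sum>i<m. of_int (coeff f i) * x ^ i) = 0" using f by (simp add: m_def)
  then have xm: "x ^ m = - (\<Sum>i<m. of_int (coeff f i) * x ^ i)" by (simp add: add_eq_0_iff2)
  have "of_int (e ^ m) * x ^ k \<in> ZZ z" for k
  proof (induction k rule: less_induct)
    case (less k)
    show ?case
    proof (cases "k < m")
      case True
      then have "of_int (e ^ m) * x ^ k = of_int (e ^ (m - k)) * (of_int e * x) ^ k"
        by (simp add: power_mult_distrib flip: power_add mult.assoc)
      then show ?thesis using e mult_in of_int_in power_in by metis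
    next
      case False
      then have "x ^ k = x ^ m * x ^ (k - m)" by (simp flip: power_add)
      then have "of_int (e ^ m) * x ^ k = - (\<Sum>i<m. of_int (coeff f i) * (of_int (e ^ m) * x ^ (i + (k - m))))"
        unfolding xm by (simp add: sum_distrib_left sum_distrib_right power_add algebra_simps sum_negf)
      then show ?thesis using False less by (simp only:) (intro uminus_in sum_in mult_in of_int_in less, auto)
    qed
  qed
  then show ?thesis using ZZ_almost_integral[OF z x, of "e ^ m"] e by simp
qed

lemma ZZ_rational_integer:
  fixes a b :: int
  assumes z: "z ^ n = 1" "n > 0" and b: "b \<noteq> 0" "of_int a / of_int b \<in> ZZ z"
  shows "b dvd a"
proof -
  have "algebraic_int (of_int a / of_int b :: complex)"
    using ZZ_integral[OF z b(2)] algebraic_int_altdef_ipoly by blast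
  then have "(of_int a / of_int b :: complex) \<in> \<int>" by (rule rational_algebraic_int_is_int) simp
  then obtain k where "(of_int a / of_int b :: complex) = of_int k" by (auto elim: Ints_cases)
  then have "(of_int a :: complex) = of_int (b * k)" using b by (simp add: field_simps)
  then have "a = b * k" by (simp only: of_int_eq_iff)
  then show ?thesis by simp
qed

text \<open>For r nonzero some nonzero integer d is a multiple of r, hence divisible by p ^ k for
  every k. The choice k = |d| is too large.\<close>

lemma ZZ_infinitely_divisible:
  assumes z: "z ^ n = 1" "n > 0" and p: "p > 1" and r: "r \<in> ZZ z" "\<And>k. dvd_in (ZZ z) (of_nat p ^ k) r"
  shows "r = 0"
proof (rule ccontr)
  interpret complex_subring "ZZ z" by (rule ZZ_ring)
  assume "r \<noteq> 0"
  then obtain w and d :: int where w: "w \<in> ZZ z" "d \<noteq> 0" "r * w = of_int d"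
    using ZZ_denominator[OF z r(1)] by blast
  define k where "k = nat \<bar>d\<bar>"
  obtain t where t: "t \<in> ZZ z" "r = of_nat p ^ k * t" using r(2)[of k] by (auto simp: dvd_in_def)
  have "of_int d / of_int (int p ^ k) = t * w" using w t p by (auto simp: field_simps)
  then have "int p ^ k dvd d"
    using t w p by (intro ZZ_rational_integer[OF z]) auto
  then have "int p ^ k \<le> \<bar>d\<bar>" using w(2) by (metis dvd_abs_iff zdvd_imp_le zero_less_abs_iff)
  moreover have "k < p ^ k" using p by (metis less_exp order.strict_trans2 power_mono Suc_1 Suc_leI zero_le)
  then have "int k < int p ^ k" by (metis of_nat_less_iff of_nat_power)
  ultimately show False unfolding k_def by simp
qed

lemma QQ_common_denominator:
  assumes z: "z ^ n = 1" "n > 0" and I: "finite I" "\<And>i. i \<in> I \<Longrightarrow> x i \<in> QQ z"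
  shows "\<exists>d :: int. d \<noteq> 0 \<and> (\<forall>i\<in>I. of_int d * x i \<in> ZZ z)"
  using I
proof (induction I)
  case empty
  show ?case by (rule exI[of _ 1]) simp
next
  interpret complex_subring "ZZ z" by (rule ZZ_ring)
  case (insert i I)
  then obtain d :: int where d: "d \<noteq> 0" "\<forall>i\<in>I. of_int d * x i \<in> ZZ z" by auto
  obtain e :: int where e: "e \<noteq> 0" "of_int e * x i \<in> ZZ z" using insert.prems[of i] QQ_denominator[OF z, of "x i"] by auto
  have "of_int (d * e) * x j \<in> ZZ z" if "j \<in> insert i I" for j
  proof (cases "j \<in> I")
    case True
    then have "of_int e * (of_int d * x j) \<in> ZZ z" using d by simp
    then show ?thesis by (simp add: algebra_simps)
  next
    case False
    then have "of_int d * (of_int e * x j) \<in> ZZ z" using e that by simp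
    then show ?thesis by (simp add: algebra_simps)
  qed
  then show ?case using d e by (intro exI[of _ "d * e"]) simp
qed

section \<open>The pair of rings \<open>\<int>[\<zeta>\<^sub>m] \<subseteq> \<int>[\<zeta>\<^sub>m\<^sub>p]\<close>\<close>

text \<open>The three roots are chosen independently. That \<open>zm\<close> and \<open>zp\<close>
  lie in S is derived: both are roots of unity of order dividing m * p, hence powers of
  \<open>zmp\<close>.\<close>

locale cyclotomic_pair =
  fixes m p :: nat and zm zp zmp :: complex
  assumes m1: "m \<ge> 1" and p_prime: "Factorial_Ring.prime p" and p2: "p > 2" and p_ndvd: "\<not> p dvd m"
    and zm: "primitive_root_of_unity m zm"
    and zp: "primitive_root_of_unity p zp"
    and zmp: "primitive_root_of_unity (m * p) zmp"
begin

abbreviation R where "R \<equiv> ZZ zm"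
abbreviation S where "S \<equiv> ZZ zmp"
abbreviation K where "K \<equiv> QQ zm"
abbreviation L where "L \<equiv> QQ zmp"
abbreviation \<pi> where "\<pi> \<equiv> 1 - zp"
abbreviation pc :: complex where "pc \<equiv> of_nat p"

sublocale R: complex_subring "ZZ zm" by (rule ZZ_ring)
sublocale S: complex_subring "ZZ zmp" by (rule ZZ_ring)
sublocale K: complex_subring "QQ zm" by (rule QQ_ring)
sublocale L: complex_subring "QQ zmp" by (rule QQ_ring)

lemma zm_power: "zm ^ m = 1" "m > 0" using zm by (auto simp: primitive_root_of_unity_def)
lemma zmp_power: "zmp ^ (m * p) = 1" "m * p > 0" using zmp by (auto simp: primitive_root_of_unity_def)
lemma zp_power: "zp ^ p = 1" "p > 0" using zp by (auto simp: primitive_root_of_unity_def)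

lemma p_pos [simp]: "0 < p" by (rule zp_power)
lemma p_neq_0 [simp]: "p \<noteq> 0" using p_pos by blast

lemma pi_nonzero [simp]: "zp \<noteq> 1" "\<pi> \<noteq> 0"
proof -
  have "p > 1" using p2 by simp
  then have "zp ^ 1 \<noteq> 1" using zp unfolding primitive_root_of_unity_def by blast
  then show "zp \<noteq> 1" "\<pi> \<noteq> 0" by simp_all
qed

lemma zp_sum: "(\<Sum>i<p. zp ^ i) = 0" using primitive_root_sum[OF zp] p2 by simp

lemma zm_in_S: "zm \<in> S"
proof -
  have "zm ^ (m * p) = 1" using zm_power by (simp add: power_mult)
  then obtain j where "zm = zmp ^ j" using primitive_root_generates[OF zmp] by blast
  then show ?thesis by (simp add: ZZ_gen)
qed

lemma zp_in_S [simp]: "zp \<in> S"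
proof -
  have "zp ^ (m * p) = 1" using zp_power by (simp add: mult.commute[of m] power_mult)
  then obtain j where "zp = zmp ^ j" using primitive_root_generates[OF zmp] by blast
  then show ?thesis by (simp add: ZZ_gen)
qed

lemma pi_in_S [simp]: "\<pi> \<in> S" by simp

lemma R_subset_S: "R \<subseteq> S" by (rule ZZ_least[OF ZZ_ring zm_in_S])
lemma R_in_S [simp]: "x \<in> R \<Longrightarrow> x \<in> S" using R_subset_S by blast
lemma R_in_K [simp]: "x \<in> R \<Longrightarrow> x \<in> K" using ZZ_subset_QQ by blast
lemma S_in_L [simp]: "x \<in> S \<Longrightarrow> x \<in> L" using ZZ_subset_QQ by blast

lemma K_in_L [simp]: "x \<in> K \<Longrightarrow> x \<in> L"
  using QQ_denominator[OF zm_power, of x] QQ_denominator[OF zmp_power, of x] R_in_S by blast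

lemma K_divide [simp]: "x \<in> K \<Longrightarrow> y \<in> K \<Longrightarrow> x / y \<in> K" by (rule QQ_divide)
lemma L_divide [simp]: "x \<in> L \<Longrightarrow> y \<in> L \<Longrightarrow> x / y \<in> L" by (rule QQ_divide)

text \<open>Bezout coefficients for the coprime numbers p and m split \<open>zmp\<close> into an
  m-th and a p-th root of unity.\<close>

lemma zmp_factor: "\<exists>r\<in>R. \<exists>b<p. zmp = r * zp ^ b"
proof -
  have "coprime p m" using p_prime p_ndvd by (simp add: prime_imp_coprime)
  then have "coprime (int p) (int m)" by simp
  then obtain u v where uv: "u * int p + v * int m = 1"
    using bezout_int[of "int p" "int m"] by (metis coprime_imp_gcd_eq_1)
  \<comment> \<open>Reduction modulo m and p gives natural exponents; it changes a * p + b * m only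
    by a multiple of m * p, the order of \<open>zmp\<close>.\<close>
  define a where "a = nat (u mod int m)"
  define b where "b = nat (v mod int p)"
  have "int (a * p + b * m) = (u mod int m) * int p + (v mod int p) * int m"
    using zm_power zp_power by (simp add: a_def b_def)
  also have "\<dots> = 1 + int (m * p) * (- (u div int m) - (v div int p))"
    using uv by (simp add: minus_div_mult_eq_mod[symmetric] algebra_simps)
  finally have eq: "int (a * p + b * m) = 1 + int (m * p) * (- (u div int m) - (v div int p))" .
  then have "int (a * p + b * m) mod int (m * p) = 1 mod int (m * p)" by (simp add: mod_mult_self2)
  then have "(a * p + b * m) mod (m * p) = 1 mod (m * p)" by (metis of_nat_1 of_nat_eq_iff of_nat_mod)
  then have "zmp ^ ((a * p + b * m) mod (m * p)) = zmp ^ (1 mod (m * p))" by simp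
  moreover have red: "zmp ^ (k mod (m * p)) = zmp ^ k" for k
  proof -
    have "zmp ^ k = zmp ^ (m * p * (k div (m * p)) + k mod (m * p))" by simp
    also have "\<dots> = zmp ^ (k mod (m * p))" unfolding power_add power_mult[of _ "m * p"] zmp_power by simp
    finally show ?thesis by simp
  qed
  ultimately have "zmp = zmp ^ (p * a + m * b)" by (simp only: red power_one_right) (simp add: mult.commute)
  also have "\<dots> = (zmp ^ p) ^ a * (zmp ^ m) ^ b" by (simp add: power_add power_mult)
  finally have z: "zmp = (zmp ^ p) ^ a * (zmp ^ m) ^ b" .
  have "(zmp ^ p) ^ m = 1" "(zmp ^ m) ^ p = 1" using zmp_power by (simp_all add: mult.commute flip: power_mult)
  then obtain i j where ij: "zmp ^ p = zm ^ i" "zmp ^ m = zp ^ j"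
    using primitive_root_generates[OF zm] primitive_root_generates[OF zp] by metis
  have "((zmp ^ m) ^ b) ^ p = 1" unfolding ij using zp_power
    by (metis mult.commute power_mult power_one)
  then obtain c where c: "c < p" "(zmp ^ m) ^ b = zp ^ c"
    using primitive_root_generates[OF zp] by metis
  have "(zmp ^ p) ^ a \<in> R" unfolding ij by (simp add: ZZ_gen)
  then show ?thesis using z c by metis
qed

text \<open>All p powers are kept in spite of the relation between them: the coefficients then form
  an element of the group ring that evaluates to s.\<close>

lemma S_span:
  assumes "s \<in> S"
  shows "\<exists>c :: nat \<Rightarrow> complex. (\<forall>i. c i \<in> R) \<and> s = (\<Sum>i<p. c i * zp ^ i)"
proof -
  define W where "W = {\<Sum>i<p. c i * zp ^ i |c. \<forall>i. c i \<in> R}"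
  have WI: "(\<Sum>i<p. c i * zp ^ i) \<in> W" if "\<And>i. c i \<in> R" for c using that by (auto simp: W_def)
  have W_int: "k * zp ^ i \<in> W" if "i < p" "k \<in> R" for i k
  proof -
    have "(\<Sum>j<p. (if j = i then k else 0) * zp ^ j) = (\<Sum>j<p. if j = i then k * zp ^ i else 0)"
      by (rule sum.cong) auto
    also have "\<dots> = k * zp ^ i" using that by simp
    finally show ?thesis using WI[of "\<lambda>j. if j = i then k else 0"] that by simp
  qed
  have W_add: "u + v \<in> W" if "u \<in> W" "v \<in> W" for u v
  proof -
    from that obtain c d where cd: "u = (\<Sum>i<p. c i * zp ^ i)" "v = (\<Sum>i<p. d i * zp ^ i)"
      "\<forall>i. c i \<in> R" "\<forall>i. d i \<in> R" by (auto simp: W_def)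
    then have "u + v = (\<Sum>i<p. (c i + d i) * zp ^ i)"
      by (simp add: sum.distrib algebra_simps)
    then show ?thesis using WI[of "\<lambda>i. c i + d i"] cd by simp
  qed
  have W_0: "0 \<in> W" using WI[of "\<lambda>_. 0"] by simp
  have W_sum: "sum g I \<in> W" if "\<And>i. i \<in> I \<Longrightarrow> g i \<in> W" for g :: "nat \<Rightarrow> complex" and I
    using that by (induction I rule: infinite_finite_induct) (auto simp: W_0 W_add)
  have W_pow: "k * zp ^ i \<in> W" if "k \<in> R" for i k
  proof -
    have "zp ^ i = zp ^ (i mod p + p * (i div p))" by simp
    also have "\<dots> = zp ^ (i mod p)" unfolding power_add power_mult zp_power(1) by simp
    finally show ?thesis using W_int[of "i mod p" k] zp_power that by simp
  qed
  have "s \<in> W" using assms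
  proof (induction rule: ZZ_induct)
    case one show ?case using W_pow[of 1 0] by simp
  next
    case gen show ?case using W_pow zmp_factor by metis
  next
    case (uminus x)
    then obtain c where c: "x = (\<Sum>i<p. c i * zp ^ i)" "\<forall>i. c i \<in> R" by (auto simp: W_def)
    then show ?case using WI[of "\<lambda>i. - c i"] by (simp add: sum_negf)
  next
    case (add x y) then show ?case by (simp add: W_add)
  next
    case (mult x y)
    then obtain c d where cd: "x = (\<Sum>i<p. c i * zp ^ i)" "y = (\<Sum>i<p. d i * zp ^ i)"
      "\<forall>i. c i \<in> R" "\<forall>i. d i \<in> R" by (auto simp: W_def)
    then have "x * y = (\<Sum>i<p. \<Sum>j<p. (c i * d j) * zp ^ (i + j))"
      by (simp add: sum_product power_add algebra_simps)
    then show ?case using cd by (auto intro!: W_sum W_pow)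
  qed
  then show ?thesis by (auto simp: W_def)
qed

lemma span_residue: "(\<And>i. i < p \<Longrightarrow> c i \<in> S) \<Longrightarrow> dvd_in S \<pi> ((\<Sum>i<p. c i * zp ^ i) - (\<Sum>i<p. c i))"
proof -
  assume c: "\<And>i. i < p \<Longrightarrow> c i \<in> S"
  have "(\<Sum>i<p. c i * zp ^ i) - (\<Sum>i<p. c i) = (\<Sum>i<p. - ((1 - zp ^ i) * c i))"
    by (simp add: algebra_simps flip: sum_subtractf)
  then show ?thesis
    using c by (simp only:) (intro S.dvd_in_sum S.dvd_in_uminus S.dvd_in_mult S.one_minus_power, auto)
qed

lemma S_residue: "s \<in> S \<Longrightarrow> \<exists>r\<in>R. dvd_in S \<pi> (s - r)"
proof -
  assume "s \<in> S"
  then obtain c where "\<forall>i. c i \<in> R" "s = (\<Sum>i<p. c i * zp ^ i)" using S_span by blast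
  then show ?thesis using span_residue[of c] R.sum_in[of "{..<p}" c] by (intro bexI[of _ "\<Sum>i<p. c i"]) auto
qed

text \<open>As p does not divide m, a fixed power map is the identity on R / p R. This makes that
  ring reduced and supplies the idempotents of \<open>bezout_mod_p\<close>.\<close>

lemma frobenius_R: "\<exists>N>1. \<forall>y\<in>R. dvd_in R pc (y ^ N - y)"
  by (rule ZZ_frobenius_coprime[OF zm_power p_prime p_ndvd])

section \<open>Ramification of p in S\<close>

lemma p_dvd_pi_power: "dvd_in S pc (\<pi> ^ p)"
  using S.dvd_in_add[OF S.frobenius_add[OF p_prime S.one_in S.uminus_in[OF zp_in_S], of 1]
      S.frobenius_uminus[OF p_prime zp_in_S, of 1]] zp_power
  by simp

text \<open>Expanding (1 - \<pi>) ^ p = 1 and cancelling one \<pi> writes p as plus or minus \<pi> ^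
  (p - 1) plus a multiple of p * \<pi>. Feeding in that \<pi> ^ k divides p raises k by one.\<close>

lemma pi_dvd_p_power: "k \<le> p - 1 \<Longrightarrow> dvd_in S (\<pi> ^ k) pc"
proof (induction k)
  case 0
  show ?case by (rule dvd_inI[of pc]) auto
next
  case (Suc k)
  define w where "w = \<pi>"
  have w: "w \<in> S" "w \<noteq> 0" "(1 - w) ^ p = 1" using zp_power by (simp_all add: w_def)
  \<comment> \<open>The i-th binomial term divided by p * w ^ 2, for 2 \<le> i < p.\<close>
  define c where "c i = of_nat ((p choose i) div p) * (- 1) ^ i * w ^ (i - 2)" for i
  have c: "c i \<in> S" for i using w by (simp add: c_def)
  have split: "{..p} = insert 0 (insert p (insert 1 {2..<p}))" using p2 by auto
  have "1 = (\<Sum>i\<le>p. of_nat (p choose i) * (- w) ^ i * 1 ^ (p - i))"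
    unfolding binomial_ring[symmetric] using w by simp
  also have "\<dots> = 1 + ((- w) ^ p + (- (pc * w) + (\<Sum>i\<in>{2..<p}. of_nat (p choose i) * (- w) ^ i)))"
    unfolding split using p2 by simp
  also have "(\<Sum>i\<in>{2..<p}. of_nat (p choose i) * (- w) ^ i) = (\<Sum>i\<in>{2..<p}. pc * w ^ 2 * c i)"
  proof (rule sum.cong[OF refl])
    fix i assume i: "i \<in> {2..<p}"
    then have "p dvd (p choose i)" using p_prime by (intro dvd_choose_prime) auto
    then have 1: "of_nat (p choose i) = pc * of_nat ((p choose i) div p)" by (metis dvd_mult_div_cancel of_nat_mult)
    have "2 + (i - 2) = i" using i by auto
    then have "(- w) ^ i = (- 1) ^ i * (w ^ 2 * w ^ (i - 2))"
      by (metis power_add power_minus)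
    then show "of_nat (p choose i) * (- w) ^ i = pc * w ^ 2 * c i"
      unfolding 1 c_def by (simp only: mult_ac)
  qed
  also have "(\<Sum>i\<in>{2..<p}. pc * w ^ 2 * c i) = pc * w ^ 2 * (\<Sum>i\<in>{2..<p}. c i)"
    by (simp add: sum_distrib_left)
  finally have "pc * w = (- w) ^ p + pc * w ^ 2 * (\<Sum>i\<in>{2..<p}. c i)"
    by (simp add: algebra_simps)
  moreover have "Suc (p - 1) = p" using p2 by simp
  then have "(- w) ^ p = w * ((- 1) ^ p * w ^ (p - 1))"
    by (metis mult.left_commute power_Suc power_minus)
  moreover have "pc * w ^ 2 * (\<Sum>i\<in>{2..<p}. c i) = w * (pc * w * (\<Sum>i\<in>{2..<p}. c i))"
    by (simp add: power2_eq_square)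
  ultimately have "w * pc = w * ((- 1) ^ p * w ^ (p - 1) + pc * w * (\<Sum>i\<in>{2..<p}. c i))"
    by (metis distrib_left mult.commute)
  then have eq: "pc = (- 1) ^ p * w ^ (p - 1) + pc * w * (\<Sum>i\<in>{2..<p}. c i)"
    using w(2) mult_left_cancel by blast
  obtain t where t: "t \<in> S" "pc = w ^ k * t" using Suc by (auto simp: dvd_in_def w_def)
  have "Suc k + (p - 1 - Suc k) = p - 1" using Suc.prems by simp
  then have "w ^ (p - 1) = w ^ Suc k * w ^ (p - 1 - Suc k)" by (metis power_add)
  then have "dvd_in S (w ^ Suc k) (w ^ (p - 1))"
    using w by (intro dvd_inI[of "w ^ (p - 1 - Suc k)"]) auto
  then have "dvd_in S (w ^ Suc k) ((- 1) ^ p * w ^ (p - 1))" by (rule S.dvd_in_mult') simp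
  moreover have "dvd_in S (w ^ Suc k) (pc * w * (\<Sum>i\<in>{2..<p}. c i))"
    by (rule dvd_inI[of "t * (\<Sum>i\<in>{2..<p}. c i)"]) (use t c in \<open>auto intro!: S.sum_in S.mult_in\<close>)
  ultimately show ?case unfolding w_def[symmetric] using eq S.dvd_in_add by metis
qed

lemma pi_dvd_p: "dvd_in S \<pi> pc" using pi_dvd_p_power[of 1] p2 by simp

lemma dvd_p_imp_dvd_pi: "dvd_in R pc r \<Longrightarrow> dvd_in S \<pi> r"
  using S.dvd_in_trans[OF pi_dvd_p] dvd_in_mono[OF _ R_subset_S] by blast

text \<open>If \<open>\<pi>\<close> divides \<open>r\<close>, then \<open>p\<close> divides a power of \<open>r\<close> in \<open>S\<close>, hence in \<open>R\<close>, as \<open>R\<close> is integrally closed;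
  but \<open>R / p R\<close> is reduced.\<close>

lemma dvd_pi_imp_dvd_p:
  assumes r: "r \<in> R" "dvd_in S \<pi> r"
  shows "dvd_in R pc r"
proof -
  obtain N where N: "N > 1" "\<And>y. y \<in> R \<Longrightarrow> dvd_in R pc (y ^ N - y)" using frobenius_R by blast
  have iter: "dvd_in R pc (r ^ (N ^ j) - r)" for j
  proof (induction j)
    case (Suc j)
    have "dvd_in R pc ((r ^ (N ^ j)) ^ N - r ^ (N ^ j))" by (rule N(2)) (use r in auto)
    then show ?case using Suc R.dvd_in_diff_trans by (metis power_Suc2 power_mult)
  qed simp
  obtain s where s: "s \<in> S" "r = \<pi> * s" using r by (auto simp: dvd_in_def)
  \<comment> \<open>A power of N, so that r ^ n is congruent to r modulo p, and at least p, so that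
    r ^ n is divisible by \<pi> ^ p and with it by p.\<close>
  define n where "n = N ^ p"
  have n: "n \<ge> p"
    unfolding n_def using N(1) by (metis less_exp less_imp_le order.strict_trans2 power_mono Suc_1 Suc_leI zero_le)
  have "r ^ n = \<pi> ^ p * (\<pi> ^ (n - p) * s ^ n)"
    using n by (simp add: s power_mult_distrib flip: power_add mult.assoc)
  then have "dvd_in S pc (r ^ n)" using S.dvd_in_mult[OF p_dvd_pi_power, of "\<pi> ^ (n - p) * s ^ n"] s by simp
  then obtain t where t: "t \<in> S" "r ^ n = pc * t" by (auto simp: dvd_in_def)
  have "t = r ^ n / pc" using t by simp
  then have "t \<in> K" using r by simp
  obtain f :: "int poly" where "lead_coeff f = 1" "poly (map_poly of_int f) t = 0"
    using ZZ_integral[OF zmp_power t(1)] by blast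
  then have "t \<in> R" by (rule ZZ_integrally_closed[OF zm \<open>t \<in> K\<close>])
  then have "dvd_in R pc (r ^ n)" using t by (auto simp: dvd_in_def)
  from R.dvd_in_diff[OF this iter[of p]] show ?thesis by (simp add: n_def)
qed

text \<open>The substitution X -> 1 - X carries the root \<open>zp\<close> to \<pi>. It is an
  involution, so divisibility of the coefficients can be carried back.\<close>

lemma pcompose_coeffs:
  assumes "\<And>i. coeff f i \<in> R" shows "coeff (pcompose f [:1, -1:]) i \<in> R"
  using assms
proof (induction f arbitrary: i)
  case (pCons a f)
  have a: "a \<in> R" using pCons.prems[of 0] by simp
  have "\<And>i. coeff f i \<in> R" using pCons.prems[of "Suc _"] by simp
  then have IH: "\<And>i. coeff (pcompose f [:1, -1:]) i \<in> R" using pCons.IH by blast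
  show ?case using IH IH[of 0] a
    by (cases i) (auto simp: pcompose_pCons coeff_pCons split: nat.split)
qed simp

text \<open>An Eisenstein argument: the expansion of \<open>f\<close> at \<open>1\<close> evaluated at \<open>\<pi>\<close> shows that \<open>p\<close> divides \<open>f\<close>.\<close>

lemma p_divides_relation:
  assumes f: "\<And>i. coeff f i \<in> R" "degree f \<le> p - 2" "poly f zp = 0"
  shows "\<exists>f'. (\<forall>i. coeff f' i \<in> R) \<and> f = smult pc f'"
proof -
  define g where "g = pcompose f [:1, -1:]"
  have g: "coeff g i \<in> R" for i unfolding g_def using f(1) by (rule pcompose_coeffs)
  have deg: "degree g \<le> p - 2" using f(2) degree_pcompose_le[of f "[:1, -1:]"] by (simp add: g_def)
  have gpi: "poly g \<pi> = 0" using f(3) by (simp add: g_def poly_pcompose)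
  have fg: "f = pcompose g [:1, -1:]"
    unfolding g_def pcompose_assoc[symmetric] by (simp add: pcompose_pCons)
  \<comment> \<open>For j < i the coefficient is divisible by p, which contains \<pi> ^ (i + 1)
    because i + 1 \<le> p - 1; for j > i the power of \<pi> itself suffices. So \<pi> divides the
    i-th coefficient, and then p does.\<close>
  have dv: "dvd_in R pc (coeff g i)" if "i \<le> p - 2" for i
    using that
  proof (induction i rule: less_induct)
    case (less i)
    have "{..p - 2} = insert i ({..p - 2} - {i})" using less.prems by auto
    moreover have "poly g \<pi> = (\<Sum>j\<le>p - 2. coeff g j * \<pi> ^ j)"
      unfolding poly_altdef using deg
      by (intro sum.mono_neutral_left) (auto simp: coeff_eq_0)
    ultimately have "0 = coeff g i * \<pi> ^ i + (\<Sum>j\<in>{..p - 2} - {i}. coeff g j * \<pi> ^ j)"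
      using gpi by (metis (no_types, lifting) Diff_iff finite_Diff finite_atMost insertI1 sum.insert)
    then have eq: "coeff g i * \<pi> ^ i = - (\<Sum>j\<in>{..p - 2} - {i}. coeff g j * \<pi> ^ j)"
      by (simp add: add_eq_0_iff2)
    have "dvd_in S (\<pi> ^ Suc i) (coeff g j * \<pi> ^ j)" if j: "j \<in> {..p - 2} - {i}" for j
    proof (cases "j < i")
      case True
      have "dvd_in S pc (coeff g j)" using less.IH[OF True] j dvd_in_mono[OF _ R_subset_S] by auto
      moreover have "dvd_in S (\<pi> ^ Suc i) pc" by (rule pi_dvd_p_power) (use less.prems p2 in auto)
      ultimately show ?thesis by (intro S.dvd_in_mult) (auto intro: S.dvd_in_trans)
    next
      case False
      then have "j = Suc i + (j - Suc i)" using j by auto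
      then have "\<pi> ^ j = \<pi> ^ Suc i * \<pi> ^ (j - Suc i)" by (metis power_add)
      then show ?thesis using g by (intro dvd_inI[of "\<pi> ^ (j - Suc i) * coeff g j"]) auto
    qed
    then have "dvd_in S (\<pi> ^ Suc i) (coeff g i * \<pi> ^ i)"
      unfolding eq by (intro S.dvd_in_uminus S.dvd_in_sum) auto
    then obtain t where t: "t \<in> S" "coeff g i * \<pi> ^ i = \<pi> ^ Suc i * t" by (auto simp: dvd_in_def)
    then have "\<pi> ^ i * coeff g i = \<pi> ^ i * (\<pi> * t)" by (simp add: algebra_simps)
    then have "coeff g i = \<pi> * t" using pi_nonzero(2) by (metis mult_left_cancel power_not_zero)
    then have "dvd_in S \<pi> (coeff g i)" using t by (auto simp: dvd_in_def)
    then show ?case by (rule dvd_pi_imp_dvd_p[OF g])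
  qed
  define g' where "g' = smult (inverse pc) g"
  have g': "coeff g' i \<in> R" for i
  proof (cases "i \<le> p - 2")
    case True
    then show ?thesis using dv[OF True] by (auto simp: g'_def dvd_in_def mult.assoc[symmetric])
  next
    case False
    then show ?thesis using deg by (simp add: g'_def coeff_eq_0)
  qed
  have "g = smult pc g'" by (simp add: g'_def)
  then have "f = smult pc (pcompose g' [:1, -1:])" using fg by (simp add: pcompose_smult)
  then show ?thesis using pcompose_coeffs[OF g'] by blast
qed

text \<open>Descent: the division by p in \<open>p_divides_relation\<close> can be repeated without
  end, and only 0 is divisible by all powers of p in R. This is the linear independence of the
  powers of \<open>zp\<close> below p - 1.\<close>

lemma no_relation:
  assumes f: "\<And>i. coeff f i \<in> R" "degree f \<le> p - 2" "poly f zp = 0"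
  shows "f = 0"
proof -
  have *: "\<exists>f'. (\<forall>i. coeff f' i \<in> R) \<and> f = smult (pc ^ k) f'" for k
  proof (induction k)
    case 0
    show ?case by (rule exI[of _ f]) (simp add: f(1))
  next
    case (Suc k)
    then obtain f' where f': "\<forall>i. coeff f' i \<in> R" "f = smult (pc ^ k) f'" by blast
    have "degree f' \<le> p - 2" "poly f' zp = 0" using f f' by auto
    then obtain f'' where "\<forall>i. coeff f'' i \<in> R" "f' = smult pc f''" using p_divides_relation f'(1) by blast
    then show ?case using f' by (intro exI[of _ f'']) (simp add: mult.commute)
  qed
  show ?thesis
  proof (rule poly_eqI)
    fix i
    have "coeff f i = 0"
    proof (rule ZZ_infinitely_divisible[OF zm_power])
      show "p > 1" using p2 by simp
      show "coeff f i \<in> R" by (rule f)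
      fix k
      obtain f' where f': "\<forall>i. coeff f' i \<in> R" "f = smult (pc ^ k) f'" using *[of k] by blast
      show "dvd_in R (pc ^ k) (coeff f i)" using f' by (intro dvd_inI[of "coeff f' i"]) auto
    qed
    then show "coeff f i = coeff 0 i" by simp
  qed
qed

text \<open>Up to a scalar, the vanishing of the sum of all p powers is the only relation over K.
  Subtracting a multiple of it kills the coefficient of index p - 1, and \<open>no_relation\<close>
  applies to the rest.\<close>

lemma zp_relation:
  assumes c: "\<And>i. i < p \<Longrightarrow> c i \<in> K" and rel: "(\<Sum>i<p. c i * zp ^ i) = 0" and i: "i < p"
  shows "c i = c (p - 1)"
proof -
  obtain d :: int where d: "d \<noteq> 0" "\<forall>i\<in>{..<p}. of_int d * c i \<in> R"
    using QQ_common_denominator[OF zm_power, of "{..<p}" c] c by auto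
  define b where "b i = of_int d * c i - of_int d * c (p - 1)" for i
  have b: "b i \<in> R" if "i < p" for i using d that p2 by (auto simp: b_def)
  have p1: "{..<p} = insert (p - 1) {..p - 2}" using p2 by auto
  define f where "f = (\<Sum>i\<le>p - 2. monom (b i) i)"
  have cf: "coeff f i = (if i \<le> p - 2 then b i else 0)" for i by (simp add: f_def coeff_sum)
  have "f = 0"
  proof (rule no_relation)
    show "coeff f i \<in> R" for i using b p2 by (auto simp: cf)
    show "degree f \<le> p - 2" by (rule degree_le) (auto simp: cf)
    have "poly f zp = (\<Sum>i\<le>p - 2. b i * zp ^ i)" by (simp add: f_def poly_sum poly_monom)
    also have "\<dots> = (\<Sum>i<p. b i * zp ^ i)" unfolding p1 using p2 by (simp add: b_def)
    also have "\<dots> = of_int d * (\<Sum>i<p. c i * zp ^ i) - of_int d * c (p - 1) * (\<Sum>i<p. zp ^ i)"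
      by (simp add: b_def sum_distrib_left sum_distrib_right sum_subtractf algebra_simps)
    also have "\<dots> = 0" using rel zp_sum by simp
    finally show "poly f zp = 0" .
  qed
  then have "b i = 0" if "i \<le> p - 2" using cf[of i] that by simp
  moreover have "i = p - 1 \<or> i \<le> p - 2" using i by auto
  ultimately show ?thesis using d(1) unfolding b_def by auto
qed

text \<open>Otherwise p would be invertible in R, and the rational number 1 / p integral.\<close>

lemma pi_not_unit: "\<not> dvd_in S \<pi> 1"
proof
  assume "dvd_in S \<pi> 1"
  then have "dvd_in R pc 1" by (intro dvd_pi_imp_dvd_p) auto
  then obtain t where "t \<in> R" "1 = pc * t" by (auto simp: dvd_in_def)
  then have "t = of_int 1 / of_int (int p)" by (simp add: field_simps)
  with \<open>t \<in> R\<close> have "of_int 1 / of_int (int p) \<in> R" by simp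
  then have "int p dvd 1" by (intro ZZ_rational_integer[OF zm_power]) (use zp_power in auto)
  then show False using p2 by simp
qed

end

section \<open>Isomorphism and stable isomorphism of modules\<close>

definition miso :: "('a, 'r) ring_scheme \<Rightarrow> ('a, 'b, 'm) module_scheme \<Rightarrow> ('a, 'c, 'n) module_scheme \<Rightarrow> bool"
  where "miso S M N \<longleftrightarrow> module_iso S M N \<noteq> {}"

text \<open>Of the module axioms, these closure properties are what inverting an isomorphism takes,
  and they pass to direct sums and powers.\<close>

definition closed_module :: "('a, 'r) ring_scheme \<Rightarrow> ('a, 'b, 'm) module_scheme \<Rightarrow> bool"
  where "closed_module S M \<longleftrightarrow> (\<forall>x\<in>carrier M. \<forall>y\<in>carrier M. x \<oplus>\<^bsub>M\<^esub> y \<in> carrier M)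
    \<and> (\<forall>a\<in>carrier S. \<forall>x\<in>carrier M. a \<odot>\<^bsub>M\<^esub> x \<in> carrier M)"

lemma misoI:
  assumes "\<And>x. x \<in> carrier M \<Longrightarrow> f x \<in> carrier N" "\<And>y. y \<in> carrier N \<Longrightarrow> g y \<in> carrier M"
    and "\<And>x. x \<in> carrier M \<Longrightarrow> g (f x) = x" "\<And>y. y \<in> carrier N \<Longrightarrow> f (g y) = y"
    and "\<And>x y. x \<in> carrier M \<Longrightarrow> y \<in> carrier M \<Longrightarrow> f (x \<oplus>\<^bsub>M\<^esub> y) = f x \<oplus>\<^bsub>N\<^esub> f y"
    and "\<And>a x. a \<in> carrier S \<Longrightarrow> x \<in> carrier M \<Longrightarrow> f (a \<odot>\<^bsub>M\<^esub> x) = a \<odot>\<^bsub>N\<^esub> f x"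
  shows "miso S M N"
proof -
  have "bij_betw f (carrier M) (carrier N)"
    by (rule bij_betw_byWitness[where f' = g]) (use assms in auto)
  then have "f \<in> module_iso S M N"
    using assms by (auto simp: module_iso_def iso_def hom_def)
  then show ?thesis by (auto simp: miso_def)
qed

definition inverse_isos ::
  "('a, 'r) ring_scheme \<Rightarrow> ('a, 'b, 'm) module_scheme \<Rightarrow> ('a, 'c, 'n) module_scheme \<Rightarrow> ('b \<Rightarrow> 'c) \<Rightarrow> ('c \<Rightarrow> 'b) \<Rightarrow> bool"
  where "inverse_isos S M N f g \<longleftrightarrow>
    (\<forall>x\<in>carrier M. f x \<in> carrier N \<and> g (f x) = x) \<and> (\<forall>y\<in>carrier N. g y \<in> carrier M \<and> f (g y) = y) \<and>
    (\<forall>x\<in>carrier M. \<forall>y\<in>carrier M. f (x \<oplus>\<^bsub>M\<^esub> y) = f x \<oplus>\<^bsub>N\<^esub> f y) \<and>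
    (\<forall>a\<in>carrier S. \<forall>x\<in>carrier M. f (a \<odot>\<^bsub>M\<^esub> x) = a \<odot>\<^bsub>N\<^esub> f x)"

lemma misoE:
  assumes "miso S M N"
  obtains f g where "inverse_isos S M N f g"
proof -
  obtain f where f: "f \<in> module_iso S M N" using assms by (auto simp: miso_def)
  then have bij: "bij_betw f (carrier M) (carrier N)" by (auto simp: module_iso_def iso_def)
  have "inverse_isos S M N f (inv_into (carrier M) f)"
    unfolding inverse_isos_def
    using f bij_betw_apply[OF bij] bij_betw_apply[OF bij_betw_inv_into[OF bij]]
      bij_betw_inv_into_left[OF bij] bij_betw_inv_into_right[OF bij]
    by (auto simp: module_iso_def iso_def hom_def)
  then show ?thesis by (rule that)
qed

lemma miso_refl: "miso S M M"
  by (rule misoI[of _ "\<lambda>x. x" _ "\<lambda>x. x"]) auto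

lemma miso_sym:
  assumes "miso S M N" "closed_module S M"
  shows "miso S N M"
proof -
  obtain f g where "inverse_isos S M N f g" using assms(1) by (rule misoE)
  note fg = this[unfolded inverse_isos_def]
  show ?thesis
  proof (rule misoI[of _ g _ f])
    fix x y assume "x \<in> carrier N" "y \<in> carrier N"
    then have "x \<oplus>\<^bsub>N\<^esub> y = f (g x \<oplus>\<^bsub>M\<^esub> g y)" "g x \<oplus>\<^bsub>M\<^esub> g y \<in> carrier M"
      using fg assms(2) by (auto simp: closed_module_def)
    then show "g (x \<oplus>\<^bsub>N\<^esub> y) = g x \<oplus>\<^bsub>M\<^esub> g y" using fg by simp
  next
    fix a x assume "a \<in> carrier S" "x \<in> carrier N"
    then have "a \<odot>\<^bsub>N\<^esub> x = f (a \<odot>\<^bsub>M\<^esub> g x)" "a \<odot>\<^bsub>M\<^esub> g x \<in> carrier M"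
      using fg assms(2) by (auto simp: closed_module_def)
    then show "g (a \<odot>\<^bsub>N\<^esub> x) = a \<odot>\<^bsub>M\<^esub> g x" using fg by simp
  qed (use fg in auto)
qed

lemma miso_trans [trans]:
  assumes "miso S M N" "miso S N P" shows "miso S M P"
proof -
  obtain f g where "inverse_isos S M N f g" using assms(1) by (rule misoE)
  note f = this[unfolded inverse_isos_def]
  obtain f' g' where "inverse_isos S N P f' g'" using assms(2) by (rule misoE)
  note f' = this[unfolded inverse_isos_def]
  show ?thesis by (rule misoI[of _ "\<lambda>x. f' (f x)" _ "\<lambda>y. g (g' y)"]) (simp_all add: f f')
qed

lemma direct_sum_simps [simp]:
  "carrier (direct_sum M N) = carrier M \<times> carrier N"
  "(x, y) \<oplus>\<^bsub>direct_sum M N\<^esub> (x', y') = (x \<oplus>\<^bsub>M\<^esub> x', y \<oplus>\<^bsub>N\<^esub> y')"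
  "a \<odot>\<^bsub>direct_sum M N\<^esub> (x, y) = (a \<odot>\<^bsub>M\<^esub> x, a \<odot>\<^bsub>N\<^esub> y)"
  by (simp_all add: direct_sum_def)

lemma module_power_simps [simp]:
  "carrier (module_power M n) = {v. length v = n \<and> set v \<subseteq> carrier M}"
  "v \<oplus>\<^bsub>module_power M n\<^esub> w = map2 (ring.add M) v w"
  "\<zero>\<^bsub>module_power M n\<^esub> = replicate n \<zero>\<^bsub>M\<^esub>"
  "a \<odot>\<^bsub>module_power M n\<^esub> v = map (\<lambda>x. a \<odot>\<^bsub>M\<^esub> x) v"
  by (simp_all add: module_power_def)

lemma regular_module_simps [simp]:
  "carrier (regular_module S) = carrier S"
  "x \<oplus>\<^bsub>regular_module S\<^esub> y = x \<oplus>\<^bsub>S\<^esub> y"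
  "\<zero>\<^bsub>regular_module S\<^esub> = \<zero>\<^bsub>S\<^esub>"
  "a \<odot>\<^bsub>regular_module S\<^esub> x = a \<otimes>\<^bsub>S\<^esub> x"
  by (simp_all add: regular_module_def)

lemma regular_module_ops: "ring.add (regular_module S) = ring.add S"
  by (simp add: regular_module_def)

lemma closed_direct_sum:
  "closed_module S M \<Longrightarrow> closed_module S N \<Longrightarrow> closed_module S (direct_sum M N)"
  by (auto simp: closed_module_def)

lemma set_map2_subset:
  "(\<And>x y. x \<in> set v \<Longrightarrow> y \<in> set w \<Longrightarrow> f x y \<in> B) \<Longrightarrow> set (map2 f v w) \<subseteq> B"
  by (auto dest: set_zip_leftD set_zip_rightD)

lemma closed_module_power:
  assumes "closed_module S M" shows "closed_module S (module_power M n)"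
  unfolding closed_module_def
proof (intro conjI ballI)
  fix v w assume "v \<in> carrier (module_power M n)" "w \<in> carrier (module_power M n)"
  then have "set (map2 (ring.add M) v w) \<subseteq> carrier M"
    using assms by (intro set_map2_subset) (auto simp: closed_module_def)
  then show "v \<oplus>\<^bsub>module_power M n\<^esub> w \<in> carrier (module_power M n)"
    using \<open>v \<in> _\<close> \<open>w \<in> _\<close> by simp
qed (use assms in \<open>auto simp: closed_module_def\<close>)

lemma miso_direct_sum:
  assumes "miso S M M'" "miso S N N'"
  shows "miso S (direct_sum M N) (direct_sum M' N')"
proof -
  obtain f g where "inverse_isos S M M' f g" using assms(1) by (rule misoE)
  note f = this[unfolded inverse_isos_def]
  obtain f' g' where "inverse_isos S N N' f' g'" using assms(2) by (rule misoE)
  note f' = this[unfolded inverse_isos_def]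
  show ?thesis
    by (rule misoI[of _ "map_prod f f'" _ "map_prod g g'"]) (auto simp: f f')
qed

lemma miso_assoc:
  "miso S (direct_sum (direct_sum M N) P) (direct_sum M (direct_sum N P))"
  by (rule misoI[of _ "\<lambda>((x, y), z). (x, (y, z))" _ "\<lambda>(x, (y, z)). ((x, y), z)"]) auto

lemma miso_assoc':
  "miso S (direct_sum M (direct_sum N P)) (direct_sum (direct_sum M N) P)"
  by (rule misoI[of _ "\<lambda>(x, (y, z)). ((x, y), z)" _ "\<lambda>((x, y), z). (x, (y, z))"]) auto

lemma miso_comm: "miso S (direct_sum M N) (direct_sum N M)"
  by (rule misoI[of _ "\<lambda>(x, y). (y, x)" _ "\<lambda>(x, y). (y, x)"]) auto

lemma miso_swap_right:
  "miso S (direct_sum (direct_sum M N) P) (direct_sum (direct_sum M P) N)"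
  by (rule misoI[of _ "\<lambda>((x, y), z). ((x, z), y)" _ "\<lambda>((x, y), z). ((x, z), y)"]) auto

lemma miso_interchange:
  "miso S (direct_sum (direct_sum M N) (direct_sum P Q)) (direct_sum (direct_sum M P) (direct_sum N Q))"
  by (rule misoI[of _ "\<lambda>((x, y), (z, w)). ((x, z), (y, w))" _ "\<lambda>((x, y), (z, w)). ((x, z), (y, w))"]) auto

lemma miso_power_split:
  "miso S (direct_sum (module_power M a) (module_power M b)) (module_power M (a + b))"
proof (rule misoI[of _ "\<lambda>(v, w). v @ w" _ "\<lambda>u. (take a u, drop a u)"])
  fix x y
  assume "x \<in> carrier (direct_sum (module_power M a) (module_power M b))"
    "y \<in> carrier (direct_sum (module_power M a) (module_power M b))"
  then show "(case x \<oplus>\<^bsub>direct_sum (module_power M a) (module_power M b)\<^esub> y of (v, w) \<Rightarrow> v @ w)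
     = (case x of (v, w) \<Rightarrow> v @ w) \<oplus>\<^bsub>module_power M (a + b)\<^esub> (case y of (v, w) \<Rightarrow> v @ w)"
    by (auto simp: zip_append)
qed (auto dest: in_set_takeD in_set_dropD)

lemma miso_power_merge:
  "miso S (module_power M (a + b)) (direct_sum (module_power M a) (module_power M b))"
proof (rule misoI[of _ "\<lambda>u. (take a u, drop a u)" _ "\<lambda>(v, w). v @ w"])
qed (auto dest: in_set_takeD in_set_dropD simp: take_map drop_map take_zip drop_zip)

lemma miso_power_zero: "miso S (direct_sum M (module_power N 0)) M"
  by (rule misoI[of _ fst _ "\<lambda>x. (x, [])"]) auto

section \<open>Stable isomorphism and classes\<close>

lemma stably_isomorphic_miso:
  "stably_isomorphic S M N \<longleftrightarrow> (\<exists>a b. miso S (direct_sum M (free_module S a)) (direct_sum N (free_module S b)))"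
  by (simp add: stably_isomorphic_def miso_def)

lemma miso_imp_stably: "miso S M N \<Longrightarrow> stably_isomorphic S M N"
  unfolding stably_isomorphic_miso by (meson miso_direct_sum miso_refl)

lemma stably_refl: "stably_isomorphic S M M" by (rule miso_imp_stably[OF miso_refl])

lemma stably_absorb: "stably_isomorphic S (direct_sum M (free_module S a)) M"
  unfolding stably_isomorphic_miso
  by (rule exI[of _ 0], rule exI[of _ a]) (rule miso_power_zero)

lemma stably_sym:
  assumes "stably_isomorphic S M N" "closed_module S M" "closed_module S (regular_module S)"
  shows "stably_isomorphic S N M"
  using assms unfolding stably_isomorphic_miso
  by (meson miso_sym closed_direct_sum closed_module_power)

text \<open>The two isomorphisms come with different free summands of N. Adding to each the summand
  of the other makes them composable.\<close>

lemma stably_trans [trans]: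
  assumes "stably_isomorphic S M N" "stably_isomorphic S N P"
  shows "stably_isomorphic S M P"
proof -
  let ?F = "free_module S"
  obtain a b c d where 1: "miso S (direct_sum M (?F a)) (direct_sum N (?F b))"
    and 2: "miso S (direct_sum N (?F c)) (direct_sum P (?F d))"
    using assms unfolding stably_isomorphic_miso by blast
  have "miso S (direct_sum M (?F (a + c))) (direct_sum M (direct_sum (?F a) (?F c)))"
    by (intro miso_direct_sum miso_refl miso_power_merge)
  also have "miso S \<dots> (direct_sum (direct_sum M (?F a)) (?F c))" by (rule miso_assoc')
  also have "miso S \<dots> (direct_sum (direct_sum N (?F b)) (?F c))"
    by (intro miso_direct_sum miso_refl 1)
  also have "miso S \<dots> (direct_sum (direct_sum N (?F c)) (?F b))" by (rule miso_swap_right)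
  also have "miso S \<dots> (direct_sum (direct_sum P (?F d)) (?F b))"
    by (intro miso_direct_sum miso_refl 2)
  also have "miso S \<dots> (direct_sum P (direct_sum (?F d) (?F b)))" by (rule miso_assoc)
  also have "miso S \<dots> (direct_sum P (?F (d + b)))"
    by (intro miso_direct_sum miso_refl miso_power_split)
  finally show ?thesis unfolding stably_isomorphic_miso by blast
qed

lemma stably_direct_sum:
  assumes "stably_isomorphic S M M'" "stably_isomorphic S N N'"
  shows "stably_isomorphic S (direct_sum M N) (direct_sum M' N')"
proof -
  let ?F = "free_module S"
  obtain a b c d where 1: "miso S (direct_sum M (?F a)) (direct_sum M' (?F b))"
    and 2: "miso S (direct_sum N (?F c)) (direct_sum N' (?F d))"
    using assms unfolding stably_isomorphic_miso by blast
  have "miso S (direct_sum (direct_sum M N) (?F (a + c))) (direct_sum (direct_sum M N) (direct_sum (?F a) (?F c)))"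
    by (intro miso_direct_sum miso_refl miso_power_merge)
  also have "miso S \<dots> (direct_sum (direct_sum M (?F a)) (direct_sum N (?F c)))" by (rule miso_interchange)
  also have "miso S \<dots> (direct_sum (direct_sum M' (?F b)) (direct_sum N' (?F d)))"
    by (intro miso_direct_sum 1 2)
  also have "miso S \<dots> (direct_sum (direct_sum M' N') (direct_sum (?F b) (?F d)))" by (rule miso_interchange)
  also have "miso S \<dots> (direct_sum (direct_sum M' N') (?F (b + d)))"
    by (intro miso_direct_sum miso_refl miso_power_split)
  finally show ?thesis unfolding stably_isomorphic_miso by blast
qed

lemma lattice_module_simps [simp]:
  "carrier (lattice_module A n M) = M"
  "v \<oplus>\<^bsub>lattice_module A n M\<^esub> w = map2 (ring.add A) v w"
  "a \<odot>\<^bsub>lattice_module A n M\<^esub> v = map (\<lambda>x. a \<otimes>\<^bsub>A\<^esub> x) v"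
  by (simp_all add: lattice_module_def module_power_def regular_module_def)

lemma closed_lattice_module:
  assumes "submodule M S (free_module A n)"
  shows "closed_module S (lattice_module A n M)"
proof -
  interpret submodule M S "free_module A n" by fact
  have "map2 (ring.add A) v w \<in> M" if "v \<in> M" "w \<in> M" for v w
    using m_closed[OF that] by (simp add: regular_module_ops)
  moreover have "map (\<lambda>x. a \<otimes>\<^bsub>A\<^esub> x) v \<in> M" if "a \<in> carrier S" "v \<in> M" for a v
    using smult_closed[OF that] by simp
  ultimately show ?thesis by (simp add: closed_module_def)
qed

text \<open>The formal part of the class group rests on closure under the two operations; \<Lambda>
  and the maximal order are both instances.\<close>

locale stable_classes =
  fixes R :: "'r ring" and A :: "('r, 'a) module" and S :: "'a set"
  assumes add_closed: "x \<in> S \<Longrightarrow> y \<in> S \<Longrightarrow> x \<oplus>\<^bsub>A\<^esub> y \<in> S"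
    and mult_closed: "x \<in> S \<Longrightarrow> y \<in> S \<Longrightarrow> x \<otimes>\<^bsub>A\<^esub> y \<in> S"
begin

abbreviation stably_iso (infix "\<bowtie>" 50) where "M \<bowtie> N \<equiv> stably_isomorphic (subring_of A S) M N"
abbreviation "lattices \<equiv> locally_free_modules R A S"
abbreviation "cls \<equiv> stable_class R A S"

lemma closed_regular: "closed_module (subring_of A S) (regular_module (subring_of A S))"
  using add_closed mult_closed by (auto simp: closed_module_def)

lemma closed_lattice: "L \<in> lattices \<Longrightarrow> closed_module (subring_of A S) L"
  by (auto simp: locally_free_modules_def locally_free_def closed_lattice_module)

lemma sym: "M \<bowtie> N \<Longrightarrow> closed_module (subring_of A S) M \<Longrightarrow> N \<bowtie> M"
  using closed_regular stably_sym by blast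

lemma cls_eq_iff:
  assumes "L \<in> lattices" "L' \<in> lattices"
  shows "cls L = cls L' \<longleftrightarrow> L \<bowtie> L'"
proof
  assume "cls L = cls L'"
  moreover have "L' \<in> cls L'" using assms stably_refl by (simp add: stable_class_def)
  ultimately have "L' \<in> cls L" by simp
  then show "L \<bowtie> L'" by (simp add: stable_class_def)
next
  assume "L \<bowtie> L'"
  moreover from this have "L' \<bowtie> L" using sym closed_lattice assms by blast
  ultimately show "cls L = cls L'" unfolding stable_class_def using stably_trans by blast
qed

text \<open>A direct sum consists of pairs and is not itself one of the lattices of lists, so the
  product class is named by a lattice \<open>Z\<close> stably isomorphic to it.\<close>

lemma cls_mult:
  assumes "L \<in> lattices" "L' \<in> lattices" "Z \<in> lattices" "Z \<bowtie> direct_sum L L'"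
  shows "monoid.mult (class_group R A S) (cls L) (cls L') = cls Z"
proof -
  have sum_closed: "closed_module (subring_of A S) (direct_sum L L')"
    using assms closed_lattice closed_direct_sum by blast
  have "(\<exists>M\<in>cls L. \<exists>N\<in>cls L'. Y \<bowtie> direct_sum M N) \<longleftrightarrow> Z \<bowtie> Y" if Y: "Y \<in> lattices" for Y
  proof
    assume "\<exists>M\<in>cls L. \<exists>N\<in>cls L'. Y \<bowtie> direct_sum M N"
    then obtain M N where MN: "M \<in> cls L" "N \<in> cls L'" "Y \<bowtie> direct_sum M N" by blast
    then have LM: "L \<bowtie> M" "L' \<bowtie> N" by (auto simp: stable_class_def)
    have "direct_sum M N \<bowtie> Y" using sym[OF MN(3) closed_lattice[OF Y]] .
    then have "direct_sum L L' \<bowtie> Y" using stably_direct_sum[OF LM] stably_trans by blast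
    then show "Z \<bowtie> Y" using assms(4) stably_trans by blast
  next
    assume "Z \<bowtie> Y"
    then have "Y \<bowtie> Z" using sym closed_lattice assms by blast
    then have "Y \<bowtie> direct_sum L L'" using assms(4) stably_trans by blast
    moreover have "L \<in> cls L" "L' \<in> cls L'" using assms stably_refl by (auto simp: stable_class_def)
    ultimately show "\<exists>M\<in>cls L. \<exists>N\<in>cls L'. Y \<bowtie> direct_sum M N" by blast
  qed
  then show ?thesis by (auto simp: class_group_def stable_class_def)
qed

text \<open>Uniqueness needs no closure under direct sums: both sides of a product are only compared up to stable isomorphism.\<close>

lemma cls_inverse:
  assumes L: "L \<in> lattices" "L' \<in> lattices" and F: "free_module (subring_of A S) 1 \<in> lattices"
    and "free_module (subring_of A S) 1 \<bowtie> direct_sum L L'"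
  shows "inv\<^bsub>class_group R A S\<^esub> (cls L) = cls L'"
proof -
  let ?F = "free_module (subring_of A S) 1"
  let ?G = "class_group R A S"
  have cF: "closed_module (subring_of A S) ?F" using closed_lattice F by blast
  have one: "\<one>\<^bsub>?G\<^esub> = cls ?F" by (simp add: class_group_def)
  have LL': "cls L \<otimes>\<^bsub>?G\<^esub> cls L' = \<one>\<^bsub>?G\<^esub>" unfolding one by (rule cls_mult[OF L F assms(4)])
  have "?F \<bowtie> direct_sum L' L" using assms(4) miso_imp_stably[OF miso_comm] stably_trans by blast
  then have L'L: "cls L' \<otimes>\<^bsub>?G\<^esub> cls L = \<one>\<^bsub>?G\<^esub>" unfolding one by (rule cls_mult[OF L(2,1) F])
  have "y = cls L'" if y: "y \<in> carrier ?G" "cls L \<otimes>\<^bsub>?G\<^esub> y = \<one>\<^bsub>?G\<^esub>" for y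
  proof -
    obtain N where N: "N \<in> lattices" "y = cls N" using y by (auto simp: class_group_def)
    have "?F \<in> cls L \<otimes>\<^bsub>?G\<^esub> y" using y(2) one F stably_refl by (auto simp: stable_class_def)
    then obtain M N' where MN: "M \<in> cls L" "N' \<in> cls N" "?F \<bowtie> direct_sum M N'"
      using N by (auto simp: class_group_def)
    have "M \<bowtie> L" "N' \<bowtie> N"
      using MN sym closed_lattice L N by (auto simp: stable_class_def)
    then have FLN: "?F \<bowtie> direct_sum L N" using MN(3) stably_direct_sum stably_trans by blast
    \<comment> \<open>The uniqueness of inverses in a commutative monoid, carried out up to stable
      isomorphism: N, then N + (L + L'), then (L + N) + L', then L'.\<close>
    have "N \<bowtie> direct_sum N ?F" using sym[OF stably_absorb] closed_direct_sum closed_lattice N cF by blast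
    also have "\<dots> \<bowtie> direct_sum N (direct_sum L L')" by (intro stably_direct_sum stably_refl assms(4))
    also have "\<dots> \<bowtie> direct_sum (direct_sum N L) L'" by (rule miso_imp_stably[OF miso_assoc'])
    also have "\<dots> \<bowtie> direct_sum (direct_sum L N) L'"
      by (intro stably_direct_sum stably_refl miso_imp_stably[OF miso_comm])
    also have "\<dots> \<bowtie> direct_sum ?F L'"
      by (intro stably_direct_sum stably_refl sym[OF FLN cF])
    also have "\<dots> \<bowtie> direct_sum L' ?F" by (rule miso_imp_stably[OF miso_comm])
    also have "\<dots> \<bowtie> L'" by (rule stably_absorb)
    finally show ?thesis using cls_eq_iff N L by simp
  qed
  then show ?thesis
    unfolding m_inv_def using LL' L'L L by (intro the_equality) (auto simp: class_group_def)
qed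

end

section \<open>The group algebra as a subring of \<open>K \<times> L\<close>\<close>

lemma (in complex_subring) cring_complex_subring: "cring (ring_of_type_algebra\<lparr>carrier := B\<rparr>)"
proof (rule cringI)
  show "abelian_group (ring_of_type_algebra\<lparr>carrier := B\<rparr>)"
  proof (rule abelian_groupI)
    fix x assume "x \<in> carrier (ring_of_type_algebra\<lparr>carrier := B\<rparr>)"
    then show "\<exists>y\<in>carrier (ring_of_type_algebra\<lparr>carrier := B\<rparr>).
        y \<oplus>\<^bsub>ring_of_type_algebra\<lparr>carrier := B\<rparr>\<^esub> x = \<zero>\<^bsub>ring_of_type_algebra\<lparr>carrier := B\<rparr>\<^esub>"
      by (intro bexI[of _ "- x"]) auto
  qed auto
  show "comm_monoid (ring_of_type_algebra\<lparr>carrier := B\<rparr>)"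
    by (rule comm_monoidI) auto
qed (auto simp: algebra_simps)

lemma Z_adjoin_eq: "Z_adjoin z = ring_of_type_algebra\<lparr>carrier := ZZ z\<rparr>"
  by (simp add: Z_adjoin_def)

lemma Q_adjoin_eq: "Q_adjoin z = ring_of_type_algebra\<lparr>carrier := QQ z\<rparr>"
  by (simp add: Q_adjoin_def)

lemma cring_Z_adjoin: "cring (Z_adjoin z)"
  using complex_subring.cring_complex_subring[OF ZZ_ring] by (simp add: Z_adjoin_eq[symmetric])

lemma cring_Q_adjoin: "cring (Q_adjoin z)"
  using complex_subring.cring_complex_subring[OF QQ_ring] by (simp add: Q_adjoin_eq[symmetric])

lemma finsum_complex:
  assumes "cring B" "ring.add B = (+)" "\<zero>\<^bsub>B\<^esub> = (0 :: complex)" "finite I" "\<And>i. i \<in> I \<Longrightarrow> f i \<in> carrier B"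
  shows "finsum B f I = sum f I"
proof -
  interpret cring B by fact
  show ?thesis using assms(4,5)
    by (induction I) (simp_all add: finsum_insert Pi_def assms(2,3))
qed

context cyclotomic_pair
begin

abbreviation A where "A \<equiv> group_ring (Q_adjoin zm) (C p)"
abbreviation Lam where "Lam \<equiv> carrier (group_ring (Z_adjoin zm) (C p))"
abbreviation \<Lambda> where "\<Lambda> \<equiv> subring_of A Lam"
abbreviation I\<^sub>p where "I\<^sub>p \<equiv> {0..<int p}"

text \<open>For w ^ p = 1 this is the algebra homomorphism that sends the generator 1 of
  \<open>C p\<close> to w. At w = 1 it is the augmentation.\<close>

definition ev :: "complex \<Rightarrow> (int \<Rightarrow> complex) \<Rightarrow> complex"
  where "ev w a = (\<Sum>x\<in>I\<^sub>p. a x * w ^ nat x)"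

abbreviation e1 where "e1 \<equiv> ev 1"
abbreviation e2 where "e2 \<equiv> ev zp"

lemma carrier_group_ring: "carrier (group_ring B (C p)) = (I\<^sub>p \<rightarrow>\<^sub>E carrier B)"
  by (simp add: group_ring_def carrier_integer_mod_group)

lemma Lam_subset: "Lam \<subseteq> carrier A"
  unfolding carrier_group_ring by (auto simp: PiE_iff)

lemma ev_add: "ring.add B = (+) \<Longrightarrow> ev w (a \<oplus>\<^bsub>group_ring B (C p)\<^esub> b) = ev w a + ev w b"
  by (simp add: ev_def group_ring_def carrier_integer_mod_group algebra_simps sum.distrib)

lemma ev_smult: "monoid.mult B = (*) \<Longrightarrow> ev w (r \<odot>\<^bsub>group_ring B (C p)\<^esub> a) = r * ev w a"
  by (simp add: ev_def group_ring_def carrier_integer_mod_group sum_distrib_left algebra_simps)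

lemma ev_zero: "\<zero>\<^bsub>B\<^esub> = 0 \<Longrightarrow> ev w \<zero>\<^bsub>group_ring B (C p)\<^esub> = 0"
  by (simp add: ev_def group_ring_def carrier_integer_mod_group)

lemma ev_one:
  assumes "\<zero>\<^bsub>B\<^esub> = 0" "\<one>\<^bsub>B\<^esub> = 1" shows "ev w \<one>\<^bsub>group_ring B (C p)\<^esub> = 1"
proof -
  have "ev w \<one>\<^bsub>group_ring B (C p)\<^esub> = (\<Sum>x\<in>I\<^sub>p. if x = 0 then 1 else 0)"
    unfolding ev_def by (rule sum.cong) (auto simp: group_ring_def carrier_integer_mod_group assms)
  then show ?thesis by simp
qed

lemma power_mod_p:
  fixes w :: complex
  assumes "0 \<le> x" "0 \<le> y" and w: "w ^ p = 1"
  shows "w ^ nat ((x + y) mod int p) = w ^ nat x * w ^ nat y"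
proof -
  obtain i where i: "x = int i" using assms(1) by (metis zero_le_imp_eq_int)
  obtain j where j: "y = int j" using assms(2) by (metis zero_le_imp_eq_int)
  have "w ^ (i + j) = w ^ ((i + j) mod p + p * ((i + j) div p))" by simp
  also have "\<dots> = w ^ ((i + j) mod p)" unfolding power_add[of w "(i + j) mod p"] power_mult w by simp
  finally show ?thesis unfolding i j by (simp add: power_add nat_mod_distrib flip: of_nat_add of_nat_mod)
qed

text \<open>As w ^ p = 1, exponents may be read modulo p, and the convolution is summed after a
  cyclic shift of the index.\<close>

lemma ev_mult:
  assumes B: "cring B" "ring.add B = (+)" "\<zero>\<^bsub>B\<^esub> = 0" "monoid.mult B = (*)"
    and w: "w ^ p = 1" and ab: "a \<in> carrier (group_ring B (C p))" "b \<in> carrier (group_ring B (C p))"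
  shows "ev w (a \<otimes>\<^bsub>group_ring B (C p)\<^esub> b) = ev w a * ev w b"
proof -
  interpret cring B by fact
  have in_B: "a y * b ((x - y) mod int p) \<in> carrier B" if "x \<in> I\<^sub>p" "y \<in> I\<^sub>p" for x y
  proof -
    have "(x - y) mod int p \<in> I\<^sub>p" by simp
    then show ?thesis using ab that m_closed B(4) unfolding carrier_group_ring PiE_iff by metis
  qed
  have sub: "((- y) mod int p + x) mod int p = (x - y) mod int p" for x y
    by (metis add.commute diff_conv_add_uminus mod_add_left_eq)
  have conv: "(a \<otimes>\<^bsub>group_ring B (C p)\<^esub> b) x = (\<Sum>y\<in>I\<^sub>p. a y * b ((x - y) mod int p))" if x: "x \<in> I\<^sub>p" for x
  proof -
    have "(a \<otimes>\<^bsub>group_ring B (C p)\<^esub> b) x = finsum B (\<lambda>y. a y * b (((- y) mod int p + x) mod int p)) I\<^sub>p"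
      using x unfolding group_ring_def
      by (auto simp: carrier_integer_mod_group B intro!: finsum_cong')
        (use in_B x sub in \<open>auto simp: carrier_integer_mod_group\<close>)
    also have "\<dots> = (\<Sum>y\<in>I\<^sub>p. a y * b ((x - y) mod int p))"
      unfolding sub by (rule finsum_complex[OF B(1-3)]) (use in_B x in auto)
    finally show ?thesis .
  qed
  have shift: "(\<Sum>x\<in>I\<^sub>p. b ((x - y) mod int p) * w ^ nat x) = w ^ nat y * ev w b" if y: "y \<in> I\<^sub>p" for y
  proof -
    have "(\<Sum>x\<in>I\<^sub>p. b ((x - y) mod int p) * w ^ nat x) = (\<Sum>z\<in>I\<^sub>p. w ^ nat y * (b z * w ^ nat z))"
    proof (rule sum.reindex_bij_witness[of _ "\<lambda>z. (z + y) mod int p" "\<lambda>x. (x - y) mod int p"])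
      fix x assume x: "x \<in> I\<^sub>p"
      show eq: "((x - y) mod int p + y) mod int p = x" using x by (simp add: mod_add_left_eq)
      show "w ^ nat y * (b ((x - y) mod int p) * w ^ nat ((x - y) mod int p)) = b ((x - y) mod int p) * w ^ nat x"
        using power_mod_p[of "(x - y) mod int p" y w] y w eq by simp
    qed (auto simp: mod_diff_left_eq)
    then show ?thesis by (simp add: ev_def sum_distrib_left)
  qed
  have "ev w (a \<otimes>\<^bsub>group_ring B (C p)\<^esub> b) = (\<Sum>x\<in>I\<^sub>p. \<Sum>y\<in>I\<^sub>p. a y * (b ((x - y) mod int p) * w ^ nat x))"
    unfolding ev_def by (rule sum.cong[OF refl]) (simp only: conv sum_distrib_right mult.assoc)
  also have "\<dots> = (\<Sum>y\<in>I\<^sub>p. a y * (\<Sum>x\<in>I\<^sub>p. b ((x - y) mod int p) * w ^ nat x))"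
    by (subst sum.swap) (simp add: sum_distrib_left)
  also have "\<dots> = (\<Sum>y\<in>I\<^sub>p. a y * w ^ nat y * ev w b)"
    by (rule sum.cong[OF refl]) (simp only: shift mult.assoc)
  finally show ?thesis by (simp add: ev_def sum_distrib_right)
qed

lemma ev_sum_nat: "ev w a = (\<Sum>i<p. a (int i) * w ^ i)"
proof -
  have "I\<^sub>p = int ` {..<p}" by (simp add: image_int_atLeastLessThan lessThan_atLeast0)
  then show ?thesis unfolding ev_def by (simp add: sum.reindex)
qed

text \<open>Equality at \<open>zp\<close> makes the coefficients of a - b constant by
  \<open>zp_relation\<close>, and equality at 1 makes p times that constant vanish.\<close>

lemma e_eqI:
  assumes a: "a \<in> carrier A" "b \<in> carrier A" and e: "e1 a = e1 b" "e2 a = e2 b"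
  shows "a = b"
proof -
  define c where "c i = a (int i) - b (int i)" for i
  have cK: "c i \<in> K" if "i < p" for i
    using a that by (auto simp: carrier_group_ring PiE_iff c_def)
  have s2: "(\<Sum>i<p. c i * zp ^ i) = 0" using e(2) by (simp add: ev_sum_nat c_def algebra_simps sum_subtractf)
  have const: "c i = c (p - 1)" if "i < p" for i using zp_relation[OF cK s2] that by blast
  have "(\<Sum>i<p. c i) = 0" using e(1) by (simp add: ev_sum_nat c_def algebra_simps sum_subtractf)
  moreover have "(\<Sum>i<p. c i) = (\<Sum>i<p. c (p - 1))" by (rule sum.cong[OF refl]) (rule const, simp)
  ultimately have "c (p - 1) = 0" by simp
  then have eq: "a (int i) = b (int i)" if "i < p" for i using const[OF that] by (simp add: c_def)
  have "a x = b x" if "x \<in> I\<^sub>p" for x using that eq[of "nat x"] by auto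
  then show ?thesis using a unfolding carrier_group_ring by (intro PiE_ext) auto
qed

definition of_coeffs :: "(nat \<Rightarrow> complex) \<Rightarrow> int \<Rightarrow> complex"
  where "of_coeffs c = (\<lambda>x\<in>I\<^sub>p. c (nat x))"

lemma of_coeffs: "e1 (of_coeffs c) = (\<Sum>i<p. c i)" "e2 (of_coeffs c) = (\<Sum>i<p. c i * zp ^ i)"
  by (auto simp: ev_sum_nat of_coeffs_def intro!: sum.cong)

lemma of_coeffs_in:
  "(\<And>i. i < p \<Longrightarrow> c i \<in> K) \<Longrightarrow> of_coeffs c \<in> carrier A"
  "(\<And>i. i < p \<Longrightarrow> c i \<in> R) \<Longrightarrow> of_coeffs c \<in> Lam"
  by (auto simp: of_coeffs_def carrier_group_ring PiE_iff)

lemma e_in: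
  assumes "a \<in> carrier A" shows "e1 a \<in> K" "e2 a \<in> L"
proof -
  have c: "a x \<in> K" if "x \<in> I\<^sub>p" for x using assms that by (auto simp: carrier_group_ring PiE_iff)
  show "e1 a \<in> K" unfolding ev_def by (rule K.sum_in) (use c in auto)
  show "e2 a \<in> L" unfolding ev_def by (rule L.sum_in) (use c in auto)
qed

lemma e_surj:
  assumes x: "x \<in> K" and y: "y \<in> L"
  shows "\<exists>a\<in>carrier A. e1 a = x \<and> e2 a = y"
proof -
  obtain d :: int where d: "d \<noteq> 0" "of_int d * y \<in> S" using y QQ_denominator[OF zmp_power] by blast
  obtain c where c: "\<And>i. c i \<in> R" "of_int d * y = (\<Sum>i<p. c i * zp ^ i)" using S_span[OF d(2)] by blast
  \<comment> \<open>A constant t added to every coefficient changes the value at 1 by p * t and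
    leaves the value at \<open>zp\<close> fixed, since the powers of \<open>zp\<close> sum to
    0.\<close>
  define t where "t = (x - (\<Sum>i<p. c i / of_int d)) / pc"
  define b where "b i = c i / of_int d + t" for i
  have t: "t \<in> K" unfolding t_def using x c by (intro K_divide K.diff_in K.sum_in) auto
  have "e1 (of_coeffs b) = x"
    unfolding of_coeffs b_def by (simp add: sum.distrib t_def)
  moreover have "e2 (of_coeffs b) = y"
  proof -
    have "e2 (of_coeffs b) = (\<Sum>i<p. c i * zp ^ i) / of_int d + t * (\<Sum>i<p. zp ^ i)"
      unfolding of_coeffs b_def by (simp add: sum.distrib sum_divide_distrib sum_distrib_left algebra_simps)
    then have "e2 (of_coeffs b) = of_int d * y / of_int d" unfolding c(2) zp_sum by simp
    then show ?thesis using d by simp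
  qed
  moreover have "of_coeffs b \<in> carrier A"
    by (rule of_coeffs_in) (use t c in \<open>auto simp: b_def\<close>)
  ultimately show ?thesis by blast
qed

text \<open>The inverse of the isomorphism from the group algebra onto K x L; on that product the
  choice is unique by \<open>e_eqI\<close>.\<close>

definition mk :: "complex \<Rightarrow> complex \<Rightarrow> int \<Rightarrow> complex"
  where "mk x y = (SOME a. a \<in> carrier A \<and> e1 a = x \<and> e2 a = y)"

lemma mk:
  assumes "x \<in> K" "y \<in> L"
  shows "mk x y \<in> carrier A" "e1 (mk x y) = x" "e2 (mk x y) = y"
proof -
  have "\<exists>a. a \<in> carrier A \<and> e1 a = x \<and> e2 a = y" using e_surj[OF assms] by blast
  then have "mk x y \<in> carrier A \<and> e1 (mk x y) = x \<and> e2 (mk x y) = y"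
    unfolding mk_def by (rule someI_ex)
  then show "mk x y \<in> carrier A" "e1 (mk x y) = x" "e2 (mk x y) = y" by auto
qed

lemma mk_e: "a \<in> carrier A \<Longrightarrow> mk (e1 a) (e2 a) = a"
  using e_in[of a] mk[of "e1 a" "e2 a"] e_eqI by blast

lemma A_add_closed: "a \<in> carrier A \<Longrightarrow> b \<in> carrier A \<Longrightarrow> a \<oplus>\<^bsub>A\<^esub> b \<in> carrier A"
  unfolding carrier_group_ring by (auto simp: group_ring_def carrier_integer_mod_group PiE_iff)

lemma group_ring_mult_closed:
  assumes B: "cring B" and ab: "a \<in> carrier (group_ring B (C p))" "b \<in> carrier (group_ring B (C p))"
  shows "a \<otimes>\<^bsub>group_ring B (C p)\<^esub> b \<in> carrier (group_ring B (C p))"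
proof -
  interpret cring B by fact
  have "(\<Oplus>\<^bsub>B\<^esub>y\<in>I\<^sub>p. a y \<otimes>\<^bsub>B\<^esub> b ((inv\<^bsub>C p\<^esub> y + x) mod int p)) \<in> carrier B" for x
  proof (rule finsum_closed)
    show "(\<lambda>y. a y \<otimes>\<^bsub>B\<^esub> b ((inv\<^bsub>C p\<^esub> y + x) mod int p)) \<in> I\<^sub>p \<rightarrow> carrier B"
    proof
      fix y assume "y \<in> I\<^sub>p"
      moreover have "(inv\<^bsub>C p\<^esub> y + x) mod int p \<in> I\<^sub>p" by simp
      ultimately show "a y \<otimes>\<^bsub>B\<^esub> b ((inv\<^bsub>C p\<^esub> y + x) mod int p) \<in> carrier B"
        using ab unfolding carrier_group_ring PiE_iff by (intro m_closed) blast+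
    qed
  qed
  then show ?thesis
    unfolding carrier_group_ring by (auto simp: group_ring_def carrier_integer_mod_group PiE_iff)
qed

lemmas A_mult_closed = group_ring_mult_closed[OF cring_Q_adjoin[of zm]]

lemma A_smult_closed: "r \<in> K \<Longrightarrow> a \<in> carrier A \<Longrightarrow> r \<odot>\<^bsub>A\<^esub> a \<in> carrier A"
  unfolding carrier_group_ring by (auto simp: group_ring_def carrier_integer_mod_group PiE_iff)

lemma A_zero_closed: "\<zero>\<^bsub>A\<^esub> \<in> carrier A" and A_one_closed: "\<one>\<^bsub>A\<^esub> \<in> carrier A"
  unfolding carrier_group_ring by (auto simp: group_ring_def carrier_integer_mod_group PiE_iff)

lemma e_simps [simp]:
  "ev w (a \<oplus>\<^bsub>A\<^esub> b) = ev w a + ev w b" "ev w (r \<odot>\<^bsub>A\<^esub> a) = r * ev w a"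
  "ev w \<zero>\<^bsub>A\<^esub> = 0" "ev w \<one>\<^bsub>A\<^esub> = 1"
  by (simp_all add: ev_add ev_smult ev_zero ev_one)

lemma e_mult:
  assumes "a \<in> carrier A" "b \<in> carrier A"
  shows "e1 (a \<otimes>\<^bsub>A\<^esub> b) = e1 a * e1 b" "e2 (a \<otimes>\<^bsub>A\<^esub> b) = e2 a * e2 b"
  by (rule ev_mult[OF cring_Q_adjoin]; use assms zp_power in simp)+

text \<open>Each ring law is checked through the two evaluations, where it becomes a law of complex
  numbers.\<close>

lemma cring_A: "cring A"
proof (rule cringI)
  show "abelian_group A"
  proof (rule abelian_groupI)
    fix a assume a: "a \<in> carrier A"
    have "mk (- e1 a) (- e2 a) \<in> carrier A" "mk (- e1 a) (- e2 a) \<oplus>\<^bsub>A\<^esub> a = \<zero>\<^bsub>A\<^esub>"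
      using mk[of "- e1 a" "- e2 a"] e_in[OF a] a
      by (auto intro!: e_eqI A_add_closed A_zero_closed)
    then show "\<exists>b\<in>carrier A. b \<oplus>\<^bsub>A\<^esub> a = \<zero>\<^bsub>A\<^esub>" by blast
  qed (auto intro!: e_eqI simp: A_add_closed A_zero_closed)
  show "comm_monoid A"
    by (rule comm_monoidI) (auto intro!: e_eqI simp: A_mult_closed A_one_closed e_mult)
qed (auto intro!: e_eqI simp: A_mult_closed A_add_closed e_mult algebra_simps)

sublocale A: cring "group_ring (Q_adjoin zm) (C p)" by (rule cring_A)

lemma e_uminus [simp]: "a \<in> carrier A \<Longrightarrow> e1 (\<ominus>\<^bsub>A\<^esub> a) = - e1 a" "a \<in> carrier A \<Longrightarrow> e2 (\<ominus>\<^bsub>A\<^esub> a) = - e2 a"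
  using e_simps(1)[of _ "\<ominus>\<^bsub>A\<^esub> a" a] by (simp_all add: A.l_neg add_eq_0_iff2)

text \<open>Given a congruent pair, lift \<open>e2 a\<close> to coefficients in R. Their sum differs
  from \<open>e1 a\<close> by an element of R that \<pi> divides, that is, by p * t. Adding t to
  every coefficient repairs the value at 1 without touching the one at \<open>zp\<close>.\<close>

lemma Lam_iff: "a \<in> Lam \<longleftrightarrow> a \<in> carrier A \<and> e1 a \<in> R \<and> e2 a \<in> S \<and> dvd_in S \<pi> (e1 a - e2 a)"
proof (intro iffI conjI)
  assume a: "a \<in> Lam"
  then show "a \<in> carrier A" using Lam_subset by blast
  have c: "a x \<in> R" if "x \<in> I\<^sub>p" for x using a that by (auto simp: carrier_group_ring PiE_iff)
  show "e1 a \<in> R" unfolding ev_def by (rule R.sum_in) (use c in auto)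
  show "e2 a \<in> S" unfolding ev_def by (rule S.sum_in) (use c in auto)
  have "dvd_in S \<pi> (e2 a - e1 a)"
    using span_residue[of "\<lambda>i. a (int i)"] c by (simp add: ev_sum_nat)
  then show "dvd_in S \<pi> (e1 a - e2 a)" by (rule S.dvd_in_diff_sym)
next
  assume a: "a \<in> carrier A \<and> e1 a \<in> R \<and> e2 a \<in> S \<and> dvd_in S \<pi> (e1 a - e2 a)"
  then obtain c where c: "\<And>i. c i \<in> R" "e2 a = (\<Sum>i<p. c i * zp ^ i)" using S_span by blast
  have sR: "(\<Sum>i<p. c i) \<in> R" using c by (intro R.sum_in)
  have "dvd_in S \<pi> (e2 a - (\<Sum>i<p. c i))" unfolding c using c by (intro span_residue) auto
  then have "dvd_in S \<pi> (e1 a - (\<Sum>i<p. c i))" using a S.dvd_in_diff_trans by blast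
  then have "dvd_in R pc (e1 a - (\<Sum>i<p. c i))" using a sR by (intro dvd_pi_imp_dvd_p) auto
  then obtain t where t: "t \<in> R" "e1 a - (\<Sum>i<p. c i) = pc * t" by (auto simp: dvd_in_def)
  define b where "b i = c i + t" for i
  have b: "of_coeffs b \<in> Lam" by (rule of_coeffs_in) (use c t in \<open>auto simp: b_def\<close>)
  have "of_coeffs b = a"
  proof (rule e_eqI)
    show "of_coeffs b \<in> carrier A" "a \<in> carrier A" using b Lam_subset a by auto
    show "e1 (of_coeffs b) = e1 a" using t(2) by (simp add: of_coeffs b_def sum.distrib algebra_simps)
    have "e2 (of_coeffs b) = (\<Sum>i<p. c i * zp ^ i) + t * (\<Sum>i<p. zp ^ i)"
      by (simp add: of_coeffs b_def sum.distrib sum_distrib_left algebra_simps)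
    then show "e2 (of_coeffs b) = e2 a" using zp_sum c by simp
  qed
  then show "a \<in> Lam" using b by simp
qed

lemma Lam_simps:
  assumes "a \<in> Lam"
  shows "a \<in> carrier A" "e1 a \<in> R" "e2 a \<in> S" "dvd_in S \<pi> (e1 a - e2 a)"
  using assms Lam_iff by auto

lemma mk_Lam: "x \<in> R \<Longrightarrow> y \<in> S \<Longrightarrow> dvd_in S \<pi> (x - y) \<Longrightarrow> mk x y \<in> Lam"
  using mk[of x y] by (simp add: Lam_iff)

lemma Lam_add: "a \<in> Lam \<Longrightarrow> b \<in> Lam \<Longrightarrow> a \<oplus>\<^bsub>A\<^esub> b \<in> Lam"
  using S.dvd_in_add[of \<pi> "e1 a - e2 a" "e1 b - e2 b"]
  by (simp add: Lam_iff A_add_closed algebra_simps)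

lemma Lam_mult: "a \<in> Lam \<Longrightarrow> b \<in> Lam \<Longrightarrow> a \<otimes>\<^bsub>A\<^esub> b \<in> Lam"
  by (simp add: Lam_iff A_mult_closed e_mult S.dvd_in_mult_cong)

lemma Lam_zero: "\<zero>\<^bsub>A\<^esub> \<in> Lam" and Lam_one: "\<one>\<^bsub>A\<^esub> \<in> Lam"
  by (simp_all add: Lam_iff A_zero_closed A_one_closed)

end

section \<open>Orders and lattices in the group algebra\<close>

lemma submodule_hull_eqI:
  assumes "submodule N R M" "U \<subseteq> N" "\<And>N'. submodule N' R M \<Longrightarrow> U \<subseteq> N' \<Longrightarrow> N \<subseteq> N'"
  shows "submodule_hull R M U = N"
  unfolding submodule_hull_def hull_def using assms by blast

lemma submodule_hull_least: "submodule N R M \<Longrightarrow> U \<subseteq> N \<Longrightarrow> submodule_hull R M U \<subseteq> N"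
  unfolding submodule_hull_def hull_def by blast

lemma submodule_hull_superset: "U \<subseteq> submodule_hull R M U"
  unfolding submodule_hull_def hull_def by blast

lemma submodule_closed:
  assumes "submodule N R M"
  shows "x \<in> N \<Longrightarrow> x \<in> carrier M" "\<zero>\<^bsub>M\<^esub> \<in> N" "x \<in> N \<Longrightarrow> y \<in> N \<Longrightarrow> x \<oplus>\<^bsub>M\<^esub> y \<in> N"
    "a \<in> carrier R \<Longrightarrow> x \<in> N \<Longrightarrow> a \<odot>\<^bsub>M\<^esub> x \<in> N"
proof -
  interpret submodule N R M by fact
  show "x \<in> N \<Longrightarrow> x \<in> carrier M" using subset by auto
  show "\<zero>\<^bsub>M\<^esub> \<in> N" using one_closed by simp
  show "x \<in> N \<Longrightarrow> y \<in> N \<Longrightarrow> x \<oplus>\<^bsub>M\<^esub> y \<in> N" using m_closed by simp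
  show "a \<in> carrier R \<Longrightarrow> x \<in> N \<Longrightarrow> a \<odot>\<^bsub>M\<^esub> x \<in> N" by (rule smult_closed)
qed

context cyclotomic_pair
begin

lemma submodule_AI:
  assumes N: "N \<subseteq> carrier A" "\<zero>\<^bsub>A\<^esub> \<in> N" "\<And>x y. x \<in> N \<Longrightarrow> y \<in> N \<Longrightarrow> x \<oplus>\<^bsub>A\<^esub> y \<in> N"
    "\<And>x. x \<in> N \<Longrightarrow> \<ominus>\<^bsub>A\<^esub> x \<in> N" "\<And>r x. r \<in> carrier B \<Longrightarrow> x \<in> N \<Longrightarrow> r \<odot>\<^bsub>A\<^esub> x \<in> N"
  shows "submodule N B A"
proof (rule submodule.intro)
  show "subgroup N (add_monoid A)"
    using N by (intro subgroup.intro) (auto simp flip: a_inv_def)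
qed (use N in \<open>unfold_locales; auto\<close>)

definition Gam where "Gam = {a \<in> carrier A. e1 a \<in> R \<and> e2 a \<in> S}"
abbreviation \<Gamma> where "\<Gamma> \<equiv> subring_of A Gam"

lemma Gam_iff: "a \<in> Gam \<longleftrightarrow> a \<in> carrier A \<and> e1 a \<in> R \<and> e2 a \<in> S" by (simp add: Gam_def)

lemma mk_Gam: "x \<in> R \<Longrightarrow> y \<in> S \<Longrightarrow> mk x y \<in> Gam"
  using mk[of x y] by (simp add: Gam_iff)

lemma Lam_Gam: "Lam \<subseteq> Gam" by (auto simp: Gam_iff Lam_iff)

lemma Gam_closed:
  "\<zero>\<^bsub>A\<^esub> \<in> Gam" "\<one>\<^bsub>A\<^esub> \<in> Gam" "a \<in> Gam \<Longrightarrow> b \<in> Gam \<Longrightarrow> a \<oplus>\<^bsub>A\<^esub> b \<in> Gam" "a \<in> Gam \<Longrightarrow> b \<in> Gam \<Longrightarrow> a \<otimes>\<^bsub>A\<^esub> b \<in> Gam"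
  "a \<in> Gam \<Longrightarrow> \<ominus>\<^bsub>A\<^esub> a \<in> Gam" "r \<in> R \<Longrightarrow> a \<in> Gam \<Longrightarrow> r \<odot>\<^bsub>A\<^esub> a \<in> Gam"
  by (simp_all add: Gam_iff A_zero_closed A_one_closed A_add_closed A_mult_closed e_mult A_smult_closed)

lemma Lam_uminus: "a \<in> Lam \<Longrightarrow> \<ominus>\<^bsub>A\<^esub> a \<in> Lam"
  using S.dvd_in_uminus[of \<pi> "e1 a - e2 a"] by (simp add: Lam_iff)

lemma Lam_smult: "r \<in> R \<Longrightarrow> a \<in> Lam \<Longrightarrow> r \<odot>\<^bsub>A\<^esub> a \<in> Lam"
  using S.dvd_in_mult'[of \<pi> "e1 a - e2 a" r] by (simp add: Lam_iff A_smult_closed algebra_simps)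

lemma subring_Gam: "subring Gam A"
  by (rule A.subringI) (auto simp: Gam_closed, auto simp: Gam_iff)

lemma submodule_Gam: "submodule Gam (Z_adjoin zm) A"
  by (rule submodule_AI) (auto simp: Gam_closed, auto simp: Gam_iff)

lemma group_add_sub:
  assumes "subgroup N (add_monoid A)" shows "group (add_monoid (A\<lparr>carrier := N\<rparr>))"
proof -
  have "add_monoid (A\<lparr>carrier := N\<rparr>) = (add_monoid A)\<lparr>carrier := N\<rparr>" by simp
  then show ?thesis using subgroup.subgroup_is_group[OF assms A.a_group] by simp
qed

lemma sub_inverse:
  assumes "subgroup N (add_monoid A)" "x \<in> N"
  shows "inv\<^bsub>add_monoid (A\<lparr>carrier := N\<rparr>)\<^esub> x = \<ominus>\<^bsub>A\<^esub> x"
  using A.add.m_inv_consistent[OF assms] by (simp add: a_inv_def)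

lemma is_order_Gam: "is_order (Q_adjoin zm) (Z_adjoin zm) A Gam"
  unfolding is_order_def
proof (intro conjI)
  show "subring Gam A" by (rule subring_Gam)
  show sub: "submodule Gam (Z_adjoin zm) A" by (rule submodule_Gam)
  have sg: "subgroup Gam (add_monoid A)" using sub by (rule submodule.axioms)
  show "finitely_generated (Z_adjoin zm) (A\<lparr>carrier := Gam\<rparr>)"
    unfolding finitely_generated_def
  proof (intro exI conjI)
    \<comment> \<open>Generators over R of the two factors R x 0 and 0 x S.\<close>
    let ?U = "insert (mk 1 0) ((\<lambda>i. mk 0 (zp ^ i)) ` {..<p})"
    show "finite ?U" by simp
    show U: "?U \<subseteq> carrier (A\<lparr>carrier := Gam\<rparr>)" by (auto intro!: mk_Gam)
    have "submodule_hull (Z_adjoin zm) (A\<lparr>carrier := Gam\<rparr>) ?U = Gam"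
    proof (rule submodule_hull_eqI)
      show "submodule Gam (Z_adjoin zm) (A\<lparr>carrier := Gam\<rparr>)"
      proof (rule submodule.intro)
        show "subgroup Gam (add_monoid (A\<lparr>carrier := Gam\<rparr>))"
          using group.subgroup_self[OF group_add_sub[OF sg]] by simp
      qed (unfold_locales, auto simp: Gam_closed)
      show "?U \<subseteq> Gam" using U by simp
      fix N assume N: "submodule N (Z_adjoin zm) (A\<lparr>carrier := Gam\<rparr>)" "?U \<subseteq> N"
      note c = submodule_closed[OF N(1), simplified]
      show "Gam \<subseteq> N"
      proof
        fix a assume a: "a \<in> Gam"
        then obtain b where b: "\<And>i. b i \<in> R" "e2 a = (\<Sum>i<p. b i * zp ^ i)" using S_span by (auto simp: Gam_iff)
        have a1: "e1 a \<in> R" using a by (simp add: Gam_iff)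
        have sS: "(\<Sum>i<k. b i * zp ^ i) \<in> S" for k using b by (intro S.sum_in S.mult_in) auto
        have "k \<le> p \<Longrightarrow> mk (e1 a) (\<Sum>i<k. b i * zp ^ i) \<in> N" for k
        proof (induction k)
          case 0
          have "e1 a \<odot>\<^bsub>A\<^esub> mk 1 0 \<in> N" using N(2) a1 by (intro c) auto
          moreover have "e1 a \<odot>\<^bsub>A\<^esub> mk 1 0 = mk (e1 a) 0"
            using a1 mk[of 1 0] mk[of "e1 a" 0] by (intro e_eqI) (auto simp: A_smult_closed)
          ultimately show ?case by simp
        next
          case (Suc k)
          let ?s = "\<Sum>i<k. b i * zp ^ i"
          have "mk (e1 a) ?s \<oplus>\<^bsub>A\<^esub> b k \<odot>\<^bsub>A\<^esub> mk 0 (zp ^ k) \<in> N"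
            using Suc N(2) b by (intro c) auto
          moreover have "mk (e1 a) ?s \<oplus>\<^bsub>A\<^esub> b k \<odot>\<^bsub>A\<^esub> mk 0 (zp ^ k) = mk (e1 a) (\<Sum>i<Suc k. b i * zp ^ i)"
            using a1 b sS[of k] sS[of "Suc k"] mk[of "e1 a" ?s] mk[of 0 "zp ^ k"] mk[of "e1 a" "\<Sum>i<Suc k. b i * zp ^ i"]
            by (intro e_eqI) (auto simp: A_smult_closed A_add_closed)
          ultimately show ?case by simp
        qed
        from this[of p] have "mk (e1 a) (e2 a) \<in> N" using b by simp
        then show "a \<in> N" using mk_e a by (simp add: Gam_iff)
      qed
    qed
    then show "submodule_hull (Z_adjoin zm) (A\<lparr>carrier := Gam\<rparr>) ?U = carrier (A\<lparr>carrier := Gam\<rparr>)" by simp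
  qed
  show "submodule_hull (Q_adjoin zm) A Gam = carrier A"
  proof (rule submodule_hull_eqI)
    show "submodule (carrier A) (Q_adjoin zm) A"
      by (rule submodule_AI) (auto simp: A_smult_closed A_add_closed)
    show "Gam \<subseteq> carrier A" by (auto simp: Gam_iff)
    fix N assume N: "submodule N (Q_adjoin zm) A" "Gam \<subseteq> N"
    show "carrier A \<subseteq> N"
    proof
      fix a assume a: "a \<in> carrier A"
      obtain d :: int where d: "d \<noteq> 0" "of_int d * e1 a \<in> R"
        using QQ_denominator[OF zm_power, of "e1 a"] e_in[OF a] by auto
      obtain e :: int where e: "e \<noteq> 0" "of_int e * e2 a \<in> S"
        using QQ_denominator[OF zmp_power, of "e2 a"] e_in[OF a] by auto
      define k :: complex where "k = of_int (d * e)"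
      have k: "k \<noteq> 0" "k \<in> K" using d e by (simp_all add: k_def)
      have "k * e1 a \<in> R" using R.mult_in[OF R.of_int_in[of e] d(2)] by (simp add: k_def algebra_simps)
      moreover have "k * e2 a \<in> S" using S.mult_in[OF S.of_int_in[of d] e(2)] by (simp add: k_def algebra_simps)
      ultimately have "k \<odot>\<^bsub>A\<^esub> a \<in> Gam" using a k by (simp add: Gam_iff A_smult_closed)
      then have "(1 / k) \<odot>\<^bsub>A\<^esub> (k \<odot>\<^bsub>A\<^esub> a) \<in> N" using N submodule_closed[OF N(1)] k by auto
      moreover have "(1 / k) \<odot>\<^bsub>A\<^esub> (k \<odot>\<^bsub>A\<^esub> a) = a" using k a by (intro e_eqI) (auto intro!: A_smult_closed)
      ultimately show "a \<in> N" by simp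
    qed
  qed
qed

text \<open>Finite generation gives one denominator for each component of the whole order. An order
  contains all powers of its elements, so the components are almost integral and lie in R and
  S.\<close>

lemma order_subset_Gam:
  assumes ord: "is_order (Q_adjoin zm) (Z_adjoin zm) A T'"
  shows "T' \<subseteq> Gam"
proof
  have sr: "subring T' A" and sm: "submodule T' (Z_adjoin zm) A" using ord by (auto simp: is_order_def)
  have sg: "subgroup T' (add_monoid A)" using sm by (rule submodule.axioms)
  have sub: "T' \<subseteq> carrier A" using submodule_closed[OF sm] by blast
  obtain U where U: "finite U" "U \<subseteq> T'" "submodule_hull (Z_adjoin zm) (A\<lparr>carrier := T'\<rparr>) U = T'"
    using ord by (auto simp: is_order_def finitely_generated_def)
  obtain d :: int where d: "d \<noteq> 0" "\<forall>u\<in>U. of_int d * e1 u \<in> R"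
    using QQ_common_denominator[OF zm_power U(1), of e1] e_in U sub by blast
  obtain e :: int where e: "e \<noteq> 0" "\<forall>u\<in>U. of_int e * e2 u \<in> S"
    using QQ_common_denominator[OF zmp_power U(1), of e2] e_in U sub by blast
  \<comment> \<open>The elements with these denominators form a submodule that contains the
    generators, hence everything.\<close>
  define N where "N = {a \<in> T'. of_int d * e1 a \<in> R \<and> of_int e * e2 a \<in> S}"
  have "submodule N (Z_adjoin zm) (A\<lparr>carrier := T'\<rparr>)"
  proof (rule submodule.intro)
    show "subgroup N (add_monoid (A\<lparr>carrier := T'\<rparr>))"
    proof (rule subgroup.intro)
      fix x assume x: "x \<in> N"
      then have xT: "x \<in> T'" "x \<in> carrier A" using sub by (auto simp: N_def)
      have "\<ominus>\<^bsub>A\<^esub> x \<in> T'" using subgroup.m_inv_closed[OF sg xT(1)] by (simp add: a_inv_def)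
      then show "inv\<^bsub>add_monoid (A\<lparr>carrier := T'\<rparr>)\<^esub> x \<in> N"
        unfolding sub_inverse[OF sg xT(1)] using x xT R.uminus_in[of "of_int d * e1 x"] S.uminus_in[of "of_int e * e2 x"]
        by (simp add: N_def)
    qed (auto simp: N_def algebra_simps submodule_closed[OF sm])
    show "submodule_axioms N (Z_adjoin zm) (A\<lparr>carrier := T'\<rparr>)"
    proof
      fix r x assume r: "r \<in> carrier (Z_adjoin zm)" and x: "x \<in> N"
      have "r * (of_int d * e1 x) \<in> R" "r * (of_int e * e2 x) \<in> S" using r x by (auto simp: N_def)
      then show "r \<odot>\<^bsub>A\<lparr>carrier := T'\<rparr>\<^esub> x \<in> N"
        using r x submodule_closed(4)[OF sm] by (simp add: N_def algebra_simps)
    qed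
  qed
  moreover have "U \<subseteq> N" using U d e by (auto simp: N_def)
  ultimately have TN: "T' \<subseteq> N" using submodule_hull_least U(3) by metis
  fix a assume a: "a \<in> T'"
  then have aA: "a \<in> carrier A" using sub by blast
  have pow: "a [^]\<^bsub>A\<^esub> k \<in> T' \<and> e1 (a [^]\<^bsub>A\<^esub> k) = e1 a ^ k \<and> e2 (a [^]\<^bsub>A\<^esub> k) = e2 a ^ k" for k :: nat
  proof (induction k)
    case 0
    show ?case using subringE(3)[OF sr] by simp
  next
    case (Suc k)
    then have "a [^]\<^bsub>A\<^esub> k \<in> carrier A" using sub by blast
    then show ?case using Suc a aA subringE(6)[OF sr] by (simp add: e_mult)
  qed
  have "e1 a \<in> R"
    using ZZ_almost_integral[OF zm _ d(1), of "e1 a"] e_in[OF aA] pow TN unfolding N_def by force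
  moreover have "e2 a \<in> S"
    using ZZ_almost_integral[OF zmp _ e(1), of "e2 a"] e_in[OF aA] pow TN unfolding N_def by force
  ultimately show "a \<in> Gam" using aA by (simp add: Gam_iff)
qed

lemma maximal_order_eq: "maximal_order (Q_adjoin zm) (Z_adjoin zm) A = Gam"
  unfolding maximal_order_def is_maximal_order_def
  using is_order_Gam order_subset_Gam by (intro the_equality) blast+

section \<open>Additive inverses in free modules over the group algebra\<close>

lemma group_free_module: "group (add_monoid (free_module A n))"
proof (rule groupI)
  fix x assume "x \<in> carrier (add_monoid (free_module A n))"
  then show "\<exists>y\<in>carrier (add_monoid (free_module A n)). y \<otimes>\<^bsub>add_monoid (free_module A n)\<^esub> x = \<one>\<^bsub>add_monoid (free_module A n)\<^esub>"
    by (intro bexI[of _ "map (a_inv A) x"])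
      (auto simp: regular_module_ops subset_iff A.l_neg intro!: nth_equalityI)
next
  fix x y z
  assume "x \<in> carrier (add_monoid (free_module A n))" "y \<in> carrier (add_monoid (free_module A n))"
    "z \<in> carrier (add_monoid (free_module A n))"
  then have l: "length x = n" "length y = n" "length z = n"
    and s: "\<And>i. i < n \<Longrightarrow> x ! i \<in> carrier A" "\<And>i. i < n \<Longrightarrow> y ! i \<in> carrier A" "\<And>i. i < n \<Longrightarrow> z ! i \<in> carrier A"
    by (auto simp: subset_iff)
  show "x \<otimes>\<^bsub>add_monoid (free_module A n)\<^esub> y \<otimes>\<^bsub>add_monoid (free_module A n)\<^esub> z =
    x \<otimes>\<^bsub>add_monoid (free_module A n)\<^esub> (y \<otimes>\<^bsub>add_monoid (free_module A n)\<^esub> z)"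
    using l s by (intro nth_equalityI) (auto simp: regular_module_ops A.a_assoc)
next
  fix x y
  assume "x \<in> carrier (add_monoid (free_module A n))" "y \<in> carrier (add_monoid (free_module A n))"
  then show "x \<otimes>\<^bsub>add_monoid (free_module A n)\<^esub> y \<in> carrier (add_monoid (free_module A n))"
    by (auto simp: regular_module_ops subset_iff dest: set_zip_leftD set_zip_rightD)
next
  fix x assume "x \<in> carrier (add_monoid (free_module A n))"
  then have l: "length x = n" and s: "\<And>i. i < n \<Longrightarrow> x ! i \<in> carrier A" by (auto simp: subset_iff)
  show "\<one>\<^bsub>add_monoid (free_module A n)\<^esub> \<otimes>\<^bsub>add_monoid (free_module A n)\<^esub> x = x"
    using l s by (intro nth_equalityI) (auto simp: regular_module_ops)
qed auto

text \<open>\<open>submodule\<close> asks for inverses in the additive monoid of the free module.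
  Written as multiplication by the scalar -1, they are covered by closure under scalars.\<close>

lemma free_module_inverse:
  assumes "v \<in> carrier (free_module A n)"
  shows "inv\<^bsub>add_monoid (free_module A n)\<^esub> v = map (\<lambda>x. (\<ominus>\<^bsub>A\<^esub> \<one>\<^bsub>A\<^esub>) \<otimes>\<^bsub>A\<^esub> x) v"
proof -
  interpret group "add_monoid (free_module A n)" by (rule group_free_module)
  have l: "length v = n" and s: "\<And>i. i < n \<Longrightarrow> v ! i \<in> carrier A" using assms by (auto simp: subset_iff)
  have "map2 (ring.add A) (map (\<lambda>x. (\<ominus>\<^bsub>A\<^esub> \<one>\<^bsub>A\<^esub>) \<otimes>\<^bsub>A\<^esub> x) v) v = replicate n \<zero>\<^bsub>A\<^esub>"
    using l s by (intro nth_equalityI) (auto simp: A.l_minus A.l_neg)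
  then show ?thesis using assms
    by (intro inv_equality) (auto simp: regular_module_ops subset_iff)
qed

end

section \<open>Locally free lattices of rank one\<close>

lemma maximalideal_Z_adjoin:
  assumes "maximalideal P (Z_adjoin z)"
  shows "P \<subseteq> ZZ z" "1 \<notin> P"
    "\<And>s t. s \<in> ZZ z \<Longrightarrow> t \<in> ZZ z \<Longrightarrow> s \<notin> P \<Longrightarrow> t \<notin> P \<Longrightarrow> s * t \<notin> P"
    "\<And>s t. s \<in> P \<Longrightarrow> t \<in> P \<Longrightarrow> s + t \<in> P" "\<And>s t. s \<in> P \<Longrightarrow> t \<in> ZZ z \<Longrightarrow> t * s \<in> P"
proof -
  interpret cring "Z_adjoin z" by (rule cring_Z_adjoin)
  interpret maximalideal P "Z_adjoin z" by fact
  interpret primeideal P "Z_adjoin z" by (rule maximalideal_prime[OF assms])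
  show "P \<subseteq> ZZ z" using a_subset .
  show "1 \<notin> P" using one_imp_carrier I_notcarr by auto
  show "s * t \<notin> P" if "s \<in> ZZ z" "t \<in> ZZ z" "s \<notin> P" "t \<notin> P" for s t
    using I_prime[of s t] that by auto
  show "s + t \<in> P" if "s \<in> P" "t \<in> P" for s t using a_closed[OF that] by simp
  show "t * s \<in> P" if "s \<in> P" "t \<in> ZZ z" for s t using I_l_closed[OF that] by simp
qed

context cyclotomic_pair
begin

definition subalg :: "(int \<Rightarrow> complex) set \<Rightarrow> bool" where
  "subalg Y \<longleftrightarrow> Y \<subseteq> carrier A \<and> \<zero>\<^bsub>A\<^esub> \<in> Y \<and> \<one>\<^bsub>A\<^esub> \<in> Y \<and> (\<forall>a\<in>Y. \<ominus>\<^bsub>A\<^esub> a \<in> Y)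
    \<and> (\<forall>a\<in>Y. \<forall>b\<in>Y. a \<oplus>\<^bsub>A\<^esub> b \<in> Y) \<and> (\<forall>a\<in>Y. \<forall>b\<in>Y. a \<otimes>\<^bsub>A\<^esub> b \<in> Y)"

lemma subalgD:
  assumes "subalg Y"
  shows "a \<in> Y \<Longrightarrow> a \<in> carrier A" "\<zero>\<^bsub>A\<^esub> \<in> Y" "\<one>\<^bsub>A\<^esub> \<in> Y" "a \<in> Y \<Longrightarrow> \<ominus>\<^bsub>A\<^esub> a \<in> Y"
    "a \<in> Y \<Longrightarrow> b \<in> Y \<Longrightarrow> a \<oplus>\<^bsub>A\<^esub> b \<in> Y" "a \<in> Y \<Longrightarrow> b \<in> Y \<Longrightarrow> a \<otimes>\<^bsub>A\<^esub> b \<in> Y"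
  using assms unfolding subalg_def by blast+

lemma subalg_Lam: "subalg Lam"
  using Lam_subset by (auto simp: subalg_def Lam_zero Lam_one Lam_uminus Lam_add Lam_mult)

lemma subalg_Gam: "subalg Gam"
  by (auto simp: subalg_def Gam_closed) (simp add: Gam_iff)

lemma submodule_freeI:
  assumes Y: "subalg Y"
    and M: "M \<subseteq> carrier (free_module A n)" "replicate n \<zero>\<^bsub>A\<^esub> \<in> M"
      "\<And>v w. v \<in> M \<Longrightarrow> w \<in> M \<Longrightarrow> map2 (ring.add A) v w \<in> M"
      "\<And>a v. a \<in> Y \<Longrightarrow> v \<in> M \<Longrightarrow> map (\<lambda>x. a \<otimes>\<^bsub>A\<^esub> x) v \<in> M"
  shows "submodule M (subring_of A Y) (free_module A n)"
proof (rule submodule.intro)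
  show "subgroup M (add_monoid (free_module A n))"
  proof (rule subgroup.intro)
    fix v assume v: "v \<in> M"
    have "\<ominus>\<^bsub>A\<^esub> \<one>\<^bsub>A\<^esub> \<in> Y" by (intro subalgD[OF Y])
    then show "inv\<^bsub>add_monoid (free_module A n)\<^esub> v \<in> M"
      using M v by (subst free_module_inverse) auto
  qed (use M in \<open>simp_all add: regular_module_ops\<close>)
qed (use M in \<open>unfold_locales; simp\<close>)

lemma submodule_lattice_self:
  assumes "submodule M B (free_module A n)"
  shows "submodule M B (lattice_module A n M)"
proof (rule submodule.intro)
  interpret submodule M B "free_module A n" by fact
  have eq: "add_monoid (lattice_module A n M) = (add_monoid (free_module A n))\<lparr>carrier := M\<rparr>"
    by (simp add: lattice_module_def)
  have "group (add_monoid (lattice_module A n M))"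
    unfolding eq by (rule subgroup_is_group[OF group_free_module])
  then show "subgroup M (add_monoid (lattice_module A n M))"
    using group.subgroup_self by (force simp: lattice_module_def)
  show "submodule_axioms M B (lattice_module A n M)"
  proof
    fix a x assume "a \<in> carrier B" "x \<in> M"
    then show "a \<odot>\<^bsub>lattice_module A n M\<^esub> x \<in> M" using smult_closed[of a x] by simp
  qed
qed

lemma finitely_generated_latticeI:
  assumes "submodule M B (free_module A n)" "finite U" "U \<subseteq> M"
    and "\<And>N. submodule N B (lattice_module A n M) \<Longrightarrow> U \<subseteq> N \<Longrightarrow> M \<subseteq> N"
  shows "finitely_generated B (lattice_module A n M)"
  unfolding finitely_generated_def
  using assms submodule_hull_eqI[OF submodule_lattice_self[OF assms(1)] assms(3,4)]
  by (intro exI[of _ U]) simp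

abbreviation singletons :: "(int \<Rightarrow> complex) set \<Rightarrow> (int \<Rightarrow> complex) list set"
  where "singletons J \<equiv> {[x] | x. x \<in> J}"

text \<open>The hypothesis \<open>loc\<close> says that J and g * Y have equal localizations at P
  for some g invertible in the algebra; division by g is then the required isomorphism.\<close>

lemma locally_free_rank_one:
  assumes Y: "subalg Y" and J: "J \<subseteq> carrier A" "\<zero>\<^bsub>A\<^esub> \<in> J" "\<And>a b. a \<in> J \<Longrightarrow> b \<in> J \<Longrightarrow> a \<oplus>\<^bsub>A\<^esub> b \<in> J"
      "\<And>a b. a \<in> Y \<Longrightarrow> b \<in> J \<Longrightarrow> a \<otimes>\<^bsub>A\<^esub> b \<in> J"
    and U: "finite U" "U \<subseteq> J"
      "\<And>N. U \<subseteq> N \<Longrightarrow> (\<And>a b. a \<in> N \<Longrightarrow> b \<in> N \<Longrightarrow> a \<oplus>\<^bsub>A\<^esub> b \<in> N) \<Longrightarrow> (\<And>a b. a \<in> Y \<Longrightarrow> b \<in> N \<Longrightarrow> a \<otimes>\<^bsub>A\<^esub> b \<in> N) \<Longrightarrow> J \<subseteq> N"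
    and loc: "\<And>P. maximalideal P (Z_adjoin zm) \<Longrightarrow>
      \<exists>g\<in>carrier A. e1 g \<noteq> 0 \<and> e2 g \<noteq> 0 \<and>
        (\<forall>a\<in>carrier A. (\<exists>s\<in>R - P. s \<odot>\<^bsub>A\<^esub> (g \<otimes>\<^bsub>A\<^esub> a) \<in> J) \<longleftrightarrow> (\<exists>s\<in>R - P. s \<odot>\<^bsub>A\<^esub> a \<in> Y))"
  shows "locally_free (Z_adjoin zm) A Y 1 (singletons J)"
  unfolding locally_free_def
proof (intro conjI allI impI)
  show sub: "submodule (singletons J) (subring_of A Y) (free_module A 1)"
    by (rule submodule_freeI[OF Y]) (use J in auto)
  show "finitely_generated (subring_of A Y) (lattice_module A 1 (singletons J))"
  proof (rule finitely_generated_latticeI[OF sub])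
    show "finite ((\<lambda>u. [u]) ` U)" "(\<lambda>u. [u]) ` U \<subseteq> singletons J" using U by auto
    fix N assume N: "submodule N (subring_of A Y) (lattice_module A 1 (singletons J))" "(\<lambda>u. [u]) ` U \<subseteq> N"
    have "J \<subseteq> {x. [x] \<in> N}"
    proof (rule U(3))
      show "U \<subseteq> {x. [x] \<in> N}" using N by auto
      show "a \<oplus>\<^bsub>A\<^esub> b \<in> {x. [x] \<in> N}" if "a \<in> {x. [x] \<in> N}" "b \<in> {x. [x] \<in> N}" for a b
        using submodule_closed(3)[OF N(1), of "[a]" "[b]"] that by simp
      show "a \<otimes>\<^bsub>A\<^esub> b \<in> {x. [x] \<in> N}" if "a \<in> Y" "b \<in> {x. [x] \<in> N}" for a b
        using submodule_closed(4)[OF N(1), of a "[b]"] that by simp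
    qed
    then show "singletons J \<subseteq> N" by auto
  qed
  fix P assume P: "maximalideal P (Z_adjoin zm)"
  obtain g where g: "g \<in> carrier A" "e1 g \<noteq> 0" "e2 g \<noteq> 0" and
    gl: "\<And>a. a \<in> carrier A \<Longrightarrow> (\<exists>s\<in>R - P. s \<odot>\<^bsub>A\<^esub> (g \<otimes>\<^bsub>A\<^esub> a) \<in> J) \<longleftrightarrow> (\<exists>s\<in>R - P. s \<odot>\<^bsub>A\<^esub> a \<in> Y)"
    using loc[OF P] by blast
  define g' where "g' = mk (1 / e1 g) (1 / e2 g)"
  have g': "g' \<in> carrier A" "e1 g' = 1 / e1 g" "e2 g' = 1 / e2 g"
    using mk[of "1 / e1 g" "1 / e2 g"] e_in[OF g(1)] by (simp_all add: g'_def)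
  have gg': "g' \<otimes>\<^bsub>A\<^esub> (g \<otimes>\<^bsub>A\<^esub> a) = a" "g \<otimes>\<^bsub>A\<^esub> (g' \<otimes>\<^bsub>A\<^esub> a) = a" if "a \<in> carrier A" for a
    using that g g' by (auto intro!: e_eqI simp: e_mult A_mult_closed)
  define XP where "XP = localize (Z_adjoin zm) P A Y"
  have XP: "a \<in> XP \<longleftrightarrow> a \<in> carrier A \<and> (\<exists>s\<in>R - P. s \<odot>\<^bsub>A\<^esub> a \<in> Y)" for a
    by (auto simp: XP_def localize_def)
  define Q where "Q = localize (Z_adjoin zm) P (module_power A 1) (singletons J)"
  have MP: "v \<in> Q \<longleftrightarrow>
      (\<exists>b\<in>carrier A. v = [b] \<and> (\<exists>s\<in>R - P. s \<odot>\<^bsub>A\<^esub> b \<in> J))" for v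
    by (cases v; cases "tl v") (auto simp: Q_def localize_def)
  have "miso (subring_of A XP) (lattice_module A 1 Q)
      (free_module (subring_of A XP) 1)"
  proof (rule misoI[of _ "map (\<lambda>x. g' \<otimes>\<^bsub>A\<^esub> x)" _ "map (\<lambda>x. g \<otimes>\<^bsub>A\<^esub> x)"])
    fix v assume v: "v \<in> carrier (lattice_module A 1 Q)"
    then obtain b where b: "b \<in> carrier A" "v = [b]" "\<exists>s\<in>R - P. s \<odot>\<^bsub>A\<^esub> b \<in> J" by (auto simp: MP)
    have "g' \<otimes>\<^bsub>A\<^esub> b \<in> XP" using gl[of "g' \<otimes>\<^bsub>A\<^esub> b"] b g' gg' by (simp add: XP A_mult_closed)
    then show "map (\<lambda>x. g' \<otimes>\<^bsub>A\<^esub> x) v \<in> carrier (free_module (subring_of A XP) 1)" using b by simp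
    show "map (\<lambda>x. g \<otimes>\<^bsub>A\<^esub> x) (map (\<lambda>x. g' \<otimes>\<^bsub>A\<^esub> x) v) = v" using b gg' by simp
  next
    fix v assume v: "v \<in> carrier (free_module (subring_of A XP) 1)"
    then obtain a where a: "v = [a]" "a \<in> XP" by (cases v) auto
    then have "g \<otimes>\<^bsub>A\<^esub> a \<in> carrier A" "\<exists>s\<in>R - P. s \<odot>\<^bsub>A\<^esub> (g \<otimes>\<^bsub>A\<^esub> a) \<in> J"
      using gl[of a] g by (auto simp: XP A_mult_closed)
    then show "map (\<lambda>x. g \<otimes>\<^bsub>A\<^esub> x) v \<in> carrier (lattice_module A 1 Q)"
      using a by (simp add: MP)
    show "map (\<lambda>x. g' \<otimes>\<^bsub>A\<^esub> x) (map (\<lambda>x. g \<otimes>\<^bsub>A\<^esub> x) v) = v" using a gg' by (simp add: XP)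
  next
    fix v w
    assume "v \<in> carrier (lattice_module A 1 Q)"
      "w \<in> carrier (lattice_module A 1 Q)"
    then obtain b c where "b \<in> carrier A" "v = [b]" "c \<in> carrier A" "w = [c]" by (auto simp: MP)
    then show "map (\<lambda>x. g' \<otimes>\<^bsub>A\<^esub> x) (v \<oplus>\<^bsub>lattice_module A 1 Q\<^esub> w)
      = map (\<lambda>x. g' \<otimes>\<^bsub>A\<^esub> x) v \<oplus>\<^bsub>free_module (subring_of A XP) 1\<^esub> map (\<lambda>x. g' \<otimes>\<^bsub>A\<^esub> x) w"
      using g' by (simp add: regular_module_ops A.r_distr)
  next
    fix a v
    assume "v \<in> carrier (lattice_module A 1 Q)"
      and a: "a \<in> carrier (subring_of A XP)"
    then obtain b where "b \<in> carrier A" "v = [b]" by (auto simp: MP)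
    then show "map (\<lambda>x. g' \<otimes>\<^bsub>A\<^esub> x) (a \<odot>\<^bsub>lattice_module A 1 Q\<^esub> v)
      = a \<odot>\<^bsub>free_module (subring_of A XP) 1\<^esub> map (\<lambda>x. g' \<otimes>\<^bsub>A\<^esub> x) v"
      using a g' by (simp add: XP A.m_lcomm)
  qed
  then show "let S\<^sub>P = subring_of A (localize (Z_adjoin zm) P A Y)
    in module_iso S\<^sub>P (lattice_module A 1 (localize (Z_adjoin zm) P (module_power A 1) (singletons J)))
        (free_module S\<^sub>P 1) \<noteq> {}"
    unfolding Let_def miso_def XP_def Q_def .
qed

lemma free_module_lattice:
  "free_module (subring_of A Y) n = lattice_module A n {v. length v = n \<and> set v \<subseteq> Y}"
  by (simp add: module_power_def lattice_module_def regular_module_def)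

lemma free_module_rank_one: "free_module (subring_of A Y) 1 = lattice_module A 1 (singletons Y)"
proof -
  have "{v. length v = 1 \<and> set v \<subseteq> Y} = singletons Y" by (auto simp: length_Suc_conv)
  then show ?thesis unfolding free_module_lattice by simp
qed

lemma locally_free_regular:
  assumes Y: "subalg Y" shows "locally_free (Z_adjoin zm) A Y 1 (singletons Y)"
proof (rule locally_free_rank_one[OF Y, where U = "{\<one>\<^bsub>A\<^esub>}"])
  fix N assume N: "{\<one>\<^bsub>A\<^esub>} \<subseteq> N" "\<And>a b. a \<in> Y \<Longrightarrow> b \<in> N \<Longrightarrow> a \<otimes>\<^bsub>A\<^esub> b \<in> N"
  show "Y \<subseteq> N"
  proof
    fix a assume "a \<in> Y"
    then show "a \<in> N" using N(2)[of a "\<one>\<^bsub>A\<^esub>"] N(1) subalgD(1)[OF Y] by auto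
  qed
next
  fix P
  show "\<exists>g\<in>carrier A. e1 g \<noteq> 0 \<and> e2 g \<noteq> 0 \<and>
        (\<forall>a\<in>carrier A. (\<exists>s\<in>R - P. s \<odot>\<^bsub>A\<^esub> (g \<otimes>\<^bsub>A\<^esub> a) \<in> Y) \<longleftrightarrow> (\<exists>s\<in>R - P. s \<odot>\<^bsub>A\<^esub> a \<in> Y))"
    by (rule bexI[of _ "\<one>\<^bsub>A\<^esub>"]) (auto simp: A_one_closed)
qed (use subalgD[OF Y] in auto)

lemma regular_lattice:
  assumes "subalg Y" shows "free_module (subring_of A Y) 1 \<in> locally_free_modules (Z_adjoin zm) A Y"
  unfolding locally_free_modules_def free_module_rank_one using locally_free_regular[OF assms] by blast

subsection \<open>Swan modules\<close>

abbreviation Sw where "Sw \<equiv> swan_module (Z_adjoin zm) (C p)"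

text \<open>By \<open>ideal_coprime_iff\<close> this is the coprimality condition in the definition
  of the Swan subgroup.\<close>

definition unit_mod_p :: "complex \<Rightarrow> bool"
  where "unit_mod_p r \<longleftrightarrow> r \<in> R \<and> (\<exists>u\<in>R. dvd_in R pc (u * r - 1))"

lemma unit_mod_p_nonzero: "unit_mod_p r \<Longrightarrow> r \<noteq> 0"
proof
  assume "unit_mod_p r" "r = 0"
  then obtain u where "dvd_in R pc (u * r - 1)" unfolding unit_mod_p_def by blast
  with \<open>r = 0\<close> have "dvd_in R pc (- 1)" by simp
  then have "dvd_in S \<pi> (- (- 1))" by (intro S.dvd_in_uminus dvd_p_imp_dvd_pi)
  then show False using pi_not_unit by simp
qed

lemma ideal_coprime_iff:
  assumes r: "r \<in> R"
  shows "Idl\<^bsub>Z_adjoin zm\<^esub> {r, [Coset.order (C p)] \<cdot>\<^bsub>Z_adjoin zm\<^esub> \<one>\<^bsub>Z_adjoin zm\<^esub>} = carrier (Z_adjoin zm) \<longleftrightarrow> unit_mod_p r"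
proof -
  interpret Z: cring "Z_adjoin zm" by (rule cring_Z_adjoin)
  have "[k] \<cdot>\<^bsub>Z_adjoin zm\<^esub> \<one>\<^bsub>Z_adjoin zm\<^esub> = of_nat k" for k :: nat
    by (induction k) (simp_all add: Z.add.nat_pow_Suc)
  then have pc: "[Coset.order (C p)] \<cdot>\<^bsub>Z_adjoin zm\<^esub> \<one>\<^bsub>Z_adjoin zm\<^esub> = pc"
    by (simp add: Coset.order_def carrier_integer_mod_group)
  let ?J = "{u * r + v * pc | u v. u \<in> R \<and> v \<in> R}"
  have JI: "u * r + v * pc \<in> ?J" if "u \<in> R" "v \<in> R" for u v using that by blast
  have "ideal ?J (Z_adjoin zm)"
  proof (rule idealI)
    show "ring (Z_adjoin zm)" by (rule Z.ring_axioms)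
    show "subgroup ?J (add_monoid (Z_adjoin zm))"
    proof (rule Z.add.subgroupI)
      show "?J \<subseteq> carrier (Z_adjoin zm)" using r by auto
      show "?J \<noteq> {}" using JI[of 0 0] by blast
      fix a assume "a \<in> ?J"
      then obtain u v where a: "a = u * r + v * pc" "u \<in> R" "v \<in> R" by blast
      have "\<ominus>\<^bsub>Z_adjoin zm\<^esub> a = - a"
        by (rule Z.minus_equality) (use a r in auto)
      also have "\<dots> = (- u) * r + (- v) * pc" using a by (simp add: algebra_simps)
      finally show "\<ominus>\<^bsub>Z_adjoin zm\<^esub> a \<in> ?J" using JI[of "- u" "- v"] a by auto
    next
      fix a b assume "a \<in> ?J" "b \<in> ?J"
      then obtain u v u' v' where ab: "a = u * r + v * pc" "u \<in> R" "v \<in> R"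
        "b = u' * r + v' * pc" "u' \<in> R" "v' \<in> R" by blast
      then have "a + b = (u + u') * r + (v + v') * pc" by (simp add: algebra_simps)
      then show "a \<oplus>\<^bsub>Z_adjoin zm\<^esub> b \<in> ?J" using JI[of "u + u'" "v + v'"] ab by auto
    qed
    fix a x assume "a \<in> ?J" and x: "x \<in> carrier (Z_adjoin zm)"
    then obtain u v where a: "a = u * r + v * pc" "u \<in> R" "v \<in> R" by blast
    have "x * a = (x * u) * r + (x * v) * pc" using a by (simp add: algebra_simps)
    then have "x * a \<in> ?J" using JI[of "x * u" "x * v"] a x by auto
    then show "x \<otimes>\<^bsub>Z_adjoin zm\<^esub> a \<in> ?J" "a \<otimes>\<^bsub>Z_adjoin zm\<^esub> x \<in> ?J" by (simp_all add: mult.commute)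
  qed
  moreover have "{r, pc} \<subseteq> ?J" using JI[of 1 0] JI[of 0 1] by auto
  ultimately have sub: "Idl\<^bsub>Z_adjoin zm\<^esub> {r, pc} \<subseteq> ?J" by (rule Z.genideal_minimal)
  have gen: "ideal (Idl\<^bsub>Z_adjoin zm\<^esub> {r, pc}) (Z_adjoin zm)" "{r, pc} \<subseteq> Idl\<^bsub>Z_adjoin zm\<^esub> {r, pc}"
    using Z.genideal_ideal[of "{r, pc}"] Z.genideal_self[of "{r, pc}"] r by auto
  show ?thesis unfolding pc
  proof
    assume "Idl\<^bsub>Z_adjoin zm\<^esub> {r, pc} = carrier (Z_adjoin zm)"
    then have "1 \<in> ?J" using sub R.one_in by blast
    then obtain u v where uv: "1 = u * r + v * pc" "u \<in> R" "v \<in> R" by blast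
    have "u * r - 1 = pc * (- v)" by (subst uv(1)) (simp add: algebra_simps)
    then show "unit_mod_p r" unfolding unit_mod_p_def using uv(2,3) r by (auto intro!: bexI[of _ u] dvd_inI[of "- v"])
  next
    assume "unit_mod_p r"
    then obtain u t where u: "u \<in> R" "t \<in> R" "u * r - 1 = pc * t" by (auto simp: unit_mod_p_def dvd_in_def)
    interpret I: ideal "Idl\<^bsub>Z_adjoin zm\<^esub> {r, pc}" "Z_adjoin zm" by (rule gen)
    have "u * r \<in> Idl\<^bsub>Z_adjoin zm\<^esub> {r, pc}" "(- t) * pc \<in> Idl\<^bsub>Z_adjoin zm\<^esub> {r, pc}"
      using gen(2) u I.I_l_closed[of r u] I.I_l_closed[of pc "- t"] by auto
    then have "u * r + (- t) * pc \<in> Idl\<^bsub>Z_adjoin zm\<^esub> {r, pc}" using I.a_closed by fastforce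
    moreover have "u * r + (- t) * pc = 1" using u(3) by (simp add: algebra_simps)
    ultimately show "Idl\<^bsub>Z_adjoin zm\<^esub> {r, pc} = carrier (Z_adjoin zm)" using I.one_imp_carrier by simp
  qed
qed

lemma T_eq: "T zm p = {stable_class (Z_adjoin zm) A Lam (lattice_module A 1 (singletons (Sw r))) | r. unit_mod_p r}"
  unfolding T_def swan_subgroup_def Let_def using ideal_coprime_iff by (auto simp: unit_mod_p_def)

lemma norm_element: "norm_element (Z_adjoin zm) (C p) \<in> Lam"
  "e1 (norm_element (Z_adjoin zm) (C p)) = pc" "e2 (norm_element (Z_adjoin zm) (C p)) = 0"
  by (auto simp: norm_element_def carrier_group_ring carrier_integer_mod_group ev_sum_nat zp_sum)

lemma group_ring_Z_ops:
  "r \<in> R \<Longrightarrow> a \<in> Lam \<Longrightarrow> r \<odot>\<^bsub>group_ring (Z_adjoin zm) (C p)\<^esub> a = r \<odot>\<^bsub>A\<^esub> a"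
  "a \<in> Lam \<Longrightarrow> b \<in> Lam \<Longrightarrow> a \<oplus>\<^bsub>group_ring (Z_adjoin zm) (C p)\<^esub> b = a \<oplus>\<^bsub>A\<^esub> b"
  "a \<in> Lam \<Longrightarrow> b \<in> Lam \<Longrightarrow> a \<otimes>\<^bsub>group_ring (Z_adjoin zm) (C p)\<^esub> b = a \<otimes>\<^bsub>A\<^esub> b"
proof -
  show "r \<odot>\<^bsub>group_ring (Z_adjoin zm) (C p)\<^esub> a = r \<odot>\<^bsub>A\<^esub> a" "a \<oplus>\<^bsub>group_ring (Z_adjoin zm) (C p)\<^esub> b = a \<oplus>\<^bsub>A\<^esub> b"
    by (simp_all add: group_ring_def)
  assume ab: "a \<in> Lam" "b \<in> Lam"
  then have "a \<otimes>\<^bsub>group_ring (Z_adjoin zm) (C p)\<^esub> b \<in> Lam" by (rule group_ring_mult_closed[OF cring_Z_adjoin])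
  then show "a \<otimes>\<^bsub>group_ring (Z_adjoin zm) (C p)\<^esub> b = a \<otimes>\<^bsub>A\<^esub> b"
    using ab Lam_subset zp_power
    by (intro e_eqI) (auto simp: e_mult ev_mult[OF cring_Z_adjoin] A_mult_closed subset_iff)
qed

lemma Sw_eq: "Sw r = {(r \<odot>\<^bsub>A\<^esub> a) \<oplus>\<^bsub>A\<^esub> (b \<otimes>\<^bsub>A\<^esub> norm_element (Z_adjoin zm) (C p)) | a b. a \<in> Lam \<and> b \<in> Lam}" if "r \<in> R"
proof -
  have "(r \<odot>\<^bsub>group_ring (Z_adjoin zm) (C p)\<^esub> a) \<oplus>\<^bsub>group_ring (Z_adjoin zm) (C p)\<^esub>
      (b \<otimes>\<^bsub>group_ring (Z_adjoin zm) (C p)\<^esub> norm_element (Z_adjoin zm) (C p)) =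
    (r \<odot>\<^bsub>A\<^esub> a) \<oplus>\<^bsub>A\<^esub> (b \<otimes>\<^bsub>A\<^esub> norm_element (Z_adjoin zm) (C p))" if "a \<in> Lam" "b \<in> Lam" for a b
    using that \<open>r \<in> R\<close> norm_element(1) by (simp add: group_ring_Z_ops Lam_smult Lam_mult)
  then show ?thesis unfolding swan_module_def Let_def by (intro Collect_cong) metis
qed

text \<open>The norm element is the pair (p, 0), so the Swan module consists of the pairs (r * a1 +
  p * b1, r * a2). Conversely, for x0 in R congruent to y, the difference of \<open>e1 w\<close> and
  r * x0 lies in R and is divisible by \<pi>, hence equals p * t.\<close>

lemma Sw_iff:
  assumes r: "r \<in> R"
  shows "w \<in> Sw r \<longleftrightarrow> w \<in> carrier A \<and> e1 w \<in> R \<and> (\<exists>y\<in>S. e2 w = r * y \<and> dvd_in S \<pi> (e1 w - r * y))"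
proof
  assume "w \<in> Sw r"
  then obtain a b where ab: "a \<in> Lam" "b \<in> Lam" "w = (r \<odot>\<^bsub>A\<^esub> a) \<oplus>\<^bsub>A\<^esub> (b \<otimes>\<^bsub>A\<^esub> norm_element (Z_adjoin zm) (C p))"
    using Sw_eq[OF r] by auto
  note n = norm_element Lam_simps(1)[OF norm_element(1)]
  have w: "e1 w = r * e1 a + e1 b * pc" "e2 w = r * e2 a"
    using ab Lam_simps n by (simp_all add: e_mult)
  have "w \<in> Lam" using ab r n by (auto intro!: Lam_add Lam_smult Lam_mult)
  moreover have "dvd_in S \<pi> (e1 w - r * e2 a)"
  proof -
    have "e1 w - r * e2 a = r * (e1 a - e2 a) + e1 b * pc" using w by (simp add: algebra_simps)
    then show ?thesis using ab r Lam_simps pi_dvd_p by (auto intro!: S.dvd_in_add S.dvd_in_mult')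
  qed
  ultimately show "w \<in> carrier A \<and> e1 w \<in> R \<and> (\<exists>y\<in>S. e2 w = r * y \<and> dvd_in S \<pi> (e1 w - r * y))"
    using w ab Lam_simps by blast
next
  assume w: "w \<in> carrier A \<and> e1 w \<in> R \<and> (\<exists>y\<in>S. e2 w = r * y \<and> dvd_in S \<pi> (e1 w - r * y))"
  then obtain y where y: "y \<in> S" "e2 w = r * y" "dvd_in S \<pi> (e1 w - r * y)" by blast
  obtain x0 where x0: "x0 \<in> R" "dvd_in S \<pi> (y - x0)" using S_residue[OF y(1)] by blast
  have "dvd_in S \<pi> (r * (y - x0))" using x0 r by (intro S.dvd_in_mult') auto
  then have "dvd_in S \<pi> (e1 w - r * x0)"
    using S.dvd_in_diff_trans[OF y(3), of "r * x0"] by (simp add: right_diff_distrib)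
  then have "dvd_in R pc (e1 w - r * x0)" using w x0 r by (intro dvd_pi_imp_dvd_p) auto
  then obtain t where t: "t \<in> R" "e1 w - r * x0 = pc * t" by (auto simp: dvd_in_def)
  have a: "mk x0 y \<in> Lam" using x0 y S.dvd_in_diff_sym by (intro mk_Lam) auto
  have b: "mk t t \<in> Lam" using t by (intro mk_Lam) auto
  note n = norm_element Lam_simps(1)[OF norm_element(1)]
  have "w = (r \<odot>\<^bsub>A\<^esub> mk x0 y) \<oplus>\<^bsub>A\<^esub> (mk t t \<otimes>\<^bsub>A\<^esub> norm_element (Z_adjoin zm) (C p))"
  proof (rule e_eqI)
    show "(r \<odot>\<^bsub>A\<^esub> mk x0 y) \<oplus>\<^bsub>A\<^esub> (mk t t \<otimes>\<^bsub>A\<^esub> norm_element (Z_adjoin zm) (C p)) \<in> carrier A"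
      using a b n r Lam_simps by (auto intro!: A_add_closed A_smult_closed A_mult_closed)
  qed (use w a b n mk[of x0 y] mk[of t t] x0 y t in \<open>auto simp: e_mult algebra_simps\<close>)
  then show "w \<in> Sw r" using a b Sw_eq[OF r] by blast
qed

lemma Sw_one: "Sw 1 = Lam"
  by (auto simp: Sw_iff Lam_iff)

text \<open>Where r is invertible at P, the Swan module and \<Lambda> agree locally. Where it is
  not, p is invertible at P, the gluing condition disappears, and (1, r) is a local
  generator.\<close>

lemma locally_free_Sw:
  assumes r: "unit_mod_p r"
  shows "locally_free (Z_adjoin zm) A Lam 1 (singletons (Sw r))"
proof (rule locally_free_rank_one[OF subalg_Lam])
  have rR: "r \<in> R" using r by (simp add: unit_mod_p_def)
  have r0: "r \<noteq> 0" by (rule unit_mod_p_nonzero[OF r])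
  let ?n = "norm_element (Z_adjoin zm) (C p)"
  note n = norm_element Lam_simps(1)[OF norm_element(1)]
  show "Sw r \<subseteq> carrier A" using Sw_iff[OF rR] by blast
  show "\<zero>\<^bsub>A\<^esub> \<in> Sw r" using Sw_iff[OF rR] by (auto simp: A_zero_closed intro!: bexI[of _ 0])
  show "a \<oplus>\<^bsub>A\<^esub> b \<in> Sw r" if ab: "a \<in> Sw r" "b \<in> Sw r" for a b
  proof -
    obtain y y' where y: "a \<in> carrier A" "b \<in> carrier A" "e1 a \<in> R" "e1 b \<in> R" "y \<in> S" "y' \<in> S" "e2 a = r * y" "e2 b = r * y'"
      "dvd_in S \<pi> (e1 a - r * y)" "dvd_in S \<pi> (e1 b - r * y')" using ab Sw_iff[OF rR] by blast
    have "dvd_in S \<pi> (e1 a + e1 b - r * (y + y'))" using S.dvd_in_add[OF y(9,10)] by (simp add: algebra_simps)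
    then show ?thesis unfolding Sw_iff[OF rR] using y
      by (auto simp: A_add_closed algebra_simps intro!: bexI[of _ "y + y'"])
  qed
  show "a \<otimes>\<^bsub>A\<^esub> b \<in> Sw r" if a: "a \<in> Lam" and b: "b \<in> Sw r" for a b
  proof -
    obtain y where y: "b \<in> carrier A" "e1 b \<in> R" "y \<in> S" "e2 b = r * y"
      "dvd_in S \<pi> (e1 b - r * y)" using b Sw_iff[OF rR] by blast
    have "dvd_in S \<pi> (e1 a * e1 b - e2 a * (r * y))"
      by (rule S.dvd_in_mult_cong) (use a y Lam_simps rR in auto)
    then show ?thesis unfolding Sw_iff[OF rR] using y Lam_simps[OF a]
      by (auto simp: A_mult_closed e_mult algebra_simps intro!: bexI[of _ "e2 a * y"])
  qed
  show "finite {r \<odot>\<^bsub>A\<^esub> \<one>\<^bsub>A\<^esub>, ?n}" by simp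
  show "{r \<odot>\<^bsub>A\<^esub> \<one>\<^bsub>A\<^esub>, ?n} \<subseteq> Sw r"
  proof -
    have "?n \<in> Sw r" unfolding Sw_iff[OF rR] using n pi_dvd_p by (auto intro!: bexI[of _ 0])
    moreover have "r \<odot>\<^bsub>A\<^esub> \<one>\<^bsub>A\<^esub> \<in> Sw r" unfolding Sw_iff[OF rR] using rR
      by (auto simp: A_smult_closed A_one_closed intro!: bexI[of _ 1])
    ultimately show ?thesis by simp
  qed
  fix N assume N: "{r \<odot>\<^bsub>A\<^esub> \<one>\<^bsub>A\<^esub>, ?n} \<subseteq> N" "\<And>a b. a \<in> N \<Longrightarrow> b \<in> N \<Longrightarrow> a \<oplus>\<^bsub>A\<^esub> b \<in> N"
    "\<And>a b. a \<in> Lam \<Longrightarrow> b \<in> N \<Longrightarrow> a \<otimes>\<^bsub>A\<^esub> b \<in> N"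
  show "Sw r \<subseteq> N"
  proof
    fix w assume "w \<in> Sw r"
    then obtain a b where ab: "a \<in> Lam" "b \<in> Lam" "w = (r \<odot>\<^bsub>A\<^esub> a) \<oplus>\<^bsub>A\<^esub> (b \<otimes>\<^bsub>A\<^esub> ?n)" using Sw_eq[OF rR] by auto
    have "r \<odot>\<^bsub>A\<^esub> a = a \<otimes>\<^bsub>A\<^esub> (r \<odot>\<^bsub>A\<^esub> \<one>\<^bsub>A\<^esub>)"
      using ab rR Lam_simps by (intro e_eqI) (auto simp: A_smult_closed A_mult_closed A_one_closed e_mult)
    then show "w \<in> N" using ab N by auto
  qed
next
  have rR: "r \<in> R" using r by (simp add: unit_mod_p_def)
  have r0: "r \<noteq> 0" by (rule unit_mod_p_nonzero[OF r])
  fix P assume P: "maximalideal P (Z_adjoin zm)"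
  note PP = maximalideal_Z_adjoin[OF P]
  show "\<exists>g\<in>carrier A. e1 g \<noteq> 0 \<and> e2 g \<noteq> 0 \<and>
        (\<forall>a\<in>carrier A. (\<exists>s\<in>R - P. s \<odot>\<^bsub>A\<^esub> (g \<otimes>\<^bsub>A\<^esub> a) \<in> Sw r) \<longleftrightarrow> (\<exists>s\<in>R - P. s \<odot>\<^bsub>A\<^esub> a \<in> Lam))"
  proof (cases "r \<in> P")
    case False
    have "(\<exists>s\<in>R - P. s \<odot>\<^bsub>A\<^esub> a \<in> Sw r) \<longleftrightarrow> (\<exists>s\<in>R - P. s \<odot>\<^bsub>A\<^esub> a \<in> Lam)" if a: "a \<in> carrier A" for a
    proof
      assume "\<exists>s\<in>R - P. s \<odot>\<^bsub>A\<^esub> a \<in> Sw r"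
      moreover have "Sw r \<subseteq> Lam" using Sw_iff[OF rR] Lam_iff rR by auto
      ultimately show "\<exists>s\<in>R - P. s \<odot>\<^bsub>A\<^esub> a \<in> Lam" by blast
    next
      assume "\<exists>s\<in>R - P. s \<odot>\<^bsub>A\<^esub> a \<in> Lam"
      then obtain s where s: "s \<in> R" "s \<notin> P" "s \<odot>\<^bsub>A\<^esub> a \<in> Lam" by blast
      note l = Lam_simps[OF s(3)]
      have "dvd_in S \<pi> (r * (s * e1 a - s * e2 a))" using l rR by (intro S.dvd_in_mult') auto
      then have "(r * s) \<odot>\<^bsub>A\<^esub> a \<in> Sw r" unfolding Sw_iff[OF rR] using l rR s a R.mult_in[OF rR, of "s * e1 a"]
        by (auto simp: A_smult_closed algebra_simps intro!: bexI[of _ "s * e2 a"])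
      moreover have "r * s \<in> R - P" using PP(3)[of r s] False s rR by auto
      ultimately show "\<exists>s\<in>R - P. s \<odot>\<^bsub>A\<^esub> a \<in> Sw r" by blast
    qed
    then show ?thesis by (intro bexI[of _ "\<one>\<^bsub>A\<^esub>"]) (auto simp: A_one_closed)
  next
    case True
    have pP: "pc \<notin> P"
    proof
      assume pP: "pc \<in> P"
      obtain u t where u: "u \<in> R" "t \<in> R" "u * r - 1 = pc * t" using r by (auto simp: unit_mod_p_def dvd_in_def)
      have "u * r + (- t) * pc \<in> P" by (intro PP(4) PP(5)) (use u True pP in auto)
      moreover have "u * r + (- t) * pc = 1" using u(3) by (simp add: algebra_simps)
      ultimately show False using PP(2) by simp
    qed
    let ?g = "mk 1 r"
    have g: "?g \<in> carrier A" "e1 ?g = 1" "e2 ?g = r" using mk[of 1 r] rR by auto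
    have "(\<exists>s\<in>R - P. s \<odot>\<^bsub>A\<^esub> (?g \<otimes>\<^bsub>A\<^esub> a) \<in> Sw r) \<longleftrightarrow> (\<exists>s\<in>R - P. s \<odot>\<^bsub>A\<^esub> a \<in> Lam)" if a: "a \<in> carrier A" for a
    proof
      assume "\<exists>s\<in>R - P. s \<odot>\<^bsub>A\<^esub> (?g \<otimes>\<^bsub>A\<^esub> a) \<in> Sw r"
      then obtain s y where s: "s \<in> R" "s \<notin> P" "s * e1 a \<in> R" "y \<in> S" "s * (r * e2 a) = r * y"
        unfolding Sw_iff[OF rR] using a g by (auto simp: e_mult)
      then have y: "s * e2 a \<in> S" using r0 by simp
      \<comment> \<open>The factor p makes every congruence modulo \<pi> true, and it is a
        legitimate denominator because P does not contain it.\<close>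
      have "dvd_in S \<pi> (pc * (s * e1 a - s * e2 a))" using s y by (intro S.dvd_in_mult[OF pi_dvd_p]) auto
      then have "(pc * s) \<odot>\<^bsub>A\<^esub> a \<in> Lam" unfolding Lam_iff
        using s y a R.mult_in[OF R.of_nat_in s(3), of p] S.mult_in[OF S.of_nat_in y, of p]
        by (auto simp: A_smult_closed algebra_simps)
      moreover have "pc * s \<in> R - P" using PP(3)[of pc s] pP s by auto
      ultimately show "\<exists>s\<in>R - P. s \<odot>\<^bsub>A\<^esub> a \<in> Lam" by blast
    next
      assume "\<exists>s\<in>R - P. s \<odot>\<^bsub>A\<^esub> a \<in> Lam"
      then obtain s where s: "s \<in> R" "s \<notin> P" "s \<odot>\<^bsub>A\<^esub> a \<in> Lam" by blast
      note l = Lam_simps[OF s(3), simplified]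
      have "dvd_in S \<pi> (pc * (s * e1 a - r * (s * e2 a)))" using s l rR by (intro S.dvd_in_mult[OF pi_dvd_p]) auto
      then have "(pc * s) \<odot>\<^bsub>A\<^esub> (?g \<otimes>\<^bsub>A\<^esub> a) \<in> Sw r" unfolding Sw_iff[OF rR]
        using l rR s a g R.mult_in[OF R.of_nat_in l(2), of p] S.mult_in[OF S.of_nat_in l(3), of p]
        by (auto simp: A_smult_closed A_mult_closed e_mult algebra_simps intro!: bexI[of _ "pc * (s * e2 a)"])
      moreover have "pc * s \<in> R - P" using PP(3)[of pc s] pP s by auto
      ultimately show "\<exists>s\<in>R - P. s \<odot>\<^bsub>A\<^esub> (?g \<otimes>\<^bsub>A\<^esub> a) \<in> Sw r" by blast
    qed
    then show ?thesis using g r0 by (intro bexI[of _ ?g]) auto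
  qed
qed

end

no_notation Formal_Power_Series.fps_nth (infixl "$" 75)

section \<open>Matrices over subrings\<close>

definition entries_in :: "complex set \<Rightarrow> complex mat \<Rightarrow> bool"
  where "entries_in B M \<longleftrightarrow> (\<forall>i<dim_row M. \<forall>j<dim_col M. M $$ (i, j) \<in> B)"

lemma entries_inD: "entries_in B M \<Longrightarrow> M \<in> carrier_mat n k \<Longrightarrow> i < n \<Longrightarrow> j < k \<Longrightarrow> M $$ (i, j) \<in> B"
  by (auto simp: entries_in_def)

lemma entries_in_mono: "entries_in B M \<Longrightarrow> B \<subseteq> B' \<Longrightarrow> entries_in B' M"
  by (auto simp: entries_in_def)

lemma mult_mat_entry:
  assumes "M \<in> carrier_mat n k" "N \<in> carrier_mat k l" "i < n" "j < l"
  shows "(M * N) $$ (i, j) = (\<Sum>t<k. M $$ (i, t) * N $$ (t, j))"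
  using assms by (simp add: scalar_prod_def atLeast0LessThan)

lemma mult_vec_entry:
  assumes "M \<in> carrier_mat n k" "v \<in> carrier_vec k" "i < n"
  shows "(M *\<^sub>v v) $ i = (\<Sum>t<k. M $$ (i, t) * v $ t)"
  using assms by (simp add: scalar_prod_def atLeast0LessThan)

context complex_subring
begin

lemma entries_in_mult:
  assumes "entries_in B M" "entries_in B N" "M \<in> carrier_mat n k" "N \<in> carrier_mat k l"
  shows "entries_in B (M * N)"
  unfolding entries_in_def
proof (intro allI impI)
  fix i j assume "i < dim_row (M * N)" "j < dim_col (M * N)"
  then have ij: "i < n" "j < l" using assms by auto
  show "(M * N) $$ (i, j) \<in> B"
    unfolding mult_mat_entry[OF assms(3,4) ij]
    by (intro sum_in mult_in) (use assms ij in \<open>auto intro: entries_inD\<close>)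
qed

lemma mult_vec_in:
  assumes "entries_in B M" "M \<in> carrier_mat n k" "v \<in> carrier_vec k" "\<forall>j<k. v $ j \<in> B" "i < n"
  shows "(M *\<^sub>v v) $ i \<in> B"
  unfolding mult_vec_entry[OF assms(2,3,5)]
  by (intro sum_in mult_in) (use assms in \<open>auto intro: entries_inD\<close>)

lemma det_in:
  assumes "entries_in B M" "M \<in> carrier_mat n n" shows "det M \<in> B"
  unfolding det_def'[OF assms(2)]
proof (intro sum_in mult_in prod_in)
  fix q i assume q: "q \<in> {q. q permutes {0..<n}}" and i: "i \<in> {0..<n}"
  then have "q i < n" by (metis atLeastLessThan_iff mem_Collect_eq permutes_in_image)
  then show "M $$ (i, q i) \<in> B" using assms i by (auto intro: entries_inD)
qed auto

lemma det_cong: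
  assumes "entries_in B M" "M \<in> carrier_mat n n" "entries_in B N" "N \<in> carrier_mat n n"
    and "\<And>i j. i < n \<Longrightarrow> j < n \<Longrightarrow> dvd_in B a (M $$ (i, j) - N $$ (i, j))"
  shows "dvd_in B a (det M - det N)"
proof -
  have "det M - det N = (\<Sum>q\<in>{q. q permutes {0..<n}}.
      signof q * ((\<Prod>i = 0..<n. M $$ (i, q i)) - (\<Prod>i = 0..<n. N $$ (i, q i))))"
    unfolding det_def'[OF assms(2)] det_def'[OF assms(4)] by (simp add: sum_subtractf algebra_simps)
  also have "dvd_in B a \<dots>"
  proof (intro dvd_in_sum dvd_in_mult' dvd_in_prod_cong)
    fix q i assume q: "q \<in> {q. q permutes {0..<n}}" and i: "i \<in> {0..<n}"
    then have "q i < n" by (metis atLeastLessThan_iff mem_Collect_eq permutes_in_image)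
    then show "dvd_in B a (M $$ (i, q i) - N $$ (i, q i))" "M $$ (i, q i) \<in> B" "N $$ (i, q i) \<in> B"
      using assms i by (auto intro: entries_inD)
  qed auto
  finally show ?thesis .
qed

text \<open>For determinant 1 the adjugate is the inverse, so inverses stay over the same
  subring.\<close>

lemma adj_mat_in:
  assumes "entries_in B M" "M \<in> carrier_mat n n" shows "entries_in B (adj_mat M)"
  unfolding entries_in_def
proof (intro allI impI)
  fix i j assume "i < dim_row (adj_mat M)" "j < dim_col (adj_mat M)"
  then have ij: "i < n" "j < n" using adj_mat(1)[OF assms(2)] by auto
  have md: "mat_delete M j i \<in> carrier_mat (n - 1) (n - 1)" using assms(2) by (simp add: mat_delete_def)
  have "entries_in B (mat_delete M j i)"
    using assms ij by (auto simp: entries_in_def mat_delete_def)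
  then have "det (mat_delete M j i) \<in> B" using det_in md by blast
  then show "adj_mat M $$ (i, j) \<in> B" using assms ij by (simp add: adj_mat_def cofactor_def)
qed

end

section \<open>Pairs of lattices glued modulo \<open>\<pi>\<close>\<close>

context cyclotomic_pair
begin

definition mcong :: "nat \<Rightarrow> complex mat \<Rightarrow> complex mat \<Rightarrow> bool"
  where "mcong n M N \<longleftrightarrow> (\<forall>i<n. \<forall>j<n. dvd_in S \<pi> (M $$ (i, j) - N $$ (i, j)))"

definition vcong :: "nat \<Rightarrow> complex vec \<Rightarrow> complex vec \<Rightarrow> bool"
  where "vcong n v w \<longleftrightarrow> (\<forall>i<n. dvd_in S \<pi> (v $ i - w $ i))"

lemma mcong_sym: "mcong n M N \<Longrightarrow> mcong n N M"
  by (auto simp: mcong_def intro: S.dvd_in_diff_sym)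

lemma mcong_trans: "mcong n M N \<Longrightarrow> mcong n N P \<Longrightarrow> mcong n M P"
  unfolding mcong_def using S.dvd_in_diff_trans by blast

lemma vcong_trans: "vcong n u v \<Longrightarrow> vcong n v w \<Longrightarrow> vcong n u w"
  unfolding vcong_def using S.dvd_in_diff_trans by blast

lemma mcong_mult_left:
  assumes "mcong n M N" "entries_in S P" "P \<in> carrier_mat n n" "M \<in> carrier_mat n n" "N \<in> carrier_mat n n"
  shows "mcong n (P * M) (P * N)"
  unfolding mcong_def
proof (intro allI impI)
  fix i j assume ij: "i < n" "j < n"
  have "(P * M) $$ (i, j) - (P * N) $$ (i, j) = (\<Sum>t<n. P $$ (i, t) * (M $$ (t, j) - N $$ (t, j)))"
    unfolding mult_mat_entry[OF assms(3,4) ij] mult_mat_entry[OF assms(3,5) ij]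
    by (simp add: sum_subtractf algebra_simps)
  then show "dvd_in S \<pi> ((P * M) $$ (i, j) - (P * N) $$ (i, j))"
    using assms ij entries_inD[OF assms(2,3)]
    by (auto simp: mcong_def intro!: S.dvd_in_sum S.dvd_in_mult')
qed

lemma mcong_mult_right:
  assumes "mcong n M N" "entries_in S P" "P \<in> carrier_mat n n" "M \<in> carrier_mat n n" "N \<in> carrier_mat n n"
  shows "mcong n (M * P) (N * P)"
  unfolding mcong_def
proof (intro allI impI)
  fix i j assume ij: "i < n" "j < n"
  have "(M * P) $$ (i, j) - (N * P) $$ (i, j) = (\<Sum>t<n. (M $$ (i, t) - N $$ (i, t)) * P $$ (t, j))"
    unfolding mult_mat_entry[OF assms(4,3) ij] mult_mat_entry[OF assms(5,3) ij]
    by (simp add: sum_subtractf algebra_simps)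
  then show "dvd_in S \<pi> ((M * P) $$ (i, j) - (N * P) $$ (i, j))"
    using assms ij entries_inD[OF assms(2,3)]
    by (auto simp: mcong_def intro!: S.dvd_in_sum S.dvd_in_mult)
qed

lemma mcong_mult_vec:
  assumes "mcong n M N" "M \<in> carrier_mat n n" "N \<in> carrier_mat n n" "v \<in> carrier_vec n" "\<forall>i<n. v $ i \<in> S"
  shows "vcong n (M *\<^sub>v v) (N *\<^sub>v v)"
  unfolding vcong_def
proof (intro allI impI)
  fix i assume i: "i < n"
  have "(M *\<^sub>v v) $ i - (N *\<^sub>v v) $ i = (\<Sum>t<n. (M $$ (i, t) - N $$ (i, t)) * v $ t)"
    unfolding mult_vec_entry[OF assms(2,4) i] mult_vec_entry[OF assms(3,4) i]
    by (simp add: sum_subtractf algebra_simps)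
  then show "dvd_in S \<pi> ((M *\<^sub>v v) $ i - (N *\<^sub>v v) $ i)"
    using assms i by (auto simp: mcong_def intro!: S.dvd_in_sum S.dvd_in_mult)
qed

lemma vcong_mult_mat:
  assumes "vcong n v w" "entries_in S P" "P \<in> carrier_mat k n" "v \<in> carrier_vec n" "w \<in> carrier_vec n"
  shows "vcong k (P *\<^sub>v v) (P *\<^sub>v w)"
  unfolding vcong_def
proof (intro allI impI)
  fix i assume i: "i < k"
  have "(P *\<^sub>v v) $ i - (P *\<^sub>v w) $ i = (\<Sum>t<n. P $$ (i, t) * (v $ t - w $ t))"
    unfolding mult_vec_entry[OF assms(3,4) i] mult_vec_entry[OF assms(3,5) i]
    by (simp add: sum_subtractf algebra_simps)
  then show "dvd_in S \<pi> ((P *\<^sub>v v) $ i - (P *\<^sub>v w) $ i)"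
    using assms i entries_inD[OF assms(2,3)] by (auto simp: vcong_def intro!: S.dvd_in_sum S.dvd_in_mult')
qed

text \<open>The Swan module of r with its second component divided by r; see
  \<open>Sw_miso_G1\<close>. The regular module is the case r = 1.\<close>

definition G1 :: "complex \<Rightarrow> (int \<Rightarrow> complex, complex \<times> complex) module"
  where "G1 r = \<lparr>carrier = {(x, y). x \<in> R \<and> y \<in> S \<and> dvd_in S \<pi> (x - r * y)},
    monoid.mult = undefined, monoid.one = undefined, ring.zero = (0, 0),
    ring.add = (\<lambda>(x, y) (x', y'). (x + x', y + y')),
    module.smult = (\<lambda>a (x, y). (e1 a * x, e2 a * y))\<rparr>"

lemma G1_simps [simp]:
  "(x, y) \<in> carrier (G1 r) \<longleftrightarrow> x \<in> R \<and> y \<in> S \<and> dvd_in S \<pi> (x - r * y)"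
  "(x, y) \<oplus>\<^bsub>G1 r\<^esub> (x', y') = (x + x', y + y')"
  "a \<odot>\<^bsub>G1 r\<^esub> (x, y) = (e1 a * x, e2 a * y)"
  by (simp_all add: G1_def)

text \<open>Milnor patching of free modules over R and S along a matrix over the residue ring S /
  \<pi> S. As R maps onto that ring, matrices over R represent all of them.\<close>

definition glue :: "nat \<Rightarrow> complex mat \<Rightarrow> (int \<Rightarrow> complex, complex vec \<times> complex vec) module"
  where "glue n G = \<lparr>carrier = {(x, y). x \<in> carrier_vec n \<and> (\<forall>i<n. x $ i \<in> R) \<and>
      y \<in> carrier_vec n \<and> (\<forall>i<n. y $ i \<in> S) \<and> vcong n x (G *\<^sub>v y)},
    monoid.mult = undefined, monoid.one = undefined, ring.zero = (0\<^sub>v n, 0\<^sub>v n),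
    ring.add = (\<lambda>(x, y) (x', y'). (x + x', y + y')),
    module.smult = (\<lambda>a (x, y). (e1 a \<cdot>\<^sub>v x, e2 a \<cdot>\<^sub>v y))\<rparr>"

lemma glue_simps [simp]:
  "(x, y) \<in> carrier (glue n G) \<longleftrightarrow> x \<in> carrier_vec n \<and> (\<forall>i<n. x $ i \<in> R) \<and>
      y \<in> carrier_vec n \<and> (\<forall>i<n. y $ i \<in> S) \<and> vcong n x (G *\<^sub>v y)"
  "(x, y) \<oplus>\<^bsub>glue n G\<^esub> (x', y') = (x + x', y + y')"
  "a \<odot>\<^bsub>glue n G\<^esub> (x, y) = (e1 a \<cdot>\<^sub>v x, e2 a \<cdot>\<^sub>v y)"
  by (simp_all add: glue_def)

lemma closed_G1: "r \<in> R \<Longrightarrow> closed_module \<Lambda> (G1 r)"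
  unfolding closed_module_def
proof (intro conjI ballI)
  assume r: "r \<in> R"
  fix m m' assume "m \<in> carrier (G1 r)" "m' \<in> carrier (G1 r)"
  then obtain x y x' y' where m: "m = (x, y)" "x \<in> R" "y \<in> S" "dvd_in S \<pi> (x - r * y)"
    "m' = (x', y')" "x' \<in> R" "y' \<in> S" "dvd_in S \<pi> (x' - r * y')" by (cases m; cases m') auto
  then show "m \<oplus>\<^bsub>G1 r\<^esub> m' \<in> carrier (G1 r)"
    using S.dvd_in_add[OF m(4,8)] by (simp add: algebra_simps)
next
  assume r: "r \<in> R"
  fix a m assume a: "a \<in> carrier \<Lambda>" and "m \<in> carrier (G1 r)"
  then obtain x y where m: "m = (x, y)" "x \<in> R" "y \<in> S" "dvd_in S \<pi> (x - r * y)" by (cases m) auto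
  have "dvd_in S \<pi> (e1 a * x - e2 a * (r * y))"
    by (rule S.dvd_in_mult_cong) (use a m Lam_simps r in auto)
  then show "a \<odot>\<^bsub>G1 r\<^esub> m \<in> carrier (G1 r)"
    using a m Lam_simps by (simp add: mult.left_commute)
qed

lemma closed_glue: 
  assumes G: "G \<in> carrier_mat n n" "entries_in R G"
  shows "closed_module \<Lambda> (glue n G)"
  unfolding closed_module_def
proof (intro conjI ballI)
  have GS: "entries_in S G" using entries_in_mono[OF G(2) R_subset_S] .
  {
  fix m m' assume "m \<in> carrier (glue n G)" "m' \<in> carrier (glue n G)"
  then obtain x y x' y' where m: "m = (x, y)" "x \<in> carrier_vec n" "\<forall>i<n. x $ i \<in> R" "y \<in> carrier_vec n" "\<forall>i<n. y $ i \<in> S"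
    "vcong n x (G *\<^sub>v y)" "m' = (x', y')" "x' \<in> carrier_vec n" "\<forall>i<n. x' $ i \<in> R" "y' \<in> carrier_vec n" "\<forall>i<n. y' $ i \<in> S"
    "vcong n x' (G *\<^sub>v y')" by (cases m; cases m') auto
  have "dvd_in S \<pi> ((x + x') $ i - (G *\<^sub>v (y + y')) $ i)" if i: "i < n" for i
    using m i G S.dvd_in_add[of \<pi> "x $ i - (G *\<^sub>v y) $ i" "x' $ i - (G *\<^sub>v y') $ i"]
    by (simp add: vcong_def mult_add_distrib_mat_vec[OF G(1) m(4,10)] algebra_simps del: index_mult_mat_vec)
  then show "m \<oplus>\<^bsub>glue n G\<^esub> m' \<in> carrier (glue n G)"
    using m by (simp add: vcong_def)
  next
  fix a m assume a: "a \<in> carrier \<Lambda>" and "m \<in> carrier (glue n G)"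
  then obtain x y where m: "m = (x, y)" "x \<in> carrier_vec n" "\<forall>i<n. x $ i \<in> R" "y \<in> carrier_vec n" "\<forall>i<n. y $ i \<in> S"
    "vcong n x (G *\<^sub>v y)" by (cases m) auto
  have "dvd_in S \<pi> ((e1 a \<cdot>\<^sub>v x) $ i - (G *\<^sub>v (e2 a \<cdot>\<^sub>v y)) $ i)" if i: "i < n" for i
  proof -
    have "dvd_in S \<pi> (e1 a * x $ i - e2 a * (G *\<^sub>v y) $ i)"
      by (rule S.dvd_in_mult_cong)
        (use a m i Lam_simps S.mult_vec_in[OF GS G(1) m(4,5) i] in \<open>auto simp: vcong_def simp del: index_mult_mat_vec\<close>)
    then show ?thesis using m i G by (simp add: mult_mat_vec[OF G(1) m(4)] del: index_mult_mat_vec)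
  qed
  then show "a \<odot>\<^bsub>glue n G\<^esub> m \<in> carrier (glue n G)"
    using m a Lam_simps by (simp add: vcong_def)
  }
qed

lemma Sw_miso_G1:
  assumes r: "r \<in> R" "r \<noteq> 0"
  shows "miso \<Lambda> (lattice_module A 1 (singletons (Sw r))) (G1 r)"
proof (rule misoI[of _ "\<lambda>v. (e1 (hd v), e2 (hd v) / r)" _ "\<lambda>(x, y). [mk x (r * y)]"])
  fix v assume "v \<in> carrier (lattice_module A 1 (singletons (Sw r)))"
  then obtain w where w: "v = [w]" "w \<in> Sw r" by auto
  then show "(e1 (hd v), e2 (hd v) / r) \<in> carrier (G1 r)" using r by (auto simp: Sw_iff)
  show "(case (e1 (hd v), e2 (hd v) / r) of (x, y) \<Rightarrow> [mk x (r * y)]) = v"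
    using w r mk_e by (auto simp: Sw_iff)
next
  fix m assume m: "m \<in> carrier (G1 r)"
  obtain x y where xy: "m = (x, y)" by (cases m)
  have "mk x (r * y) \<in> Sw r" using m xy r mk[of x "r * y"] by (auto simp: Sw_iff)
  then show "(case m of (x, y) \<Rightarrow> [mk x (r * y)]) \<in> carrier (lattice_module A 1 (singletons (Sw r)))" by (simp add: xy)
  show "(e1 (hd (case m of (x, y) \<Rightarrow> [mk x (r * y)])), e2 (hd (case m of (x, y) \<Rightarrow> [mk x (r * y)])) / r) = m"
    using m xy r mk[of x "r * y"] by auto
next
  fix v v' assume "v \<in> carrier (lattice_module A 1 (singletons (Sw r)))" "v' \<in> carrier (lattice_module A 1 (singletons (Sw r)))"
  then show "(e1 (hd (v \<oplus>\<^bsub>lattice_module A 1 (singletons (Sw r))\<^esub> v')), e2 (hd (v \<oplus>\<^bsub>lattice_module A 1 (singletons (Sw r))\<^esub> v')) / r)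
    = (e1 (hd v), e2 (hd v) / r) \<oplus>\<^bsub>G1 r\<^esub> (e1 (hd v'), e2 (hd v') / r)"
    by (auto simp: add_divide_distrib)
next
  fix a v assume a: "a \<in> carrier \<Lambda>" "v \<in> carrier (lattice_module A 1 (singletons (Sw r)))"
  then obtain w where w: "v = [w]" "w \<in> carrier A" using r by (auto simp: Sw_iff)
  then show "(e1 (hd (a \<odot>\<^bsub>lattice_module A 1 (singletons (Sw r))\<^esub> v)), e2 (hd (a \<odot>\<^bsub>lattice_module A 1 (singletons (Sw r))\<^esub> v)) / r)
    = a \<odot>\<^bsub>G1 r\<^esub> (e1 (hd v), e2 (hd v) / r)"
    using a Lam_simps(1)[of a] by (simp add: e_mult)
qed

lemma G1_one_miso_regular: "miso \<Lambda> (free_module \<Lambda> 1) (G1 1)"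
  using Sw_miso_G1[of 1] unfolding Sw_one free_module_rank_one by simp

text \<open>Multiplication by u on the second coordinates absorbs a unit of S, so the constant r
  matters only modulo \<pi> and up to such units.\<close>

lemma G1_miso_unit:
  assumes "r \<in> R" "s \<in> R" "u \<in> S" "v \<in> S" "u * v = 1" "dvd_in S \<pi> (r - s * u)"
  shows "miso \<Lambda> (G1 r) (G1 s)"
proof (rule misoI[of _ "\<lambda>(x, y). (x, u * y)" _ "\<lambda>(x, y). (x, v * y)"])
  fix m assume m: "m \<in> carrier (G1 r)"
  obtain x y where xy: "m = (x, y)" by (cases m)
  have eq: "x - s * (u * y) = (x - r * y) + (r - s * u) * y" by (simp add: algebra_simps)
  have "dvd_in S \<pi> (x - s * (u * y))"
    unfolding eq using m xy assms by (auto intro!: S.dvd_in_add S.dvd_in_mult)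
  then show "(case m of (x, y) \<Rightarrow> (x, u * y)) \<in> carrier (G1 s)" using m xy assms by simp
  show "(case case m of (x, y) \<Rightarrow> (x, u * y) of (x, y) \<Rightarrow> (x, v * y)) = m"
    using xy assms(5) by (simp add: mult.assoc[symmetric] mult.commute[of v u])
next
  fix m assume m: "m \<in> carrier (G1 s)"
  obtain x y where xy: "m = (x, y)" by (cases m)
  have eq: "x - r * (v * y) = (x - s * (u * v) * y) - (r - s * u) * (v * y)" by (simp add: algebra_simps)
  have "dvd_in S \<pi> (x - r * (v * y))"
    unfolding eq using m xy assms by (auto intro!: S.dvd_in_diff S.dvd_in_mult)
  then show "(case m of (x, y) \<Rightarrow> (x, v * y)) \<in> carrier (G1 r)" using m xy assms by simp
  show "(case case m of (x, y) \<Rightarrow> (x, v * y) of (x, y) \<Rightarrow> (x, u * y)) = m"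
    using xy assms(5) by (simp add: mult.assoc[symmetric])
qed (auto simp: algebra_simps)

text \<open>Whitehead's lemma: \<open>U diag(r, s) V\<close> with \<open>U = [[1, s'], [-s, 1 - s s']]\<close> and \<open>V = [[0, -1], [1, r]]\<close> is
  congruent to \<open>diag(1, r s)\<close> when \<open>s s' \<equiv> 1\<close>.\<close>

lemma G1_whitehead:
  assumes r: "r \<in> R" and s: "s \<in> R" "s' \<in> R" "dvd_in S \<pi> (s' * s - 1)"
  shows "miso \<Lambda> (direct_sum (G1 r) (G1 s)) (direct_sum (G1 1) (G1 (r * s)))"
proof -
  \<comment> \<open>\<open>U\<close> acts on the first coordinates and the inverse of
    \<open>V\<close> on the second: if x is congruent to D y, then U x is congruent to U D V applied
    to the new second coordinates. The map g uses the inverse matrices.\<close>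
  define f where "f = (\<lambda>((x, y), (x', y')). ((x + s' * x', r * y + y'), (- s * x + (1 - s * s') * x', - y)))"
  have f: "f ((x, y), (x', y')) = ((x + s' * x', r * y + y'), (- s * x + (1 - s * s') * x', - y))" for x y x' y'
    by (simp add: f_def)
  define g where "g = (\<lambda>((x, y), (x', y')). (((1 - s * s') * x - s' * x', - y'), (s * x + x', y + r * y')))"
  have g: "g ((x, y), (x', y')) = (((1 - s * s') * x - s' * x', - y'), (s * x + x', y + r * y'))" for x y x' y'
    by (simp add: g_def)
  show ?thesis
  proof (rule misoI[of _ f _ g])
  fix m assume m: "m \<in> carrier (direct_sum (G1 r) (G1 s))"
  obtain x y x' y' where xy: "m = ((x, y), (x', y'))" by (cases m) auto
  have in_S: "x \<in> R" "x' \<in> R" "y \<in> S" "y' \<in> S" and d: "dvd_in S \<pi> (x - r * y)" "dvd_in S \<pi> (x' - s * y')"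
    using m xy by auto
  have eq1: "x + s' * x' - 1 * (r * y + y') = (x - r * y) + s' * (x' - s * y') + (s' * s - 1) * y'"
    by (simp add: algebra_simps)
  have eq2: "- s * x + (1 - s * s') * x' - r * s * (- y) = - (s * (x - r * y)) - (s' * s - 1) * x'"
    by (simp add: algebra_simps)
  have "dvd_in S \<pi> (x + s' * x' - 1 * (r * y + y'))" "dvd_in S \<pi> (- s * x + (1 - s * s') * x' - r * s * (- y))"
    unfolding eq1 eq2
    by (intro S.dvd_in_add S.dvd_in_diff S.dvd_in_uminus d S.dvd_in_mult'[OF d(1)] S.dvd_in_mult'[OF d(2)] S.dvd_in_mult[OF s(3)];
      use in_S r s in simp)+
  then show "f m \<in> carrier (direct_sum (G1 1) (G1 (r * s)))"
    unfolding xy f g using in_S r s by simp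
  show "g (f m) = m"
    unfolding xy f g by (simp add: algebra_simps)
next
  fix m assume m: "m \<in> carrier (direct_sum (G1 1) (G1 (r * s)))"
  obtain x y x' y' where xy: "m = ((x, y), (x', y'))" by (cases m) auto
  have in_S: "x \<in> R" "x' \<in> R" "y \<in> S" "y' \<in> S" and d: "dvd_in S \<pi> (x - y)" "dvd_in S \<pi> (x' - r * s * y')"
    using m xy by auto
  have eq1: "(1 - s * s') * x - s' * x' - r * (- y') = - ((s' * s - 1) * x) - s' * (x' - r * s * y') - (s' * s - 1) * (r * y')"
    by (simp add: algebra_simps)
  have eq2: "s * x + x' - s * (y + r * y') = s * (x - y) + (x' - r * s * y')"
    by (simp add: algebra_simps)
  have "dvd_in S \<pi> ((1 - s * s') * x - s' * x' - r * (- y'))" "dvd_in S \<pi> (s * x + x' - s * (y + r * y'))"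
    unfolding eq1 eq2
    by (intro S.dvd_in_add S.dvd_in_diff S.dvd_in_uminus d S.dvd_in_mult'[OF d(1)] S.dvd_in_mult'[OF d(2)] S.dvd_in_mult[OF s(3)];
      use in_S r s in simp)+
  then show "g m \<in> carrier (direct_sum (G1 r) (G1 s))"
    unfolding xy f g using in_S r s by simp
  show "f (g m) = m"
    unfolding xy f g by (simp add: algebra_simps)
qed (auto simp: f g algebra_simps)
qed

text \<open>\<open>G1 1\<close> is \<Lambda> and is absorbed stably, so the sum of two classes
  corresponds to the product of the constants.\<close>

lemma G1_direct_sum_stably:
  assumes r: "r \<in> R" and s: "s \<in> R" "s' \<in> R" "dvd_in S \<pi> (s' * s - 1)"
  shows "stably_isomorphic \<Lambda> (direct_sum (G1 r) (G1 s)) (G1 (r * s))"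
proof -
  have cl: "closed_module \<Lambda> (free_module \<Lambda> 1)"
    by (intro closed_module_power) (auto simp: closed_module_def Lam_add Lam_mult)
  have "miso \<Lambda> (direct_sum (G1 r) (G1 s)) (direct_sum (G1 1) (G1 (r * s)))" by (rule G1_whitehead[OF assms])
  also have "miso \<Lambda> \<dots> (direct_sum (G1 (r * s)) (G1 1))" by (rule miso_comm)
  also have "miso \<Lambda> \<dots> (direct_sum (G1 (r * s)) (free_module \<Lambda> 1))"
    by (intro miso_direct_sum miso_refl miso_sym[OF G1_one_miso_regular cl])
  finally have "miso \<Lambda> (direct_sum (G1 r) (G1 s)) (direct_sum (G1 (r * s)) (free_module \<Lambda> 1))" .
  then show ?thesis using miso_imp_stably stably_absorb stably_trans by blast
qed

lemma free_miso_glue: "miso \<Lambda> (free_module \<Lambda> n) (glue n (1\<^sub>m n))"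
proof (rule misoI[of _ "\<lambda>l. (vec n (\<lambda>i. e1 (l ! i)), vec n (\<lambda>i. e2 (l ! i)))" _
      "\<lambda>(x, y). map (\<lambda>i. mk (x $ i) (y $ i)) [0..<n]"])
  fix l assume l: "l \<in> carrier (free_module \<Lambda> n)"
  then have ln: "length l = n" "\<And>i. i < n \<Longrightarrow> l ! i \<in> Lam" by (auto simp: subset_iff)
  then show "(vec n (\<lambda>i. e1 (l ! i)), vec n (\<lambda>i. e2 (l ! i))) \<in> carrier (glue n (1\<^sub>m n))"
    by (simp add: vcong_def Lam_simps)
  show "(case (vec n (\<lambda>i. e1 (l ! i)), vec n (\<lambda>i. e2 (l ! i))) of (x, y) \<Rightarrow> map (\<lambda>i. mk (x $ i) (y $ i)) [0..<n]) = l"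
    using ln by (auto intro!: nth_equalityI simp: mk_e Lam_simps(1))
next
  fix m assume "m \<in> carrier (glue n (1\<^sub>m n))"
  then obtain x y where m: "m = (x, y)" "x \<in> carrier_vec n" "\<forall>i<n. x $ i \<in> R" "y \<in> carrier_vec n" "\<forall>i<n. y $ i \<in> S"
    "vcong n x y" by (cases m) auto
  then have "mk (x $ i) (y $ i) \<in> Lam" if "i < n" for i using that by (intro mk_Lam) (auto simp: vcong_def)
  then show "(case m of (x, y) \<Rightarrow> map (\<lambda>i. mk (x $ i) (y $ i)) [0..<n]) \<in> carrier (free_module \<Lambda> n)"
    using m by auto
  show "(vec n (\<lambda>i. e1 ((case m of (x, y) \<Rightarrow> map (\<lambda>i. mk (x $ i) (y $ i)) [0..<n]) ! i)),
      vec n (\<lambda>i. e2 ((case m of (x, y) \<Rightarrow> map (\<lambda>i. mk (x $ i) (y $ i)) [0..<n]) ! i))) = m"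
    using m mk by auto
next
  fix l l' assume "l \<in> carrier (free_module \<Lambda> n)" "l' \<in> carrier (free_module \<Lambda> n)"
  then show "(vec n (\<lambda>i. e1 ((l \<oplus>\<^bsub>free_module \<Lambda> n\<^esub> l') ! i)), vec n (\<lambda>i. e2 ((l \<oplus>\<^bsub>free_module \<Lambda> n\<^esub> l') ! i))) =
    (vec n (\<lambda>i. e1 (l ! i)), vec n (\<lambda>i. e2 (l ! i))) \<oplus>\<^bsub>glue n (1\<^sub>m n)\<^esub> (vec n (\<lambda>i. e1 (l' ! i)), vec n (\<lambda>i. e2 (l' ! i)))"
    by (auto simp: regular_module_ops)
next
  fix a l assume a: "a \<in> carrier \<Lambda>" and l: "l \<in> carrier (free_module \<Lambda> n)"
  then have "length l = n" "\<And>i. i < n \<Longrightarrow> l ! i \<in> carrier A" "a \<in> carrier A" using Lam_subset by (auto simp: subset_iff)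
  then show "(vec n (\<lambda>i. e1 ((a \<odot>\<^bsub>free_module \<Lambda> n\<^esub> l) ! i)), vec n (\<lambda>i. e2 ((a \<odot>\<^bsub>free_module \<Lambda> n\<^esub> l) ! i))) =
    a \<odot>\<^bsub>glue n (1\<^sub>m n)\<^esub> (vec n (\<lambda>i. e1 (l ! i)), vec n (\<lambda>i. e2 (l ! i)))"
    by (auto simp: e_mult)
qed

end

context cyclotomic_pair
begin

subsection \<open>Reduction to a Swan module\<close>

text \<open>The block matrix with block rows (d, w) and (0, G).\<close>

definition bl :: "nat \<Rightarrow> complex \<Rightarrow> (nat \<Rightarrow> complex) \<Rightarrow> complex mat \<Rightarrow> complex mat"
  where "bl n d w G = mat (Suc n) (Suc n) (\<lambda>(i, j). if i = 0 then (if j = 0 then d else w (j - 1))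
    else if j = 0 then 0 else G $$ (i - 1, j - 1))"

lemma bl_carrier [simp]: "bl n d w G \<in> carrier_mat (Suc n) (Suc n)"
  by (simp add: bl_def)

lemma bl_simps [simp]:
  "bl n d w G $$ (0, 0) = d" "j < n \<Longrightarrow> bl n d w G $$ (0, Suc j) = w j"
  "i < n \<Longrightarrow> bl n d w G $$ (Suc i, 0) = 0" "i < n \<Longrightarrow> j < n \<Longrightarrow> bl n d w G $$ (Suc i, Suc j) = G $$ (i, j)"
  by (simp_all add: bl_def)

lemma det_bl:
  assumes "G \<in> carrier_mat n n" shows "det (bl n d w G) = d * det G"
proof -
  have "bl n d w G = four_block_mat (mat 1 1 (\<lambda>_. d)) (mat 1 n (\<lambda>(i, j). w j)) (0\<^sub>m n 1) G"
    using assms by (intro eq_matI) (auto simp: bl_def)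
  moreover have "det (mat 1 1 (\<lambda>_. d)) = d" by (subst det_single) auto
  ultimately show ?thesis
    using det_four_block_mat_lower_left_zero_col[of "mat 1 1 (\<lambda>_. d)" "mat 1 n (\<lambda>(i, j). w j)" n "0\<^sub>m n 1" G] assms
    by simp
qed

lemma bl_entries_in:
  assumes "d \<in> B" "0 \<in> B" "\<And>j. j < n \<Longrightarrow> w j \<in> B" "entries_in B G" "G \<in> carrier_mat n n"
  shows "entries_in B (bl n d w G)"
  using assms by (auto simp: entries_in_def bl_def)

lemma all_less_Suc_iff: "(\<forall>i<Suc n. P i) \<longleftrightarrow> P 0 \<and> (\<forall>i<n. P (Suc i))"
  using less_Suc_eq_0_disj by auto

lemma mcong_bl:
  "mcong (Suc n) M (bl n d w G) \<longleftrightarrow> dvd_in S \<pi> (M $$ (0, 0) - d) \<and> (\<forall>j<n. dvd_in S \<pi> (M $$ (0, Suc j) - w j))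
    \<and> (\<forall>i<n. dvd_in S \<pi> (M $$ (Suc i, 0)) \<and> (\<forall>j<n. dvd_in S \<pi> (M $$ (Suc i, Suc j) - G $$ (i, j))))"
  unfolding mcong_def all_less_Suc_iff by auto

lemma one_mat_entries_in: "complex_subring B \<Longrightarrow> entries_in B (1\<^sub>m n)"
  using complex_subring.zero_in complex_subring.one_in by (auto simp: entries_in_def)

text \<open>With w = 0 the first coordinates decouple from the others.\<close>

lemma glue_split:
  assumes G: "G \<in> carrier_mat n n"
  shows "miso \<Lambda> (glue (Suc n) (bl n d (\<lambda>_. 0) G)) (direct_sum (G1 d) (glue n G))"
proof -
  define hd' where "hd' v = v $ 0" for v :: "complex vec"
  define tl' where "tl' v = vec n (\<lambda>i. v $ Suc i)" for v :: "complex vec"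
  define cons' where "cons' a v = vec (Suc n) (\<lambda>i. if i = 0 then a else v $ (i - 1))" for a :: complex and v
  have cons: "cons' a v \<in> carrier_vec (Suc n)" "cons' a v $ 0 = a" "i < n \<Longrightarrow> cons' a v $ Suc i = v $ i" for a v i
    by (simp_all add: cons'_def)
  have tl: "tl' v \<in> carrier_vec n" "i < n \<Longrightarrow> tl' v $ i = v $ Suc i" for v i by (simp_all add: tl'_def)
  have cong: "vcong (Suc n) x (bl n d (\<lambda>_. 0) G *\<^sub>v y) \<longleftrightarrow>
      dvd_in S \<pi> (x $ 0 - d * y $ 0) \<and> vcong n (tl' x) (G *\<^sub>v tl' y)"
    if xy: "x \<in> carrier_vec (Suc n)" "y \<in> carrier_vec (Suc n)" for x y
  proof -
    have "(bl n d (\<lambda>_. 0) G *\<^sub>v y) $ 0 = d * y $ 0"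
      by (simp add: mult_vec_entry[OF bl_carrier xy(2)] sum.lessThan_Suc_shift del: sum.lessThan_Suc index_mult_mat_vec)
    moreover have "(bl n d (\<lambda>_. 0) G *\<^sub>v y) $ Suc i = (G *\<^sub>v tl' y) $ i" if "i < n" for i
      using that
      by (simp add: mult_vec_entry[OF bl_carrier xy(2)] mult_vec_entry[OF G tl(1)] sum.lessThan_Suc_shift tl(2)
          del: sum.lessThan_Suc index_mult_mat_vec)
    ultimately show ?thesis unfolding vcong_def all_less_Suc_iff by (simp add: tl del: index_mult_mat_vec)
  qed
  have tc: "tl' (cons' a v) = v" if "v \<in> carrier_vec n" for a v using that by (auto simp: tl cons tl'_def)
  have ct: "cons' (v $ 0) (tl' v) = v" if "v \<in> carrier_vec (Suc n)" for v
    using that by (intro eq_vecI) (auto simp: cons'_def tl'_def)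
  show ?thesis
  proof (rule misoI[of _ "\<lambda>(x, y). ((x $ 0, y $ 0), (tl' x, tl' y))" _ "\<lambda>((a, b), (x, y)). (cons' a x, cons' b y)"])
    fix m assume "m \<in> carrier (glue (Suc n) (bl n d (\<lambda>_. 0) G))"
    then obtain x y where m: "m = (x, y)" "x \<in> carrier_vec (Suc n)" "\<forall>i<Suc n. x $ i \<in> R"
      "y \<in> carrier_vec (Suc n)" "\<forall>i<Suc n. y $ i \<in> S" "vcong (Suc n) x (bl n d (\<lambda>_. 0) G *\<^sub>v y)"
      by (cases m) auto
    then show "(case m of (x, y) \<Rightarrow> ((x $ 0, y $ 0), (tl' x, tl' y))) \<in> carrier (direct_sum (G1 d) (glue n G))"
      by (simp add: cong tl)
    show "(case case m of (x, y) \<Rightarrow> ((x $ 0, y $ 0), (tl' x, tl' y)) of (ab, xy) \<Rightarrow>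
        (case ab of (a, b) \<Rightarrow> \<lambda>(x, y). (cons' a x, cons' b y)) xy) = m"
      using m by (simp add: ct)
  next
    fix m assume "m \<in> carrier (direct_sum (G1 d) (glue n G))"
    then obtain a b x y where m: "m = ((a, b), (x, y))" "a \<in> R" "b \<in> S" "dvd_in S \<pi> (a - d * b)"
      "x \<in> carrier_vec n" "\<forall>i<n. x $ i \<in> R" "y \<in> carrier_vec n" "\<forall>i<n. y $ i \<in> S" "vcong n x (G *\<^sub>v y)"
      by (cases m) auto
    then show "(case m of (ab, xy) \<Rightarrow> (case ab of (a, b) \<Rightarrow> \<lambda>(x, y). (cons' a x, cons' b y)) xy)
        \<in> carrier (glue (Suc n) (bl n d (\<lambda>_. 0) G))"
      by (simp add: cons cong tc all_less_Suc_iff)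
    show "(case (case m of (ab, xy) \<Rightarrow> (case ab of (a, b) \<Rightarrow> \<lambda>(x, y). (cons' a x, cons' b y)) xy) of
        (x, y) \<Rightarrow> ((x $ 0, y $ 0), (tl' x, tl' y))) = m"
      using m by (simp add: cons tc)
  qed (auto simp: tl'_def intro!: eq_vecI)
qed

text \<open>Modulo \<pi>, the relation x = G y implies U x = U G y = H (V y).\<close>

lemma glue_map:
  assumes M: "G \<in> carrier_mat n n" "H \<in> carrier_mat n n" "U \<in> carrier_mat n n" "V \<in> carrier_mat n n"
    and e: "entries_in R U" "entries_in S V" and c: "mcong n (U * G) (H * V)"
    and xy: "(x, y) \<in> carrier (glue n G)"
  shows "(U *\<^sub>v x, V *\<^sub>v y) \<in> carrier (glue n H)"
proof -
  have x: "x \<in> carrier_vec n" "\<forall>i<n. x $ i \<in> R" and y: "y \<in> carrier_vec n" "\<forall>i<n. y $ i \<in> S"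
    and d: "vcong n x (G *\<^sub>v y)" using xy by auto
  have "vcong n (U *\<^sub>v x) (U *\<^sub>v (G *\<^sub>v y))"
    by (rule vcong_mult_mat[OF d entries_in_mono[OF e(1) R_subset_S] M(3) x(1)]) (use M y in simp)
  moreover have "vcong n ((U * G) *\<^sub>v y) ((H * V) *\<^sub>v y)"
    by (rule mcong_mult_vec[OF c]) (use M y in auto)
  ultimately have "vcong n (U *\<^sub>v x) (H *\<^sub>v (V *\<^sub>v y))"
    using vcong_trans M y(1) by simp
  then show ?thesis
    using R.mult_vec_in[OF e(1) M(3) x] S.mult_vec_in[OF e(2) M(4) y] M x(1) y(1)
    by (simp del: index_mult_mat_vec)
qed

lemma glue_base_change:
  assumes M: "G \<in> carrier_mat n n" "H \<in> carrier_mat n n" "U \<in> carrier_mat n n" "V \<in> carrier_mat n n"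
    and e: "entries_in R U" "entries_in S V" and det: "det U = 1" "det V = 1" and c: "mcong n (U * G) (H * V)"
  shows "miso \<Lambda> (glue n G) (glue n H)"
proof -
  have one: "1 \<cdot>\<^sub>m 1\<^sub>m n = (1\<^sub>m n :: complex mat)" by (rule eq_matI) auto
  define U' where "U' = adj_mat U"
  define V' where "V' = adj_mat V"
  have U': "U' \<in> carrier_mat n n" "U * U' = 1\<^sub>m n" "U' * U = 1\<^sub>m n" "entries_in R U'"
    using adj_mat[OF M(3)] det R.adj_mat_in[OF e(1) M(3)] by (simp_all add: U'_def one)
  have V': "V' \<in> carrier_mat n n" "V * V' = 1\<^sub>m n" "V' * V = 1\<^sub>m n" "entries_in S V'"
    using adj_mat[OF M(4)] det S.adj_mat_in[OF e(2) M(4)] by (simp_all add: V'_def one)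
  \<comment> \<open>Multiplying the congruence by both inverse matrices interchanges the roles of G
    and H.\<close>
  have c': "mcong n (U' * H) (G * V')"
  proof -
    have "mcong n (U' * (U * G) * V') (U' * (H * V) * V')"
      by (intro mcong_mult_right mcong_mult_left c V' entries_in_mono[OF U'(4) R_subset_S] U') (use M U' V' in auto)
    moreover have "U' * (U * G) * V' = G * V'"
      using assoc_mult_mat[OF U'(1) M(3) M(1)] U' M by simp
    moreover have "U' * (H * V) * V' = U' * H"
      using assoc_mult_mat[OF _ M(4) V'(1), of "U' * H" n] assoc_mult_mat[OF U'(1) M(2) M(4)] U' V' M by simp
    ultimately show ?thesis using mcong_sym by simp
  qed
  show ?thesis
  proof (rule misoI[of _ "\<lambda>(x, y). (U *\<^sub>v x, V *\<^sub>v y)" _ "\<lambda>(x, y). (U' *\<^sub>v x, V' *\<^sub>v y)"])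
    fix m assume m: "m \<in> carrier (glue n G)"
    then show "(case m of (x, y) \<Rightarrow> (U *\<^sub>v x, V *\<^sub>v y)) \<in> carrier (glue n H)"
      using glue_map[OF M e c] by (cases m) auto
    show "(case case m of (x, y) \<Rightarrow> (U *\<^sub>v x, V *\<^sub>v y) of (x, y) \<Rightarrow> (U' *\<^sub>v x, V' *\<^sub>v y)) = m"
      using m assoc_mult_mat_vec[OF U'(1) M(3)] assoc_mult_mat_vec[OF V'(1) M(4)] U' V'
      by (cases m) (auto simp flip: assoc_mult_mat_vec)
  next
    fix m assume m: "m \<in> carrier (glue n H)"
    then show "(case m of (x, y) \<Rightarrow> (U' *\<^sub>v x, V' *\<^sub>v y)) \<in> carrier (glue n G)"
      using glue_map[OF M(2,1) U'(1) V'(1) U'(4) V'(4) c'] by (cases m) auto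
    show "(case case m of (x, y) \<Rightarrow> (U' *\<^sub>v x, V' *\<^sub>v y) of (x, y) \<Rightarrow> (U *\<^sub>v x, V *\<^sub>v y)) = m"
      using m assoc_mult_mat_vec[OF M(3) U'(1)] assoc_mult_mat_vec[OF M(4) V'(1)] U' V'
      by (cases m) (auto simp flip: assoc_mult_mat_vec)
  qed (auto simp: mult_add_distrib_mat_vec[OF M(3)] mult_add_distrib_mat_vec[OF M(4)]
      mult_mat_vec[OF M(3)] mult_mat_vec[OF M(4)] simp del: index_mult_mat_vec)
qed

text \<open>Since \<open>a ^ N \<equiv> a\<close>, the element \<open>e = a ^ (N - 1)\<close> is idempotent modulo \<open>p\<close> and the ideal generated by \<open>a\<close>
  and \<open>b\<close> is generated by \<open>a + (1 - e) b\<close>.\<close>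

lemma bezout_mod_p:
  assumes "a \<in> R" "b \<in> R"
  shows "\<exists>t\<in>R. \<exists>c\<in>R. dvd_in R pc (b - c * (a + t * b))"
proof -
  obtain N where N: "N > 1" "\<And>y. y \<in> R \<Longrightarrow> dvd_in R pc (y ^ N - y)" using frobenius_R by blast
  define k where "k = N - 2"
  have Nk: "N = Suc (Suc k)" using N(1) by (simp add: k_def)
  obtain w where w: "w \<in> R" "a ^ Suc (Suc k) - a = pc * w" using N(2)[OF assms(1)] by (auto simp: dvd_in_def Nk)
  define e where "e = a * a ^ k"
  have e: "e \<in> R" using assms by (simp add: e_def)
  have ae: "a * e = a + pc * w" using w(2) by (simp add: e_def algebra_simps)
  have ee: "e * e = e + pc * (w * a ^ k)"
  proof -
    have "e * e = (a * e) * a ^ k" by (simp add: e_def)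
    also have "\<dots> = e + pc * (w * a ^ k)" unfolding ae by (simp add: e_def algebra_simps)
    finally show ?thesis .
  qed
  \<comment> \<open>Modulo p the ring splits along e. On the part of 1 - e the generator a + (1 - e)
    * b is b, so the multiplier is 1. On the part of e the generator is a with inverse a ^ k, so the
    multiplier is a ^ k * b.\<close>
  define c where "c = (1 - e) + e * a ^ k * b"
  have c: "c \<in> R" using e assms by (simp add: c_def)
  have a_e: "a * a ^ k = e" by (simp add: e_def)
  have "c * (a + (1 - e) * b) =
      a - a * e + (1 - (e + e) + e * e) * b + e * (a * a ^ k) * b + (e - e * e) * (a ^ k * b * b)"
    unfolding c_def by (simp add: algebra_simps)
  also have "\<dots> = b + pc * (- w + (w * a ^ k) * b + (w * a ^ k) * b - (w * a ^ k) * (a ^ k * b * b))"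
    unfolding a_e ae ee by (simp add: algebra_simps)
  finally have "b - c * (a + (1 - e) * b) = pc * (- (- w + (w * a ^ k) * b + (w * a ^ k) * b - (w * a ^ k) * (a ^ k * b * b)))"
    by (simp add: algebra_simps)
  moreover have "- (- w + (w * a ^ k) * b + (w * a ^ k) * b - (w * a ^ k) * (a ^ k * b * b)) \<in> R"
    by (intro R.add_in R.mult_in R.uminus_in R.diff_in R.power_in w assms)
  ultimately have "dvd_in R pc (b - c * (a + (1 - e) * b))" by (auto simp: dvd_in_def)
  then show ?thesis using c e by (intro bexI[of _ "1 - e"] bexI[of _ c]) auto
qed

lemma addrow_mat_entries_in: "complex_subring B \<Longrightarrow> a \<in> B \<Longrightarrow> entries_in B (addrow_mat n a k l)"
  using complex_subring.zero_in[of B] complex_subring.one_in[of B] complex_subring.add_in[of B]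
  by (auto simp: entries_in_def)

text \<open>For each entry b below the corner a, the row operation giving a + t * b makes the corner
  generate both modulo p; subtracting c times it then removes b. Only row 0 and the treated row
  change, so earlier zeros persist.\<close>

lemma clear_column:
  assumes G: "G \<in> carrier_mat (Suc n) (Suc n)" "entries_in R G"
  shows "k \<le> n \<Longrightarrow> \<exists>U\<in>carrier_mat (Suc n) (Suc n). entries_in R U \<and> det U = 1 \<and>
    (\<forall>i<k. dvd_in R pc ((U * G) $$ (Suc i, 0)))"
proof (induction k)
  case 0
  show ?case by (rule bexI[of _ "1\<^sub>m (Suc n)"]) (auto intro: one_mat_entries_in ZZ_ring)
next
  case (Suc k)
  then obtain U where U: "U \<in> carrier_mat (Suc n) (Suc n)" "entries_in R U" "det U = 1"
    "\<forall>i<k. dvd_in R pc ((U * G) $$ (Suc i, 0))" by auto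
  have k: "Suc k < Suc n" using Suc.prems by simp
  define M where "M = U * G"
  have M: "M \<in> carrier_mat (Suc n) (Suc n)" "entries_in R M"
    using U G R.entries_in_mult[OF U(2) G(2) U(1) G(1)] by (simp_all add: M_def)
  define a where "a = M $$ (0, 0)"
  define b where "b = M $$ (Suc k, 0)"
  have "a \<in> R" "b \<in> R" using M k by (auto simp: a_def b_def intro: entries_inD)
  then obtain t c where tc: "t \<in> R" "c \<in> R" "dvd_in R pc (b - c * (a + t * b))" using bezout_mod_p by blast
  define E1 where "E1 = addrow_mat (Suc n) t 0 (Suc k)"
  define E2 where "E2 = addrow_mat (Suc n) (- c) (Suc k) 0"
  have E: "E1 \<in> carrier_mat (Suc n) (Suc n)" "E2 \<in> carrier_mat (Suc n) (Suc n)" "entries_in R E1" "entries_in R E2"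
    "det E1 = 1" "det E2 = 1"
    using tc by (auto simp: E1_def E2_def det_addrow_mat intro!: addrow_mat_entries_in ZZ_ring)
  define W where "W = E2 * (E1 * U)"
  have W: "W \<in> carrier_mat (Suc n) (Suc n)" "entries_in R W" "det W = 1"
    using E U R.entries_in_mult[OF E(3) U(2) E(1) U(1)]
      R.entries_in_mult[OF E(4) R.entries_in_mult[OF E(3) U(2) E(1) U(1)] E(2), of "Suc n"]
      det_mult[OF E(1) U(1)] det_mult[OF E(2), of "E1 * U"]
    by (auto simp: W_def)
  have "W * G = E2 * (E1 * M)"
    using E U G by (simp add: W_def M_def assoc_mult_mat[of _ "Suc n" "Suc n" _ "Suc n" _ "Suc n"])
  also have "E1 * M = addrow t 0 (Suc k) M" unfolding E1_def by (rule addrow_mat[symmetric, OF M(1) k])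
  also have "E2 * addrow t 0 (Suc k) M = addrow (- c) (Suc k) 0 (addrow t 0 (Suc k) M)"
    unfolding E2_def by (rule addrow_mat[symmetric, of _ _ "Suc n"]) (use M in auto)
  finally have WG: "W * G = addrow (- c) (Suc k) 0 (addrow t 0 (Suc k) M)" .
  have "dvd_in R pc ((W * G) $$ (Suc i, 0))" if i: "i < Suc k" for i
  proof (cases "i = k")
    case True
    have "(W * G) $$ (Suc k, 0) = b - c * (a + t * b)"
      unfolding WG using M k by (simp add: a_def b_def algebra_simps)
    then show ?thesis using tc True by simp
  next
    case False
    then have "(W * G) $$ (Suc i, 0) = M $$ (Suc i, 0)" unfolding WG using M k i by simp
    then show ?thesis using U(4) False i by (simp add: M_def)
  qed
  then show ?case using W by blast
qed

lemma unit_mod_p_mult: "unit_mod_p r \<Longrightarrow> unit_mod_p s \<Longrightarrow> unit_mod_p (r * s)"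
proof -
  assume "unit_mod_p r" "unit_mod_p s"
  then obtain u v where uv: "r \<in> R" "s \<in> R" "u \<in> R" "v \<in> R" "dvd_in R pc (u * r - 1)" "dvd_in R pc (v * s - 1)"
    by (auto simp: unit_mod_p_def)
  have "dvd_in R pc ((u * r) * (v * s) - 1 * 1)" by (rule R.dvd_in_mult_cong) (use uv in auto)
  then show ?thesis unfolding unit_mod_p_def using uv
    by (intro conjI bexI[of _ "u * v"]) (auto simp: algebra_simps)
qed

lemma unit_mod_p_pi: "unit_mod_p r \<Longrightarrow> \<exists>u\<in>R. dvd_in S \<pi> (u * r - 1)"
  unfolding unit_mod_p_def using dvd_p_imp_dvd_pi by blast

lemma unit_mod_pI_pi: "r \<in> R \<Longrightarrow> u \<in> R \<Longrightarrow> dvd_in S \<pi> (u * r - 1) \<Longrightarrow> unit_mod_p r"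
  unfolding unit_mod_p_def by (auto intro!: bexI[of _ u] dvd_pi_imp_dvd_p)

lemma closed_free: "closed_module \<Lambda> (free_module \<Lambda> n)"
  by (intro closed_module_power) (auto simp: closed_module_def Lam_add Lam_mult)

text \<open>Row operations over R clear the first column modulo p; the corner d and the determinant
  of the remaining block are then units modulo p, because the whole determinant is. The rest of the
  first row is cleared on the S side, \<open>G1 d\<close> splits off, and d multiplies the constant
  found for the block.\<close>

lemma glue_stably_G1:
  "G \<in> carrier_mat n n \<Longrightarrow> entries_in R G \<Longrightarrow> unit_mod_p (det G) \<Longrightarrow>
    \<exists>r. unit_mod_p r \<and> stably_isomorphic \<Lambda> (glue n G) (G1 r)"
proof (induction n arbitrary: G)
  case 0
  \<comment> \<open>For n = 0 the glued module is zero and stably isomorphic to \<Lambda>, that is,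
    to \<open>G1 1\<close>.\<close>
  have "G = 1\<^sub>m 0" using 0 by auto
  then have "miso \<Lambda> (glue 0 G) (free_module \<Lambda> 0)"
    using miso_sym[OF free_miso_glue closed_free, of 0] by simp
  then have "miso \<Lambda> (direct_sum (glue 0 G) (free_module \<Lambda> 1)) (direct_sum (free_module \<Lambda> 0) (free_module \<Lambda> 1))"
    by (intro miso_direct_sum miso_refl)
  also have "miso \<Lambda> \<dots> (direct_sum (free_module \<Lambda> 1) (free_module \<Lambda> 0))" by (rule miso_comm)
  also have "miso \<Lambda> \<dots> (direct_sum (G1 1) (free_module \<Lambda> 0))"
    by (intro miso_direct_sum miso_refl G1_one_miso_regular)
  finally have "stably_isomorphic \<Lambda> (glue 0 G) (G1 1)" unfolding stably_isomorphic_miso by blast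
  moreover have "unit_mod_p 1" by (auto simp: unit_mod_p_def intro!: bexI[of _ 1])
  ultimately show ?case by blast
next
  case (Suc n)
  obtain U where U: "U \<in> carrier_mat (Suc n) (Suc n)" "entries_in R U" "det U = 1"
    "\<forall>i<n. dvd_in R pc ((U * G) $$ (Suc i, 0))" using clear_column[OF Suc.prems(1,2), of n] by auto
  define M where "M = U * G"
  have M: "M \<in> carrier_mat (Suc n) (Suc n)" "entries_in R M"
    using U Suc.prems R.entries_in_mult[OF U(2) Suc.prems(2) U(1) Suc.prems(1)] by (simp_all add: M_def)
  define d where "d = M $$ (0, 0)"
  define w where "w j = M $$ (0, Suc j)" for j
  define G' where "G' = mat n n (\<lambda>(i, j). M $$ (Suc i, Suc j))"
  have d: "d \<in> R" and w: "\<And>j. j < n \<Longrightarrow> w j \<in> R"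
    and G': "G' \<in> carrier_mat n n" "entries_in R G'"
    using M by (auto simp: d_def w_def G'_def entries_in_def)
  have MB: "mcong (Suc n) M (bl n d w G')"
    unfolding mcong_bl using U(4) by (auto simp: d_def w_def G'_def M_def[symmetric] intro: dvd_p_imp_dvd_pi)
  have detM: "det M = det G" using det_mult[OF U(1) Suc.prems(1)] U by (simp add: M_def)
  have bl_in: "entries_in R (bl n d w G')" by (rule bl_entries_in) (use d w G' in auto)
  have dG: "dvd_in S \<pi> (det G - d * det G')"
    using S.det_cong[OF entries_in_mono[OF M(2) R_subset_S] M(1) entries_in_mono[OF bl_in R_subset_S] bl_carrier, of \<pi>]
      MB det_bl[OF G'(1)] detM by (simp add: mcong_def)
  \<comment> \<open>For s inverse to det G modulo \<pi>, the product s * det G' inverts d, and s * d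
    inverts det G'.\<close>
  obtain s where s: "s \<in> R" "dvd_in S \<pi> (s * det G - 1)" using unit_mod_p_pi[OF Suc.prems(3)] by blast
  have dR: "det G' \<in> R" using R.det_in G' by blast
  have "dvd_in S \<pi> (s * (det G - d * det G'))" using dG s by (intro S.dvd_in_mult') auto
  from S.dvd_in_diff[OF s(2) this] have sd: "dvd_in S \<pi> (s * (d * det G') - 1)" by (simp add: algebra_simps)
  have ud: "unit_mod_p d" by (rule unit_mod_pI_pi[of _ "s * det G'"]) (use d s dR sd in \<open>auto simp: algebra_simps\<close>)
  have uG: "unit_mod_p (det G')" by (rule unit_mod_pI_pi[of _ "s * d"]) (use d s dR sd in \<open>auto simp: algebra_simps\<close>)
  obtain d' where d': "d' \<in> R" "dvd_in S \<pi> (d' * d - 1)" using unit_mod_p_pi[OF ud] by blast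
  \<comment> \<open>Column operations: d' inverts d modulo \<pi>, so adding d' * w j times the first
    column of \<open>Hm\<close> reproduces w. They act on the S side of the gluing.\<close>
  define V where "V = bl n 1 (\<lambda>j. d' * w j) (1\<^sub>m n)"
  have V: "V \<in> carrier_mat (Suc n) (Suc n)" "entries_in S V" "det V = 1"
  proof -
    show "V \<in> carrier_mat (Suc n) (Suc n)" "det V = 1" by (simp_all add: V_def det_bl)
    have "entries_in R V" unfolding V_def by (rule bl_entries_in) (use d' w one_mat_entries_in[OF ZZ_ring] in auto)
    then show "entries_in S V" by (rule entries_in_mono[OF _ R_subset_S])
  qed
  define Hm where "Hm = bl n d (\<lambda>_. 0) G'"
  have HV: "Hm * V = bl n d (\<lambda>j. d * (d' * w j)) G'"
  proof (rule eq_matI)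
    fix i j assume "i < dim_row (bl n d (\<lambda>j. d * (d' * w j)) G')" "j < dim_col (bl n d (\<lambda>j. d * (d' * w j)) G')"
    then have ij: "i < Suc n" "j < Suc n" by (simp_all add: bl_def)
    have "(Hm * V) $$ (i, j) = Hm $$ (i, 0) * V $$ (0, j) + (\<Sum>t<n. Hm $$ (i, Suc t) * V $$ (Suc t, j))"
      unfolding mult_mat_entry[OF bl_carrier[of n d "\<lambda>_. 0" G', folded Hm_def] V(1) ij] by (rule sum.lessThan_Suc_shift)
    also have "(\<Sum>t<n. Hm $$ (i, Suc t) * V $$ (Suc t, j)) = (\<Sum>t<n. if Suc t = j then Hm $$ (i, Suc t) else 0)"
    proof (rule sum.cong[OF refl])
      fix t assume "t \<in> {..<n}"
      then show "Hm $$ (i, Suc t) * V $$ (Suc t, j) = (if Suc t = j then Hm $$ (i, Suc t) else 0)"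
        using ij by (cases j) (auto simp: V_def)
    qed
    also have "\<dots> = (if j = 0 then 0 else Hm $$ (i, j))"
      using ij by (cases j) auto
    finally show "(Hm * V) $$ (i, j) = bl n d (\<lambda>j. d * (d' * w j)) G' $$ (i, j)"
      using ij by (cases i; cases j) (auto simp: Hm_def V_def)
  qed (auto simp: Hm_def V_def bl_def)
  have cong: "mcong (Suc n) (U * G) (Hm * V)"
  proof -
    have "dvd_in S \<pi> (w j - d * (d' * w j))" if "j < n" for j
    proof -
      have "dvd_in S \<pi> (- ((d' * d - 1) * w j))" using d' w that by (intro S.dvd_in_uminus S.dvd_in_mult) auto
      then show ?thesis by (simp add: algebra_simps)
    qed
    then have "mcong (Suc n) (bl n d w G') (bl n d (\<lambda>j. d * (d' * w j)) G')" unfolding mcong_bl by auto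
    then show ?thesis using MB mcong_trans unfolding HV M_def by blast
  qed
  have "miso \<Lambda> (glue (Suc n) G) (glue (Suc n) Hm)"
    by (rule glue_base_change[OF Suc.prems(1) _ U(1) V(1) U(2) V(2) U(3) V(3) cong]) (simp add: Hm_def)
  also have "miso \<Lambda> \<dots> (direct_sum (G1 d) (glue n G'))" unfolding Hm_def by (rule glue_split[OF G'(1)])
  finally have 1: "stably_isomorphic \<Lambda> (glue (Suc n) G) (direct_sum (G1 d) (glue n G'))" by (rule miso_imp_stably)
  obtain r where r: "unit_mod_p r" "stably_isomorphic \<Lambda> (glue n G') (G1 r)" using Suc.IH[OF G' uG] by blast
  note 1
  also have "stably_isomorphic \<Lambda> (direct_sum (G1 d) (glue n G')) (direct_sum (G1 d) (G1 r))"
    by (intro stably_direct_sum stably_refl r)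
  also have "stably_isomorphic \<Lambda> \<dots> (G1 (d * r))"
  proof -
    obtain r' where "r' \<in> R" "dvd_in S \<pi> (r' * r - 1)" using unit_mod_p_pi[OF r(1)] by blast
    then show ?thesis using G1_direct_sum_stably[OF d] r(1) by (auto simp: unit_mod_p_def)
  qed
  finally show ?case using unit_mod_p_mult[OF ud r(1)] by blast
qed

end

context cyclotomic_pair
begin

subsection \<open>Invariance of the gluing determinant\<close>

text \<open>Supplies scalars of \<Lambda> with one prescribed component; for S the other component
  is a representative in R of the same residue class.\<close>

lemma residue_lift:
  "t \<in> R \<Longrightarrow> \<exists>a\<in>Lam. e1 a = t" "t \<in> S \<Longrightarrow> \<exists>a\<in>Lam. e2 a = t"
proof -
  show "\<exists>a\<in>Lam. e1 a = t" if "t \<in> R" using that mk_Lam[of t t] mk[of t t] by (intro bexI[of _ "mk t t"]) auto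
  assume t: "t \<in> S"
  obtain r where "r \<in> R" "dvd_in S \<pi> (t - r)" using S_residue[OF t] by blast
  then show "\<exists>a\<in>Lam. e2 a = t"
    using t mk_Lam[of r t] mk[of r t] S.dvd_in_diff_sym by (intro bexI[of _ "mk r t"]) auto
qed

text \<open>With \<open>eps2\<close>, these are the elements (p, 0) and (0, \<pi>) of \<Lambda>:
  each annihilates one component and acts on the other as a nonzero scalar.\<close>

definition eps1 where "eps1 = mk pc 0"
definition eps2 where "eps2 = mk 0 \<pi>"

lemma eps: "eps1 \<in> Lam" "e1 eps1 = pc" "e2 eps1 = 0" "eps2 \<in> Lam" "e1 eps2 = 0" "e2 eps2 = \<pi>"
  using mk[of pc 0] mk[of 0 \<pi>] mk_Lam[of pc 0] mk_Lam[of 0 \<pi>] pi_dvd_p S.dvd_in_uminus[OF S.dvd_in_self[of \<pi>]]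
  by (simp_all add: eps1_def eps2_def)

text \<open>Stated for both projections at once: \<open>q\<close> is one of them, \<open>E\<close> the corresponding character with values in \<open>B\<close>,
  and \<open>a\<close> an element that annihilates the other factor only.\<close>

lemma matrix_of_linear:
  fixes f :: "complex vec \<times> complex vec \<Rightarrow> complex vec \<times> complex vec"
  assumes sel: "(q = fst \<and> E = e1 \<and> B = R \<and> a = eps1 \<and> c = pc) \<or> (q = snd \<and> E = e2 \<and> B = S \<and> a = eps2 \<and> c = \<pi>)"
    and G: "G \<in> carrier_mat n n" "entries_in R G"
    and fin: "\<And>m. m \<in> carrier (glue n G) \<Longrightarrow> f m \<in> carrier (glue k H)"
    and fadd: "\<And>m m'. m \<in> carrier (glue n G) \<Longrightarrow> m' \<in> carrier (glue n G) \<Longrightarrow> f (m \<oplus>\<^bsub>glue n G\<^esub> m') = f m \<oplus>\<^bsub>glue k H\<^esub> f m'"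
    and fsm: "\<And>b m. b \<in> Lam \<Longrightarrow> m \<in> carrier (glue n G) \<Longrightarrow> f (b \<odot>\<^bsub>glue n G\<^esub> m) = b \<odot>\<^bsub>glue k H\<^esub> f m"
    and basis: "\<And>j. j < n \<Longrightarrow> \<exists>m\<in>carrier (glue n G). q m = unit_vec n j"
  shows "\<exists>U\<in>carrier_mat k n. entries_in B U \<and> (\<forall>m\<in>carrier (glue n G). q (f m) = U *\<^sub>v q m)"
proof -
  have cl: "closed_module \<Lambda> (glue n G)" by (rule closed_glue[OF G])
  have q_in: "q m \<in> carrier_vec l" "i < l \<Longrightarrow> q m $ i \<in> B" if "m \<in> carrier (glue l N)" for m l N i
    using sel that by (cases m; auto)+
  have q_add: "q (m \<oplus>\<^bsub>glue l N\<^esub> m') = q m + q m'" for m m' l N using sel by (cases m; cases m'; auto)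
  have q_sm: "q (b \<odot>\<^bsub>glue l N\<^esub> m) = E b \<cdot>\<^sub>v q m" for b m l N using sel by (cases m; auto)
  have lift: "\<exists>b\<in>Lam. E b = t" if "t \<in> B" for t using sel residue_lift that by auto
  have a: "a \<in> Lam" "E a = c" "c \<noteq> 0" using sel eps by auto
  \<comment> \<open>Multiplication by \<open>a\<close> erases the other component, so
    \<open>q (f m)\<close> depends on \<open>q m\<close> alone once the nonzero constant c is
    cancelled.\<close>
  have a_det: "a \<odot>\<^bsub>glue n G\<^esub> m = a \<odot>\<^bsub>glue n G\<^esub> m'" if "q m = q m'" "m \<in> carrier (glue n G)" "m' \<in> carrier (glue n G)" for m m'
    using sel that eps by (cases m; cases m') (auto intro!: eq_vecI)
  obtain b where b: "\<And>j. j < n \<Longrightarrow> b j \<in> carrier (glue n G)" "\<And>j. j < n \<Longrightarrow> q (b j) = unit_vec n j"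
    using basis by metis
  define U where "U = mat k n (\<lambda>(i, j). q (f (b j)) $ i)"
  have U: "U \<in> carrier_mat k n" by (simp add: U_def)
  have U_in: "entries_in B U" using q_in(2)[OF fin[OF b(1)]] by (auto simp: entries_in_def U_def)
  have "q (f m) = U *\<^sub>v q m" if m: "m \<in> carrier (glue n G)" for m
  proof -
    define x where "x = q m"
    have x: "x \<in> carrier_vec n" "\<And>i. i < n \<Longrightarrow> x $ i \<in> B" using q_in m by (auto simp: x_def)
    \<comment> \<open>An element m' with the same q-component as m is assembled from lifts of the
      unit vectors, on which f is known.\<close>
    have "l \<le> n \<Longrightarrow> \<exists>m'\<in>carrier (glue n G). q m' = vec n (\<lambda>i. if i < l then x $ i else 0)
      \<and> q (f m') = vec k (\<lambda>i. \<Sum>j<l. U $$ (i, j) * x $ j)" for l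
    proof (induction l)
      case 0
      have z: "\<zero>\<^bsub>A\<^esub> \<in> Lam" "E \<zero>\<^bsub>A\<^esub> = 0" using Lam_zero sel by auto
      have "\<zero>\<^bsub>A\<^esub> \<odot>\<^bsub>glue n G\<^esub> m \<in> carrier (glue n G)" using cl m z by (auto simp: closed_module_def)
      moreover have "q (\<zero>\<^bsub>A\<^esub> \<odot>\<^bsub>glue n G\<^esub> m) = vec n (\<lambda>i. 0)"
        unfolding q_sm using x z by (auto simp: x_def[symmetric])
      moreover have "q (f (\<zero>\<^bsub>A\<^esub> \<odot>\<^bsub>glue n G\<^esub> m)) = vec k (\<lambda>i. 0)"
        unfolding fsm[OF z(1) m] q_sm using q_in(1)[OF fin[OF m]] z by auto
      ultimately show ?case by auto
    next
      case (Suc l)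
      then obtain m' where m': "m' \<in> carrier (glue n G)" "q m' = vec n (\<lambda>i. if i < l then x $ i else 0)"
        "q (f m') = vec k (\<lambda>i. \<Sum>j<l. U $$ (i, j) * x $ j)" by auto
      have l: "l < n" using Suc.prems by simp
      obtain t where t: "t \<in> Lam" "E t = x $ l" using lift x(2)[OF l] by blast
      let ?d = "t \<odot>\<^bsub>glue n G\<^esub> b l"
      have d: "?d \<in> carrier (glue n G)" using cl t b(1)[OF l] by (auto simp: closed_module_def)
      have "m' \<oplus>\<^bsub>glue n G\<^esub> ?d \<in> carrier (glue n G)" using cl m' d by (auto simp: closed_module_def)
      moreover have "q (m' \<oplus>\<^bsub>glue n G\<^esub> ?d) = vec n (\<lambda>i. if i < Suc l then x $ i else 0)"
        unfolding q_add q_sm m' b(2)[OF l] t using l by (intro eq_vecI) (auto simp: less_Suc_eq)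
      moreover have "q (f (m' \<oplus>\<^bsub>glue n G\<^esub> ?d)) = vec k (\<lambda>i. \<Sum>j<Suc l. U $$ (i, j) * x $ j)"
        unfolding fadd[OF m'(1) d] fsm[OF t(1) b(1)[OF l]] q_add q_sm m'(3) t(2)
        using l q_in(1)[OF fin[OF b(1)[OF l]]] by (intro eq_vecI) (auto simp: U_def)
      ultimately show ?case by blast
    qed
    from this[of n] obtain m' where m': "m' \<in> carrier (glue n G)" "q m' = vec n (\<lambda>i. if i < n then x $ i else 0)"
        "q (f m') = vec k (\<lambda>i. \<Sum>j<n. U $$ (i, j) * x $ j)" by auto
    have "q m' = q m" unfolding m' using x by (intro eq_vecI) (auto simp: x_def)
    then have "a \<odot>\<^bsub>glue n G\<^esub> m' = a \<odot>\<^bsub>glue n G\<^esub> m" using a_det m m' by blast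
    then have "a \<odot>\<^bsub>glue k H\<^esub> f m' = a \<odot>\<^bsub>glue k H\<^esub> f m"
      using fsm[OF a(1) m] fsm[OF a(1) m'(1)] by simp
    then have "q (a \<odot>\<^bsub>glue k H\<^esub> f m') = q (a \<odot>\<^bsub>glue k H\<^esub> f m)" by simp
    then have cq: "c \<cdot>\<^sub>v q (f m') = c \<cdot>\<^sub>v q (f m)" by (simp only: q_sm a)
    have "q (f m') $ i = q (f m) $ i" if "i < k" for i
      using arg_cong[OF cq, of "\<lambda>v. v $ i"] that a(3) q_in(1)[OF fin[OF m]] q_in(1)[OF fin[OF m'(1)]]
      by simp
    then have "q (f m) $ i = (U *\<^sub>v x) $ i" if "i < k" for i
      using that m'(3) mult_vec_entry[OF U x(1) that] by simp
    then show ?thesis unfolding x_def[symmetric] using q_in(1)[OF fin[OF m]] U by (intro eq_vecI) auto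
  qed
  then show ?thesis using U U_in by blast
qed

lemma mat_eqI_unit_vec:
  fixes M :: "complex mat"
  assumes "M \<in> carrier_mat n n" "\<And>j. j < n \<Longrightarrow> M *\<^sub>v unit_vec n j = unit_vec n j"
  shows "M = 1\<^sub>m n"
proof (rule eq_matI)
  fix i j assume "i < dim_row (1\<^sub>m n :: complex mat)" "j < dim_col (1\<^sub>m n :: complex mat)"
  then have ij: "i < n" "j < n" by auto
  have "M $$ (i, j) = (M *\<^sub>v unit_vec n j) $ i" using assms(1) ij by simp
  then show "M $$ (i, j) = 1\<^sub>m n $$ (i, j)" using assms(2)[OF ij(2)] ij by simp
qed (use assms in auto)

text \<open>U * V and V * U have the same trace, and the characteristic is 0.\<close>

lemma inverse_matrices_square:
  fixes U V :: "complex mat"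
  assumes "U \<in> carrier_mat k n" "V \<in> carrier_mat n k" "V * U = 1\<^sub>m n" "U * V = 1\<^sub>m k"
  shows "k = n"
proof -
  have "(of_nat k :: complex) = (\<Sum>i<k. (U * V) $$ (i, i))" using assms by simp
  also have "\<dots> = (\<Sum>i<k. \<Sum>j<n. U $$ (i, j) * V $$ (j, i))"
    by (rule sum.cong[OF refl]) (use mult_mat_entry[OF assms(1,2)] in auto)
  also have "\<dots> = (\<Sum>j<n. \<Sum>i<k. V $$ (j, i) * U $$ (i, j))" by (subst sum.swap) (simp add: mult.commute)
  also have "\<dots> = (\<Sum>j<n. (V * U) $$ (j, j))"
    by (rule sum.cong[OF refl]) (use mult_mat_entry[OF assms(2,1)] in auto)
  also have "\<dots> = of_nat n" using assms by simp
  finally show ?thesis by simp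
qed

lemma glue_snd_surj:
  assumes G: "G \<in> carrier_mat n n" "entries_in R G" and j: "j < n"
  shows "(col G j, unit_vec n j) \<in> carrier (glue n G)"
proof -
  have "G *\<^sub>v unit_vec n j = col G j" using G j by (intro eq_vecI) auto
  then show ?thesis using G j entries_inD[OF G(2,1)] by (auto simp: vcong_def unit_vec_def)
qed

text \<open>Hitting the unit vectors in the first component takes an inverse N of G modulo \<pi>;
  its columns are the second components.\<close>

lemma glue_fst_surj:
  assumes G: "G \<in> carrier_mat n n" "entries_in R G" and N: "N \<in> carrier_mat n n" "entries_in R N"
    and GN: "mcong n (G * N) (1\<^sub>m n)" and j: "j < n"
  shows "(unit_vec n j, col N j) \<in> carrier (glue n G)"
proof -
  have "G *\<^sub>v col N j = col (G * N) j" using G N j by (intro eq_vecI) auto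
  moreover have "vcong n (unit_vec n j) (col (G * N) j)"
    unfolding vcong_def
  proof (intro allI impI)
    fix i assume i: "i < n"
    have "dvd_in S \<pi> (1\<^sub>m n $$ (i, j) - (G * N) $$ (i, j))"
      using mcong_sym[OF GN] i j unfolding mcong_def by blast
    then show "dvd_in S \<pi> (unit_vec n j $ i - col (G * N) j $ i)"
      using i j G N by (simp add: unit_vec_def split: if_splits)
  qed
  ultimately show ?thesis using G N j entries_inD[OF N(2,1)] by (auto simp: unit_vec_def)
qed

text \<open>An isomorphism acts on the two components by invertible matrices U over R and V over S
  with U G congruent to H V. On determinants this is the claim, with u = det V / det U.\<close>

lemma glue_miso_det:
  assumes G: "G \<in> carrier_mat n n" "entries_in R G" "N \<in> carrier_mat n n" "entries_in R N" "mcong n (G * N) (1\<^sub>m n)"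
    and H: "H \<in> carrier_mat k k" "entries_in R H" "N' \<in> carrier_mat k k" "entries_in R N'" "mcong k (H * N') (1\<^sub>m k)"
    and iso: "miso \<Lambda> (glue n G) (glue k H)"
  shows "\<exists>u\<in>S. \<exists>v\<in>S. u * v = 1 \<and> dvd_in S \<pi> (det G - det H * u)"
proof -
  obtain f g where fg: "inverse_isos \<Lambda> (glue n G) (glue k H) f g" using iso by (rule misoE)
  obtain g' f' where gf: "inverse_isos \<Lambda> (glue k H) (glue n G) g' f'"
    using miso_sym[OF iso closed_glue[OF G(1,2)]] by (rule misoE)
  have clG: "closed_module \<Lambda> (glue n G)" by (rule closed_glue[OF G(1,2)])
  note fg' = fg[unfolded inverse_isos_def]
  have f_in: "f m \<in> carrier (glue k H)" and g_f: "g (f m) = m" if "m \<in> carrier (glue n G)" for m using fg' that by auto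
  have g_in: "g m \<in> carrier (glue n G)" and f_g: "f (g m) = m" if "m \<in> carrier (glue k H)" for m using fg' that by auto
  have f_add: "f (m \<oplus>\<^bsub>glue n G\<^esub> m') = f m \<oplus>\<^bsub>glue k H\<^esub> f m'"
    if "m \<in> carrier (glue n G)" "m' \<in> carrier (glue n G)" for m m' using fg' that by auto
  have f_sm: "f (b \<odot>\<^bsub>glue n G\<^esub> m) = b \<odot>\<^bsub>glue k H\<^esub> f m" if "b \<in> Lam" "m \<in> carrier (glue n G)" for b m
    using fg' that by auto
  have g_add: "g (m \<oplus>\<^bsub>glue k H\<^esub> m') = g m \<oplus>\<^bsub>glue n G\<^esub> g m'"
    if m: "m \<in> carrier (glue k H)" "m' \<in> carrier (glue k H)" for m m'
  proof -
    have "g m \<oplus>\<^bsub>glue n G\<^esub> g m' \<in> carrier (glue n G)" using clG g_in m by (auto simp: closed_module_def)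
    then show ?thesis using g_f f_add[OF g_in g_in, OF m] f_g m by metis
  qed
  have g_sm: "g (b \<odot>\<^bsub>glue k H\<^esub> m) = b \<odot>\<^bsub>glue n G\<^esub> g m" if m: "b \<in> Lam" "m \<in> carrier (glue k H)" for b m
  proof -
    have "b \<odot>\<^bsub>glue n G\<^esub> g m \<in> carrier (glue n G)" using clG g_in m by (auto simp: closed_module_def)
    then show ?thesis using g_f f_sm[OF m(1) g_in[OF m(2)]] f_g m by metis
  qed
  have b1: "\<exists>m\<in>carrier (glue n G). fst m = unit_vec n j" if "j < n" for j
    by (rule bexI[OF _ glue_fst_surj[OF G that]]) (rule fst_conv)
  have b1': "\<exists>m\<in>carrier (glue n G). snd m = unit_vec n j" if "j < n" for j
    by (rule bexI[OF _ glue_snd_surj[OF G(1,2) that]]) (rule snd_conv)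
  have b2: "\<exists>m\<in>carrier (glue k H). fst m = unit_vec k j" if "j < k" for j
    by (rule bexI[OF _ glue_fst_surj[OF H that]]) (rule fst_conv)
  have b2': "\<exists>m\<in>carrier (glue k H). snd m = unit_vec k j" if "j < k" for j
    by (rule bexI[OF _ glue_snd_surj[OF H(1,2) that]]) (rule snd_conv)
  obtain U where U: "U \<in> carrier_mat k n" "entries_in R U" "\<And>m. m \<in> carrier (glue n G) \<Longrightarrow> fst (f m) = U *\<^sub>v fst m"
    using matrix_of_linear[of fst e1 R eps1 pc G n f k H, OF _ G(1,2) f_in f_add f_sm b1] by blast
  obtain V where V: "V \<in> carrier_mat k n" "entries_in S V" "\<And>m. m \<in> carrier (glue n G) \<Longrightarrow> snd (f m) = V *\<^sub>v snd m"
    using matrix_of_linear[of snd e2 S eps2 \<pi> G n f k H, OF _ G(1,2) f_in f_add f_sm b1'] by blast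
  obtain U' where U': "U' \<in> carrier_mat n k" "entries_in R U'" "\<And>m. m \<in> carrier (glue k H) \<Longrightarrow> fst (g m) = U' *\<^sub>v fst m"
    using matrix_of_linear[of fst e1 R eps1 pc H k g n G, OF _ H(1,2) g_in g_add g_sm b2] by blast
  obtain V' where V': "V' \<in> carrier_mat n k" "entries_in S V'" "\<And>m. m \<in> carrier (glue k H) \<Longrightarrow> snd (g m) = V' *\<^sub>v snd m"
    using matrix_of_linear[of snd e2 S eps2 \<pi> H k g n G, OF _ H(1,2) g_in g_add g_sm b2'] by blast
  have UU: "U' * U = 1\<^sub>m n"
  proof (rule mat_eqI_unit_vec)
    show "U' * U \<in> carrier_mat n n" using U U' by auto
    fix j assume "j < n"
    then obtain m where m: "m \<in> carrier (glue n G)" "fst m = unit_vec n j" using b1 by blast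
    have "U' *\<^sub>v (U *\<^sub>v fst m) = fst (g (f m))" using U'(3)[OF f_in] U(3) m by simp
    then show "(U' * U) *\<^sub>v unit_vec n j = unit_vec n j" using g_f m U U' by simp
  qed
  have UU': "U * U' = 1\<^sub>m k"
  proof (rule mat_eqI_unit_vec)
    show "U * U' \<in> carrier_mat k k" using U U' by auto
    fix j assume "j < k"
    then obtain m where m: "m \<in> carrier (glue k H)" "fst m = unit_vec k j" using b2 by blast
    have "U *\<^sub>v (U' *\<^sub>v fst m) = fst (f (g m))" using U(3)[OF g_in] U'(3) m by simp
    then show "(U * U') *\<^sub>v unit_vec k j = unit_vec k j" using f_g m U U' by simp
  qed
  have kn: "k = n" by (rule inverse_matrices_square[OF U(1) U'(1) UU UU'])
  have VV: "V' * V = 1\<^sub>m n"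
  proof (rule mat_eqI_unit_vec)
    show "V' * V \<in> carrier_mat n n" using V V' by auto
    fix j assume "j < n"
    then obtain m where m: "m \<in> carrier (glue n G)" "snd m = unit_vec n j" using b1' by blast
    have "V' *\<^sub>v (V *\<^sub>v snd m) = snd (g (f m))" using V'(3)[OF f_in] V(3) m by simp
    then show "(V' * V) *\<^sub>v unit_vec n j = unit_vec n j" using g_f m V V' by simp
  qed
  note c = U(1)[unfolded kn] V(1)[unfolded kn] U'(1)[unfolded kn] V'(1)[unfolded kn] G(1) H(1)[unfolded kn]
  have US: "entries_in S U" using entries_in_mono[OF U(2) R_subset_S] .
  have cong: "mcong n (U * G) (H * V)"
    unfolding mcong_def
  proof (intro allI impI)
    fix i j assume ij: "i < n" "j < n"
    \<comment> \<open>The congruence is tested on the pairs of column j of G and unit vector j,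
      which lie in the glued module.\<close>
    let ?m = "(col G j, unit_vec n j)"
    have m: "?m \<in> carrier (glue n G)" by (rule glue_snd_surj[OF G(1,2) ij(2)])
    obtain x y where xy: "f ?m = (x, y)" by (cases "f ?m")
    have "vcong n x (H *\<^sub>v y)" using f_in[OF m] xy kn by simp
    moreover have "x = U *\<^sub>v col G j" "y = V *\<^sub>v unit_vec n j" using U(3)[OF m] V(3)[OF m] xy by simp_all
    moreover have "V *\<^sub>v unit_vec n j = col V j" using c ij by (intro eq_vecI) auto
    ultimately have "dvd_in S \<pi> ((U *\<^sub>v col G j) $ i - (H *\<^sub>v col V j) $ i)" using ij by (simp add: vcong_def)
    then show "dvd_in S \<pi> ((U * G) $$ (i, j) - (H * V) $$ (i, j))" using c ij by simp
  qed
  have "dvd_in S \<pi> (det (U * G) - det (H * V))"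
  proof (rule S.det_cong)
    show "entries_in S (U * G)" by (rule S.entries_in_mult[OF US entries_in_mono[OF G(2) R_subset_S] c(1,5)])
    show "entries_in S (H * V)" by (rule S.entries_in_mult[OF entries_in_mono[OF H(2) R_subset_S] V(2) c(6,2)])
    show "U * G \<in> carrier_mat n n" "H * V \<in> carrier_mat n n" using c by auto
    show "dvd_in S \<pi> ((U * G) $$ (i, j) - (H * V) $$ (i, j))" if "i < n" "j < n" for i j
      using cong that by (simp add: mcong_def)
  qed
  then have d: "dvd_in S \<pi> (det U * det G - det H * det V)"
    using det_mult[OF c(1,5)] det_mult[OF c(6,2)] by simp
  have dU: "det U' * det U = 1" using det_mult[OF c(3,1)] UU by simp
  have dV: "det V' * det V = 1" using det_mult[OF c(4,2)] VV by simp
  have in_S: "det U \<in> S" "det U' \<in> S" "det V \<in> S" "det V' \<in> S"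
    using S.det_in[OF US c(1)] S.det_in[OF entries_in_mono[OF U'(2) R_subset_S] c(3)] S.det_in[OF V(2) c(2)] S.det_in[OF V'(2) c(4)]
    by auto
  have "dvd_in S \<pi> (det U' * (det U * det G - det H * det V))" by (rule S.dvd_in_mult'[OF d in_S(2)])
  moreover have "det U' * (det U * det G - det H * det V) = (det U' * det U) * det G - det H * (det V * det U')"
    by (simp add: algebra_simps)
  ultimately have "dvd_in S \<pi> (det G - det H * (det V * det U'))" using dU by simp
  moreover have "(det V * det U') * (det V' * det U) = 1"
    using dU dV by (metis mult.assoc mult.commute mult.right_neutral)
  ultimately show ?thesis using in_S by (intro bexI[of _ "det V * det U'"] bexI[of _ "det V' * det U"]) auto
qed

lemma G1_free_miso_glue:
  "miso \<Lambda> (direct_sum (G1 r) (free_module \<Lambda> a)) (glue (Suc a) (bl a r (\<lambda>_. 0) (1\<^sub>m a)))" if r: "r \<in> R"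
proof -
  have bl: "entries_in R (bl a r (\<lambda>_. 0) (1\<^sub>m a))"
    by (rule bl_entries_in) (use r one_mat_entries_in[OF ZZ_ring] in auto)
  have "miso \<Lambda> (direct_sum (G1 r) (free_module \<Lambda> a)) (direct_sum (G1 r) (glue a (1\<^sub>m a)))"
    by (intro miso_direct_sum miso_refl free_miso_glue)
  also have "miso \<Lambda> \<dots> (glue (Suc a) (bl a r (\<lambda>_. 0) (1\<^sub>m a)))"
    by (rule miso_sym[OF glue_split closed_glue]) (use bl in auto)
  finally show ?thesis .
qed

lemma bl_inverse:
  assumes r: "unit_mod_p r"
  shows "\<exists>N\<in>carrier_mat (Suc a) (Suc a). entries_in R N \<and> mcong (Suc a) (bl a r (\<lambda>_. 0) (1\<^sub>m a) * N) (1\<^sub>m (Suc a))"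
proof -
  obtain u where u: "u \<in> R" "dvd_in S \<pi> (u * r - 1)" using unit_mod_p_pi[OF r] by blast
  let ?N = "bl a u (\<lambda>_. 0) (1\<^sub>m a)"
  have N: "entries_in R ?N"
    by (rule bl_entries_in) (use u one_mat_entries_in[OF ZZ_ring] in auto)
  have prod: "(bl a r (\<lambda>_. 0) (1\<^sub>m a) * ?N) $$ (i, j) = (if i = 0 \<and> j = 0 then r * u else if i = j then 1 else 0)"
    if ij: "i < Suc a" "j < Suc a" for i j
  proof -
    have "(bl a r (\<lambda>_. 0) (1\<^sub>m a) * ?N) $$ (i, j) = (\<Sum>t<Suc a. if t = i then (if i = 0 then r else 1) * ?N $$ (i, j) else 0)"
      unfolding mult_mat_entry[OF bl_carrier bl_carrier ij]
      by (rule sum.cong[OF refl]) (use ij in \<open>auto simp: bl_def\<close>)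
    also have "\<dots> = (if i = 0 then r else 1) * ?N $$ (i, j)" using ij by simp
    finally show ?thesis using ij by (auto simp: bl_def)
  qed
  have "mcong (Suc a) (bl a r (\<lambda>_. 0) (1\<^sub>m a) * ?N) (1\<^sub>m (Suc a))"
    unfolding mcong_def using prod u(2) by (auto simp: mult.commute)
  then show ?thesis using N by (intro bexI[of _ ?N]) auto
qed

text \<open>With free summands added, \<open>G1 r\<close> is glued along diag(r, 1, ..., 1), whose
  determinant is r. The ranks of the two sides may differ at first; \<open>glue_miso_det\<close>
  allows for it.\<close>

lemma G1_stably_imp:
  assumes r: "unit_mod_p r" and s: "unit_mod_p s" and iso: "stably_isomorphic \<Lambda> (G1 r) (G1 s)"
  shows "\<exists>u\<in>S. \<exists>v\<in>S. u * v = 1 \<and> dvd_in S \<pi> (r - s * u)"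
proof -
  have rs: "r \<in> R" "s \<in> R" using r s by (simp_all add: unit_mod_p_def)
  obtain a b where ab: "miso \<Lambda> (direct_sum (G1 r) (free_module \<Lambda> a)) (direct_sum (G1 s) (free_module \<Lambda> b))"
    using iso unfolding stably_isomorphic_miso by blast
  let ?G = "bl a r (\<lambda>_. 0) (1\<^sub>m a)" and ?H = "bl b s (\<lambda>_. 0) (1\<^sub>m b)"
  have in_R: "entries_in R ?G" "entries_in R ?H"
    by (rule bl_entries_in; use rs one_mat_entries_in[OF ZZ_ring] in auto)+
  have "miso \<Lambda> (glue (Suc a) ?G) (direct_sum (G1 r) (free_module \<Lambda> a))"
    by (rule miso_sym[OF G1_free_miso_glue[OF rs(1)] closed_direct_sum[OF closed_G1[OF rs(1)] closed_free]])
  also note ab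
  also note G1_free_miso_glue[OF rs(2), of b]
  finally have iso': "miso \<Lambda> (glue (Suc a) ?G) (glue (Suc b) ?H)" .
  obtain N where N: "N \<in> carrier_mat (Suc a) (Suc a)" "entries_in R N" "mcong (Suc a) (?G * N) (1\<^sub>m (Suc a))"
    using bl_inverse[OF r] by blast
  obtain N' where N': "N' \<in> carrier_mat (Suc b) (Suc b)" "entries_in R N'" "mcong (Suc b) (?H * N') (1\<^sub>m (Suc b))"
    using bl_inverse[OF s] by blast
  show ?thesis
    using glue_miso_det[OF bl_carrier in_R(1) N bl_carrier in_R(2) N' iso'] by (simp add: det_bl)
qed

end

subsection \<open>Locally free modules over \<open>\<Lambda>\<close>\<close>

text \<open>Zorn's lemma for the ideals that contain J and avoid 1; a union of a chain of them is
  another.\<close>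

lemma (in cring) ideal_in_maximalideal:
  assumes J: "ideal J R" "\<one> \<notin> J"
  shows "\<exists>P. maximalideal P R \<and> J \<subseteq> P"
proof -
  define F where "F = {I. ideal I R \<and> \<one> \<notin> I \<and> J \<subseteq> I}"
  have "\<exists>P\<in>F. \<forall>I\<in>F. P \<subseteq> I \<longrightarrow> I = P"
  proof (rule subset_Zorn_nonempty)
    show "F \<noteq> {}" using J by (auto simp: F_def)
    fix Ch assume Ch: "Ch \<noteq> {}" "subset.chain F Ch"
    then have "subset.chain {I. ideal I R} Ch" by (auto simp: subset_chain_def F_def)
    then have "ideal (\<Union>Ch) R" using chain_Union_is_ideal[of Ch] Ch(1) by simp
    then show "\<Union>Ch \<in> F" using Ch by (auto simp: subset_chain_def F_def)
  qed
  then obtain P where P: "P \<in> F" "\<And>I. I \<in> F \<Longrightarrow> P \<subseteq> I \<Longrightarrow> I = P" by blast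
  have "maximalideal P R"
  proof (rule maximalidealI)
    show "ideal P R" using P(1) by (simp add: F_def)
    show "carrier R \<noteq> P" using P(1) by (auto simp: F_def)
    fix I assume I: "ideal I R" "P \<subseteq> I" "I \<subseteq> carrier R"
    show "I = P \<or> I = carrier R"
    proof (cases "\<one> \<in> I")
      case True
      then show ?thesis using ideal.one_imp_carrier[OF I(1)] by simp
    next
      case False
      then show ?thesis using P I by (auto simp: F_def)
    qed
  qed
  then show ?thesis using P(1) by (auto simp: F_def)
qed

context cyclotomic_pair
begin

abbreviation act where "act a \<equiv> map (\<lambda>x. a \<otimes>\<^bsub>group_ring (Q_adjoin zm) (C p)\<^esub> x)"
abbreviation sm where "sm r \<equiv> map (\<lambda>x. r \<odot>\<^bsub>group_ring (Q_adjoin zm) (C p)\<^esub> x)"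

lemma scalar_in_Lam: "r \<in> R \<Longrightarrow> mk r r \<in> Lam"
  by (rule mk_Lam) auto

lemma smult_eq_mult: "r \<in> R \<Longrightarrow> a \<in> carrier A \<Longrightarrow> r \<odot>\<^bsub>A\<^esub> a = mk r r \<otimes>\<^bsub>A\<^esub> a"
  using mk[of r r] by (intro e_eqI) (auto simp: A_smult_closed A_mult_closed e_mult)

lemma list_eqI:
  "length v = length w \<Longrightarrow> (\<And>i. i < length w \<Longrightarrow> v ! i \<in> carrier A \<and> w ! i \<in> carrier A \<and> e1 (v ! i) = e1 (w ! i) \<and> e2 (v ! i) = e2 (w ! i)) \<Longrightarrow> v = w"
  by (rule nth_equalityI) (auto intro: e_eqI)

text \<open>In \<Lambda> itself an element (x, 0) has x divisible by \<pi>, hence x = p * t and (x,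
  0) = (p, 0) * (t, t). Local freeness carries this to the localizations of M. The scalars r for
  which r times the given element is an \<open>eps1\<close>-multiple thus form an ideal contained in
  no maximal one.\<close>

lemma locally_free_annihilator:
  assumes lf: "locally_free (Z_adjoin zm) A Lam n M" and mm: "mm \<in> M" and e2m: "\<forall>x\<in>set mm. e2 x = 0"
  shows "\<exists>m'\<in>M. mm = act eps1 m'"
proof -
  have sub: "submodule M \<Lambda> (free_module A n)" using lf by (simp add: locally_free_def)
  have M_in: "length v = n" "i < n \<Longrightarrow> v ! i \<in> carrier A" if "v \<in> M" for v i
    using submodule_closed(1)[OF sub that] by (auto simp: subset_iff)
  have M_add: "map2 (ring.add A) v w \<in> M" if "v \<in> M" "w \<in> M" for v w
    using submodule_closed(3)[OF sub that] by (simp add: regular_module_ops)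
  have M_act: "act a v \<in> M" if "a \<in> Lam" "v \<in> M" for a v using submodule_closed(4)[OF sub, of a v] that by simp
  have M_sm: "sm r v \<in> M" if "r \<in> R" "v \<in> M" for r v
  proof -
    have eq: "sm r v = act (mk r r) v" using M_in[OF that(2)] that(1) by (auto simp: smult_eq_mult in_set_conv_nth)
    show ?thesis unfolding eq by (rule M_act[OF scalar_in_Lam[OF that(1)] that(2)])
  qed
  note epsA = eps Lam_simps(1)[OF eps(1)] Lam_simps(1)[OF eps(4)]
  define J where "J = {r \<in> R. \<exists>m'\<in>M. sm r mm = act eps1 m'}"
  have J_add: "r + s \<in> J" if rs: "r \<in> J" "s \<in> J" for r s
  proof -
    obtain u v where uv: "u \<in> M" "sm r mm = act eps1 u" "v \<in> M" "sm s mm = act eps1 v" "r \<in> R" "s \<in> R"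
      using rs by (auto simp: J_def)
    have ru: "r \<odot>\<^bsub>A\<^esub> (mm ! i) = eps1 \<otimes>\<^bsub>A\<^esub> (u ! i)" "s \<odot>\<^bsub>A\<^esub> (mm ! i) = eps1 \<otimes>\<^bsub>A\<^esub> (v ! i)" if "i < n" for i
      using arg_cong[OF uv(2), of "\<lambda>l. l ! i"] arg_cong[OF uv(4), of "\<lambda>l. l ! i"] that M_in uv(1,3) mm by simp_all
    have "sm (r + s) mm = act eps1 (map2 (ring.add A) u v)"
    proof (rule nth_equalityI)
      fix i assume "i < length (sm (r + s) mm)"
      then have i: "i < n" using M_in mm by simp
      have "(r + s) \<odot>\<^bsub>A\<^esub> (mm ! i) = r \<odot>\<^bsub>A\<^esub> (mm ! i) \<oplus>\<^bsub>A\<^esub> s \<odot>\<^bsub>A\<^esub> (mm ! i)"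
        using M_in[OF mm] i uv by (intro e_eqI) (auto simp: A_smult_closed A_add_closed algebra_simps)
      also have "\<dots> = eps1 \<otimes>\<^bsub>A\<^esub> (u ! i \<oplus>\<^bsub>A\<^esub> v ! i)"
        unfolding ru[OF i] using M_in uv i epsA by (simp add: A.r_distr)
      finally show "sm (r + s) mm ! i = act eps1 (map2 (ring.add A) u v) ! i" using M_in uv mm i by simp
    qed (use M_in uv mm in simp)
    then show ?thesis unfolding J_def using uv M_add[OF uv(1,3)] R.add_in by blast
  qed
  have J_mult: "x * r \<in> J" if rx: "r \<in> J" "x \<in> R" for r x
  proof -
    obtain u where u: "u \<in> M" "sm r mm = act eps1 u" "r \<in> R" using rx by (auto simp: J_def)
    have ru: "r \<odot>\<^bsub>A\<^esub> (mm ! i) = eps1 \<otimes>\<^bsub>A\<^esub> (u ! i)" if "i < n" for i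
      using arg_cong[OF u(2), of "\<lambda>l. l ! i"] that M_in u(1) mm by simp
    have "sm (x * r) mm = act eps1 (sm x u)"
    proof (rule nth_equalityI)
      fix i assume "i < length (sm (x * r) mm)"
      then have i: "i < n" using M_in mm by simp
      have "(x * r) \<odot>\<^bsub>A\<^esub> (mm ! i) = x \<odot>\<^bsub>A\<^esub> (r \<odot>\<^bsub>A\<^esub> (mm ! i))"
        using M_in[OF mm] i u rx by (intro e_eqI) (auto simp: A_smult_closed)
      also have "\<dots> = eps1 \<otimes>\<^bsub>A\<^esub> (x \<odot>\<^bsub>A\<^esub> (u ! i))"
        unfolding ru[OF i] using M_in u i epsA rx by (intro e_eqI) (auto simp: A_smult_closed A_mult_closed e_mult)
      finally show "sm (x * r) mm ! i = act eps1 (sm x u) ! i" using M_in u mm i by simp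
    qed (use M_in u mm in simp)
    then show ?thesis unfolding J_def using u rx M_sm[OF rx(2) u(1)] R.mult_in by blast
  qed
  have J0: "0 \<in> J"
  proof -
    have "sm 0 mm = act eps1 (sm 0 mm)"
      using M_in[OF mm] epsA by (intro list_eqI) (auto simp: A_smult_closed A_mult_closed e_mult)
    then show ?thesis unfolding J_def using M_sm[OF R.zero_in mm] R.zero_in by blast
  qed
  interpret Z: cring "Z_adjoin zm" by (rule cring_Z_adjoin)
  have J_ideal: "ideal J (Z_adjoin zm)"
  proof (rule idealI)
    show "ring (Z_adjoin zm)" by (rule Z.ring_axioms)
    show "subgroup J (add_monoid (Z_adjoin zm))"
    proof (rule Z.add.subgroupI)
      show "J \<subseteq> carrier (Z_adjoin zm)" by (auto simp: J_def)
      show "J \<noteq> {}" using J0 by blast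
      fix r assume r: "r \<in> J"
      then have "r \<in> R" by (simp add: J_def)
      then have "\<ominus>\<^bsub>Z_adjoin zm\<^esub> r = (- 1) * r" by (intro Z.minus_equality) auto
      then show "\<ominus>\<^bsub>Z_adjoin zm\<^esub> r \<in> J" using J_mult[OF r, of "- 1"] by simp
    qed (use J_add in auto)
  qed (use J_mult in \<open>auto simp: mult.commute\<close>)
  have "1 \<in> J"
  proof (rule ccontr)
    assume "1 \<notin> J"
    then obtain P where P: "maximalideal P (Z_adjoin zm)" "J \<subseteq> P"
      using Z.ideal_in_maximalideal[OF J_ideal] by auto
    note PP = maximalideal_Z_adjoin[OF P(1)]
    define LP where "LP = localize (Z_adjoin zm) P A Lam"
    have LP: "a \<in> LP \<longleftrightarrow> a \<in> carrier A \<and> (\<exists>s\<in>R - P. s \<odot>\<^bsub>A\<^esub> a \<in> Lam)" for a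
      by (auto simp: LP_def localize_def)
    have Lam_LP: "a \<in> LP" if "a \<in> Lam" for a
      unfolding LP using that PP(2) Lam_simps(1)[OF that] Lam_smult[of 1 a] by (auto intro!: bexI[of _ 1])
    define MP where "MP = localize (Z_adjoin zm) P (module_power A n) M"
    have MP: "v \<in> MP \<longleftrightarrow> length v = n \<and> set v \<subseteq> carrier A \<and> (\<exists>s\<in>R - P. sm s v \<in> M)" for v
      by (auto simp: MP_def localize_def)
    have "miso (subring_of A LP) (lattice_module A n MP) (free_module (subring_of A LP) n)"
      using lf P(1) by (simp add: locally_free_def Let_def miso_def LP_def MP_def)
    then obtain f g where fg: "inverse_isos (subring_of A LP) (lattice_module A n MP) (free_module (subring_of A LP) n) f g"
      by (rule misoE)
    note fg' = fg[unfolded inverse_isos_def]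
    have f_in: "length (f v) = n" "i < n \<Longrightarrow> f v ! i \<in> LP" "g (f v) = v" if "v \<in> MP" for v i
      using fg' that by (auto simp: subset_iff)
    have g_in: "g w \<in> MP" "f (g w) = w" if "length w = n" "set w \<subseteq> LP" for w using fg' that by auto
    have f_act: "f (act a v) = act a (f v)" if "a \<in> LP" "v \<in> MP" for a v using fg' that by auto
    have m_MP: "mm \<in> MP" unfolding MP using M_in[OF mm] M_sm[of 1 mm] mm PP(2)
      by (auto simp: in_set_conv_nth intro!: bexI[of _ 1])
    define l where "l = f mm"
    have l: "length l = n" "\<And>i. i < n \<Longrightarrow> l ! i \<in> LP" using f_in[OF m_MP] by (auto simp: l_def)
    have lA: "l ! i \<in> carrier A" if "i < n" for i using l(2)[OF that] by (simp add: LP)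
    \<comment> \<open>The local isomorphism preserves scalar action but not components, so the
      vanishing of the second components is expressed through \<open>eps2\<close>.\<close>
    have eq0: "act eps2 mm = act \<zero>\<^bsub>A\<^esub> mm"
      using M_in[OF mm] e2m epsA by (intro list_eqI) (auto simp: A_mult_closed e_mult A_zero_closed)
    have eq: "act eps2 l = act \<zero>\<^bsub>A\<^esub> l"
      unfolding l_def f_act[OF Lam_LP[OF eps(4)] m_MP, symmetric] f_act[OF Lam_LP[OF Lam_zero] m_MP, symmetric] eq0 ..
    have e2l: "e2 (l ! i) = 0" if "i < n" for i
    proof -
      have "eps2 \<otimes>\<^bsub>A\<^esub> l ! i = \<zero>\<^bsub>A\<^esub> \<otimes>\<^bsub>A\<^esub> l ! i" using arg_cong[OF eq, of "\<lambda>v. v ! i"] l that by simp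
      then have "e2 (eps2 \<otimes>\<^bsub>A\<^esub> l ! i) = e2 (\<zero>\<^bsub>A\<^esub> \<otimes>\<^bsub>A\<^esub> l ! i)" by (rule arg_cong)
      then show ?thesis using lA[OF that] epsA by (simp add: e_mult A_zero_closed)
    qed
    define l' where "l' = map (\<lambda>x. mk (e1 x / pc) (e1 x / pc)) l"
    \<comment> \<open>After clearing a denominator s outside P, the argument for \<Lambda> applies
      to each entry.\<close>
    have l'_LP: "mk (e1 (l ! i) / pc) (e1 (l ! i) / pc) \<in> LP" if i: "i < n" for i
    proof -
      obtain s where s: "s \<in> R" "s \<notin> P" "s \<odot>\<^bsub>A\<^esub> l ! i \<in> Lam" using l(2)[OF i] unfolding LP by blast
      have "dvd_in S \<pi> (s * e1 (l ! i))" "s * e1 (l ! i) \<in> R" using Lam_simps(2,4)[OF s(3)] e2l[OF i] by simp_all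
      then obtain t where t: "t \<in> R" "s * e1 (l ! i) = pc * t" using dvd_pi_imp_dvd_p by (auto simp: dvd_in_def)
      have k: "e1 (l ! i) / pc \<in> K" using e_in[OF lA[OF i]] by simp
      have "s \<odot>\<^bsub>A\<^esub> mk (e1 (l ! i) / pc) (e1 (l ! i) / pc) = mk t t"
        using mk[of "e1 (l ! i) / pc" "e1 (l ! i) / pc"] mk[of t t] k t s
        by (intro e_eqI) (auto simp: A_smult_closed)
      then show ?thesis unfolding LP using mk(1)[of "e1 (l ! i) / pc" "e1 (l ! i) / pc"] k s scalar_in_Lam[OF t(1)]
        by (auto intro!: bexI[of _ s])
    qed
    have l': "length l' = n" "set l' \<subseteq> LP" using l l'_LP by (auto simp: l'_def in_set_conv_nth)
    have ll': "l = act eps1 l'"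
    proof (rule list_eqI)
      fix i assume "i < length (act eps1 l')"
      then have i: "i < n" using l' by simp
      have k: "e1 (l ! i) / pc \<in> K" using e_in[OF lA[OF i]] by simp
      show "l ! i \<in> carrier A \<and> act eps1 l' ! i \<in> carrier A \<and> e1 (l ! i) = e1 (act eps1 l' ! i) \<and> e2 (l ! i) = e2 (act eps1 l' ! i)"
        using lA[OF i] e2l[OF i] i l l' epsA mk[of "e1 (l ! i) / pc" "e1 (l ! i) / pc"] k
        by (simp add: l'_def e_mult A_mult_closed)
    qed (use l l' in simp)
    note gl' = g_in[OF l']
    obtain s where s: "s \<in> R" "s \<notin> P" "sm s (g l') \<in> M" using gl'(1) unfolding MP by blast
    have gA: "length (g l') = n" "\<And>i. i < n \<Longrightarrow> g l' ! i \<in> carrier A" using gl'(1) unfolding MP by (auto simp: subset_iff)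
    have comm: "sm s (act eps1 (g l')) = act eps1 (sm s (g l'))"
      using gA s epsA by (intro list_eqI) (auto simp: A_smult_closed A_mult_closed e_mult)
    have "act eps1 (g l') \<in> MP" unfolding MP
    proof (intro conjI bexI[of _ s])
      show "length (act eps1 (g l')) = n" using gA by simp
      show "set (act eps1 (g l')) \<subseteq> carrier A" using gA epsA by (auto simp: in_set_conv_nth A_mult_closed)
      show "sm s (act eps1 (g l')) \<in> M" unfolding comm by (rule M_act[OF eps(1) s(3)])
      show "s \<in> R - P" using s by simp
    qed
    then have "act eps1 (g l') = g (f (act eps1 (g l')))" using f_in by simp
    also have "f (act eps1 (g l')) = l" using f_act[OF Lam_LP[OF eps(1)] gl'(1)] gl'(2) ll' by simp
    also have "g l = mm" using f_in(3)[OF m_MP] by (simp add: l_def)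
    finally have "sm s mm = act eps1 (sm s (g l'))" using comm by simp
    then have "s \<in> J" unfolding J_def using s by blast
    then show False using P(2) s by blast
  qed
  then obtain m' where m': "m' \<in> M" "sm 1 mm = act eps1 m'" by (auto simp: J_def)
  have "sm 1 mm = mm" using M_in[OF mm] by (intro list_eqI) (auto simp: A_smult_closed)
  then show ?thesis using m' by auto
qed

text \<open>Column j of G is the first component of an element whose second component is unit vector
  j. Subtracting such elements from m, and then some (0, \<pi> * t), leaves second component 0. By
  \<open>ann\<close> the remaining first component is a multiple of p, so \<open>F1 m\<close> is
  congruent to G times \<open>F2 m\<close>.\<close>

lemma glue_of_embedding:
  fixes N :: nat and Mo :: "(int \<Rightarrow> complex, 'b, 'c) module_scheme" and F1 F2 :: "'b \<Rightarrow> complex vec"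
  assumes cl: "closed_module \<Lambda> Mo"
    and F_in: "\<And>m. m \<in> carrier Mo \<Longrightarrow> F1 m \<in> carrier_vec N \<and> F2 m \<in> carrier_vec N \<and> (\<forall>i<N. F1 m $ i \<in> R \<and> F2 m $ i \<in> S)"
    and F_add: "\<And>m m'. m \<in> carrier Mo \<Longrightarrow> m' \<in> carrier Mo \<Longrightarrow> F1 (m \<oplus>\<^bsub>Mo\<^esub> m') = F1 m + F1 m' \<and> F2 (m \<oplus>\<^bsub>Mo\<^esub> m') = F2 m + F2 m'"
    and F_sm: "\<And>a m. a \<in> Lam \<Longrightarrow> m \<in> carrier Mo \<Longrightarrow> F1 (a \<odot>\<^bsub>Mo\<^esub> m) = e1 a \<cdot>\<^sub>v F1 m \<and> F2 (a \<odot>\<^bsub>Mo\<^esub> m) = e2 a \<cdot>\<^sub>v F2 m"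
    and inj: "\<And>m m'. m \<in> carrier Mo \<Longrightarrow> m' \<in> carrier Mo \<Longrightarrow> F1 m = F1 m' \<Longrightarrow> F2 m = F2 m' \<Longrightarrow> m = m'"
    and surj1: "\<And>x. x \<in> carrier_vec N \<Longrightarrow> (\<forall>i<N. x $ i \<in> R) \<Longrightarrow> \<exists>m\<in>carrier Mo. F1 m = x"
    and surj2: "\<And>y. y \<in> carrier_vec N \<Longrightarrow> (\<forall>i<N. y $ i \<in> S) \<Longrightarrow> \<exists>m\<in>carrier Mo. F2 m = y"
    and ann: "\<And>m. m \<in> carrier Mo \<Longrightarrow> F2 m = 0\<^sub>v N \<Longrightarrow> \<exists>m'\<in>carrier Mo. m = eps1 \<odot>\<^bsub>Mo\<^esub> m'"
  shows "\<exists>G\<in>carrier_mat N N. entries_in R G \<and> unit_mod_p (det G) \<and> miso \<Lambda> Mo (glue N G)"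
proof -
  have add_in: "m \<oplus>\<^bsub>Mo\<^esub> m' \<in> carrier Mo" if "m \<in> carrier Mo" "m' \<in> carrier Mo" for m m'
    using cl that by (auto simp: closed_module_def)
  have sm_in: "a \<odot>\<^bsub>Mo\<^esub> m \<in> carrier Mo" if "a \<in> Lam" "m \<in> carrier Mo" for a m
    using cl that by (auto simp: closed_module_def)
  \<comment> \<open>The image contains p R ^ N x 0 and, by the next step, 0 x \<pi> S ^ N: lift one
    component and multiply by \<open>eps1\<close> or \<open>eps2\<close>.\<close>
  have ideal1: "\<exists>m\<in>carrier Mo. F1 m = pc \<cdot>\<^sub>v x \<and> F2 m = 0\<^sub>v N" if x: "x \<in> carrier_vec N" "\<forall>i<N. x $ i \<in> R" for x
  proof -
    obtain m where m: "m \<in> carrier Mo" "F1 m = x" using surj1[OF x] by blast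
    have "F2 (eps1 \<odot>\<^bsub>Mo\<^esub> m) = 0\<^sub>v N" using F_sm[OF eps(1) m(1)] F_in[OF m(1)] eps by (auto intro!: eq_vecI)
    then show ?thesis using F_sm[OF eps(1) m(1)] sm_in[OF eps(1) m(1)] m eps by (intro bexI[of _ "eps1 \<odot>\<^bsub>Mo\<^esub> m"]) auto
  qed
  have ideal2: "\<exists>m\<in>carrier Mo. F1 m = 0\<^sub>v N \<and> F2 m = \<pi> \<cdot>\<^sub>v y" if y: "y \<in> carrier_vec N" "\<forall>i<N. y $ i \<in> S" for y
  proof -
    obtain m where m: "m \<in> carrier Mo" "F2 m = y" using surj2[OF y] by blast
    have "F1 (eps2 \<odot>\<^bsub>Mo\<^esub> m) = 0\<^sub>v N" using F_sm[OF eps(4) m(1)] F_in[OF m(1)] eps by (auto intro!: eq_vecI)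
    then show ?thesis using F_sm[OF eps(4) m(1)] sm_in[OF eps(4) m(1)] m eps by (intro bexI[of _ "eps2 \<odot>\<^bsub>Mo\<^esub> m"]) auto
  qed
  have "\<exists>m\<in>carrier Mo. F2 m = unit_vec N j" if "j < N" for j
    by (rule surj2) (auto simp: unit_vec_def)
  then obtain b where b: "\<And>j. j < N \<Longrightarrow> b j \<in> carrier Mo" "\<And>j. j < N \<Longrightarrow> F2 (b j) = unit_vec N j" by metis
  define G where "G = mat N N (\<lambda>(i, j). F1 (b j) $ i)"
  have G: "G \<in> carrier_mat N N" "entries_in R G" using F_in[OF b(1)] by (auto simp: G_def entries_in_def)
  have GS: "entries_in S G" using entries_in_mono[OF G(2) R_subset_S] .
  have comb: "\<exists>m\<in>carrier Mo. F1 m = G *\<^sub>v r \<and> F2 m = r" if r: "r \<in> carrier_vec N" "\<forall>i<N. r $ i \<in> R" for r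
  proof -
    have "k \<le> N \<Longrightarrow> \<exists>m\<in>carrier Mo. F1 m = vec N (\<lambda>i. \<Sum>j<k. G $$ (i, j) * r $ j)
        \<and> F2 m = vec N (\<lambda>i. if i < k then r $ i else 0)" for k
    proof (induction k)
      case 0
      obtain m where "m \<in> carrier Mo" "F1 m = pc \<cdot>\<^sub>v 0\<^sub>v N" "F2 m = 0\<^sub>v N" using ideal1[of "0\<^sub>v N"] by auto
      then show ?case by (intro bexI[of _ m]) (auto intro!: eq_vecI)
    next
      case (Suc k)
      then obtain m where m: "m \<in> carrier Mo" "F1 m = vec N (\<lambda>i. \<Sum>j<k. G $$ (i, j) * r $ j)"
        "F2 m = vec N (\<lambda>i. if i < k then r $ i else 0)" by auto
      have k: "k < N" using Suc.prems by simp
      have rk: "r $ k \<in> R" using r k by simp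
      let ?d = "mk (r $ k) (r $ k) \<odot>\<^bsub>Mo\<^esub> b k"
      have t: "mk (r $ k) (r $ k) \<in> Lam" "e1 (mk (r $ k) (r $ k)) = r $ k" "e2 (mk (r $ k) (r $ k)) = r $ k"
        using scalar_in_Lam[OF rk] mk[of "r $ k" "r $ k"] rk by auto
      have d: "?d \<in> carrier Mo" using sm_in t b(1)[OF k] by blast
      have "F1 (m \<oplus>\<^bsub>Mo\<^esub> ?d) = vec N (\<lambda>i. \<Sum>j<Suc k. G $$ (i, j) * r $ j)"
        using F_add[OF m(1) d] F_sm[OF t(1) b(1)[OF k]] t m k F_in[OF b(1)[OF k]]
        by (auto intro!: eq_vecI simp: G_def)
      moreover have "F2 (m \<oplus>\<^bsub>Mo\<^esub> ?d) = vec N (\<lambda>i. if i < Suc k then r $ i else 0)"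
        using F_add[OF m(1) d] F_sm[OF t(1) b(1)[OF k]] t m k b(2)[OF k]
        by (auto intro!: eq_vecI simp: less_Suc_eq)
      ultimately show ?case using add_in[OF m(1) d] by blast
    qed
    from this[of N] obtain m where m: "m \<in> carrier Mo" "F1 m = vec N (\<lambda>i. \<Sum>j<N. G $$ (i, j) * r $ j)"
        "F2 m = vec N (\<lambda>i. if i < N then r $ i else 0)" by auto
    have "F1 m = G *\<^sub>v r" unfolding m(2) using G r
      by (intro eq_vecI) (simp_all add: mult_vec_entry[OF G(1) r(1)] del: index_mult_mat_vec)
    moreover have "F2 m = r" unfolding m(3) using r by (intro eq_vecI) auto
    ultimately show ?thesis using m by blast
  qed
  \<comment> \<open>Coefficients in R act through the scalars (r, r) of \<Lambda>; entries from S
    are reduced to them modulo \<pi>.\<close>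
  have split: "\<exists>r t. r \<in> carrier_vec N \<and> (\<forall>i<N. r $ i \<in> R) \<and> t \<in> carrier_vec N \<and> (\<forall>i<N. t $ i \<in> S) \<and> y = r + \<pi> \<cdot>\<^sub>v t"
    if y: "y \<in> carrier_vec N" "\<forall>i<N. y $ i \<in> S" for y
  proof -
    have "\<exists>r t. r \<in> R \<and> t \<in> S \<and> y $ i = r + \<pi> * t" if i: "i < N" for i
    proof -
      obtain r where r: "r \<in> R" "dvd_in S \<pi> (y $ i - r)" using S_residue[of "y $ i"] y i by blast
      then obtain t where "t \<in> S" "y $ i - r = \<pi> * t" by (auto simp: dvd_in_def)
      then show ?thesis using r by (intro exI[of _ r] exI[of _ t]) (simp add: algebra_simps)
    qed
    then obtain r t where rt: "\<And>i. i < N \<Longrightarrow> r i \<in> R" "\<And>i. i < N \<Longrightarrow> t i \<in> S" "\<And>i. i < N \<Longrightarrow> y $ i = r i + \<pi> * t i"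
      by metis
    then show ?thesis using y by (intro exI[of _ "vec N r"] exI[of _ "vec N t"]) (auto intro!: eq_vecI)
  qed
  have to_glue: "vcong N (F1 m) (G *\<^sub>v F2 m)" if m: "m \<in> carrier Mo" for m
  proof -
    obtain r t where rt: "r \<in> carrier_vec N" "\<forall>i<N. r $ i \<in> R" "t \<in> carrier_vec N" "\<forall>i<N. t $ i \<in> S" "F2 m = r + \<pi> \<cdot>\<^sub>v t"
      using split[of "F2 m"] F_in[OF m] by blast
    obtain u where u: "u \<in> carrier Mo" "F1 u = G *\<^sub>v (- r)" "F2 u = - r" using comb[of "- r"] rt by auto
    obtain v where v: "v \<in> carrier Mo" "F1 v = 0\<^sub>v N" "F2 v = \<pi> \<cdot>\<^sub>v (- t)" using ideal2[of "- t"] rt by auto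
    let ?w = "(m \<oplus>\<^bsub>Mo\<^esub> u) \<oplus>\<^bsub>Mo\<^esub> v"
    have w: "?w \<in> carrier Mo" using m u v add_in by blast
    have Fw: "F1 ?w = F1 m + G *\<^sub>v (- r) + 0\<^sub>v N" "F2 ?w = F2 m + - r + \<pi> \<cdot>\<^sub>v (- t)"
      using F_add[OF add_in[OF m u(1)] v(1)] F_add[OF m u(1)] u v by auto
    have "F2 ?w = 0\<^sub>v N" unfolding Fw rt(5) using rt by (intro eq_vecI) auto
    then obtain w' where w': "w' \<in> carrier Mo" "?w = eps1 \<odot>\<^bsub>Mo\<^esub> w'" using ann[OF w] by blast
    have pw: "F1 m + G *\<^sub>v (- r) + 0\<^sub>v N = pc \<cdot>\<^sub>v F1 w'" using Fw(1) w'(2) F_sm[OF eps(1) w'(1)] eps by simp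
    have GSr: "(G *\<^sub>v r) $ i - (G *\<^sub>v F2 m) $ i = - (\<pi> * (G *\<^sub>v t) $ i)" if "i < N" for i
      using that G rt by (simp add: mult_add_distrib_mat_vec[OF G(1)] mult_mat_vec[OF G(1)] del: index_mult_mat_vec)
    show ?thesis unfolding vcong_def
    proof (intro allI impI)
      fix i assume i: "i < N"
      have gr: "(G *\<^sub>v (- r)) $ i = - ((G *\<^sub>v r) $ i)"
        using mult_vec_entry[OF G(1) rt(1) i] mult_vec_entry[OF G(1) _ i, of "- r"] rt i
        by (simp add: sum_negf del: index_mult_mat_vec)
      have "(F1 m + G *\<^sub>v (- r) + 0\<^sub>v N) $ i = (pc \<cdot>\<^sub>v F1 w') $ i" using pw by simp
      then have "F1 m $ i - (G *\<^sub>v r) $ i = pc * F1 w' $ i"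
        using gr i carrier_vecD[of "F1 w'" N] F_in[OF m] F_in[OF w'(1)] G by (simp del: index_mult_mat_vec)
      then have 1: "dvd_in S \<pi> (F1 m $ i - (G *\<^sub>v r) $ i)"
        using F_in[OF w'(1)] i by (auto intro!: S.dvd_in_mult pi_dvd_p)
      have "(G *\<^sub>v t) $ i \<in> S" using S.mult_vec_in[OF GS G(1) rt(3,4) i] .
      then have "dvd_in S \<pi> ((G *\<^sub>v r) $ i - (G *\<^sub>v F2 m) $ i)"
        unfolding GSr[OF i] by (intro S.dvd_in_uminus S.dvd_in_mult) auto
      then show "dvd_in S \<pi> (F1 m $ i - (G *\<^sub>v F2 m) $ i)" using 1 S.dvd_in_diff_trans by blast
    qed
  qed
  \<comment> \<open>A lift m of y has first component congruent to x modulo \<pi>, hence modulo p,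
    and \<open>ideal1\<close> supplies the difference.\<close>
  have from_glue: "\<exists>m\<in>carrier Mo. F1 m = x \<and> F2 m = y" if xy: "(x, y) \<in> carrier (glue N G)" for x y
  proof -
    have x: "x \<in> carrier_vec N" "\<forall>i<N. x $ i \<in> R" and y: "y \<in> carrier_vec N" "\<forall>i<N. y $ i \<in> S"
      and c: "vcong N x (G *\<^sub>v y)" using xy by auto
    obtain m where m: "m \<in> carrier Mo" "F2 m = y" using surj2[OF y] by blast
    have d: "dvd_in R pc (x $ i - F1 m $ i)" if i: "i < N" for i
    proof (rule dvd_pi_imp_dvd_p)
      show "x $ i - F1 m $ i \<in> R" using x F_in[OF m(1)] i by auto
      have "dvd_in S \<pi> (F1 m $ i - (G *\<^sub>v y) $ i)" using to_glue[OF m(1)] m(2) i by (simp add: vcong_def)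
      moreover have "dvd_in S \<pi> (x $ i - (G *\<^sub>v y) $ i)" using c i by (simp add: vcong_def)
      ultimately show "dvd_in S \<pi> (x $ i - F1 m $ i)" using S.dvd_in_diff_sym S.dvd_in_diff_trans by blast
    qed
    define w where "w i = (x $ i - F1 m $ i) / pc" for i
    have w: "w i \<in> R" "x $ i = F1 m $ i + pc * w i" if i: "i < N" for i
      using d[OF i] by (auto simp: dvd_in_def w_def)
    obtain u where u: "u \<in> carrier Mo" "F1 u = pc \<cdot>\<^sub>v vec N w" "F2 u = 0\<^sub>v N" using ideal1[of "vec N w"] w by auto
    have "F1 (m \<oplus>\<^bsub>Mo\<^esub> u) = x" using F_add[OF m(1) u(1)] u x F_in[OF m(1)]
      by (auto intro!: eq_vecI simp: w(2))
    moreover have "F2 (m \<oplus>\<^bsub>Mo\<^esub> u) = y" using F_add[OF m(1) u(1)] u m y by simp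
    ultimately show ?thesis using add_in[OF m(1) u(1)] by blast
  qed
  \<comment> \<open>Lifts of the unit vectors of R ^ N provide the columns of a right inverse W of G
    modulo \<pi>.\<close>
  have "unit_mod_p (det G)"
  proof -
    have "\<exists>r. r \<in> carrier_vec N \<and> (\<forall>i<N. r $ i \<in> R) \<and> vcong N (unit_vec N j) (G *\<^sub>v r)" if "j < N" for j
    proof -
      have "\<exists>m\<in>carrier Mo. F1 m = unit_vec N j" by (rule surj1) (auto simp: unit_vec_def)
      then obtain m where m: "m \<in> carrier Mo" "F1 m = unit_vec N j" by blast
      obtain r t where rt: "r \<in> carrier_vec N" "\<forall>i<N. r $ i \<in> R" "t \<in> carrier_vec N" "\<forall>i<N. t $ i \<in> S" "F2 m = r + \<pi> \<cdot>\<^sub>v t"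
        using split[of "F2 m"] F_in[OF m(1)] by blast
      have "vcong N (F2 m) r" unfolding vcong_def rt(5) using rt by (auto intro!: dvd_inI)
      then have "vcong N (G *\<^sub>v F2 m) (G *\<^sub>v r)" by (rule vcong_mult_mat[OF _ GS G(1)]) (use F_in[OF m(1)] rt in auto)
      then show ?thesis using to_glue[OF m(1)] vcong_trans m(2) rt by metis
    qed
    then obtain r where r: "\<And>j. j < N \<Longrightarrow> r j \<in> carrier_vec N" "\<And>j. j < N \<Longrightarrow> \<forall>i<N. r j $ i \<in> R"
      "\<And>j. j < N \<Longrightarrow> vcong N (unit_vec N j) (G *\<^sub>v r j)" by metis
    define W where "W = mat N N (\<lambda>(i, j). r j $ i)"
    have W: "W \<in> carrier_mat N N" "entries_in R W" using r by (auto simp: W_def entries_in_def)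
    have "dvd_in S \<pi> (det (G * W) - det (1\<^sub>m N))"
    proof (rule S.det_cong)
      show "entries_in S (G * W)" by (rule S.entries_in_mult[OF GS entries_in_mono[OF W(2) R_subset_S] G(1) W(1)])
      show "entries_in S (1\<^sub>m N)" by (rule one_mat_entries_in[OF ZZ_ring])
      fix i j assume ij: "i < N" "j < N"
      have "(G * W) $$ (i, j) = (G *\<^sub>v r j) $ i"
        unfolding mult_mat_entry[OF G(1) W(1) ij] mult_vec_entry[OF G(1) r(1)[OF ij(2)] ij(1)]
        by (rule sum.cong) (use ij in \<open>auto simp: W_def\<close>)
      then show "dvd_in S \<pi> ((G * W) $$ (i, j) - 1\<^sub>m N $$ (i, j))"
        using r(3)[OF ij(2)] ij S.dvd_in_diff_sym by (simp add: vcong_def unit_vec_def del: index_mult_mat index_mult_mat_vec)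
    qed (use G W in auto)
    then have "dvd_in S \<pi> (det W * det G - 1)" using det_mult[OF G(1) W(1)] by (simp add: mult.commute)
    then show ?thesis using unit_mod_pI_pi R.det_in[OF G(2,1)] R.det_in[OF W(2,1)] by blast
  qed
  moreover have "miso \<Lambda> Mo (glue N G)"
  proof (rule misoI[of _ "\<lambda>m. (F1 m, F2 m)" _ "\<lambda>xy. SOME m. m \<in> carrier Mo \<and> F1 m = fst xy \<and> F2 m = snd xy"])
    show "(F1 m, F2 m) \<in> carrier (glue N G)" if "m \<in> carrier Mo" for m
      using F_in[OF that] to_glue[OF that] by simp
    have some: "(SOME m. m \<in> carrier Mo \<and> F1 m = fst xy \<and> F2 m = snd xy) \<in> carrier Mo \<and>
        F1 (SOME m. m \<in> carrier Mo \<and> F1 m = fst xy \<and> F2 m = snd xy) = fst xy \<and>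
        F2 (SOME m. m \<in> carrier Mo \<and> F1 m = fst xy \<and> F2 m = snd xy) = snd xy" if "xy \<in> carrier (glue N G)" for xy
    proof (rule someI_ex)
      show "\<exists>m. m \<in> carrier Mo \<and> F1 m = fst xy \<and> F2 m = snd xy"
        using from_glue[of "fst xy" "snd xy"] that by auto
    qed
    show "(SOME m. m \<in> carrier Mo \<and> F1 m = fst xy \<and> F2 m = snd xy) \<in> carrier Mo"
      "(F1 (SOME m. m \<in> carrier Mo \<and> F1 m = fst xy \<and> F2 m = snd xy), F2 (SOME m. m \<in> carrier Mo \<and> F1 m = fst xy \<and> F2 m = snd xy)) = xy"
      if "xy \<in> carrier (glue N G)" for xy
      using some[OF that] by (simp_all add: prod_eq_iff)
    show "(SOME m'. m' \<in> carrier Mo \<and> F1 m' = fst (F1 m, F2 m) \<and> F2 m' = snd (F1 m, F2 m)) = m" if "m \<in> carrier Mo" for m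
      by (rule some_equality) (use that inj in auto)
  qed (use F_add F_sm in auto)
  ultimately show ?thesis using G by blast
qed

end

context cyclotomic_pair
begin

lemma submodule_hull_closed:
  fixes n B M
  defines "GM \<equiv> submodule_hull B (free_module A n) M"
  shows "replicate n \<zero>\<^bsub>A\<^esub> \<in> GM" "v \<in> GM \<Longrightarrow> w \<in> GM \<Longrightarrow> map2 (ring.add A) v w \<in> GM"
    "a \<in> carrier B \<Longrightarrow> v \<in> GM \<Longrightarrow> act a v \<in> GM"
  unfolding GM_def submodule_hull_def hull_def
  using submodule_closed(2)[of _ B "free_module A n"] submodule_closed(3)[of _ B "free_module A n" v w]
    submodule_closed(4)[of _ B "free_module A n" a v]
  by (auto simp: regular_module_ops)

text \<open>Over the maximal order \<open>R \<times> S\<close> the module becomes free; the two components of a free basis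
  present the \<open>\<Lambda>\<close>-module as a pair of lattices glued along a matrix.\<close>

lemma locally_free_stably_G1:
  assumes lf: "locally_free (Z_adjoin zm) A Lam n M"
    and st: "stably_isomorphic \<Gamma> (lattice_module A n (extend_scalars A Gam n M)) (free_module \<Gamma> 1)"
  shows "\<exists>r. unit_mod_p r \<and> stably_isomorphic \<Lambda> (lattice_module A n M) (G1 r)"
proof -
  have sub: "submodule M \<Lambda> (free_module A n)" using lf by (simp add: locally_free_def)
  have M_in: "length v = n" "set v \<subseteq> carrier A" if "v \<in> M" for v
    using submodule_closed(1)[OF sub that] by auto
  have M_act: "act a v \<in> M" if "a \<in> Lam" "v \<in> M" for a v using submodule_closed(4)[OF sub, of a v] that by simp
  have M_0: "replicate n \<zero>\<^bsub>A\<^esub> \<in> M" using submodule_closed(2)[OF sub] by simp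
  define GM where "GM = extend_scalars A Gam n M"
  have GM_hull: "GM = submodule_hull \<Gamma> (free_module A n) M" by (simp add: GM_def extend_scalars_def)
  have GM_0: "replicate n \<zero>\<^bsub>A\<^esub> \<in> GM" and GM_add: "\<And>v w. v \<in> GM \<Longrightarrow> w \<in> GM \<Longrightarrow> map2 (ring.add A) v w \<in> GM"
    and GM_act: "\<And>a v. a \<in> Gam \<Longrightarrow> v \<in> GM \<Longrightarrow> act a v \<in> GM"
    unfolding GM_hull by (rule submodule_hull_closed; simp)+
  have M_GM: "M \<subseteq> GM" unfolding GM_hull by (rule submodule_hull_superset)
  have GM_least: "GM \<subseteq> N" if "submodule N \<Gamma> (free_module A n)" "M \<subseteq> N" for N
    unfolding GM_hull using that by (rule submodule_hull_least)
  have "submodule (carrier (free_module A n)) \<Gamma> (free_module A n)"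
  proof (rule submodule_freeI[OF subalg_Gam])
    fix v w assume "v \<in> carrier (free_module A n)" "w \<in> carrier (free_module A n)"
    then show "map2 (ring.add A) v w \<in> carrier (free_module A n)"
      by (auto simp: A_add_closed subset_iff dest: set_zip_leftD set_zip_rightD)
  next
    fix a v assume "a \<in> Gam" "v \<in> carrier (free_module A n)"
    then show "act a v \<in> carrier (free_module A n)" by (auto simp: Gam_iff A_mult_closed subset_iff)
  qed auto
  then have "GM \<subseteq> carrier (free_module A n)" by (rule GM_least) (use M_in in auto)
  then have GM_in: "length v = n" "set v \<subseteq> carrier A" if "v \<in> GM" for v using that by auto
  \<comment> \<open>Over the maximal order the extension of M becomes free after adding a free
    summand. The coordinates of this free module, evaluated at 1 and \<open>zp\<close>, are the maps
    \<open>F1\<close> and \<open>F2\<close> below.\<close>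
  obtain a b where "miso \<Gamma> (direct_sum (lattice_module A n GM) (free_module \<Gamma> a)) (direct_sum (free_module \<Gamma> 1) (free_module \<Gamma> b))"
    using st unfolding stably_isomorphic_miso GM_def by blast
  then have "miso \<Gamma> (direct_sum (lattice_module A n GM) (free_module \<Gamma> a)) (free_module \<Gamma> (1 + b))"
    using miso_power_split miso_trans by blast
  then obtain f g where fg: "inverse_isos \<Gamma> (direct_sum (lattice_module A n GM) (free_module \<Gamma> a)) (free_module \<Gamma> (1 + b)) f g"
    by (rule misoE)
  define N where "N = 1 + b"
  define GL where "GL = {l. length l = a \<and> set l \<subseteq> Gam}"
  define LL where "LL = {l. length l = a \<and> set l \<subseteq> Lam}"
  have LG: "LL \<subseteq> GL" using Lam_Gam by (auto simp: LL_def GL_def)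
  note fg' = fg[folded N_def, unfolded inverse_isos_def]
  have f_in: "length (f (v, l)) = N" "i < N \<Longrightarrow> f (v, l) ! i \<in> Gam" and g_f: "g (f (v, l)) = (v, l)"
    if "v \<in> GM" "l \<in> GL" for v l i
    using fg' that by (auto simp: GL_def subset_iff)
  have g_in: "fst (g w) \<in> GM" "snd (g w) \<in> GL" and f_g: "f (g w) = w"
    if "length w = N" "set w \<subseteq> Gam" for w
    using fg' that by (auto simp: GL_def mem_Times_iff)
  have f_add: "f (map2 (ring.add A) v v', map2 (ring.add A) l l') = map2 (ring.add A) (f (v, l)) (f (v', l'))"
    if "v \<in> GM" "v' \<in> GM" "l \<in> GL" "l' \<in> GL" for v v' l l'
    using fg' that by (auto simp: GL_def regular_module_ops)
  have f_act: "f (act c v, act c l) = act c (f (v, l))" if "c \<in> Gam" "v \<in> GM" "l \<in> GL" for c v l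
    using fg' that by (auto simp: GL_def)
  have GL_act: "act c l \<in> GL" if "c \<in> Gam" "l \<in> GL" for c l
    using that Gam_closed(4) by (auto simp: GL_def)
  have GL_0: "replicate a \<zero>\<^bsub>A\<^esub> \<in> GL" "replicate a \<zero>\<^bsub>A\<^esub> \<in> LL"
    using Gam_closed(1) Lam_zero by (auto simp: GL_def LL_def)
  define F1 where "F1 vl = vec N (\<lambda>i. e1 (f vl ! i))" for vl
  define F2 where "F2 vl = vec N (\<lambda>i. e2 (f vl ! i))" for vl
  have F_in: "F1 (v, l) \<in> carrier_vec N" "F2 (v, l) \<in> carrier_vec N" "i < N \<Longrightarrow> F1 (v, l) $ i \<in> R" "i < N \<Longrightarrow> F2 (v, l) $ i \<in> S"
    if "v \<in> GM" "l \<in> GL" for v l i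
    using f_in(2)[OF that] by (auto simp: F1_def F2_def Gam_iff)
  have F_add: "F1 (map2 (ring.add A) v v', map2 (ring.add A) l l') = F1 (v, l) + F1 (v', l')"
      "F2 (map2 (ring.add A) v v', map2 (ring.add A) l l') = F2 (v, l) + F2 (v', l')"
    if "v \<in> GM" "v' \<in> GM" "l \<in> GL" "l' \<in> GL" for v v' l l'
    unfolding F1_def F2_def f_add[OF that] using f_in(1) that by (auto intro!: eq_vecI)
  have F_act: "F1 (act c v, act c l) = e1 c \<cdot>\<^sub>v F1 (v, l)" "F2 (act c v, act c l) = e2 c \<cdot>\<^sub>v F2 (v, l)"
    if "c \<in> Gam" "v \<in> GM" "l \<in> GL" for c v l
    unfolding F1_def F2_def f_act[OF that] using f_in[OF that(2,3)] that(1) by (auto intro!: eq_vecI simp: e_mult Gam_iff)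
  have F_inj: "(v, l) = (v', l')" if "v \<in> GM" "l \<in> GL" "v' \<in> GM" "l' \<in> GL" "F1 (v, l) = F1 (v', l')" "F2 (v, l) = F2 (v', l')" for v l v' l'
  proof -
    have "f (v, l) = f (v', l')"
    proof (rule list_eqI)
      fix i assume "i < length (f (v', l'))"
      then have i: "i < N" using f_in that by simp
      show "f (v, l) ! i \<in> carrier A \<and> f (v', l') ! i \<in> carrier A \<and> e1 (f (v, l) ! i) = e1 (f (v', l') ! i) \<and> e2 (f (v, l) ! i) = e2 (f (v', l') ! i)"
        using f_in(2)[OF that(1,2) i] f_in(2)[OF that(3,4) i] arg_cong[OF that(5), of "\<lambda>v. v $ i"] arg_cong[OF that(6), of "\<lambda>v. v $ i"] i
        by (simp add: F1_def F2_def Gam_iff)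
    qed (use f_in that in simp)
    then show ?thesis using g_f that by metis
  qed
  have F_surj: "\<exists>v\<in>GM. \<exists>l\<in>GL. F1 (v, l) = x \<and> F2 (v, l) = y"
    if x: "x \<in> carrier_vec N" "\<forall>i<N. x $ i \<in> R" and y: "y \<in> carrier_vec N" "\<forall>i<N. y $ i \<in> S" for x y
  proof -
    define w where "w = map (\<lambda>i. mk (x $ i) (y $ i)) [0..<N]"
    have w: "length w = N" "set w \<subseteq> Gam" using x y by (auto simp: w_def intro!: mk_Gam)
    have "F1 (g w) = x" "F2 (g w) = y" using f_g[OF w] x y mk
      by (auto simp: F1_def F2_def w_def intro!: eq_vecI)
    then show ?thesis using g_in[OF w] by (metis prod.collapse)
  qed
  \<comment> \<open>For one component at a time, M plus a free \<Lambda>-module attains every value: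
    a scalar of the maximal order can be replaced by one of \<Lambda> with the same component. Only
    the two components jointly are constrained.\<close>
  have down: "\<exists>v'\<in>M. \<exists>l'\<in>LL. q (v', l') = q (v, l)"
    if sel: "(q = F1 \<and> E = e1 \<and> c = mk 1 0) \<or> (q = F2 \<and> E = e2 \<and> c = mk 0 1)" and vl: "v \<in> GM" "l \<in> GL" for q E c v l
  proof -
    have c: "c \<in> Gam" "E c = 1" and c_eq: "\<And>x y. x \<in> Gam \<Longrightarrow> y \<in> Gam \<Longrightarrow> E x = E y \<Longrightarrow> c \<otimes>\<^bsub>A\<^esub> x = c \<otimes>\<^bsub>A\<^esub> y"
      using sel mk[of 1 0] mk[of 0 1] mk_Gam[of 1 0] mk_Gam[of 0 1] by (auto intro!: e_eqI simp: A_mult_closed e_mult Gam_iff)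
    have q_add: "q (map2 (ring.add A) v v', map2 (ring.add A) l l') = q (v, l) + q (v', l')"
      if "v \<in> GM" "v' \<in> GM" "l \<in> GL" "l' \<in> GL" for v v' l l' using sel F_add[OF that] by auto
    have q_act: "q (act c v, act c l) = E c \<cdot>\<^sub>v q (v, l)" if "c \<in> Gam" "v \<in> GM" "l \<in> GL" for c v l
      using sel F_act[OF that] by auto
    have q_in: "q (v, l) \<in> carrier_vec N" if "v \<in> GM" "l \<in> GL" for v l using sel F_in[OF that] by auto
    have lift: "\<exists>d\<in>Lam. E d = E x" if "x \<in> Gam" for x using sel residue_lift that by (auto simp: Gam_iff)
    let ?Z = "replicate n \<zero>\<^bsub>A\<^esub>" and ?W = "replicate a \<zero>\<^bsub>A\<^esub>"
    have zero_act: "act d (replicate k \<zero>\<^bsub>A\<^esub>) = replicate k \<zero>\<^bsub>A\<^esub>" if "d \<in> Gam" for d k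
      using that by (simp add: Gam_iff)
    have add_zero: "map2 (ring.add A) v (replicate (length v) \<zero>\<^bsub>A\<^esub>) = v"
      "map2 (ring.add A) (replicate (length v) \<zero>\<^bsub>A\<^esub>) v = v" if "set v \<subseteq> carrier A" for v
      using that by (auto intro!: nth_equalityI simp: subset_iff)
    \<comment> \<open>A submodule over the maximal order that contains M, so it contains the whole
      extension.\<close>
    define V where "V = {v \<in> GM. \<exists>v'\<in>M. q (v', ?W) = q (v, ?W)}"
    have "submodule V \<Gamma> (free_module A n)"
    proof (rule submodule_freeI[OF subalg_Gam])
      show "V \<subseteq> carrier (free_module A n)" using GM_in by (auto simp: V_def)
      show "?Z \<in> V" using GM_0 M_0 by (auto simp: V_def)
      fix v w assume "v \<in> V" "w \<in> V"
      then obtain v' w' where vw: "v \<in> GM" "w \<in> GM" "v' \<in> M" "w' \<in> M" "q (v', ?W) = q (v, ?W)" "q (w', ?W) = q (w, ?W)"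
        by (auto simp: V_def)
      have OO: "map2 (ring.add A) ?W ?W = ?W" using add_zero(1)[of ?W] by (simp add: set_replicate_conv_if A_zero_closed)
      have "q (map2 (ring.add A) v' w', ?W) = q (map2 (ring.add A) v w, ?W)"
        using q_add[of v' w' ?W ?W] q_add[of v w ?W ?W] vw M_GM GL_0 OO by auto
      moreover have "map2 (ring.add A) v' w' \<in> M" using submodule_closed(3)[OF sub, of v' w'] vw by (simp add: regular_module_ops)
      ultimately show "map2 (ring.add A) v w \<in> V" using GM_add vw unfolding V_def by blast
    next
      fix d v assume d: "d \<in> Gam" and "v \<in> V"
      then obtain v' where v: "v \<in> GM" "v' \<in> M" "q (v', ?W) = q (v, ?W)" by (auto simp: V_def)
      obtain t where t: "t \<in> Lam" "E t = E d" using lift[OF d] by blast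
      have tG: "t \<in> Gam" using t Lam_Gam by blast
      have "q (act t v', ?W) = q (act d v, ?W)"
        using q_act[OF tG subsetD[OF M_GM v(2)] GL_0(1)] q_act[OF d v(1) GL_0(1)] v(3) t(2)
        unfolding zero_act[OF tG] zero_act[OF d] by simp
      then show "act d v \<in> V" using GM_act[OF d v(1)] M_act[OF t(1) v(2)] unfolding V_def by blast
    qed
    moreover have "M \<subseteq> V" using M_GM by (auto simp: V_def)
    ultimately have "GM \<subseteq> V" by (rule GM_least)
    then obtain v' where v': "v' \<in> M" "q (v', ?W) = q (v, ?W)" using vl by (auto simp: V_def)
    have "\<forall>x\<in>set l. \<exists>d\<in>Lam. E d = E x" using lift vl by (auto simp: GL_def)
    then obtain d where d: "\<And>x. x \<in> set l \<Longrightarrow> d x \<in> Lam \<and> E (d x) = E x" by metis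
    define l' where "l' = map d l"
    have l': "l' \<in> LL" using d vl by (auto simp: l'_def LL_def GL_def)
    have l'G: "l' \<in> GL" using l' LG by blast
    \<comment> \<open>The idempotent c, which is (1, 0) or (0, 1), makes l and l' equal and leaves
      the component q unchanged.\<close>
    have "act c l' = act c l" unfolding l'_def map_map o_def
      by (rule map_cong[OF refl], rule c_eq) (use d vl Lam_Gam in \<open>auto simp: GL_def\<close>)
    then have "E c \<cdot>\<^sub>v q (?Z, l') = E c \<cdot>\<^sub>v q (?Z, l)"
      using q_act[OF c(1) GM_0 l'G] q_act[OF c(1) GM_0 vl(2)] by simp
    then have ql: "q (?Z, l') = q (?Z, l)" using c(2) by simp
    have lens: "length v' = n" "length v = n" "length l = a" "length l' = a"
      "set v' \<subseteq> carrier A" "set v \<subseteq> carrier A" "set l \<subseteq> carrier A" "set l' \<subseteq> carrier A"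
      using M_in v' GM_in vl l'G by (auto simp: GL_def Gam_iff subset_iff)
    have "q (v', l') = q (v', ?W) + q (?Z, l')"
      using q_add[of v' ?Z ?W l'] v' M_GM GM_0 GL_0 l'G add_zero[of v'] add_zero[of l'] lens by auto
    also have "\<dots> = q (v, ?W) + q (?Z, l)" using v' ql by simp
    also have "\<dots> = q (v, l)"
      using q_add[of v ?Z ?W l] vl GM_0 GL_0 add_zero[of v] add_zero[of l] lens by auto
    finally show ?thesis using v' l' by blast
  qed
  define Mo where "Mo = direct_sum (lattice_module A n M) (free_module \<Lambda> a)"
  have Mo: "carrier Mo = M \<times> LL" by (simp add: Mo_def LL_def)
  have Mo_add: "(v, l) \<oplus>\<^bsub>Mo\<^esub> (v', l') = (map2 (ring.add A) v v', map2 (ring.add A) l l')" for v l v' l'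
    by (simp add: Mo_def regular_module_ops)
  have Mo_act: "c \<odot>\<^bsub>Mo\<^esub> (v, l) = (act c v, act c l)" for c v l by (simp add: Mo_def)
  have "\<exists>G\<in>carrier_mat N N. entries_in R G \<and> unit_mod_p (det G) \<and> miso \<Lambda> Mo (glue N G)"
  proof (rule glue_of_embedding)
    show "closed_module \<Lambda> Mo" unfolding Mo_def by (rule closed_direct_sum[OF closed_lattice_module[OF sub] closed_free])
    fix mo assume mo: "mo \<in> carrier Mo"
    then obtain v l where vl: "mo = (v, l)" "v \<in> M" "l \<in> LL" unfolding Mo by blast
    then have vlG: "v \<in> GM" "l \<in> GL" using M_GM LG by auto
    show "F1 mo \<in> carrier_vec N \<and> F2 mo \<in> carrier_vec N \<and> (\<forall>i<N. F1 mo $ i \<in> R \<and> F2 mo $ i \<in> S)"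
      using F_in[OF vlG] vl by auto
    show "F1 (c \<odot>\<^bsub>Mo\<^esub> mo) = e1 c \<cdot>\<^sub>v F1 mo \<and> F2 (c \<odot>\<^bsub>Mo\<^esub> mo) = e2 c \<cdot>\<^sub>v F2 mo" if "c \<in> Lam" for c
      using F_act[OF _ vlG, of c] that Lam_Gam unfolding vl Mo_act by auto
    show "\<exists>mo'\<in>carrier Mo. mo = eps1 \<odot>\<^bsub>Mo\<^esub> mo'" if F2: "F2 mo = 0\<^sub>v N"
    proof -
      have epsG: "eps1 \<in> Gam" "eps2 \<in> Gam" using eps Lam_Gam by auto
      have zG: "\<zero>\<^bsub>A\<^esub> \<in> Gam" by (rule Gam_closed)
      \<comment> \<open>By means of \<open>eps2\<close>, the vanishing of \<open>F2\<close> passes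
        through the jointly injective coordinates to every entry of v and l.\<close>
      have "(act eps2 v, act eps2 l) = (act \<zero>\<^bsub>A\<^esub> v, act \<zero>\<^bsub>A\<^esub> l)"
      proof (rule F_inj)
        show "F1 (act eps2 v, act eps2 l) = F1 (act \<zero>\<^bsub>A\<^esub> v, act \<zero>\<^bsub>A\<^esub> l)"
          using F_act(1)[OF epsG(2) vlG] F_act(1)[OF zG vlG] eps F_in[OF vlG] by (auto intro!: eq_vecI)
        show "F2 (act eps2 v, act eps2 l) = F2 (act \<zero>\<^bsub>A\<^esub> v, act \<zero>\<^bsub>A\<^esub> l)"
          using F_act(2)[OF epsG(2) vlG] F_act(2)[OF zG vlG] F2 vl by (auto intro!: eq_vecI)
      qed (use GM_act GL_act epsG zG vlG in auto)
      then have eq: "\<And>x. x \<in> set v \<union> set l \<Longrightarrow> eps2 \<otimes>\<^bsub>A\<^esub> x = \<zero>\<^bsub>A\<^esub> \<otimes>\<^bsub>A\<^esub> x" by auto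
      have e20: "e2 x = 0" if x: "x \<in> set v \<union> set l" for x
      proof -
        have xA: "x \<in> carrier A" using x M_in[OF vl(2)] vl(3) Lam_subset by (auto simp: LL_def)
        have "e2 (eps2 \<otimes>\<^bsub>A\<^esub> x) = e2 (\<zero>\<^bsub>A\<^esub> \<otimes>\<^bsub>A\<^esub> x)" using eq[OF x] by simp
        then show ?thesis using xA eps Lam_simps(1)[OF eps(4)] by (simp add: e_mult A_zero_closed)
      qed
      obtain v' where v': "v' \<in> M" "v = act eps1 v'" using locally_free_annihilator[OF lf vl(2)] e20 by auto
      define l' where "l' = map (\<lambda>x. mk (e1 x / pc) (e1 x / pc)) l"
      have lx: "mk (e1 x / pc) (e1 x / pc) \<in> Lam" "eps1 \<otimes>\<^bsub>A\<^esub> mk (e1 x / pc) (e1 x / pc) = x" if x: "x \<in> set l" for x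
      proof -
        have xL: "x \<in> Lam" using vl(3) x by (auto simp: LL_def)
        note xs = Lam_simps[OF xL]
        have "dvd_in R pc (e1 x)" using xs e20[of x] x by (intro dvd_pi_imp_dvd_p) auto
        then have "e1 x / pc \<in> R" by (auto simp: dvd_in_def)
        then show "mk (e1 x / pc) (e1 x / pc) \<in> Lam" "eps1 \<otimes>\<^bsub>A\<^esub> mk (e1 x / pc) (e1 x / pc) = x"
          using xs e20[of x] x mk[of "e1 x / pc" "e1 x / pc"] eps Lam_simps(1)[OF eps(1)]
          by (auto intro!: e_eqI scalar_in_Lam simp: e_mult A_mult_closed)
      qed
      have "l' \<in> LL" "act eps1 l' = l" using lx vl(3) by (auto simp: l'_def LL_def intro: map_idI)
      then show ?thesis using v' unfolding vl Mo by (intro bexI[of _ "(v', l')"]) (auto simp: Mo_act)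
    qed
    fix mo' assume mo': "mo' \<in> carrier Mo"
    then obtain w k where wk: "mo' = (w, k)" "w \<in> M" "k \<in> LL" unfolding Mo by blast
    then have wkG: "w \<in> GM" "k \<in> GL" using M_GM LG by auto
    show "F1 (mo \<oplus>\<^bsub>Mo\<^esub> mo') = F1 mo + F1 mo' \<and> F2 (mo \<oplus>\<^bsub>Mo\<^esub> mo') = F2 mo + F2 mo'"
      unfolding vl wk Mo_add using F_add[OF vlG(1) wkG(1) vlG(2) wkG(2)] by simp
    show "mo = mo'" if "F1 mo = F1 mo'" "F2 mo = F2 mo'"
      unfolding vl wk by (rule F_inj[OF vlG wkG]) (use that vl wk in auto)
  next
    fix x :: "complex vec" assume x: "x \<in> carrier_vec N" "\<forall>i<N. x $ i \<in> R"
    obtain v l where vl: "v \<in> GM" "l \<in> GL" "F1 (v, l) = x" using F_surj[OF x, of "0\<^sub>v N"] by auto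
    then show "\<exists>mo\<in>carrier Mo. F1 mo = x" using down[of F1 e1 "mk 1 0" v l] unfolding Mo by auto
  next
    fix y :: "complex vec" assume y: "y \<in> carrier_vec N" "\<forall>i<N. y $ i \<in> S"
    obtain v l where vl: "v \<in> GM" "l \<in> GL" "F2 (v, l) = y" using F_surj[OF _ _ y, of "0\<^sub>v N"] by auto
    then show "\<exists>mo\<in>carrier Mo. F2 mo = y" using down[of F2 e2 "mk 0 1" v l] unfolding Mo by auto
  qed
  then obtain G where G: "G \<in> carrier_mat N N" "entries_in R G" "unit_mod_p (det G)" "miso \<Lambda> Mo (glue N G)" by blast
  obtain r where r: "unit_mod_p r" "stably_isomorphic \<Lambda> (glue N G) (G1 r)" using glue_stably_G1[OF G(1-3)] by blast
  have "stably_isomorphic \<Lambda> (lattice_module A n M) Mo"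
    unfolding Mo_def by (rule stably_sym[OF stably_absorb])
      (use closed_direct_sum[OF closed_lattice_module[OF sub] closed_free] in \<open>auto simp: closed_module_def Lam_add Lam_mult\<close>)
  then have "stably_isomorphic \<Lambda> (lattice_module A n M) (G1 r)"
    by (rule stably_trans[OF stably_trans[OF _ miso_imp_stably[OF G(4)]] r(2)])
  then show ?thesis using r(1) by blast
qed

end

section \<open>The cokernel\<close>

context cyclotomic_pair
begin

abbreviation \<rho> where "\<rho> \<equiv> reduction zp zmp"
abbreviation Res where "Res \<equiv> residue_units zp zmp"
abbreviation Hs where "Hs \<equiv> \<rho> ` Units (Z_adjoin zmp)"

lemma residue_ideal: "ideal (residue_ideal zp zmp) (Z_adjoin zmp)"
  unfolding residue_ideal_def by (rule cring.cgenideal_ideal[OF cring_Z_adjoin pi_in_S])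

lemma residue_ideal_iff: "x \<in> residue_ideal zp zmp \<longleftrightarrow> dvd_in S \<pi> x"
  unfolding residue_ideal_def cgenideal_def dvd_in_def by (auto simp: mult.commute)

lemma reduction_eq: "\<rho> x = {y. dvd_in S \<pi> (y - x)}"
proof -
  have "\<rho> x = {y. y - x \<in> residue_ideal zp zmp}"
    unfolding reduction_def a_r_coset_def' by (auto intro!: bexI[of _ "_ - x"])
  then show ?thesis by (simp add: residue_ideal_iff)
qed

lemma reduction_eq_iff: "\<rho> x = \<rho> y \<longleftrightarrow> dvd_in S \<pi> (x - y)"
proof
  assume "\<rho> x = \<rho> y"
  moreover have "x \<in> \<rho> x" by (simp add: reduction_eq)
  ultimately show "dvd_in S \<pi> (x - y)" by (simp add: reduction_eq)
next
  assume "dvd_in S \<pi> (x - y)"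
  then show "\<rho> x = \<rho> y" unfolding reduction_eq
    using S.dvd_in_diff_trans S.dvd_in_diff_sym by blast
qed

lemma quotient_simps:
  "carrier (Z_adjoin zmp Quot residue_ideal zp zmp) = \<rho> ` S"
  "\<one>\<^bsub>Z_adjoin zmp Quot residue_ideal zp zmp\<^esub> = \<rho> 1"
  "x \<in> S \<Longrightarrow> y \<in> S \<Longrightarrow> \<rho> x \<otimes>\<^bsub>Z_adjoin zmp Quot residue_ideal zp zmp\<^esub> \<rho> y = \<rho> (x * y)"
  using ideal.rcoset_mult_add[OF residue_ideal, of x y]
  by (auto simp: FactRing_def A_RCOSETS_def' reduction_def)

lemma comm_group_Res: "comm_group Res"
proof -
  interpret Q: cring "Z_adjoin zmp Quot residue_ideal zp zmp"
    by (rule ideal.quotient_is_cring[OF residue_ideal cring_Z_adjoin])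
  show ?thesis unfolding residue_units_def by (rule Q.units_comm_group)
qed

lemma Res_simps:
  "\<one>\<^bsub>Res\<^esub> = \<rho> 1" "x \<in> S \<Longrightarrow> y \<in> S \<Longrightarrow> \<rho> x \<otimes>\<^bsub>Res\<^esub> \<rho> y = \<rho> (x * y)"
  by (simp_all add: residue_units_def units_of_one units_of_mult quotient_simps)

lemma Res_carrierI:
  assumes "x \<in> S" "y \<in> S" "dvd_in S \<pi> (y * x - 1)"
  shows "\<rho> x \<in> carrier Res"
proof -
  have "\<rho> (y * x) = \<rho> 1" "\<rho> (x * y) = \<rho> 1"
    using assms(3) by (simp_all add: reduction_eq_iff mult.commute)
  then show ?thesis
    using assms(1,2) unfolding residue_units_def units_of_carrier Units_def quotient_simps
    by (auto simp: quotient_simps intro!: bexI[of _ y])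
qed

lemma Res_unit_mod_p: "unit_mod_p r \<Longrightarrow> \<rho> r \<in> carrier Res"
  using unit_mod_p_pi[of r] R_in_S Res_carrierI unfolding unit_mod_p_def by blast

text \<open>Since \<open>\<zeta>\<^sub>p \<equiv> 1\<close>, the residue ring is already exhausted by \<open>R\<close>.\<close>

lemma Res_carrier: "carrier Res = \<rho> ` {r. unit_mod_p r}"
proof (intro equalityI subsetI)
  fix c assume "c \<in> carrier Res"
  then obtain x y where xy: "c = \<rho> x" "x \<in> S" "y \<in> S" "\<rho> (x * y) = \<rho> 1"
    unfolding residue_units_def units_of_carrier Units_def quotient_simps by (auto simp: quotient_simps)
  obtain r u where ru: "r \<in> R" "u \<in> R" "dvd_in S \<pi> (x - r)" "dvd_in S \<pi> (y - u)"
    using S_residue xy by meson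
  have "dvd_in S \<pi> (x * y - r * u)"
    using S.dvd_in_mult[OF ru(3) xy(3)] S.dvd_in_mult'[OF ru(4) R_in_S[OF ru(1)]]
      S.dvd_in_add[of \<pi> "(x - r) * y" "r * (y - u)"] by (simp add: algebra_simps)
  then have "dvd_in S \<pi> (u * r - 1)"
    using xy(4) S.dvd_in_diff_trans S.dvd_in_diff_sym unfolding reduction_eq_iff by (metis mult.commute)
  then have "unit_mod_p r" using unit_mod_pI_pi ru by blast
  then show "c \<in> \<rho> ` {r. unit_mod_p r}" using xy(1) ru(3) reduction_eq_iff by blast
qed (use Res_unit_mod_p in auto)

lemma Units_Z_adjoin: "u \<in> Units (Z_adjoin z) \<longleftrightarrow> u \<in> ZZ z \<and> (\<exists>v\<in>ZZ z. u * v = 1)"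
  by (auto simp: Units_def mult.commute)

lemma Units_reduction: "u \<in> Units (Z_adjoin zmp) \<Longrightarrow> \<rho> u \<in> carrier Res"
  by (auto simp: Units_Z_adjoin mult.commute intro: Res_carrierI)

lemma inv_reduction:
  assumes "u \<in> S" "v \<in> S" "u * v = 1"
  shows "inv\<^bsub>Res\<^esub> (\<rho> v) = \<rho> u"
proof -
  interpret Q: comm_group Res by (rule comm_group_Res)
  have "u \<in> Units (Z_adjoin zmp)" "v \<in> Units (Z_adjoin zmp)"
    using assms by (auto simp: Units_Z_adjoin mult.commute)
  then show ?thesis using assms Units_reduction by (intro Q.inv_equality) (simp_all add: Res_simps)
qed

lemma subgroup_Hs: "subgroup Hs Res"
proof -
  interpret Q: comm_group Res by (rule comm_group_Res)
  show ?thesis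
  proof (rule Q.subgroupI)
    show "Hs \<subseteq> carrier Res" using Units_reduction by blast
    show "Hs \<noteq> {}" using Units_Z_adjoin[of 1 zmp] by auto
    show "inv\<^bsub>Res\<^esub> a \<in> Hs" if a: "a \<in> Hs" for a
    proof -
      obtain v u where "a = \<rho> v" "v \<in> S" "u \<in> S" "v * u = 1" using a by (auto simp: Units_Z_adjoin)
      moreover from this have "u \<in> Units (Z_adjoin zmp)" by (auto simp: Units_Z_adjoin mult.commute)
      ultimately show ?thesis using inv_reduction[of u v] by (simp add: mult.commute)
    qed
    show "a \<otimes>\<^bsub>Res\<^esub> b \<in> Hs" if ab: "a \<in> Hs" "b \<in> Hs" for a b
    proof -
      obtain u v u' v' where u: "a = \<rho> u" "u \<in> S" "u' \<in> S" "u * u' = 1" and v: "b = \<rho> v" "v \<in> S" "v' \<in> S" "v * v' = 1"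
        using ab by (auto simp: Units_Z_adjoin)
      have "(u * v) * (u' * v') = 1" using arg_cong2[OF u(4) v(4), of "(*)"] by (simp add: ac_simps)
      then have "u * v \<in> Units (Z_adjoin zmp)"
        unfolding Units_Z_adjoin using u v by (intro conjI bexI[of _ "u' * v'"]) simp_all
      moreover have "a \<otimes>\<^bsub>Res\<^esub> b = \<rho> (u * v)" using u v by (simp add: Res_simps)
      ultimately show ?thesis by blast
    qed
  qed
qed

text \<open>Units of R are units of S, so all pairs land in the image of the units of S, and the
  pairs (1, v) already reach all of it.\<close>

lemma h_image: "h zp zmp ` carrier (units_of (Z_adjoin zm) \<times>\<times> units_of (Z_adjoin zmp)) = Hs"
proof (intro equalityI subsetI)
  fix c assume "c \<in> h zp zmp ` carrier (units_of (Z_adjoin zm) \<times>\<times> units_of (Z_adjoin zmp))"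
  then obtain u v where uv: "u \<in> Units (Z_adjoin zm)" "v \<in> Units (Z_adjoin zmp)"
    "c = \<rho> u \<otimes>\<^bsub>Res\<^esub> inv\<^bsub>Res\<^esub> (\<rho> v)" by (auto simp: DirProd_def units_of_carrier h_def)
  obtain v' where v': "v' \<in> S" "v' * v = 1" "v \<in> S" using uv(2) by (auto simp: Units_Z_adjoin mult.commute)
  have "u \<in> Units (Z_adjoin zmp)" using uv(1) R_in_S unfolding Units_Z_adjoin by blast
  moreover have "v' \<in> Units (Z_adjoin zmp)" using v' unfolding Units_Z_adjoin by blast
  ultimately show "c \<in> Hs"
    unfolding uv(3) inv_reduction[OF v'(1,3,2)] by (intro subgroup.m_closed[OF subgroup_Hs] imageI)
next
  fix c assume "c \<in> Hs"
  then obtain u v where uv: "c = \<rho> u" "u \<in> S" "v \<in> S" "u * v = 1" by (auto simp: Units_Z_adjoin)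
  have "c = h zp zmp (1, v)" using uv inv_reduction[OF uv(2-4)] by (simp add: h_def Res_simps)
  moreover have "(1, v) \<in> carrier (units_of (Z_adjoin zm) \<times>\<times> units_of (Z_adjoin zmp))"
    using uv by (auto simp: DirProd_def units_of_carrier Units_Z_adjoin mult.commute)
  ultimately show "c \<in> h zp zmp ` carrier (units_of (Z_adjoin zm) \<times>\<times> units_of (Z_adjoin zmp))" by blast
qed

lemma cok_h_eq: "cok_h zm zp zmp = Res Mod Hs"
  unfolding cok_h_def h_image ..

text \<open>The condition on the right is that of \<open>cl_eq_iff\<close>; this makes the map from
  Swan classes to cosets well defined and injective.\<close>

lemma coset_eq_iff:
  assumes r: "unit_mod_p r" "unit_mod_p s"
  shows "Hs #>\<^bsub>Res\<^esub> \<rho> r = Hs #>\<^bsub>Res\<^esub> \<rho> s \<longleftrightarrow> (\<exists>u\<in>S. \<exists>v\<in>S. u * v = 1 \<and> dvd_in S \<pi> (r - s * u))"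
proof -
  interpret Q: comm_group Res by (rule comm_group_Res)
  have in_S: "s \<in> S" using r R_in_S by (simp add: unit_mod_p_def)
  have "Hs #>\<^bsub>Res\<^esub> \<rho> r = Hs #>\<^bsub>Res\<^esub> \<rho> s \<longleftrightarrow> \<rho> r \<in> Hs #>\<^bsub>Res\<^esub> \<rho> s"
    using Q.repr_independence[OF _ _ subgroup_Hs] Q.rcos_self[OF _ subgroup_Hs] Res_unit_mod_p r by metis
  also have "\<dots> \<longleftrightarrow> (\<exists>u\<in>Units (Z_adjoin zmp). \<rho> r = \<rho> u \<otimes>\<^bsub>Res\<^esub> \<rho> s)" by (auto simp: r_coset_def)
  also have "\<dots> \<longleftrightarrow> (\<exists>u\<in>Units (Z_adjoin zmp). dvd_in S \<pi> (r - s * u))"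
    using in_S by (intro bex_cong) (auto simp: Units_Z_adjoin Res_simps reduction_eq_iff mult.commute)
  also have "\<dots> \<longleftrightarrow> (\<exists>u\<in>S. \<exists>v\<in>S. u * v = 1 \<and> dvd_in S \<pi> (r - s * u))"
    unfolding Bex_def Units_Z_adjoin by blast
  finally show ?thesis .
qed

end

section \<open>Swan classes\<close>

context cyclotomic_pair
begin

interpretation SL: stable_classes "Z_adjoin zm" A Lam
  by unfold_locales (auto simp: Lam_add Lam_mult)

interpretation SG: stable_classes "Z_adjoin zm" A Gam
  by unfold_locales (auto simp: Gam_closed)

abbreviation SwL where "SwL r \<equiv> lattice_module A 1 (singletons (Sw r))"
definition cl where "cl r = stable_class (Z_adjoin zm) A Lam (SwL r)"

lemma T_cl: "T zm p = {cl r | r. unit_mod_p r}"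
  unfolding T_eq cl_def ..

lemma SwL_lattice: "unit_mod_p r \<Longrightarrow> SwL r \<in> locally_free_modules (Z_adjoin zm) A Lam"
  unfolding locally_free_modules_def using locally_free_Sw by blast

lemma SwL_G1:
  assumes "unit_mod_p r"
  shows "stably_isomorphic \<Lambda> (SwL r) (G1 r)" "stably_isomorphic \<Lambda> (G1 r) (SwL r)"
proof -
  have r: "r \<in> R" "r \<noteq> 0" using assms unit_mod_p_nonzero by (auto simp: unit_mod_p_def)
  show 1: "stably_isomorphic \<Lambda> (SwL r) (G1 r)" by (rule miso_imp_stably[OF Sw_miso_G1[OF r]])
  show "stably_isomorphic \<Lambda> (G1 r) (SwL r)" by (rule SL.sym[OF 1 SL.closed_lattice[OF SwL_lattice[OF assms]]])
qed

lemma cl_eq_iff: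
  assumes r: "unit_mod_p r" and s: "unit_mod_p s"
  shows "cl r = cl s \<longleftrightarrow> (\<exists>u\<in>S. \<exists>v\<in>S. u * v = 1 \<and> dvd_in S \<pi> (r - s * u))"
proof -
  have "cl r = cl s \<longleftrightarrow> stably_isomorphic \<Lambda> (SwL r) (SwL s)"
    unfolding cl_def by (rule SL.cls_eq_iff[OF SwL_lattice[OF r] SwL_lattice[OF s]])
  also have "\<dots> \<longleftrightarrow> stably_isomorphic \<Lambda> (G1 r) (G1 s)"
  proof
    assume st: "stably_isomorphic \<Lambda> (SwL r) (SwL s)"
    show "stably_isomorphic \<Lambda> (G1 r) (G1 s)"
      by (rule stably_trans[OF stably_trans[OF SwL_G1(2)[OF r] st] SwL_G1(1)[OF s]])
  next
    assume st: "stably_isomorphic \<Lambda> (G1 r) (G1 s)"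
    show "stably_isomorphic \<Lambda> (SwL r) (SwL s)"
      by (rule stably_trans[OF stably_trans[OF SwL_G1(1)[OF r] st] SwL_G1(2)[OF s]])
  qed
  also have "\<dots> \<longleftrightarrow> (\<exists>u\<in>S. \<exists>v\<in>S. u * v = 1 \<and> dvd_in S \<pi> (r - s * u))"
  proof
    assume "\<exists>u\<in>S. \<exists>v\<in>S. u * v = 1 \<and> dvd_in S \<pi> (r - s * u)"
    then obtain u v where uv: "u \<in> S" "v \<in> S" "u * v = 1" "dvd_in S \<pi> (r - s * u)" by blast
    have rs: "r \<in> R" "s \<in> R" using r s by (auto simp: unit_mod_p_def)
    show "stably_isomorphic \<Lambda> (G1 r) (G1 s)" by (rule miso_imp_stably[OF G1_miso_unit[OF rs uv]])
  qed (rule G1_stably_imp[OF r s])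
  finally show ?thesis .
qed

lemma cl_cong:
  assumes "unit_mod_p r" "unit_mod_p s" "dvd_in S \<pi> (r - s)"
  shows "cl r = cl s"
  unfolding cl_eq_iff[OF assms(1,2)] using assms(3) by (intro bexI[of _ 1]) auto

section \<open>Group structure on the Swan classes\<close>

lemma unit_mod_p_one: "unit_mod_p 1"
  unfolding unit_mod_p_def by (auto intro!: bexI[of _ 1])

lemma SwL_mult:
  assumes r: "unit_mod_p r" and s: "unit_mod_p s"
  shows "stably_isomorphic \<Lambda> (SwL (r * s)) (direct_sum (SwL r) (SwL s))"
proof -
  have rs: "r \<in> R" "s \<in> R" using r s by (auto simp: unit_mod_p_def)
  obtain s' where s': "s' \<in> R" "dvd_in S \<pi> (s' * s - 1)" using unit_mod_p_pi[OF s] by blast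
  have "stably_isomorphic \<Lambda> (direct_sum (G1 r) (G1 s)) (SwL (r * s))"
    by (rule stably_trans[OF G1_direct_sum_stably[OF rs s'] SwL_G1(2)[OF unit_mod_p_mult[OF r s]]])
  then have "stably_isomorphic \<Lambda> (SwL (r * s)) (direct_sum (G1 r) (G1 s))"
    by (rule SL.sym) (intro closed_direct_sum closed_G1 rs)
  then show ?thesis
    by (rule stably_trans) (intro stably_direct_sum SwL_G1(2) r s)
qed

lemma Cl_mult:
  assumes r: "unit_mod_p r" and s: "unit_mod_p s"
  shows "cl r \<otimes>\<^bsub>Cl zm p\<^esub> cl s = cl (r * s)"
  unfolding Cl_def cl_def
  by (rule SL.cls_mult[OF SwL_lattice[OF r] SwL_lattice[OF s] SwL_lattice[OF unit_mod_p_mult[OF r s]] SwL_mult[OF r s]])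

lemma SwL_one: "SwL 1 = free_module \<Lambda> 1"
  unfolding Sw_one free_module_rank_one ..

lemma Cl_one: "\<one>\<^bsub>Cl zm p\<^esub> = cl 1"
  unfolding cl_def SwL_one by (simp add: Cl_def class_group_def)

text \<open>The inverse in \<open>Cl\<close> is a definite description; \<open>cls_inverse\<close>
  evaluates it once some u with r * u congruent to 1 is exhibited.\<close>

lemma Cl_inverse:
  assumes r: "unit_mod_p r"
  shows "\<exists>u. unit_mod_p u \<and> inv\<^bsub>Cl zm p\<^esub> (cl r) = cl u"
proof -
  obtain u where u: "u \<in> R" "dvd_in S \<pi> (u * r - 1)" using unit_mod_p_pi[OF r] by blast
  have rR: "r \<in> R" using r by (simp add: unit_mod_p_def)
  have uu: "unit_mod_p u" by (rule unit_mod_pI_pi[OF u(1) rR]) (use u in \<open>simp add: mult.commute\<close>)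
  have ru: "unit_mod_p (r * u)" by (rule unit_mod_p_mult[OF r uu])
  have "cl 1 = cl (r * u)"
    by (rule cl_cong[OF unit_mod_p_one ru]) (use S.dvd_in_diff_sym[OF u(2)] in \<open>simp add: mult.commute\<close>)
  then have "stably_isomorphic \<Lambda> (SwL 1) (SwL (r * u))"
    using SL.cls_eq_iff[OF SwL_lattice[OF unit_mod_p_one] SwL_lattice[OF ru]] unfolding cl_def by blast
  then have "stably_isomorphic \<Lambda> (SwL 1) (direct_sum (SwL r) (SwL u))"
    by (rule stably_trans[OF _ SwL_mult[OF r uu]])
  then have "inv\<^bsub>Cl zm p\<^esub> (cl r) = cl u"
    unfolding Cl_def cl_def SwL_one
    by (rule SL.cls_inverse[OF SwL_lattice[OF r] SwL_lattice[OF uu] regular_lattice[OF subalg_Lam]])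
  then show ?thesis using uu by blast
qed

lemma subgroup_T: "subgroup (T zm p) (Cl zm p)"
proof (rule subgroup.intro)
  show "T zm p \<subseteq> carrier (Cl zm p)"
    using SwL_lattice by (auto simp: T_cl cl_def Cl_def class_group_def)
  show "\<one>\<^bsub>Cl zm p\<^esub> \<in> T zm p" using unit_mod_p_one unfolding T_cl Cl_one by blast
next
  fix x y assume "x \<in> T zm p" "y \<in> T zm p"
  then obtain r s where "x = cl r" "y = cl s" "unit_mod_p r" "unit_mod_p s" unfolding T_cl by blast
  then have "x \<otimes>\<^bsub>Cl zm p\<^esub> y = cl (r * s)" "unit_mod_p (r * s)" by (simp_all add: Cl_mult unit_mod_p_mult)
  then show "x \<otimes>\<^bsub>Cl zm p\<^esub> y \<in> T zm p" unfolding T_cl by blast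
next
  fix x assume "x \<in> T zm p"
  then obtain r where "x = cl r" "unit_mod_p r" unfolding T_cl by blast
  then obtain u where "inv\<^bsub>Cl zm p\<^esub> x = cl u" "unit_mod_p u" using Cl_inverse by blast
  then show "inv\<^bsub>Cl zm p\<^esub> x \<in> T zm p" unfolding T_cl by blast
qed

lemma T_iso_cok: "(Cl zm p)\<lparr>carrier := T zm p\<rparr> \<cong> cok_h zm zp zmp"
proof -
  interpret Q: comm_group Res by (rule comm_group_Res)
  interpret H: normal Hs Res by (rule Q.subgroup_imp_normal[OF subgroup_Hs])
  \<comment> \<open>The constant r of a class is chosen; by \<open>cl_eq_iff\<close> and
    \<open>coset_eq_iff\<close> the coset does not depend on it.\<close>
  define F where "F c = Hs #>\<^bsub>Res\<^esub> \<rho> (SOME r. unit_mod_p r \<and> c = cl r)" for c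
  have F: "F (cl r) = Hs #>\<^bsub>Res\<^esub> \<rho> r" if r: "unit_mod_p r" for r
  proof -
    define s where "s = (SOME s. unit_mod_p s \<and> cl r = cl s)"
    have s: "unit_mod_p s \<and> cl r = cl s" unfolding s_def by (rule someI[of _ r]) (simp add: r)
    then have "Hs #>\<^bsub>Res\<^esub> \<rho> r = Hs #>\<^bsub>Res\<^esub> \<rho> s" using cl_eq_iff[of r s] coset_eq_iff[of r s] r by simp
    then show ?thesis by (simp add: F_def s_def)
  qed
  have "F \<in> iso ((Cl zm p)\<lparr>carrier := T zm p\<rparr>) (Res Mod Hs)"
  proof (rule isoI)
    show "F \<in> hom ((Cl zm p)\<lparr>carrier := T zm p\<rparr>) (Res Mod Hs)"
    proof (rule homI)
      fix x assume "x \<in> carrier ((Cl zm p)\<lparr>carrier := T zm p\<rparr>)"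
      then obtain r where r: "x = cl r" "unit_mod_p r" by (auto simp: T_cl)
      then show "F x \<in> carrier (Res Mod Hs)"
        using F Q.rcosetsI[OF H.subset Res_unit_mod_p[OF r(2)]] by (simp add: FactGroup_def)
      fix y assume "y \<in> carrier ((Cl zm p)\<lparr>carrier := T zm p\<rparr>)"
      then obtain s where s: "y = cl s" "unit_mod_p s" by (auto simp: T_cl)
      have "F (x \<otimes>\<^bsub>Cl zm p\<^esub> y) = Hs #>\<^bsub>Res\<^esub> \<rho> (r * s)"
        using F[OF unit_mod_p_mult[OF r(2) s(2)]] Cl_mult[OF r(2) s(2)] r s by simp
      also have "\<dots> = Hs #>\<^bsub>Res\<^esub> (\<rho> r \<otimes>\<^bsub>Res\<^esub> \<rho> s)"
        using Res_simps(2)[of r s] r s R_in_S by (simp add: unit_mod_p_def)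
      also have "\<dots> = F x \<otimes>\<^bsub>Res Mod Hs\<^esub> F y"
        using H.rcos_sum[OF Res_unit_mod_p[OF r(2)] Res_unit_mod_p[OF s(2)]] r s F by (simp add: FactGroup_def)
      finally show "F (x \<otimes>\<^bsub>(Cl zm p)\<lparr>carrier := T zm p\<rparr>\<^esub> y) = F x \<otimes>\<^bsub>Res Mod Hs\<^esub> F y" by simp
    qed
    show "bij_betw F (carrier ((Cl zm p)\<lparr>carrier := T zm p\<rparr>)) (carrier (Res Mod Hs))"
    proof (rule bij_betw_imageI)
      show "inj_on F (carrier ((Cl zm p)\<lparr>carrier := T zm p\<rparr>))"
      proof (rule inj_onI)
        fix x y assume "x \<in> carrier ((Cl zm p)\<lparr>carrier := T zm p\<rparr>)" "y \<in> carrier ((Cl zm p)\<lparr>carrier := T zm p\<rparr>)"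
        then obtain r s where rs: "x = cl r" "unit_mod_p r" "y = cl s" "unit_mod_p s" by (auto simp: T_cl)
        assume "F x = F y"
        then show "x = y" using F cl_eq_iff[OF rs(2,4)] coset_eq_iff[OF rs(2,4)] rs by simp
      qed
      have "F ` T zm p = (\<lambda>r. Hs #>\<^bsub>Res\<^esub> \<rho> r) ` {r. unit_mod_p r}"
        unfolding T_cl using F by (force simp: image_iff)
      also have "\<dots> = rcosets\<^bsub>Res\<^esub> Hs" unfolding RCOSETS_def Res_carrier by blast
      finally show "F ` carrier ((Cl zm p)\<lparr>carrier := T zm p\<rparr>) = carrier (Res Mod Hs)" by (simp add: FactGroup_def)
    qed
  qed
  then show ?thesis unfolding cok_h_eq by (rule is_isoI)
qed

text \<open>Over R x S the gluing condition dissolves and R x r S results, because (r, r) and (p, 0)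
  lie in the Swan module and r is a unit modulo p.\<close>

lemma extend_scalars_Sw:
  assumes r: "unit_mod_p r"
  defines "E \<equiv> {w \<in> carrier A. e1 w \<in> R \<and> (\<exists>y\<in>S. e2 w = r * y)}"
  shows "extend_scalars A Gam 1 (singletons (Sw r)) = singletons E"
    "submodule (singletons E) \<Gamma> (free_module A 1)"
proof -
  have rR: "r \<in> R" and rS: "r \<in> S" using r R_in_S by (auto simp: unit_mod_p_def)
  have E_add: "a \<oplus>\<^bsub>A\<^esub> b \<in> E" if ab: "a \<in> E" "b \<in> E" for a b
  proof -
    obtain y z where "y \<in> S" "z \<in> S" "e2 a = r * y" "e2 b = r * z" using ab by (auto simp: E_def)
    then have "e2 (a \<oplus>\<^bsub>A\<^esub> b) = r * (y + z)" "y + z \<in> S" using ab by (simp_all add: E_def algebra_simps)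
    then show ?thesis using ab by (auto simp: E_def A_add_closed simp del: S.add_in)
  qed
  have E_mult: "a \<otimes>\<^bsub>A\<^esub> b \<in> E" if ab: "a \<in> Gam" "b \<in> E" for a b
  proof -
    obtain z where "z \<in> S" "e2 b = r * z" using ab by (auto simp: E_def)
    then have "e2 (a \<otimes>\<^bsub>A\<^esub> b) = r * (e2 a * z)" "e2 a * z \<in> S" using ab by (simp_all add: E_def Gam_iff e_mult)
    then show ?thesis using ab by (auto simp: E_def Gam_iff A_mult_closed e_mult)
  qed
  show sub: "submodule (singletons E) \<Gamma> (free_module A 1)"
  proof (rule submodule_freeI[OF subalg_Gam])
    show "singletons E \<subseteq> carrier (free_module A 1)" by (auto simp: E_def)
    show "replicate 1 \<zero>\<^bsub>A\<^esub> \<in> singletons E" by (auto simp: E_def A_zero_closed intro!: bexI[of _ 0])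
  qed (use E_add E_mult in auto)
  have least: "singletons E \<subseteq> N" if N: "submodule N \<Gamma> (free_module A 1)" "singletons (Sw r) \<subseteq> N" for N
  proof
    fix v assume "v \<in> singletons E"
    then obtain w y where w: "v = [w]" "w \<in> carrier A" "e1 w \<in> R" "y \<in> S" "e2 w = r * y" by (auto simp: E_def)
    obtain u t where ut: "u \<in> R" "t \<in> R" "u * r - 1 = pc * t" using r by (auto simp: unit_mod_p_def dvd_in_def)
    have SwI: "mk r r \<in> Sw r" "mk pc 0 \<in> Sw r"
      using rR rS mk[of r r] mk[of pc 0] pi_dvd_p by (auto simp: Sw_iff intro: bexI[of _ 1] bexI[of _ 0])
    \<comment> \<open>From u * r - p * t = 1, a pair (x, r * y) is (x * u, y) * (r, r) plus (- t *
      x, 0) * (p, 0).\<close>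
    let ?a = "mk (e1 w * u) y" and ?b = "mk (- (t * e1 w)) 0"
    have G: "?a \<in> Gam" "?b \<in> Gam" using w ut by (auto intro!: mk_Gam)
    have "e1 w * u * r - t * e1 w * pc = e1 w"
      using arg_cong[OF ut(3), of "\<lambda>z. e1 w * z"] by (simp add: algebra_simps)
    then have eq: "w = (?a \<otimes>\<^bsub>A\<^esub> mk r r) \<oplus>\<^bsub>A\<^esub> (?b \<otimes>\<^bsub>A\<^esub> mk pc 0)"
      using w ut rR rS mk[of "e1 w * u" y] mk[of "- (t * e1 w)" 0] mk[of r r] mk[of pc 0]
      by (intro e_eqI) (simp_all add: A_add_closed A_mult_closed e_mult mult.commute)
    have "[?a \<otimes>\<^bsub>A\<^esub> mk r r] \<in> N" "[?b \<otimes>\<^bsub>A\<^esub> mk pc 0] \<in> N"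
      using submodule_closed(4)[OF N(1), of ?a "[mk r r]"] submodule_closed(4)[OF N(1), of ?b "[mk pc 0]"] SwI N(2) G
      by (auto simp: regular_module_ops)
    then have "[?a \<otimes>\<^bsub>A\<^esub> mk r r \<oplus>\<^bsub>A\<^esub> (?b \<otimes>\<^bsub>A\<^esub> mk pc 0)] \<in> N"
      using submodule_closed(3)[OF N(1), of "[?a \<otimes>\<^bsub>A\<^esub> mk r r]" "[?b \<otimes>\<^bsub>A\<^esub> mk pc 0]"] by (simp add: regular_module_ops)
    then have "[w] \<in> N" unfolding eq[symmetric] .
    then show "v \<in> N" using w(1) by simp
  qed
  have "singletons (Sw r) \<subseteq> singletons E" using rR by (auto simp: E_def Sw_iff)
  then show "extend_scalars A Gam 1 (singletons (Sw r)) = singletons E"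
    unfolding extend_scalars_def by (rule submodule_hull_eqI[OF sub _ least])
qed

text \<open>Division of the second component by r maps R x r S onto R x S.\<close>

lemma extend_scalars_Sw_free:
  assumes r: "unit_mod_p r"
  shows "miso \<Gamma> (lattice_module A 1 (extend_scalars A Gam 1 (singletons (Sw r)))) (free_module \<Gamma> 1)"
proof -
  have rR: "r \<in> R" "r \<in> S" "r \<noteq> 0" using r R_in_S unit_mod_p_nonzero by (auto simp: unit_mod_p_def)
  let ?E = "{w \<in> carrier A. e1 w \<in> R \<and> (\<exists>y\<in>S. e2 w = r * y)}"
  let ?M = "lattice_module A 1 (singletons ?E)" and ?N = "lattice_module A 1 (singletons Gam)"
  let ?f = "\<lambda>v. [mk (e1 (hd v)) (e2 (hd v) / r)]" and ?g = "\<lambda>v. [mk (e1 (hd v)) (r * e2 (hd v))]"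
  have f: "mk (e1 w) (e2 w / r) \<in> Gam" "e1 (mk (e1 w) (e2 w / r)) = e1 w" "e2 (mk (e1 w) (e2 w / r)) = e2 w / r"
    if "w \<in> ?E" for w using that rR mk[of "e1 w" "e2 w / r"] mk_Gam[of "e1 w" "e2 w / r"] by auto
  have g: "mk (e1 w) (r * e2 w) \<in> ?E" "e1 (mk (e1 w) (r * e2 w)) = e1 w" "e2 (mk (e1 w) (r * e2 w)) = r * e2 w"
    if "w \<in> Gam" for w using that rR mk[of "e1 w" "r * e2 w"] by (auto simp: Gam_iff)
  have "miso \<Gamma> ?M ?N"
  proof (rule misoI[of _ ?f _ ?g])
    fix v assume "v \<in> carrier ?M"
    then obtain w where w: "v = [w]" "w \<in> ?E" by auto
    show "?f v \<in> carrier ?N" using f(1)[OF w(2)] w(1) by simp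
    have "mk (e1 w) (r * (e2 w / r)) = w" using mk_e[of w] w(2) rR(3) by simp
    then show "?g (?f v) = v" using f(2,3)[OF w(2)] w(1) by simp
    fix v' assume "v' \<in> carrier ?M"
    then obtain w' where w': "v' = [w']" "w' \<in> ?E" by auto
    obtain y y' where y: "y \<in> S" "y' \<in> S" "e2 w = r * y" "e2 w' = r * y'" using w(2) w'(2) by auto
    have ww: "w \<oplus>\<^bsub>A\<^esub> w' \<in> ?E" using w(2) w'(2) y
      by (auto simp: A_add_closed intro!: bexI[of _ "y + y'"] simp: algebra_simps)
    have "mk (e1 (w \<oplus>\<^bsub>A\<^esub> w')) (e2 (w \<oplus>\<^bsub>A\<^esub> w') / r) = mk (e1 w) (e2 w / r) \<oplus>\<^bsub>A\<^esub> mk (e1 w') (e2 w' / r)"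
      using f[OF ww] f[OF w(2)] f[OF w'(2)] w(2) w'(2)
      by (intro e_eqI) (simp_all add: A_add_closed Gam_iff add_divide_distrib)
    then show "?f (v \<oplus>\<^bsub>?M\<^esub> v') = ?f v \<oplus>\<^bsub>?N\<^esub> ?f v'" using w(1) w'(1) by simp
  next
    fix v assume "v \<in> carrier ?N"
    then obtain w where w: "v = [w]" "w \<in> Gam" by auto
    show "?g v \<in> carrier ?M" using g(1)[OF w(2)] w(1) by simp
    have "mk (e1 w) (r * e2 w / r) = w" using mk_e[of w] w(2) rR(3) by (simp add: Gam_iff)
    then show "?f (?g v) = v" using g(2,3)[OF w(2)] w(1) by simp
  next
    fix a v assume a: "a \<in> carrier \<Gamma>" and "v \<in> carrier ?M"
    then obtain w where w: "v = [w]" "w \<in> ?E" by auto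
    have aG: "a \<in> Gam" using a by simp
    obtain y where y: "y \<in> S" "e2 w = r * y" using w(2) by auto
    have aw: "a \<otimes>\<^bsub>A\<^esub> w \<in> ?E" using w(2) y aG
      by (auto simp: A_mult_closed e_mult Gam_iff intro!: bexI[of _ "e2 a * y"])
    have "mk (e1 (a \<otimes>\<^bsub>A\<^esub> w)) (e2 (a \<otimes>\<^bsub>A\<^esub> w) / r) = a \<otimes>\<^bsub>A\<^esub> mk (e1 w) (e2 w / r)"
      using f[OF aw] f[OF w(2)] w(2) aG
      by (intro e_eqI) (simp_all add: A_mult_closed e_mult Gam_iff)
    then show "?f (a \<odot>\<^bsub>?M\<^esub> v) = a \<odot>\<^bsub>?N\<^esub> ?f v" using w(1) by simp
  qed
  then show ?thesis unfolding extend_scalars_Sw[OF r] free_module_rank_one .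
qed

text \<open>Swan modules lie in the kernel group because their extensions are free. Conversely, a
  module of the kernel group is stably isomorphic to some \<open>G1 r\<close> by
  \<open>locally_free_stably_G1\<close>, hence to a Swan module.\<close>

lemma T_eq_D: "T zm p = D zm p"
proof (intro equalityI subsetI)
  fix c assume "c \<in> T zm p"
  then obtain r where r: "c = cl r" "unit_mod_p r" unfolding T_cl by blast
  let ?E = "lattice_module A 1 (extend_scalars A Gam 1 (singletons (Sw r)))"
  have 1: "stably_isomorphic \<Gamma> ?E (free_module \<Gamma> 1)" by (rule miso_imp_stably[OF extend_scalars_Sw_free[OF r(2)]])
  have sub: "submodule (extend_scalars A Gam 1 (singletons (Sw r))) \<Gamma> (free_module A 1)"
    using extend_scalars_Sw[OF r(2)] by simp
  have 2: "stably_isomorphic \<Gamma> (free_module \<Gamma> 1) ?E" by (rule SG.sym[OF 1 closed_lattice_module[OF sub]])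
  have "stable_class (Z_adjoin zm) A Gam ?E = \<one>\<^bsub>class_group (Z_adjoin zm) A Gam\<^esub>"
    using stably_trans[OF 1] stably_trans[OF 2] by (auto simp: class_group_def stable_class_def)
  then show "c \<in> D zm p"
    unfolding D_def kernel_group_def Let_def maximal_order_eq r(1) cl_def using locally_free_Sw[OF r(2)] by blast
next
  fix c assume "c \<in> D zm p"
  then obtain n M where M: "c = stable_class (Z_adjoin zm) A Lam (lattice_module A n M)" "locally_free (Z_adjoin zm) A Lam n M"
    "stable_class (Z_adjoin zm) A Gam (lattice_module A n (extend_scalars A Gam n M)) = \<one>\<^bsub>class_group (Z_adjoin zm) A Gam\<^esub>"
    unfolding D_def kernel_group_def Let_def maximal_order_eq by blast
  have "free_module \<Gamma> 1 \<in> stable_class (Z_adjoin zm) A Gam (free_module \<Gamma> 1)"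
    unfolding stable_class_def using regular_lattice[OF subalg_Gam] stably_refl by blast
  then have "free_module \<Gamma> 1 \<in> stable_class (Z_adjoin zm) A Gam (lattice_module A n (extend_scalars A Gam n M))"
    unfolding M(3) by (simp add: class_group_def)
  then have "stably_isomorphic \<Gamma> (lattice_module A n (extend_scalars A Gam n M)) (free_module \<Gamma> 1)"
    unfolding stable_class_def by blast
  then obtain r where r: "unit_mod_p r" "stably_isomorphic \<Lambda> (lattice_module A n M) (G1 r)"
    using locally_free_stably_G1[OF M(2)] by blast
  have "lattice_module A n M \<in> locally_free_modules (Z_adjoin zm) A Lam"
    unfolding locally_free_modules_def using M(2) by blast
  then have "c = cl r"
    unfolding M(1) cl_def using SL.cls_eq_iff[OF _ SwL_lattice[OF r(1)]] stably_trans[OF r(2) SwL_G1(2)[OF r(1)]] by blast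
  then show "c \<in> T zm p" unfolding T_cl using r(1) by blast
qed

end

theorem theorem3p1:
  fixes m p :: nat and \<zeta>\<^sub>m \<zeta>\<^sub>p \<zeta>\<^sub>m\<^sub>p :: complex
  assumes "m \<ge> 1" and "Factorial_Ring.prime p" and "p > 2" and "\<not> p dvd m"
    and "primitive_root_of_unity m \<zeta>\<^sub>m"
    and "primitive_root_of_unity p \<zeta>\<^sub>p"
    and "primitive_root_of_unity (m * p) \<zeta>\<^sub>m\<^sub>p"
  shows "T \<zeta>\<^sub>m p = D \<zeta>\<^sub>m p
    \<and> subgroup (T \<zeta>\<^sub>m p) (Cl \<zeta>\<^sub>m p)
    \<and> (Cl \<zeta>\<^sub>m p)\<lparr>carrier := T \<zeta>\<^sub>m p\<rparr> \<cong> cok_h \<zeta>\<^sub>m \<zeta>\<^sub>p \<zeta>\<^sub>m\<^sub>p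
    \<and> cok_h \<zeta>\<^sub>m \<zeta>\<^sub>p \<zeta>\<^sub>m\<^sub>p
        = residue_units \<zeta>\<^sub>p \<zeta>\<^sub>m\<^sub>p Mod (reduction \<zeta>\<^sub>p \<zeta>\<^sub>m\<^sub>p ` Units (Z_adjoin \<zeta>\<^sub>m\<^sub>p))"
proof -
  interpret cyclotomic_pair m p \<zeta>\<^sub>m \<zeta>\<^sub>p \<zeta>\<^sub>m\<^sub>p by (rule cyclotomic_pair.intro) fact+
  show ?thesis using T_eq_D subgroup_T T_iso_cok cok_h_eq by blast
qed

end
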